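(* Let $F$ be a non-archimedean local field. (1) For any integers $d_1,d_2\ge1$ and any (quasi-)characters $\omega_1,\omega_2$ of $F^\times$ the regularized convolution is a (well-defined) bilinear map $$\mathcal{S}^{(d_1)}_{\mathrm{sis}}(F;\omega_1)\times\mathcal{S}^{(d_2)}_{\mathrm{sis}}(F;\omega_2)\to\mathcal{S}^{(d_1+d_2)}_{\mathrm{sis}}(F;\omega_1\omega_2),\qquad(f_1,f_2)\mapsto f_1*_{\mathrm{pv}}f_2.$$ (2) The regularized Mellin transform converts $*_{\mathrm{pv}}$ to point-wise multiplication: for any $f_j\in\mathcal{S}^{(d_j)}_{\mathrm{sis}}(F;\omega_j)$ we have the equality of functions in $\mathfrak{M}^{(d_1+d_2)}_{\mathrm{sis}}(F;\omega_1\omega_2)$ $$\mathfrak{M}^{\mathrm{pv}}(f_1*_{\mathrm{pv}}f_2)(\xi,s)=\mathfrak{M}^{\mathrm{pv}}(f_1)(\xi,s)\cdot\mathfrak{M}^{\mathrm{pv}}(f_2)(\xi,s).$$ (3) Let $\mathcal{S}_{\mathrm{sis}}(F,\widetilde{F^\times})$ be the span of all $\mathcal{S}^{(d)}_{\mathrm{sis}}(F;\omega)$ for $d\in\mathbb{Z}_{\ge0}$ and (quasi-)characters $\omega$ of $F^\times$. Then $(\mathcal{S}_{\mathrm{sis}}(F,\widetilde{F^\times}),*_{\mathrm{pv}})$ is a commutative algebra, which contains $(\mathcal{S}_{\mathrm{sis}}(F),*_{\mathrm{pv}})$ as an ideal.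
   Context: $F$ has ring of integers $\mathcal{O}_F$, maximal ideal $\mathcal{P}_F$, uniformizer $\varpi_F$, valuation $v_F$, absolute value $|\cdot|_F$, residue cardinality $q$; $\psi$ is an additive character trivial on $\mathcal{O}_F$ but not on $\mathcal{P}_F^{-1}$; $dx$ is the self-dual Haar measure and $d^\times x=dx/|x|_F$. $\mathfrak{c}(\chi)$ is the least $m\ge0$ such that $\chi$ is trivial on $(1+\mathcal{P}_F^m)\cap\mathcal{O}_F^\times$; $\varepsilon(s,\chi,\psi)$ is Tate's local epsilon factor. Germs: for a quasi-character $\omega$ of $F^\times$, $d\ge1$ and $l>\max(\mathfrak{c}(\omega),1)$, $G_l(\cdot;\omega,d)$ is the function on $F^\times$ supported on $\varpi_F^{-ld}\mathcal{O}_F^\times$ with, for $y\in\mathcal{O}_F^\times$, $G_l(\varpi_F^{-l}y;\omega,1)=\psi(\varpi_F^{-l}y)\omega(\varpi_F^{-l}y)$ if $d=1$, and for $d>1$ $$G_l(\varpi_F^{-ld}y;\omega,d)=\int_{(\mathcal{O}_F^\times)^{d-1}}\psi\left(\frac{y(t_2\cdots t_d)^{-1}+t_2+\cdots+t_d}{\varpi_F^l}\right)\omega\left(\frac{t_d}{\varpi_F^l}\right)dt_2\cdots dt_d.$$ Put $G_{\ge N}=\sum_{l\ge N}G_l$. Spaces: a finite function on $F^\times$ is a continuous function whose translates span a finite-dimensional space. $\mathcal{S}_{\mathrm{sis}}(F)$ is the space of continuous functions on $F^\times$ that vanish for $|y|_F\gg1$ and coincide with a finite function for $|y|_F$ small.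 For $d\ge1$, $\mathcal{S}^{(d)}_{\mathrm{sis}}(F;\omega)$ is the space of continuous $f$ on $F^\times$ that coincide with a finite function for $|y|_F$ small and such that for some $N\ge1$ and $C\in\mathbb{C}$, $f(y)=C\,G_{\ge N}(y;\omega,d)$ whenever $v_F(y)\le-Nd$. $\mathcal{S}^{(0)}_{\mathrm{sis}}(F;\omega)=\mathcal{S}_{\mathrm{sis}}(F)$. Principal values: $\int^{\mathrm{pv}}_{F^\times}f(y)d^\times y=\lim_{N\to\infty}\sum_{n=-N}^N\int_{\varpi_F^n\mathcal{O}_F^\times}f(y)d^\times y$ when the limit exists; $(f_1*_{\mathrm{pv}}f_2)(x)=\int^{\mathrm{pv}}_{F^\times}f_1(xy^{-1})f_2(y)d^\times y$. The regularized Mellin transform of $f$ at a character $\xi$ of $\mathcal{O}_F^\times$ (regarded as a character of $F^\times$ via $\xi(\varpi_F)=1$) and $s\in\mathbb{C}$ is $\mathfrak{M}^{\mathrm{pv}}(f)(\xi,s)=\int^{\mathrm{pv}}_{F^\times}f(t)\xi(t)|t|_F^sd^\times t$; for $f$ in any of the spaces $\mathcal{S}^{(d)}_{\mathrm{sis}}(F;\omega)$ with $d\ge0$ and $\omega$ a quasi-character of $F^\times$, it is defined for $\Re(s)\gg1$ and is extended meromorphically to $s\in\mathbb{C}$. Mellin side: $\mathfrak{M}_{\mathrm{sis}}(F)=C_c(\widehat{\mathcal{O}_F^\times},\mathbb{C}(q^{-s}))$ is the space of finitely supported functions on the discrete group $\widehat{\mathcal{O}_F^\times}$ with values in rational functions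 of $q^{-s}$. For $d\ge1$ and $N\ge1$ let $E_{\ge N}(\xi,q^{-s};\omega,d)=\varepsilon(1-s,\xi^{-1},\psi)^{d-1}\varepsilon(1-s,\xi^{-1}\omega^{-1},\psi)$ if $\mathfrak{c}(\xi)\ge N$ and $0$ otherwise; $\mathfrak{M}^{(d)}_{\mathrm{sis}}(F;\omega)=\mathfrak{M}_{\mathrm{sis}}(F)\oplus\mathbb{C}\cdot E_{\ge N}(\cdot;\omega,d)$, independent of $N$.
   Formalization: The functions in S_sis(F) and S_sis^(d)(F;ω) are taken locally constant rather than merely continuous; with continuous complex-valued functions the statement fails (e.g. Σ 2^{-k}ξ_k on the units, c(ξ_k)=k, convolved with a germ of ψ). *)

theory Defs
  imports
    "HOL-Complex_Analysis.Complex_Analysis"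
    "HOL-Library.Function_Algebras"
begin

section \<open>Non-archimedean local fields\<close>

text \<open>The normalized valuation \<open>fval\<close> is constrained on nonzero elements only; its value at
  \<open>0\<close> is irrelevant.\<close>

class discrete_valued_field = field +
  fixes fval :: "'a \<Rightarrow> int"
  assumes fval_mult: "x \<noteq> 0 \<Longrightarrow> y \<noteq> 0 \<Longrightarrow> fval (x * y) = fval x + fval y"
    and fval_add: "x \<noteq> 0 \<Longrightarrow> y \<noteq> 0 \<Longrightarrow> x + y \<noteq> 0 \<Longrightarrow> min (fval x) (fval y) \<le> fval (x + y)"
    and fval_normalized: "\<exists>x. x \<noteq> 0 \<and> fval x = 1"

context discrete_valued_field
begin

definition frac_ideal :: "int \<Rightarrow> 'a set"  \<comment> \<open>\<open>\<P>\<^sub>F\<^sup>m\<close>\<close>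
  where "frac_ideal m = {x. x = 0 \<or> m \<le> fval x}"

abbreviation ring_of_integers :: "'a set"
  where "ring_of_integers \<equiv> frac_ideal 0"

definition shell :: "int \<Rightarrow> 'a set"  \<comment> \<open>\<open>\<varpi>\<^sub>F\<^sup>n \<O>\<^sub>F\<^sup>\<times>\<close>, for any uniformizer\<close>
  where "shell n = {x. x \<noteq> 0 \<and> fval x = n}"

abbreviation int_units :: "'a set"
  where "int_units \<equiv> shell 0"

definition residue_classes :: "'a set set"  \<comment> \<open>\<open>\<O>\<^sub>F / \<P>\<^sub>F\<close>\<close>
  where "residue_classes =
    ring_of_integers // {(x, y). x \<in> ring_of_integers \<and> y \<in> ring_of_integers \<and> x - y \<in> frac_ideal 1}"

definition fabs :: "'a \<Rightarrow> real"
  where "fabs x = (if x = 0 then 0 else real (card residue_classes) powi (- fval x))"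

definition uniformizer :: "'a \<Rightarrow> bool"
  where "uniformizer p \<longleftrightarrow> p \<noteq> 0 \<and> fval p = 1"

end

definition residue_card :: "'a::discrete_valued_field itself \<Rightarrow> nat"  \<comment> \<open>\<open>q\<close>\<close>
  where "residue_card _ = card (residue_classes :: 'a set set)"

text \<open>A non-archimedean local field is a field that is complete for a discrete valuation with
  finite residue field.  Its metric is the one of the normalized absolute value.\<close>

class nonarch_local_field = discrete_valued_field + complete_space +
  assumes finite_residue_classes: "finite residue_classes"
    and dist_eq_fabs: "dist x y = fabs (x - y)"

section \<open>Additive characters and the self-dual measure\<close>

definition additive_character :: "('a::nonarch_local_field \<Rightarrow> complex) \<Rightarrow> bool"
  where "additive_character \<psi> \<longleftrightarrow>
    continuous_on UNIV \<psi> \<and> (\<forall>x. cmod (\<psi> x) = 1) \<and> (\<forall>x y. \<psi> (x + y) = \<psi> x * \<psi> y)"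

definition haar_measure :: "'a::nonarch_local_field measure \<Rightarrow> bool"
  where "haar_measure M \<longleftrightarrow> sets M = sets borel
    \<and> (\<forall>a. \<forall>A\<in>sets M. emeasure M ((+) a ` A) = emeasure M A)
    \<and> (\<forall>K. compact K \<longrightarrow> emeasure M K < \<infinity>)
    \<and> (\<forall>U. open U \<and> U \<noteq> {} \<longrightarrow> 0 < emeasure M U)"

definition schwartz_bruhat :: "('a::nonarch_local_field \<Rightarrow> complex) set"
  where "schwartz_bruhat = {\<Phi>. (\<forall>x. \<forall>\<^sub>F y in nhds x. \<Phi> y = \<Phi> x)
    \<and> (\<exists>K. compact K \<and> (\<forall>x. x \<notin> K \<longrightarrow> \<Phi> x = 0))}"

definition fourier :: "('a::nonarch_local_field \<Rightarrow> complex) \<Rightarrow> 'a measure \<Rightarrow> ('a \<Rightarrow> complex) \<Rightarrow> 'a \<Rightarrow> complex"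
  where "fourier \<psi> dx \<Phi> y = (LINT x|dx. \<Phi> x * \<psi> (x * y))"

definition self_dual_haar :: "('a::nonarch_local_field \<Rightarrow> complex) \<Rightarrow> 'a measure \<Rightarrow> bool"
  where "self_dual_haar \<psi> dx \<longleftrightarrow> haar_measure dx
    \<and> (\<forall>\<Phi>\<in>schwartz_bruhat. \<forall>x. fourier \<psi> dx (fourier \<psi> dx \<Phi>) x = \<Phi> (- x))"

definition mult_measure :: "'a::nonarch_local_field measure \<Rightarrow> 'a measure"
  where "mult_measure dx = density dx (\<lambda>x. ennreal (1 / fabs x))"

section \<open>Multiplicative characters\<close>

text \<open>Throughout, a function on \<open>F\<^sup>\<times>\<close> is represented by the function on \<open>F\<close> that extends it by \<open>0\<close>,
  and likewise a character of \<open>\<O>\<^sub>F\<^sup>\<times>\<close>.  In particular \<open>\<lambda>x. inverse (\<eta> x)\<close> represents \<open>\<eta>\<^sup>-\<^sup>1\<close>.\<close>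

definition quasi_characters :: "('a::nonarch_local_field \<Rightarrow> complex) set"
  where "quasi_characters = {\<omega>. continuous_on (- {0}) \<omega> \<and> \<omega> 0 = 0 \<and> (\<forall>x. x \<noteq> 0 \<longrightarrow> \<omega> x \<noteq> 0)
    \<and> (\<forall>x y. x \<noteq> 0 \<longrightarrow> y \<noteq> 0 \<longrightarrow> \<omega> (x * y) = \<omega> x * \<omega> y)}"

definition unit_characters :: "('a::nonarch_local_field \<Rightarrow> complex) set"
  where "unit_characters = {\<xi>. continuous_on int_units \<xi> \<and> (\<forall>x. x \<notin> int_units \<longrightarrow> \<xi> x = 0)
    \<and> (\<forall>x\<in>int_units. cmod (\<xi> x) = 1) \<and> (\<forall>x\<in>int_units. \<forall>y\<in>int_units. \<xi> (x * y) = \<xi> x * \<xi> y)}"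

definition unit_char_ext :: "'a::nonarch_local_field \<Rightarrow> ('a \<Rightarrow> complex) \<Rightarrow> 'a \<Rightarrow> complex"
  \<comment> \<open>extension to \<open>F\<^sup>\<times>\<close> by the value 1 at the uniformizer\<close>
  where "unit_char_ext p \<xi> x = \<xi> (x * p powi (- fval x))"

definition conductor_exp :: "('a::nonarch_local_field \<Rightarrow> complex) \<Rightarrow> nat"
  where "conductor_exp \<eta> = (LEAST m. \<forall>x\<in>((+) 1 ` frac_ideal (int m)) \<inter> int_units. \<eta> x = 1)"

section \<open>Meromorphic functions\<close>

text \<open>Meromorphic functions on \<open>\<complex>\<close> are represented by their nicely meromorphic representatives,
  which are uniquely determined; consequently sums, products and quotients in the field of
  meromorphic functions are the pointwise ones followed by \<open>remove_sings\<close>.\<close>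

definition mero_continuation ::
    "(complex \<Rightarrow> bool) \<Rightarrow> (complex \<Rightarrow> complex) \<Rightarrow> (complex \<Rightarrow> complex) \<Rightarrow> bool"
  \<comment> \<open>\<open>g\<close> is defined (as expressed by \<open>D\<close>) for \<open>Re s\<close> large, and \<open>h\<close> is its meromorphic continuation\<close>
  where "mero_continuation D g h \<longleftrightarrow>
    h nicely_meromorphic_on UNIV \<and> (\<exists>\<sigma>. \<forall>s. \<sigma> < Re s \<longrightarrow> D s \<and> h s = g s)"

definition q_power :: "'a::nonarch_local_field itself \<Rightarrow> complex \<Rightarrow> complex"  \<comment> \<open>\<open>q\<^sup>-\<^sup>s\<close>\<close>
  where "q_power T s = of_nat (residue_card T) powr (- s)"

definition rational_in_q_power :: "'a::nonarch_local_field itself \<Rightarrow> (complex \<Rightarrow> complex) set"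
  where "rational_in_q_power T =
    {remove_sings (\<lambda>s. poly P (q_power T s) / poly Q (q_power T s)) | P Q. Q \<noteq> 0}"

section \<open>Tate's local epsilon factor\<close>

definition zeta_integrand :: "('a::nonarch_local_field \<Rightarrow> complex) \<Rightarrow> ('a \<Rightarrow> complex) \<Rightarrow> complex \<Rightarrow> 'a \<Rightarrow> complex"
  where "zeta_integrand \<Phi> \<eta> s x = \<Phi> x * \<eta> x * of_real (fabs x) powr s"

definition zeta :: "'a::nonarch_local_field measure \<Rightarrow> ('a \<Rightarrow> complex) \<Rightarrow> ('a \<Rightarrow> complex) \<Rightarrow> complex \<Rightarrow> complex"
  where "zeta dx \<Phi> \<eta> = (THE h. mero_continuation
    (\<lambda>s. integrable (mult_measure dx) (zeta_integrand \<Phi> \<eta> s))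
    (\<lambda>s. LINT x|mult_measure dx. zeta_integrand \<Phi> \<eta> s x) h)"

definition L_factor :: "'a::nonarch_local_field \<Rightarrow> ('a \<Rightarrow> complex) \<Rightarrow> complex \<Rightarrow> complex"
  where "L_factor p \<eta> s =
    (if conductor_exp \<eta> = 0 then 1 / (1 - \<eta> p * q_power TYPE('a) s) else 1)"

text \<open>The epsilon factor is defined by Tate's local functional equation
  \<open>Z(1-s, \<eta>\<^sup>-\<^sup>1, \<Phi>^) / L(1-s, \<eta>\<^sup>-\<^sup>1) = \<epsilon>(s, \<eta>, \<psi>) Z(s, \<eta>, \<Phi>) / L(s, \<eta>)\<close>, an identity of meromorphic
  functions of \<open>s\<close>.\<close>

definition epsilon :: "'a::nonarch_local_field \<Rightarrow> ('a \<Rightarrow> complex) \<Rightarrow> 'a measure \<Rightarrow> ('a \<Rightarrow> complex) \<Rightarrow> complex \<Rightarrow> complex"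
  where "epsilon p \<psi> dx \<eta> = (THE e. e holomorphic_on UNIV \<and>
    (\<forall>\<Phi>\<in>schwartz_bruhat. \<forall>\<^sub>\<approx>s\<in>UNIV.
      zeta dx (fourier \<psi> dx \<Phi>) (\<lambda>x. inverse (\<eta> x)) (1 - s) / L_factor p (\<lambda>x. inverse (\<eta> x)) (1 - s)
      = e s * (zeta dx \<Phi> \<eta> s / L_factor p \<eta> s)))"

section \<open>Germs\<close>

definition germ :: "'a::nonarch_local_field \<Rightarrow> ('a \<Rightarrow> complex) \<Rightarrow> 'a measure \<Rightarrow>
    nat \<Rightarrow> ('a \<Rightarrow> complex) \<Rightarrow> nat \<Rightarrow> 'a \<Rightarrow> complex"
  where "germ p \<psi> dx l \<omega> d x =
    (if x \<notin> shell (- int (l * d)) then 0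
     else if d = 1 then \<psi> x * \<omega> x
     else let y = x * p ^ (l * d) in
       set_lebesgue_integral (\<Pi>\<^sub>M i\<in>{2..d}. dx) (\<Pi>\<^sub>E i\<in>{2..d}. int_units)
         (\<lambda>t. \<psi> ((y * inverse (\<Prod>i\<in>{2..d}. t i) + (\<Sum>i\<in>{2..d}. t i)) / p ^ l) * \<omega> (t d / p ^ l)))"

text \<open>The supports of the germs are disjoint, so that the following sum has at most one nonzero
  term at each point.\<close>

definition germ_ge :: "'a::nonarch_local_field \<Rightarrow> ('a \<Rightarrow> complex) \<Rightarrow> 'a measure \<Rightarrow>
    nat \<Rightarrow> ('a \<Rightarrow> complex) \<Rightarrow> nat \<Rightarrow> 'a \<Rightarrow> complex"
  where "germ_ge p \<psi> dx N \<omega> d x = (\<Sum>\<^sub>\<infinity>l\<in>{N..}. germ p \<psi> dx l \<omega> d x)"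

section \<open>Function spaces\<close>

global_interpretation fun_space: vector_space "\<lambda>(c::complex) (f :: 'a \<Rightarrow> complex) x. c * f x"
  by standard (auto simp: algebra_simps fun_eq_iff)

definition finite_functions :: "('a::nonarch_local_field \<Rightarrow> complex) set"
  where "finite_functions = {\<phi>. continuous_on (- {0}) \<phi> \<and> \<phi> 0 = 0
    \<and> (\<exists>B. finite B \<and> fun_space.span {(\<lambda>x. \<phi> (a * x)) | a. a \<noteq> 0} = fun_space.span B)}"

text \<open>On a non-archimedean field the functions making up the spaces below have to be smooth, that
  is, locally constant (continuous for the discrete topology on \<open>\<complex>\<close>).  Continuity for the usual
  topology of \<open>\<complex>\<close> is not enough: a continuous function supported on \<open>\<O>\<^sub>F\<^sup>\<times>\<close> may have a nonzero
  Mellin transform at infinitely many characters, and its convolution with a germ then does not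
  belong to the space it should.\<close>

definition smooth_functions :: "('a::nonarch_local_field \<Rightarrow> complex) set"
  where "smooth_functions = {f. f 0 = 0 \<and> (\<forall>x. x \<noteq> 0 \<longrightarrow> (\<forall>\<^sub>F y in nhds x. f y = f x))}"

definition finite_near_zero :: "('a::nonarch_local_field \<Rightarrow> complex) \<Rightarrow> bool"
  where "finite_near_zero f \<longleftrightarrow>
    (\<exists>\<phi>\<in>finite_functions. \<exists>r>0. \<forall>y. y \<noteq> 0 \<longrightarrow> fabs y < r \<longrightarrow> f y = \<phi> y)"

definition S_sis :: "('a::nonarch_local_field \<Rightarrow> complex) set"
  where "S_sis = {f\<in>smooth_functions. finite_near_zero f \<and> (\<exists>R. \<forall>y. R < fabs y \<longrightarrow> f y = 0)}"

text \<open>The condition \<open>N > max (conductor_exp \<omega>) 1\<close> is the range in which the germs are considered.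
  It does not restrict the space, as \<open>N\<close> may always be enlarged.\<close>

definition S_sis_deg :: "'a::nonarch_local_field \<Rightarrow> ('a \<Rightarrow> complex) \<Rightarrow> 'a measure \<Rightarrow>
    nat \<Rightarrow> ('a \<Rightarrow> complex) \<Rightarrow> ('a \<Rightarrow> complex) set"
  where "S_sis_deg p \<psi> dx d \<omega> =
    (if d = 0 then S_sis
     else {f\<in>smooth_functions. finite_near_zero f \<and>
       (\<exists>N C. N > max (conductor_exp \<omega>) 1 \<and>
         (\<forall>y. y \<noteq> 0 \<longrightarrow> fval y \<le> - int (N * d) \<longrightarrow> f y = C * germ_ge p \<psi> dx N \<omega> d y))})"

definition S_sis_total :: "'a::nonarch_local_field \<Rightarrow> ('a \<Rightarrow> complex) \<Rightarrow> 'a measure \<Rightarrow> ('a \<Rightarrow> complex) set"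
  where "S_sis_total p \<psi> dx = fun_space.span (\<Union>d. \<Union>\<omega>\<in>quasi_characters. S_sis_deg p \<psi> dx d \<omega>)"

section \<open>Principal values, convolution and the Mellin transform\<close>

definition pv_partial :: "'a::nonarch_local_field measure \<Rightarrow> ('a \<Rightarrow> complex) \<Rightarrow> nat \<Rightarrow> complex"
  where "pv_partial dx f N =
    (\<Sum>n\<in>{- int N..int N}. set_lebesgue_integral (mult_measure dx) (shell n) f)"

definition pv_exists :: "'a::nonarch_local_field measure \<Rightarrow> ('a \<Rightarrow> complex) \<Rightarrow> bool"
  where "pv_exists dx f \<longleftrightarrow>
    (\<forall>n. set_integrable (mult_measure dx) (shell n) f) \<and> convergent (pv_partial dx f)"

definition pv_integral :: "'a::nonarch_local_field measure \<Rightarrow> ('a \<Rightarrow> complex) \<Rightarrow> complex"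
  where "pv_integral dx f = lim (pv_partial dx f)"

definition pv_conv_defined :: "'a::nonarch_local_field measure \<Rightarrow> ('a \<Rightarrow> complex) \<Rightarrow> ('a \<Rightarrow> complex) \<Rightarrow> bool"
  where "pv_conv_defined dx f1 f2 \<longleftrightarrow>
    (\<forall>x. x \<noteq> 0 \<longrightarrow> pv_exists dx (\<lambda>y. f1 (x * inverse y) * f2 y))"

definition pv_conv :: "'a::nonarch_local_field measure \<Rightarrow> ('a \<Rightarrow> complex) \<Rightarrow> ('a \<Rightarrow> complex) \<Rightarrow> 'a \<Rightarrow> complex"
  where "pv_conv dx f1 f2 x =
    (if x = 0 then 0 else pv_integral dx (\<lambda>y. f1 (x * inverse y) * f2 y))"

definition mellin_integrand :: "'a::nonarch_local_field \<Rightarrow> ('a \<Rightarrow> complex) \<Rightarrow> ('a \<Rightarrow> complex) \<Rightarrow> complex \<Rightarrow> 'a \<Rightarrow> complex"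
  where "mellin_integrand p f \<xi> s t = f t * unit_char_ext p \<xi> t * of_real (fabs t) powr s"

definition is_mellin :: "'a::nonarch_local_field \<Rightarrow> 'a measure \<Rightarrow> ('a \<Rightarrow> complex) \<Rightarrow> ('a \<Rightarrow> complex) \<Rightarrow>
    (complex \<Rightarrow> complex) \<Rightarrow> bool"
  where "is_mellin p dx f \<xi> = mero_continuation
    (\<lambda>s. pv_exists dx (mellin_integrand p f \<xi> s)) (\<lambda>s. pv_integral dx (mellin_integrand p f \<xi> s))"

definition mellin_defined :: "'a::nonarch_local_field \<Rightarrow> 'a measure \<Rightarrow> ('a \<Rightarrow> complex) \<Rightarrow> bool"
  where "mellin_defined p dx f \<longleftrightarrow> (\<forall>\<xi>\<in>unit_characters. \<exists>h. is_mellin p dx f \<xi> h)"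

definition mellin :: "'a::nonarch_local_field \<Rightarrow> 'a measure \<Rightarrow> ('a \<Rightarrow> complex) \<Rightarrow> ('a \<Rightarrow> complex) \<Rightarrow> complex \<Rightarrow> complex"
  \<comment> \<open>extended by \<open>0\<close> to functions \<open>\<xi>\<close> that are not characters of \<open>\<O>\<^sub>F\<^sup>\<times>\<close>, as are the elements of
    the spaces below\<close>
  where "mellin p dx f \<xi> = (if \<xi> \<in> unit_characters then THE h. is_mellin p dx f \<xi> h else (\<lambda>s. 0))"

definition M_sis :: "(('a::nonarch_local_field \<Rightarrow> complex) \<Rightarrow> complex \<Rightarrow> complex) set"
  where "M_sis = {m. finite {\<xi>. m \<xi> \<noteq> (\<lambda>s. 0)} \<and> (\<forall>\<xi>. \<xi> \<notin> unit_characters \<longrightarrow> m \<xi> = (\<lambda>s. 0))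
    \<and> (\<forall>\<xi>\<in>unit_characters. m \<xi> \<in> rational_in_q_power TYPE('a))}"

definition E_ge :: "'a::nonarch_local_field \<Rightarrow> ('a \<Rightarrow> complex) \<Rightarrow> 'a measure \<Rightarrow>
    nat \<Rightarrow> ('a \<Rightarrow> complex) \<Rightarrow> nat \<Rightarrow> ('a \<Rightarrow> complex) \<Rightarrow> complex \<Rightarrow> complex"
  where "E_ge p \<psi> dx N \<omega> d \<xi> s =
    (if \<xi> \<in> unit_characters \<and> N \<le> conductor_exp \<xi>
     then epsilon p \<psi> dx (\<lambda>x. inverse (unit_char_ext p \<xi> x)) (1 - s) ^ (d - 1)
        * epsilon p \<psi> dx (\<lambda>x. inverse (unit_char_ext p \<xi> x) * inverse (\<omega> x)) (1 - s)
     else 0)"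

text \<open>The space does not depend on the choice of \<open>N\<close>, which is therefore left open.\<close>

definition M_sis_deg :: "'a::nonarch_local_field \<Rightarrow> ('a \<Rightarrow> complex) \<Rightarrow> 'a measure \<Rightarrow>
    nat \<Rightarrow> ('a \<Rightarrow> complex) \<Rightarrow> (('a \<Rightarrow> complex) \<Rightarrow> complex \<Rightarrow> complex) set"
  where "M_sis_deg p \<psi> dx d \<omega> =
    {\<lambda>\<xi>. remove_sings (\<lambda>s. m \<xi> s + C * E_ge p \<psi> dx N \<omega> d \<xi> s) | m C N. m \<in> M_sis \<and> N \<ge> 1}"

section \<open>Algebraic vocabulary for spaces of functions\<close>

definition bilinear_map_on :: "('a \<Rightarrow> complex) set \<Rightarrow> ('a \<Rightarrow> complex) set \<Rightarrow> ('a \<Rightarrow> complex) set \<Rightarrow>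
    (('a \<Rightarrow> complex) \<Rightarrow> ('a \<Rightarrow> complex) \<Rightarrow> 'a \<Rightarrow> complex) \<Rightarrow> bool"
  where "bilinear_map_on S T U B \<longleftrightarrow>
    fun_space.subspace S \<and> fun_space.subspace T \<and> fun_space.subspace U
    \<and> (\<forall>f\<in>S. \<forall>g\<in>T. B f g \<in> U)
    \<and> (\<forall>f\<in>S. \<forall>f'\<in>S. \<forall>g\<in>T. B (f + f') g = B f g + B f' g)
    \<and> (\<forall>f\<in>S. \<forall>g\<in>T. \<forall>g'\<in>T. B f (g + g') = B f g + B f g')
    \<and> (\<forall>c. \<forall>f\<in>S. \<forall>g\<in>T. B (\<lambda>x. c * f x) g = (\<lambda>x. c * B f g x) \<and> B f (\<lambda>x. c * g x) = (\<lambda>x. c * B f g x))"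

definition commutative_algebra_on :: "('a \<Rightarrow> complex) set \<Rightarrow>
    (('a \<Rightarrow> complex) \<Rightarrow> ('a \<Rightarrow> complex) \<Rightarrow> 'a \<Rightarrow> complex) \<Rightarrow> bool"  \<comment> \<open>not necessarily unital\<close>
  where "commutative_algebra_on A B \<longleftrightarrow> bilinear_map_on A A A B
    \<and> (\<forall>f\<in>A. \<forall>g\<in>A. \<forall>h\<in>A. B (B f g) h = B f (B g h))
    \<and> (\<forall>f\<in>A. \<forall>g\<in>A. B f g = B g f)"

definition algebra_ideal :: "('a \<Rightarrow> complex) set \<Rightarrow> ('a \<Rightarrow> complex) set \<Rightarrow>
    (('a \<Rightarrow> complex) \<Rightarrow> ('a \<Rightarrow> complex) \<Rightarrow> 'a \<Rightarrow> complex) \<Rightarrow> bool"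
  where "algebra_ideal I A B \<longleftrightarrow> fun_space.subspace I \<and> I \<subseteq> A
    \<and> (\<forall>f\<in>I. \<forall>g\<in>A. B f g \<in> I \<and> B g f \<in> I)"

end

theory Submission
  imports Defs "HOL-Library.Groups_Big_Fun"
begin

text \<open>A function \<open>f\<close> on \<open>F\<^sup>\<times>\<close> is encoded by the array of its components \<open>u \<mapsto> f (\<varpi>\<^sup>n u)\<close> on the units, so that
  \<open>*\<^sub>p\<^sub>v\<close> becomes the convolution of arrays with respect to convolution on \<open>\<O>\<^sup>\<times>\<close>.  Principal values exist
  because, after averaging over \<open>1 + \<P>\<^sup>M\<close>, the arrays in question vanish for \<open>n\<close> small, while for \<open>n\<close> large
  the components have bounded level and satisfy a linear recurrence, which is what being a finite function
  near \<open>0\<close> means.  A germ of degree \<open>d\<close> is, on each shell, a convolution of \<open>d - 1\<close> copies of \<open>\<psi>\<close> and one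
  copy of \<open>\<psi> \<omega>\<close>; stationary phase gives \<open>\<psi> \<omega>1 * \<psi> \<omega>2 = \<psi> * \<psi> \<omega>1 \<omega>2\<close> on shells that are deep enough, hence
  the convolution of two germs is again a germ.  The recurrence makes the Mellin transforms rational in
  \<open>q\<^sup>-\<^sup>s\<close>, and Tate's functional equation evaluates \<open>\<epsilon>\<close> of a ramified character as a Gauss sum, that is, as a
  component of the Mellin transform of \<open>\<psi>\<close>.\<close>

section \<open>Valuation and ultrametric\<close>

text \<open>The obstacle: the level of a germ on shell \<open>- l d\<close> grows with
  \<open>l\<close>, so the arrays are infinite in both directions and share no common level. What
  saves the convolution is an orthogonality: a function invariant under \<open>1 + P^M\<close>
  annihilates every function whose average over \<open>1 + P^M\<close> is 0. For a fixed total
  index, pairs with one index far to the left and the other far to the right therefore vanish,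
  finitely many terms remain, and the principal value is the limit of an eventually constant
  sequence. The algebra laws become rearrangements of finite sums, proved once on
  \<open>conv_space\<close>, which contains all the spaces at issue. The same orthogonality
  separates germs of different depth. Stationary phase at depth \<open>l\<close> needs both
  conductors to be at most \<open>l div 2\<close>, whence the bound of the form
  \<open>2 * max + 2\<close> on \<open>N\<close>; this is harmless because a change of
  \<open>N\<close> alters a sum of germs by an element of \<open>S_sis\<close> only, and
  \<open>S_sis\<close> is an ideal. On the Mellin side germs are seen by characters of large
  conductor only; for these the zeta integrals are Laurent polynomials in \<open>q^-s\<close>, and a
  single test function pins down the epsilon factor.\<close>

lemma fval_one [simp]: "fval (1::'a::discrete_valued_field) = 0"
  using fval_mult[of "1::'a" 1] by simp

lemma fval_uminus [simp]: "fval (- x) = fval (x::'a::discrete_valued_field)"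
proof (cases "x = 0")
  case False
  have "fval (-1::'a) + fval (-1::'a) = 0"
    using fval_mult[of "-1::'a" "-1"] by simp
  then show ?thesis
    using fval_mult[of "-1" x] False by simp
qed simp

lemma fval_inverse: "x \<noteq> 0 \<Longrightarrow> fval (inverse x) = - fval x"
  using fval_mult[of x "inverse x"] by simp

lemma fval_divide: "x \<noteq> 0 \<Longrightarrow> y \<noteq> 0 \<Longrightarrow> fval (x / y) = fval x - fval y"
  by (simp add: divide_inverse fval_mult fval_inverse)

lemma fval_power: "x \<noteq> 0 \<Longrightarrow> fval (x ^ n) = int n * fval x"
  by (induction n) (auto simp: fval_mult algebra_simps)

lemma fval_power_int: "x \<noteq> 0 \<Longrightarrow> fval (x powi n) = n * fval x"
  by (cases "n \<ge> 0") (simp_all add: power_int_def fval_power fval_inverse)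

text \<open>The upper bound comes from the ultrametric inequality for
  \<open>x = (x + y) + (- y)\<close>, whose minimum cannot be attained at \<open>y\<close>.\<close>

lemma fval_add_eq: "x \<noteq> 0 \<Longrightarrow> y = 0 \<or> fval x < fval y \<Longrightarrow> x + y \<noteq> 0 \<and> fval (x + y) = fval x"
proof (cases "y = 0")
  case False
  assume *: "x \<noteq> 0" "y = 0 \<or> fval x < fval y"
  with False have lt: "fval x < fval y" by simp
  have nz: "x + y \<noteq> 0"
  proof
    assume "x + y = 0"
    then have "y = - x" by (simp add: eq_neg_iff_add_eq_0 add.commute)
    with lt show False by simp
  qed
  have "fval x \<le> fval (x + y)" using fval_add[OF *(1) False nz] lt by simp
  moreover have "min (fval (x + y)) (fval (- y)) \<le> fval x"
    using fval_add[of "x + y" "- y"] * False nz by simp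
  ultimately show ?thesis using nz lt by simp
qed simp

lemma frac_ideal_iff: "x \<in> frac_ideal n \<longleftrightarrow> x = 0 \<or> n \<le> fval x"
  by (simp add: frac_ideal_def)

lemma shell_iff: "x \<in> shell n \<longleftrightarrow> x \<noteq> 0 \<and> fval x = n"
  by (simp add: shell_def)

lemma frac_ideal_zero [simp]: "0 \<in> frac_ideal n"
  by (simp add: frac_ideal_iff)

lemma frac_ideal_uminus [simp]: "- x \<in> frac_ideal n \<longleftrightarrow> x \<in> frac_ideal n"
  by (simp add: frac_ideal_iff)

lemma frac_ideal_add: "x \<in> frac_ideal n \<Longrightarrow> y \<in> frac_ideal n \<Longrightarrow> x + y \<in> frac_ideal n"
  using fval_add[of x y] by (cases "x = 0 \<or> y = 0 \<or> x + y = 0") (auto simp: frac_ideal_iff)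

lemma frac_ideal_diff: "x \<in> frac_ideal n \<Longrightarrow> y \<in> frac_ideal n \<Longrightarrow> x - y \<in> frac_ideal n"
  using frac_ideal_add[of x n "- y"] by simp

lemma frac_ideal_mult: "x \<in> frac_ideal m \<Longrightarrow> y \<in> frac_ideal n \<Longrightarrow> x * y \<in> frac_ideal (m + n)"
  using fval_mult[of x y] by (cases "x = 0 \<or> y = 0") (auto simp: frac_ideal_iff)

lemma frac_ideal_mono: "x \<in> frac_ideal m \<Longrightarrow> n \<le> m \<Longrightarrow> x \<in> frac_ideal n"
  by (auto simp: frac_ideal_iff)

lemma frac_ideal_mult_iff: "c \<noteq> 0 \<Longrightarrow> c * x \<in> frac_ideal n \<longleftrightarrow> x \<in> frac_ideal (n - fval c)"
  using fval_mult[of c x] by (cases "x = 0") (auto simp: frac_ideal_iff)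

lemma frac_ideal_cancel_right: "y \<in> frac_ideal n \<Longrightarrow> x + y \<in> frac_ideal n \<longleftrightarrow> x \<in> frac_ideal n"
  using frac_ideal_add[of x n y] frac_ideal_diff[of "x + y" n y] by auto

lemma shell_mult: "x \<in> shell m \<Longrightarrow> y \<in> shell n \<Longrightarrow> x * y \<in> shell (m + n)"
  by (auto simp: shell_iff fval_mult)

lemma shell_inverse: "x \<in> shell m \<Longrightarrow> inverse x \<in> shell (- m)"
  by (auto simp: shell_iff fval_inverse)

lemma shell_add: "x \<in> shell m \<Longrightarrow> y \<in> frac_ideal (m + 1) \<Longrightarrow> x + y \<in> shell m"
  using fval_add_eq[of x y] by (auto simp: shell_iff frac_ideal_iff)

lemma shell_subset: "shell n \<subseteq> frac_ideal n"
  by (auto simp: shell_iff frac_ideal_iff)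

lemma int_units_mult: "u \<in> int_units \<Longrightarrow> v \<in> int_units \<Longrightarrow> u * v \<in> int_units"
  using shell_mult[of u 0 v 0] by simp

lemma int_units_inverse [simp]: "inverse u \<in> int_units \<longleftrightarrow> u \<in> int_units"
  using shell_inverse[of u 0] shell_inverse[of "inverse u" 0] by auto

lemma one_in_units [simp]: "1 \<in> (int_units :: 'a::discrete_valued_field set)"
  by (simp add: shell_iff)

lemma int_units_nonzero: "u \<in> int_units \<Longrightarrow> u \<noteq> 0"
  by (simp add: shell_iff)

text \<open>These are the balls of the metric, indexed by valuation. Topology, compactness and
  equality of measures are all tested on them; any two are nested or disjoint.\<close>

definition coset :: "'a::discrete_valued_field \<Rightarrow> int \<Rightarrow> 'a set"
  where "coset a n = {x. x - a \<in> frac_ideal n}"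

lemma coset_iff: "x \<in> coset a n \<longleftrightarrow> x - a \<in> frac_ideal n"
  by (simp add: coset_def)

lemma coset_self [simp]: "a \<in> coset a n"
  by (simp add: coset_iff)

lemma coset_zero: "coset 0 n = frac_ideal n"
  by (auto simp: coset_iff)

lemma coset_eq: "b \<in> coset a n \<Longrightarrow> coset b n = coset a n"
  using frac_ideal_cancel_right[of "b - a" n] by (auto simp: coset_iff) (metis diff_add_cancel add_diff_eq)+

lemma coset_mono: "m \<le> n \<Longrightarrow> coset a n \<subseteq> coset a m"
  by (auto simp: coset_iff intro: frac_ideal_mono)

lemma coset_sym: "x \<in> coset a n \<longleftrightarrow> a \<in> coset x n"
  using frac_ideal_uminus[of "x - a" n] by (simp add: coset_iff)

lemma coset_disjoint_or_subset:
  assumes "m \<le> n"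
  shows "coset a m \<inter> coset b n = {} \<or> coset b n \<subseteq> coset a m"
proof (cases "coset a m \<inter> coset b n = {}")
  case False
  then obtain x where "x \<in> coset a m" "x \<in> coset b n" by blast
  then show ?thesis using coset_eq[of x a m] coset_eq[of x b n] coset_mono[OF assms, of x] by auto
qed simp

lemma coset_translate: "coset a n = (+) a ` frac_ideal n"
proof -
  have "x \<in> (+) a ` frac_ideal n" if "x - a \<in> frac_ideal n" for x
    using that by (intro image_eqI[of _ _ "x - a"]) auto
  then show ?thesis by (auto simp: coset_iff)
qed

lemma coset_shell:
  assumes "a \<in> shell m" "m < n" shows "coset a n \<subseteq> shell m"
proof
  fix x assume "x \<in> coset a n"
  then have "x - a \<in> frac_ideal (m + 1)" using assms by (auto simp: coset_iff intro: frac_ideal_mono)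
  from shell_add[OF assms(1) this] show "x \<in> shell m" by (simp add: algebra_simps)
qed

section \<open>Topology\<close>

abbreviation q_of :: "'a::discrete_valued_field itself \<Rightarrow> real"
  where "q_of T \<equiv> real (residue_card T)"

text \<open>The classes of 0 and 1 differ because \<open>fval 1 = 0\<close>. Hence
  \<open>q > 1\<close>, and powers of \<open>q\<close> order the shells strictly.\<close>

lemma residue_card_ge_2: "residue_card TYPE('a::nonarch_local_field) \<ge> 2"
proof -
  let ?r = "{(x, y). x \<in> ring_of_integers \<and> y \<in> ring_of_integers \<and> x - y \<in> frac_ideal (1::int)} :: ('a \<times> 'a) set"
  have "?r `` {0} \<in> residue_classes" "?r `` {1} \<in> residue_classes"
    unfolding residue_classes_def by (rule quotientI, simp add: frac_ideal_iff)+
  moreover have "1 \<in> ?r `` {1}" "1 \<notin> ?r `` {0}"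
    by (auto simp: frac_ideal_iff)
  then have "?r `` {0} \<noteq> ?r `` {1}" by metis
  ultimately have "card {?r `` {0}, ?r `` {1}} \<le> card (residue_classes :: 'a set set)"
    by (intro card_mono finite_residue_classes) auto
  with \<open>?r `` {0} \<noteq> ?r `` {1}\<close> show ?thesis by (simp add: residue_card_def)
qed

lemma q_gt_1: "q_of TYPE('a::nonarch_local_field) > 1"
  using residue_card_ge_2[where 'a='a] by simp

lemma q_pos: "q_of TYPE('a::nonarch_local_field) > 0"
  using q_gt_1[where 'a='a] by simp

lemma fabs_eq: "fabs (x::'a::nonarch_local_field) = (if x = 0 then 0 else q_of TYPE('a) powi (- fval x))"
  by (simp add: fabs_def residue_card_def)

lemma fabs_pos: "x \<noteq> 0 \<Longrightarrow> fabs (x::'a::nonarch_local_field) > 0"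
  using q_pos[where 'a='a] by (simp add: fabs_eq)

lemma fabs_nonneg [simp]: "fabs (x::'a::nonarch_local_field) \<ge> 0"
  using fabs_pos[of x] by (cases "x = 0") (auto simp: fabs_eq)

lemma fabs_shell: "x \<in> shell n \<Longrightarrow> fabs (x::'a::nonarch_local_field) = q_of TYPE('a) powi (- n)"
  by (simp add: fabs_eq shell_iff)

lemma powi_le_iff: "(b::real) > 1 \<Longrightarrow> b powi m \<le> b powi n \<longleftrightarrow> m \<le> n"
  using power_int_strict_increasing[of n m b] power_int_increasing[of m n b] by (cases "m \<le> n") auto

lemma powi_less_iff: "(b::real) > 1 \<Longrightarrow> b powi m < b powi n \<longleftrightarrow> m < n"
  using powi_le_iff[of b n m] by auto

lemma fabs_le_iff: "fabs (x::'a::nonarch_local_field) \<le> q_of TYPE('a) powi (- n) \<longleftrightarrow> x \<in> frac_ideal n"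
  using q_gt_1[where 'a='a] q_pos[where 'a='a]
  by (auto simp del: of_nat_less_iff of_nat_0_less_iff simp: fabs_eq frac_ideal_iff powi_le_iff powi_less_iff)

lemma fabs_less_iff: "fabs (x::'a::nonarch_local_field) < q_of TYPE('a) powi (- n) \<longleftrightarrow> x \<in> frac_ideal (n + 1)"
  using q_gt_1[where 'a='a] q_pos[where 'a='a]
  by (auto simp del: of_nat_less_iff of_nat_0_less_iff simp: fabs_eq frac_ideal_iff powi_le_iff powi_less_iff)

lemma dist_le_iff: "dist x (y::'a::nonarch_local_field) \<le> q_of TYPE('a) powi (- n) \<longleftrightarrow> x \<in> coset y n"
  by (simp add: dist_eq_fabs fabs_le_iff coset_iff)

lemma dist_less_iff: "dist x (y::'a::nonarch_local_field) < q_of TYPE('a) powi (- n) \<longleftrightarrow> x \<in> coset y (n + 1)"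
  by (simp add: dist_eq_fabs fabs_less_iff coset_iff)

lemma coset_eq_ball: "coset a (n + 1) = ball (a::'a::nonarch_local_field) (q_of TYPE('a) powi (- n))"
  by (auto simp: dist_less_iff[symmetric] dist_commute)

lemma coset_eq_cball: "coset a n = cball (a::'a::nonarch_local_field) (q_of TYPE('a) powi (- n))"
  by (auto simp: dist_le_iff[symmetric] dist_commute)

lemma open_coset [simp, intro]: "open (coset (a::'a::nonarch_local_field) n)"
  using coset_eq_ball[of a "n - 1"] by simp

lemma closed_coset [simp, intro]: "closed (coset (a::'a::nonarch_local_field) n)"
  by (simp add: coset_eq_cball)

lemma ex_q_powi_less:
  assumes "e > 0" shows "\<exists>n\<ge>k. q_of TYPE('a::nonarch_local_field) powi (- n) < e"
proof -
  have "inverse (q_of TYPE('a)) < 1" using q_gt_1[where 'a='a] by (simp add: inverse_less_1_iff)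
  then obtain m :: nat where m: "inverse (q_of TYPE('a)) ^ m < e"
    using real_arch_pow_inv[OF assms] by blast
  have "q_of TYPE('a) powi (- (max k (int m))) \<le> q_of TYPE('a) powi (- int m)"
    using q_gt_1[where 'a='a] by (intro power_int_increasing) auto
  also have "\<dots> < e" using m by (simp add: power_int_minus power_inverse)
  finally show ?thesis by (intro exI[of _ "max k (int m)"]) auto
qed

lemma ex_q_powi_greater: "\<exists>n\<le>k. e < q_of TYPE('a::nonarch_local_field) powi (- n)"
proof -
  obtain m :: nat where m: "e < q_of TYPE('a) ^ m"
    using real_arch_pow[OF q_gt_1[where 'a='a]] by blast
  have "q_of TYPE('a) powi int m \<le> q_of TYPE('a) powi (- (min k (- int m)))"
    using q_gt_1[where 'a='a] by (intro power_int_increasing) auto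
  then show ?thesis using m by (intro exI[of _ "min k (- int m)"]) auto
qed

lemma ex_coset_subset:
  assumes "open S" "(x::'a::nonarch_local_field) \<in> S" shows "\<exists>n\<ge>k. coset x n \<subseteq> S"
proof -
  obtain e where "e > 0" "ball x e \<subseteq> S" using assms openE by blast
  moreover obtain n where "n \<ge> k" "q_of TYPE('a) powi (- n) < e" using ex_q_powi_less[OF \<open>e > 0\<close>] by blast
  ultimately show ?thesis by (intro exI[of _ n]) (auto simp: coset_eq_cball)
qed

lemma eventually_nhds_coset:
  "eventually P (nhds (x::'a::nonarch_local_field)) \<longleftrightarrow> (\<exists>n\<ge>k. \<forall>y\<in>coset x n. P y)"
proof
  assume "eventually P (nhds x)"
  then obtain S where "open S" "x \<in> S" "\<forall>y\<in>S. P y" unfolding eventually_nhds by blast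
  then show "\<exists>n\<ge>k. \<forall>y\<in>coset x n. P y" using ex_coset_subset[of S x k] by blast
next
  assume "\<exists>n\<ge>k. \<forall>y\<in>coset x n. P y"
  then show "eventually P (nhds x)" unfolding eventually_nhds using open_coset coset_self by blast
qed

lemma tendsto_coset_iff:
  "(f \<longlongrightarrow> (l::'a::nonarch_local_field)) F \<longleftrightarrow> (\<forall>n. eventually (\<lambda>x. f x \<in> coset l n) F)"
proof
  assume "(f \<longlongrightarrow> l) F" then show "\<forall>n. eventually (\<lambda>x. f x \<in> coset l n) F"
    by (auto intro: topological_tendstoD)
next
  assume *: "\<forall>n. eventually (\<lambda>x. f x \<in> coset l n) F"
  show "(f \<longlongrightarrow> l) F"
  proof (rule topological_tendstoI)
    fix S assume "open S" "l \<in> S"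
    then obtain n where "coset l n \<subseteq> S" using ex_coset_subset by blast
    with * show "\<forall>\<^sub>F x in F. f x \<in> S" by (meson eventually_mono subsetD)
  qed
qed

lemma eventually_in_coset: "eventually (\<lambda>y. y \<in> coset x n) (nhds (x::'a::nonarch_local_field))"
  by (meson open_coset coset_self eventually_nhds)

text \<open>The class fixes the metric only, so continuity of the operations has to be derived. For
  addition the same \<open>n\<close> serves both summands, since \<open>frac_ideal n\<close> is a
  group.\<close>

instance nonarch_local_field \<subseteq> topological_ab_group_add
proof
  fix a b :: 'a
  show "LIM x nhds a \<times>\<^sub>F nhds b. fst x + snd x :> nhds (a + b)"
  proof (unfold tendsto_coset_iff, intro allI)
    fix n
    show "\<forall>\<^sub>F x in nhds a \<times>\<^sub>F nhds b. fst x + snd x \<in> coset (a + b) n"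
      unfolding eventually_prod_filter
      by (rule exI[of _ "\<lambda>x. x \<in> coset a n"], rule exI[of _ "\<lambda>x. x \<in> coset b n"])
        (use eventually_in_coset[of a n] eventually_in_coset[of b n] in \<open>auto simp: coset_iff add_diff_add intro!: frac_ideal_add\<close>)
  qed
  show "(uminus \<longlongrightarrow> - a) (nhds a)"
  proof (unfold tendsto_coset_iff, intro allI)
    fix n
    have "- x \<in> coset (- a) n" if "x \<in> coset a n" for x
      using that frac_ideal_uminus[of "x - a" n] by (simp add: coset_iff)
    then show "\<forall>\<^sub>F x in nhds a. - x \<in> coset (- a) n"
      using eventually_in_coset[of a n] by (auto elim: eventually_mono)
  qed
qed

text \<open>Expand around \<open>(a, b)\<close>: the linear terms lie in
  \<open>P^(n - k) P^k\<close>, the quadratic one in \<open>P^(2 n - 2 k)\<close>, which is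
  contained in \<open>P^n\<close> because \<open>k \<le> 0 \<le> n\<close>.\<close>

lemma mult_coset:
  fixes a b :: "'a::nonarch_local_field"
  assumes "x \<in> coset a (n - k)" "y \<in> coset b (n - k)" "k \<le> 0" "a \<in> frac_ideal k" "b \<in> frac_ideal k" "n \<ge> 0"
  shows "x * y \<in> coset (a * b) n"
proof -
  have "x * y - a * b = (x - a) * (y - b) + a * (y - b) + (x - a) * b" by (simp add: algebra_simps)
  moreover have "(x - a) * (y - b) \<in> frac_ideal n"
    using frac_ideal_mult[of "x - a" "n - k" "y - b" "n - k"] assms
    by (auto simp: coset_iff intro: frac_ideal_mono)
  moreover have "a * (y - b) \<in> frac_ideal n"
    using frac_ideal_mult[of a k "y - b" "n - k"] assms by (auto simp: coset_iff)
  moreover have "(x - a) * b \<in> frac_ideal n"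
    using frac_ideal_mult[of "x - a" "n - k" b k] assms by (auto simp: coset_iff)
  ultimately show ?thesis by (auto simp: coset_iff intro!: frac_ideal_add)
qed

instance nonarch_local_field \<subseteq> topological_comm_monoid_mult
proof
  fix a b :: 'a
  obtain k where k: "k \<le> 0" "a \<in> frac_ideal k" "b \<in> frac_ideal k"
    by (rule that[of "min 0 (min (fval a) (fval b))"]) (auto simp: frac_ideal_iff)
  show "LIM x nhds a \<times>\<^sub>F nhds b. fst x * snd x :> nhds (a * b)"
  proof (unfold tendsto_coset_iff, intro allI)
    fix n
    have "\<forall>\<^sub>F x in nhds a \<times>\<^sub>F nhds b. fst x * snd x \<in> coset (a * b) (max 0 n)"
      unfolding eventually_prod_filter
      by (rule exI[of _ "\<lambda>x. x \<in> coset a (max 0 n - k)"], rule exI[of _ "\<lambda>x. x \<in> coset b (max 0 n - k)"])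
        (use k in \<open>auto intro!: eventually_in_coset mult_coset[where k=k]\<close>)
    then show "\<forall>\<^sub>F x in nhds a \<times>\<^sub>F nhds b. fst x * snd x \<in> coset (a * b) n"
      by (rule eventually_mono) (use coset_mono[of n "max 0 n" "a * b"] in auto)
  qed
qed

text \<open>Since \<open>n > fval a\<close>, the point \<open>x\<close> has the valuation of
  \<open>a\<close>, so dividing \<open>x - a\<close> by \<open>a x\<close> costs exactly
  \<open>2 * fval a\<close>.\<close>

lemma inverse_coset:
  fixes a :: "'a::nonarch_local_field"
  assumes "a \<noteq> 0" "x \<in> coset a n" "n > fval a" shows "inverse x \<in> coset (inverse a) (n - 2 * fval a)"
proof -
  have x: "x \<in> shell (fval a)" using coset_shell[of a "fval a" n] assms by (auto simp: shell_iff)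
  then have x0: "x \<noteq> 0" "fval x = fval a" by (auto simp: shell_iff)
  have "inverse x - inverse a = - ((x - a) * (inverse a * inverse x))" using x0 assms by (simp add: field_simps)
  moreover have "inverse a * inverse x \<in> frac_ideal (- 2 * fval a)"
    using x0 assms by (simp add: frac_ideal_iff fval_mult fval_inverse)
  ultimately show ?thesis using assms frac_ideal_mult[of "x - a" n "inverse a * inverse x" "- 2 * fval a"]
    by (simp add: coset_iff)
qed

lemma continuous_on_inverse_field: "continuous_on (- {0}) (inverse :: 'a::nonarch_local_field \<Rightarrow> 'a)"
proof (unfold continuous_on_def, intro ballI)
  fix a :: 'a assume "a \<in> - {0}"
  then have a: "a \<noteq> 0" by simp
  have "(inverse \<longlongrightarrow> inverse a) (nhds a)"
  proof (unfold tendsto_coset_iff, intro allI)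
    fix n
    define m where "m = max (n + 2 * fval a) (fval a + 1)"
    have "inverse x \<in> coset (inverse a) n" if "x \<in> coset a m" for x
    proof -
      have "m > fval a" "n \<le> m - 2 * fval a" by (simp_all add: m_def)
      then show ?thesis using inverse_coset[OF a that] coset_mono[of n "m - 2 * fval a" "inverse a"] by blast
    qed
    then show "\<forall>\<^sub>F x in nhds a. inverse x \<in> coset (inverse a) n"
      using eventually_in_coset[of a m] by (auto elim: eventually_mono)
  qed
  then show "(inverse \<longlongrightarrow> inverse a) (at a within - {0})"
    by (rule tendsto_mono[rotated]) (simp add: at_within_def)
qed

lemma finite_ideal_cosets_step:
  fixes n :: int
  shows "\<exists>R. finite R \<and> frac_ideal n \<subseteq> (\<Union>r\<in>R. coset (r::'a::nonarch_local_field) (n + 1))"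
proof -
  let ?r = "{(x, y). x \<in> ring_of_integers \<and> y \<in> ring_of_integers \<and> x - y \<in> frac_ideal (1::int)} :: ('a \<times> 'a) set"
  obtain p :: 'a where p: "p \<noteq> 0" "fval p = 1" using fval_normalized by blast
  define c where "c = p powi n"
  have c: "c \<noteq> 0" "fval c = n" using p by (auto simp: c_def fval_power_int)
  define R where "R = (\<lambda>C::'a set. c * (SOME x. x \<in> C)) ` residue_classes"
  have "x \<in> (\<Union>r\<in>R. coset r (n + 1))" if "x \<in> frac_ideal n" for x
  proof -
    define y where "y = inverse c * x"
    have y: "y \<in> ring_of_integers" using that c by (simp add: y_def frac_ideal_mult_iff fval_inverse)
    define C where "C = ?r `` {y}"
    have C: "C \<in> residue_classes" unfolding C_def residue_classes_def using y by (rule quotientI)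
    have "y \<in> C" using y by (auto simp: C_def)
    then have "(SOME z. z \<in> C) \<in> C" by (rule someI)
    then have "y - (SOME z. z \<in> C) \<in> frac_ideal 1" by (auto simp: C_def)
    then have "c * (y - (SOME z. z \<in> C)) \<in> frac_ideal (n + 1)" using c by (simp add: frac_ideal_mult_iff)
    then have "x \<in> coset (c * (SOME z. z \<in> C)) (n + 1)" using c by (simp add: coset_iff right_diff_distrib y_def flip: mult.assoc)
    with C show ?thesis by (auto simp: R_def)
  qed
  moreover have "finite R" by (simp add: R_def finite_residue_classes)
  ultimately show ?thesis by blast
qed

lemma finite_ideal_cosets:
  "\<exists>R. finite R \<and> frac_ideal n \<subseteq> (\<Union>r\<in>R. coset (r::'a::nonarch_local_field) (n + int k))"
proof (induction k)
  case 0
  show ?case by (rule exI[of _ "{0}"]) (simp add: coset_zero)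
next
  case (Suc k)
  then obtain R where R: "finite R" "frac_ideal n \<subseteq> (\<Union>r\<in>R. coset (r::'a) (n + int k))" by blast
  obtain S where S: "finite S" "frac_ideal (n + int k) \<subseteq> (\<Union>r\<in>S. coset (r::'a) (n + int k + 1))"
    using finite_ideal_cosets_step[of "n + int k"] by metis
  have "x \<in> (\<Union>r\<in>(\<lambda>(r, s). r + s) ` (R \<times> S). coset r (n + int (Suc k)))" if x: "x \<in> frac_ideal n" for x
  proof -
    obtain r where r: "r \<in> R" "x - r \<in> frac_ideal (n + int k)" using R x by (auto simp: coset_iff)
    obtain s where s: "s \<in> S" "x - r - s \<in> frac_ideal (n + int k + 1)" using S r by (auto simp: coset_iff)
    show ?thesis using r s by (intro UN_I[of "r + s"]) (auto simp: coset_iff algebra_simps)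
  qed
  with R S show ?case by (intro exI[of _ "(\<lambda>(r, s). r + s) ` (R \<times> S)"]) auto
qed

text \<open>Completeness is part of the class; total boundedness is the finiteness of the residue
  field, iterated in \<open>finite_ideal_cosets\<close>.\<close>

lemma compact_frac_ideal: "compact (frac_ideal n :: 'a::nonarch_local_field set)"
  unfolding compact_eq_totally_bounded
proof
  show "complete (frac_ideal n :: 'a set)"
    using closed_coset[of 0 n] by (simp add: coset_zero complete_eq_closed)
  show "\<forall>e>0. \<exists>k. finite k \<and> frac_ideal n \<subseteq> (\<Union>x\<in>k. ball (x::'a) e)"
  proof (intro allI impI)
    fix e :: real assume "e > 0"
    then obtain m where m: "m \<ge> n" "q_of TYPE('a) powi (- m) < e" using ex_q_powi_less by blast
    obtain R where R: "finite R" "frac_ideal n \<subseteq> (\<Union>r\<in>R. coset (r::'a) (n + int (nat (m - n))))"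
      using finite_ideal_cosets by blast
    have "coset r m \<subseteq> ball r e" for r :: 'a using m by (auto simp: coset_eq_cball)
    then have "(\<Union>r\<in>R. coset r m) \<subseteq> (\<Union>r\<in>R. ball r e)" by blast
    moreover have "n + int (nat (m - n)) = m" using m by simp
    ultimately show "\<exists>k. finite k \<and> frac_ideal n \<subseteq> (\<Union>x\<in>k. ball (x::'a) e)"
      using R by (metis subset_trans)
  qed
qed

lemma compact_coset: "compact (coset (a::'a::nonarch_local_field) n)"
  unfolding coset_translate by (intro compact_continuous_image compact_frac_ideal continuous_intros)

lemma shell_eq_diff: "shell n = frac_ideal n - frac_ideal (n + 1)"
  by (auto simp: shell_iff frac_ideal_iff)

lemma compact_shell: "compact (shell n :: 'a::nonarch_local_field set)"
  unfolding shell_eq_diff using open_coset[of 0 "n + 1"]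
  by (intro compact_diff compact_frac_ideal) (simp add: coset_zero)

lemma open_shell: "open (shell n :: 'a::nonarch_local_field set)"
  unfolding shell_eq_diff using open_coset[of 0 n] closed_coset[of 0 "n + 1"]
  by (intro open_Diff) (auto simp: coset_zero)

lemma UN_frac_ideal: "(\<Union>i::nat. frac_ideal (- int i)) = (UNIV::'a::nonarch_local_field set)"
proof -
  have "x \<in> frac_ideal (- int (nat (- fval x)))" for x :: 'a by (auto simp: frac_ideal_iff)
  then show ?thesis by blast
qed

text \<open>The centres are representatives of \<open>P^(- i)\<close> modulo
  \<open>P^(j - i)\<close>, finitely many for each \<open>i\<close> and \<open>j\<close>. Second
  countability makes the Borel sets of a product the product of the Borel sets, on which
  measurability of the field operations rests.\<close>

lemma countable_coset_basis:
  "\<exists>B. countable B \<and> topological_basis B \<and> B \<subseteq> range (\<lambda>(a::'a::nonarch_local_field, n). coset a n)"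
proof -
  have "\<exists>R. \<forall>i j. finite (R i j) \<and> frac_ideal (- int i) \<subseteq> (\<Union>r\<in>R i j. coset (r::'a) (- int i + int j))"
    by (intro choice allI finite_ideal_cosets)
  then obtain R where R: "\<And>i j. finite (R i j)"
      "\<And>i j. frac_ideal (- int i) \<subseteq> (\<Union>r\<in>R i j. coset (r::'a) (- int i + int j))" by blast
  define X where "X = (\<Union>i j. R i j)"
  have X: "\<exists>r\<in>X. x \<in> coset r n" for x :: 'a and n
  proof -
    obtain i where i: "x \<in> frac_ideal (- int i)" using UN_frac_ideal by blast
    obtain r where r: "r \<in> R i (nat (n + int i))" "x \<in> coset r (- int i + int (nat (n + int i)))"
      using R i by blast
    have "coset r (- int i + int (nat (n + int i))) \<subseteq> coset r n" by (rule coset_mono) auto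
    with r show ?thesis by (auto simp: X_def)
  qed
  define B where "B = (\<lambda>(r, n). coset r n) ` (X \<times> UNIV)"
  have "countable X" unfolding X_def by (intro countable_UN countableI_type) (rule countable_finite[OF R(1)])
  then have "countable B" by (auto simp: B_def)
  moreover have "topological_basis B"
  proof (rule topological_basisI)
    fix S assume "S \<in> B" then show "open S" by (auto simp: B_def)
  next
    fix S and x :: 'a assume "open S" "x \<in> S"
    then obtain n where n: "coset x n \<subseteq> S" using ex_coset_subset by blast
    obtain r where "r \<in> X" "x \<in> coset r n" using X by blast
    with n show "\<exists>B'\<in>B. x \<in> B' \<and> B' \<subseteq> S"
      using coset_eq[of x r n] by (intro bexI[of _ "coset r n"]) (auto simp: B_def)
  qed
  moreover have "B \<subseteq> range (\<lambda>(a, n). coset a n)" by (auto simp: B_def)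
  ultimately show ?thesis by (intro exI[of _ B] conjI)
qed

instance nonarch_local_field \<subseteq> second_countable_topology
  by standard (use countable_coset_basis topological_basis_imp_subbasis in blast)

lemma borel_measurable_mult_field [measurable (raw)]:
  fixes f g :: "_ \<Rightarrow> 'a::nonarch_local_field"
  assumes "f \<in> borel_measurable M" "g \<in> borel_measurable M"
  shows "(\<lambda>x. f x * g x) \<in> borel_measurable M"
  using assms by (rule borel_measurable_continuous_Pair) (intro continuous_intros)

lemma borel_measurable_inverse_field [measurable (raw)]:
  fixes f :: "_ \<Rightarrow> 'a::nonarch_local_field"
  assumes "f \<in> borel_measurable M"
  shows "(\<lambda>x. inverse (f x)) \<in> borel_measurable M"
proof -
  \<comment> \<open>Both branches are \<open>inverse\<close>: the split isolates the point 0, off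
    which the function is continuous.\<close>
  have "(\<lambda>x::'a. if x \<in> - {0} then inverse x else inverse x) \<in> borel_measurable borel"
  proof (rule borel_measurable_continuous_on_if)
    show "continuous_on (- (- {0})) (inverse :: 'a \<Rightarrow> 'a)" unfolding double_complement by simp
  qed (simp_all add: continuous_on_inverse_field borel_open)
  then have "inverse \<in> borel_measurable (borel :: 'a measure)" unfolding if_cancel .
  from measurable_compose[OF assms this] show ?thesis .
qed

lemma sets_coset [measurable, simp]: "coset (a::'a::nonarch_local_field) n \<in> sets borel"
  by (simp add: borel_open)

lemma sets_frac_ideal [measurable, simp]: "(frac_ideal n :: 'a::nonarch_local_field set) \<in> sets borel"
  using sets_coset[of 0 n] by (simp add: coset_zero)

lemma sets_shell [measurable, simp]: "(shell n :: 'a::nonarch_local_field set) \<in> sets borel"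
  by (simp add: borel_open open_shell)

text \<open>The finest radius occurring in a finite subcover works everywhere, because a coset that
  meets a larger one lies inside it. The parameter \<open>k\<close> lets callers prescribe how small
  the radius is.\<close>

lemma locally_constant_compact:
  fixes h :: "'a::nonarch_local_field \<Rightarrow> 'b"
  assumes K: "compact K" and h: "\<And>x. x \<in> K \<Longrightarrow> \<forall>\<^sub>F y in nhds x. h y = h x"
  shows "\<exists>n\<ge>k. \<forall>x\<in>K. \<forall>y\<in>coset x n. h y = h x"
proof -
  have "\<exists>m. \<forall>x\<in>K. m x \<ge> k \<and> (\<forall>y\<in>coset x (m x). h y = h x)"
  proof (rule bchoice, rule ballI)
    fix x assume "x \<in> K"
    from h[OF this, unfolded eventually_nhds_coset[where k=k]]
    show "\<exists>m. m \<ge> k \<and> (\<forall>y\<in>coset x m. h y = h x)" .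
  qed
  then obtain m where m: "\<And>x. x \<in> K \<Longrightarrow> m x \<ge> k" "\<And>x y. x \<in> K \<Longrightarrow> y \<in> coset x (m x) \<Longrightarrow> h y = h x"
    by blast
  obtain X where X: "X \<subseteq> K" "finite X" "K \<subseteq> (\<Union>x\<in>X. coset x (m x))"
    using compactE_image[OF K, of K "\<lambda>x. coset x (m x)"] coset_self by blast
  define n where "n = Max (insert k (m ` X))"
  have n: "n \<ge> k" "\<And>x. x \<in> X \<Longrightarrow> n \<ge> m x" using X by (auto simp: n_def)
  have "h y = h x" if xy: "x \<in> K" "y \<in> coset x n" for x y
  proof -
    obtain z where z: "z \<in> X" "x \<in> coset z (m z)" using X xy(1) by blast
    have "coset x n \<subseteq> coset x (m z)" using n z by (intro coset_mono) auto
    then have "y \<in> coset z (m z)" using xy(2) coset_eq[OF z(2)] by blast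
    then have "h y = h z" "h x = h z" using z m X by blast+
    then show ?thesis by simp
  qed
  with n show ?thesis by blast
qed

section \<open>Haar measure\<close>

lemma borel_eq_cosets:
  "sets borel = sigma_sets UNIV (insert {} (range (\<lambda>(a::'a::nonarch_local_field, n). coset a n)))"
proof (rule antisym)
  obtain B where B: "countable B" "topological_basis B" "B \<subseteq> range (\<lambda>(a::'a, n). coset a n)"
    using countable_coset_basis by blast
  have "sets (borel :: 'a measure) = sigma_sets UNIV B"
    unfolding borel_eq_countable_basis[OF B(1,2)] by (simp add: sets_measure_of)
  also have "\<dots> \<subseteq> sigma_sets UNIV (insert {} (range (\<lambda>(a::'a, n). coset a n)))"
    using B(3) by (intro sigma_sets_mono') auto
  finally show "sets borel \<subseteq> sigma_sets UNIV (insert {} (range (\<lambda>(a::'a, n). coset a n)))" .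
  show "sigma_sets UNIV (insert {} (range (\<lambda>(a::'a, n). coset a n))) \<subseteq> sets borel"
    using sets.sigma_sets_subset[of "insert {} (range (\<lambda>(a::'a, n). coset a n))" borel]
    by (metis (no_types, lifting) image_subset_iff insert_subset sets.empty_sets sets_coset space_borel split_beta)
qed

text \<open>Cosets are nested or disjoint, so together with the empty set they are closed under
  intersection, and they determine a Borel measure that is finite on the exhausting sets
  \<open>frac_ideal (- int i)\<close>.\<close>

lemma measure_eqI_cosets:
  fixes M N :: "'a::nonarch_local_field measure"
  assumes M: "sets M = sets borel" "sets N = sets borel"
    and eq: "\<And>a n. emeasure M (coset a n) = emeasure N (coset a n)"
    and fin: "\<And>n. emeasure M (frac_ideal n) \<noteq> \<infinity>"
  shows "M = N"
proof (rule measure_eqI_generator_eq)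
  let ?E = "insert {} (range (\<lambda>(a::'a, n). coset a n))"
  show "Int_stable ?E"
  proof (rule Int_stableI)
    fix S T assume "S \<in> ?E" "T \<in> ?E"
    then consider "S = {} \<or> T = {}" | a m b n where "S = coset a m" "T = coset b n" by auto
    then show "S \<inter> T \<in> ?E"
    proof cases
      case 2
      have "S \<inter> T = {} \<or> T \<subseteq> S \<or> S \<subseteq> T"
        using coset_disjoint_or_subset[of m n a b] coset_disjoint_or_subset[of n m b a] 2
        by (cases "m \<le> n") (auto simp: Int_commute)
      then have "S \<inter> T = {} \<or> S \<inter> T = T \<or> S \<inter> T = S" by blast
      then show ?thesis using 2 by auto
    qed auto
  qed
  show "?E \<subseteq> Pow UNIV" by simp
  show "emeasure M X = emeasure N X" if "X \<in> ?E" for X using that eq by auto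
  show "sets M = sigma_sets UNIV ?E" "sets N = sigma_sets UNIV ?E" using M borel_eq_cosets by auto
  show "range (\<lambda>i::nat. frac_ideal (- int i)) \<subseteq> ?E" by (auto simp: coset_zero[symmetric])
  show "(\<Union>i::nat. frac_ideal (- int i)) = (UNIV :: 'a set)" by (rule UN_frac_ideal)
  show "emeasure M (frac_ideal (- int i)) \<noteq> \<infinity>" for i by (rule fin)
qed

lemma complex_integrable_mult_iff:
  "c \<noteq> 0 \<Longrightarrow> integrable M (\<lambda>x. c * f x) \<longleftrightarrow> integrable M (f :: 'b \<Rightarrow> complex)"
  using integrable_mult_right[of c M f] integrable_mult_right[of "1 / c" M "\<lambda>x. c * f x"] by auto

locale haar_field =
  fixes p :: "'a::nonarch_local_field" and dx :: "'a measure" and q :: real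
  assumes unif: "uniformizer p" and haar: "haar_measure dx" and q_def: "q = q_of TYPE('a)"
begin

lemmas q_simp [simp] = q_def[symmetric]

lemma q_gt [simp]: "q > 1" and q_gt_0 [simp]: "q > 0" and q_ge_0 [simp]: "q \<ge> 0" and q_nz [simp]: "q \<noteq> 0"
  using q_gt_1[where 'a='a] by simp_all

lemma p_nz [simp]: "p \<noteq> 0" and fval_p [simp]: "fval p = 1"
  using unif unfolding uniformizer_def by auto

lemma sets_dx [simp, measurable_cong]: "sets dx = sets borel"
  using haar by (simp add: haar_measure_def)

lemma space_dx [simp]: "space dx = UNIV"
  using sets_eq_imp_space_eq[OF sets_dx] by simp

lemma dx_translate: "A \<in> sets borel \<Longrightarrow> emeasure dx ((+) a ` A) = emeasure dx A"
  using haar by (simp add: haar_measure_def)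

lemma dx_coset: "emeasure dx (coset a n) = emeasure dx (frac_ideal n)"
  unfolding coset_translate by (rule dx_translate) simp

lemma dx_compact: "compact K \<Longrightarrow> emeasure dx K < \<infinity>"
  using haar by (simp add: haar_measure_def)

lemma dx_ideal_finite: "emeasure dx (frac_ideal n) < \<infinity>"
  by (intro dx_compact compact_frac_ideal)

lemma dx_ideal_pos: "emeasure dx (frac_ideal n) > 0"
proof -
  have "open (frac_ideal n :: 'a set)" using open_coset[of 0 n] by (simp add: coset_zero)
  moreover have "(frac_ideal n :: 'a set) \<noteq> {}" using frac_ideal_zero by blast
  ultimately show ?thesis using haar by (simp add: haar_measure_def)
qed

sublocale sigma_finite_measure dx
proof
  show "\<exists>A. countable A \<and> A \<subseteq> sets dx \<and> \<Union> A = space dx \<and> (\<forall>a\<in>A. emeasure dx a \<noteq> \<infinity>)"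
    using UN_frac_ideal
    by (intro exI[of _ "range (\<lambda>i::nat. frac_ideal (- int i))"]) (auto intro!: less_imp_neq dx_ideal_finite[simplified])
qed

text \<open>Multiplication by an element of valuation \<open>n\<close> carries the \<open>q\<close>
  residue classes to cosets of \<open>P^(n + 1)\<close> that partition \<open>P^n\<close>;
  translation invariance gives them equal measure.\<close>

lemma dx_ideal_step: "emeasure dx (frac_ideal n) = ennreal q * emeasure dx (frac_ideal (n + 1))"
proof -
  let ?r = "{(x, y). x \<in> ring_of_integers \<and> y \<in> ring_of_integers \<and> x - y \<in> frac_ideal (1::int)} :: ('a \<times> 'a) set"
  define c where "c = p powi n"
  have c: "c \<noteq> 0" "fval c = n" by (auto simp: c_def fval_power_int)
  have eqv: "equiv ring_of_integers ?r"
  proof (rule equivI)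
    show "?r \<subseteq> ring_of_integers \<times> ring_of_integers" by auto
    show "refl_on ring_of_integers ?r" by (auto simp: refl_on_def)
    show "sym ?r" using coset_sym by (auto simp: sym_def coset_iff)
    show "trans ?r"
    proof (rule transI)
      fix x y z assume "(x, y) \<in> ?r" "(y, z) \<in> ?r"
      then show "(x, z) \<in> ?r" using frac_ideal_add[of "x - y" 1 "y - z"] by auto
    qed
  qed
  have cls: "\<exists>a. (*) c ` C = coset a (n + 1)" if "C \<in> residue_classes" for C :: "'a set"
  proof -
    obtain y where y: "y \<in> ring_of_integers" "C = ?r `` {y}" using \<open>C \<in> residue_classes\<close>
      unfolding residue_classes_def by (rule quotientE)
    have C: "C = coset y 1"
    proof (intro set_eqI iffI)
      fix x :: 'a assume "x \<in> coset y 1"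
      then have "y - x \<in> frac_ideal 1" using coset_sym[of x y 1] by (simp add: coset_iff)
      have "y - (y - x) \<in> ring_of_integers"
        by (rule frac_ideal_diff) (use y frac_ideal_mono[OF \<open>y - x \<in> frac_ideal 1\<close>, of 0] in auto)
      then have "x \<in> ring_of_integers" by simp
      with \<open>y - x \<in> frac_ideal 1\<close> show "x \<in> C" using y by simp
    next
      fix x :: 'a assume "x \<in> C"
      then show "x \<in> coset y 1" using y coset_sym[of x y 1] by (simp add: coset_iff)
    qed
    have "(*) c ` C = coset (c * y) (n + 1)"
    proof (intro set_eqI iffI)
      fix x :: 'a assume "x \<in> (*) c ` C"
      then obtain z where "z \<in> C" "x = c * z" by blast
      then have "x = c * z" "z - y \<in> frac_ideal 1" by (simp_all add: C coset_iff)
      then show "x \<in> coset (c * y) (n + 1)"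
        using c frac_ideal_mult_iff[of c "z - y" "n + 1"] by (simp add: coset_iff right_diff_distrib)
    next
      fix x :: 'a assume x: "x \<in> coset (c * y) (n + 1)"
      have "c * (inverse c * x - y) = x - c * y" using c by (simp add: field_simps)
      then have "inverse c * x - y \<in> frac_ideal 1"
        using x c frac_ideal_mult_iff[of c "inverse c * x - y" "n + 1"] by (simp add: coset_iff)
      then show "x \<in> (*) c ` C" using c by (intro image_eqI[of _ _ "inverse c * x"]) (auto simp: C coset_iff)
    qed
    then show ?thesis by blast
  qed
  have "frac_ideal n = (\<Union>C\<in>residue_classes. (*) c ` C)"
  proof -
    have "\<Union> residue_classes = (ring_of_integers :: 'a set)"
      unfolding residue_classes_def by (rule Union_quotient[OF eqv])
    then have "(\<Union>C\<in>residue_classes. (*) c ` C) = (*) c ` ring_of_integers" by (metis image_Union)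
    also have "\<dots> = frac_ideal n"
    proof (intro set_eqI iffI)
      fix x :: 'a assume "x \<in> frac_ideal n"
      then have "inverse c * x \<in> ring_of_integers" using c by (simp add: frac_ideal_mult_iff fval_inverse)
      then show "x \<in> (*) c ` ring_of_integers" using c by (intro image_eqI[of _ _ "inverse c * x"]) auto
    qed (use c in \<open>auto simp: frac_ideal_mult_iff\<close>)
    finally show ?thesis by simp
  qed
  then have "emeasure dx (frac_ideal n) = (\<Sum>C\<in>residue_classes. emeasure dx ((*) c ` C))"
  proof (simp, intro sum_emeasure[symmetric])
    show "(\<lambda>C. (*) c ` C) ` residue_classes \<subseteq> sets dx" using cls by force
    show "disjoint_family_on (\<lambda>C. (*) c ` C) residue_classes"
    proof (unfold disjoint_family_on_def, intro ballI impI)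
      fix C D :: "'a set" assume "C \<in> residue_classes" "D \<in> residue_classes" "C \<noteq> D"
      then have "C \<inter> D = {}" using quotient_disj[OF eqv] unfolding residue_classes_def by blast
      then show "(*) c ` C \<inter> (*) c ` D = {}" using c by auto
    qed
  qed (rule finite_residue_classes)
  also have "\<dots> = (\<Sum>C\<in>(residue_classes :: 'a set set). emeasure dx (frac_ideal (n + 1)))"
    using cls dx_coset by (intro sum.cong) (auto, metis)
  also have "\<dots> = ennreal q * emeasure dx (frac_ideal (n + 1))"
    by (simp add: q_def residue_card_def ennreal_of_nat_eq_real_of_nat del: q_simp)
  finally show ?thesis .
qed

lemma dx_ideal: "emeasure dx (frac_ideal n) = ennreal (q powi (- n)) * emeasure dx ring_of_integers"
proof -
  have step: "emeasure dx (frac_ideal (n + int k)) * ennreal (q ^ k) = emeasure dx (frac_ideal n)" for n k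
  proof (induction k)
    case (Suc k)
    show ?case using Suc dx_ideal_step[of "n + int k"]
      by (simp add: ennreal_mult ac_simps)
  qed simp
  show ?thesis
  proof (cases "n \<ge> 0")
    case True
    have "ennreal (q powi (- n)) * ennreal (q ^ nat n) = 1"
      using True by (simp add: ennreal_mult[symmetric] power_int_minus power_int_def power_inverse)
    then show ?thesis using step[of 0 "nat n"] True by (metis add_0 int_nat_eq mult.commute mult.left_commute mult_1)
  next
    case False
    then show ?thesis using step[of n "nat (- n)"] by (simp add: power_int_def mult.commute)
  qed
qed

text \<open>The preimage of a coset is a coset with exponent lowered by \<open>fval c\<close>, and
  \<open>dx_ideal\<close> tells how its measure changes.\<close>

lemma dx_scale:
  assumes "c \<noteq> 0"
  shows "distr dx borel ((*) c) = density dx (\<lambda>_. ennreal (q powi fval c))"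
proof (rule measure_eqI_cosets)
  have vim: "(*) c -` coset a n = coset (inverse c * a) (n - fval c)" for a n
  proof -
    have "c * x - a = c * (x - inverse c * a)" for x using assms by (simp add: field_simps)
    then show ?thesis using assms by (auto simp: coset_iff frac_ideal_mult_iff)
  qed
  have *: "emeasure (distr dx borel ((*) c)) (coset a n) = emeasure dx (frac_ideal (n - fval c))" for a n
    by (subst emeasure_distr) (auto simp: vim dx_coset)
  show "emeasure (distr dx borel ((*) c)) (coset a n) = emeasure (density dx (\<lambda>_. ennreal (q powi fval c))) (coset a n)" for a n
    by (simp add: * emeasure_density_const dx_coset dx_ideal[of n] dx_ideal[of "n - fval c"] power_int_add ennreal_mult mult.assoc
      power_int_diff power_int_minus field_simps flip: ennreal_mult)
  show "emeasure (distr dx borel ((*) c)) (frac_ideal n) \<noteq> \<infinity>" for n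
    using *[of 0 n] dx_ideal_finite[of "n - fval c"] by (simp add: coset_zero)
qed simp_all

lemma integral_dx_scale:
  fixes f :: "'a \<Rightarrow> complex"
  assumes [measurable]: "f \<in> borel_measurable borel" and c: "c \<noteq> 0"
  shows "(LINT x|dx. f (c * x)) = q powi fval c * (LINT x|dx. f x)"
proof -
  have "(LINT x|dx. f (c * x)) = (LINT x|distr dx borel ((*) c). f x)"
    by (rule integral_distr[symmetric]) simp_all
  also have "\<dots> = q powi fval c * (LINT x|dx. f x)"
    by (simp add: dx_scale[OF c] integral_density scaleR_conv_of_real)
  finally show ?thesis .
qed

lemma integrable_dx_scale:
  fixes f :: "'a \<Rightarrow> complex"
  assumes [measurable]: "f \<in> borel_measurable borel" and c: "c \<noteq> 0"
  shows "integrable dx (\<lambda>x. f (c * x)) \<longleftrightarrow> integrable dx f"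
proof -
  have "integrable dx (\<lambda>x. f (c * x)) \<longleftrightarrow> integrable (distr dx borel ((*) c)) f"
    by (rule integrable_distr_eq[symmetric]) simp_all
  also have "\<dots> \<longleftrightarrow> integrable dx f"
    by (simp add: dx_scale[OF c] integrable_density power_int_not_zero scaleR_conv_of_real complex_integrable_mult_iff)
  finally show ?thesis .
qed

lemma dx_translate_measure: "distr dx borel ((+) a) = dx"
proof (rule measure_eqI_cosets)
  have "(+) a -` coset b n = coset (b - a) n" for b n by (auto simp: coset_iff algebra_simps)
  then show "emeasure (distr dx borel ((+) a)) (coset b n) = emeasure dx (coset b n)" for b n
    by (subst emeasure_distr) (auto simp: dx_coset)
  then show "emeasure (distr dx borel ((+) a)) (frac_ideal n) \<noteq> \<infinity>" for n
    using dx_ideal_finite[of n] by (metis coset_zero less_irrefl infinity_ennreal_def)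
qed simp_all

lemma integral_dx_translate:
  fixes f :: "'a \<Rightarrow> complex"
  assumes [measurable]: "f \<in> borel_measurable borel"
  shows "(LINT x|dx. f (a + x)) = (LINT x|dx. f x)"
proof -
  have "(LINT x|dx. f (a + x)) = (LINT x|distr dx borel ((+) a). f x)"
    by (rule integral_distr[symmetric]) simp_all
  then show ?thesis by (simp add: dx_translate_measure)
qed

text \<open>Haar measure of the group of units, as the restriction of \<open>dx\<close>. It is left
  unnormalized, so that it is at once the measure in the integrals defining the germs and the
  restriction of \<open>mult_measure dx\<close>.\<close>

definition \<nu> :: "'a measure" where "\<nu> = density dx (indicator int_units)"

lemma sets_nu [simp, measurable_cong]: "sets \<nu> = sets borel"
  by (simp add: \<nu>_def)

lemma space_nu [simp]: "space \<nu> = UNIV"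
  by (simp add: \<nu>_def)

lemma emeasure_nu: "A \<in> sets borel \<Longrightarrow> emeasure \<nu> A = emeasure dx (A \<inter> int_units)"
  by (simp add: \<nu>_def emeasure_density nn_integral_set_ennreal Int_commute flip: indicator_inter_arith)

sublocale nu: finite_measure \<nu>
proof
  have "emeasure \<nu> (space \<nu>) = emeasure dx int_units" by (simp add: emeasure_nu)
  also have "\<dots> < \<infinity>" by (intro dx_compact compact_shell)
  finally show "emeasure \<nu> (space \<nu>) \<noteq> \<infinity>" by simp
qed

lemma AE_nu: "AE u in \<nu>. u \<in> int_units"
  unfolding \<nu>_def by (subst AE_density) (auto simp: indicator_def)

text \<open>Such a map permutes the cosets inside the units without changing their radius, and
  cosets of equal radius have equal measure. An involution is asked for because then the preimage of
  a coset around \<open>w\<close> is, within the units, the coset around \<open>T w\<close>.\<close>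

lemma nu_isometry:
  assumes T [measurable]: "T \<in> borel_measurable borel"
    and units: "\<And>v. v \<in> int_units \<Longrightarrow> T v \<in> int_units"
    and inv: "\<And>v. v \<in> int_units \<Longrightarrow> T (T v) = v"
    and iso: "\<And>v w n. v \<in> int_units \<Longrightarrow> w \<in> int_units \<Longrightarrow> T v \<in> coset (T w) n \<longleftrightarrow> v \<in> coset w n"
  shows "distr \<nu> borel T = \<nu>"
proof (rule measure_eqI_cosets)
  have same: "emeasure dx (coset v n \<inter> int_units) = emeasure dx (coset w n \<inter> int_units)"
    if "v \<in> int_units" "w \<in> int_units" for v w n
  proof (cases "n \<ge> 1")
    case True
    then have "coset v n \<inter> int_units = coset v n" "coset w n \<inter> int_units = coset w n"
      using coset_shell[of v 0 n] coset_shell[of w 0 n] that by auto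
    then show ?thesis by (simp add: dx_coset)
  next
    case False
    \<comment> \<open>For \<open>n \<le> 0\<close> a coset around one unit contains all of
      them.\<close>
    have *: "coset v n \<inter> int_units = int_units" if "v \<in> int_units" for v
    proof -
      have "u - v \<in> frac_ideal n" if "u \<in> int_units" for u
      proof (rule frac_ideal_mono)
        show "u - v \<in> ring_of_integers"
          using that \<open>v \<in> int_units\<close> shell_subset[of 0] by (auto intro!: frac_ideal_diff)
      qed (use False in simp)
      then show ?thesis by (auto simp: coset_iff)
    qed
    then show ?thesis using *[OF that(1)] *[OF that(2)] by simp
  qed
  show eq: "emeasure (distr \<nu> borel T) (coset a n) = emeasure \<nu> (coset a n)" for a n
  proof (cases "coset a n \<inter> int_units = {}")
    case True
    then have "T -` coset a n \<inter> int_units = {}" using units by auto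
    then show ?thesis using True measurable_sets_borel[OF T, of "coset a n"]
      by (subst emeasure_distr) (simp_all add: emeasure_nu)
  next
    case False
    then obtain w where w: "w \<in> int_units" "w \<in> coset a n" by blast
    have "T -` coset a n \<inter> int_units = coset (T w) n \<inter> int_units"
      using iso[of _ "T w" n] inv[OF w(1)] units w coset_eq[OF w(2)] by auto
    moreover have "emeasure (distr \<nu> borel T) (coset a n) = emeasure dx (T -` coset a n \<inter> int_units)"
      using measurable_sets_borel[OF T, of "coset a n"] by (subst emeasure_distr) (simp_all add: emeasure_nu)
    ultimately show ?thesis using same[of "T w" w n] w units coset_eq[OF w(2)] by (simp add: emeasure_nu)
  qed
  show "emeasure (distr \<nu> borel T) (frac_ideal n) \<noteq> \<infinity>" for n
    using eq[of 0 n] by (simp add: coset_zero)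
qed simp_all

text \<open>The map \<open>v \<mapsto> u / v\<close> is its own inverse, which is what
  \<open>nu_isometry\<close> asks for. Invariance under multiplication then follows by composing two
  such maps.\<close>

lemma integral_nu_div:
  fixes f :: "'a \<Rightarrow> complex"
  assumes [measurable]: "f \<in> borel_measurable borel" and u: "u \<in> int_units"
  shows "(LINT v|\<nu>. f (u * inverse v)) = (LINT v|\<nu>. f v)"
proof -
  have "distr \<nu> borel (\<lambda>v. u * inverse v) = \<nu>"
  proof (rule nu_isometry)
    show "(\<lambda>v. u * inverse v) \<in> borel_measurable borel" by measurable
    fix v :: 'a assume v: "v \<in> int_units"
    show "u * inverse v \<in> int_units" using u v by (simp add: int_units_mult)
    show "u * inverse (u * inverse v) = v" using u v by (simp add: shell_iff)
    fix w :: 'a and n assume w: "w \<in> int_units"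
    have "u * inverse v - u * inverse w = (- u * inverse v * inverse w) * (v - w)"
      using u v w by (simp add: shell_iff field_simps)
    moreover have "- u * inverse v * inverse w \<noteq> 0" "fval (- u * inverse v * inverse w) = 0"
      using u v w by (auto simp: shell_iff fval_mult fval_inverse)
    ultimately show "u * inverse v \<in> coset (u * inverse w) n \<longleftrightarrow> v \<in> coset w n"
      unfolding coset_iff by (metis frac_ideal_mult_iff diff_zero)
  qed
  then have "(LINT v|\<nu>. f v) = (LINT v|distr \<nu> borel (\<lambda>v. u * inverse v). f v)" by simp
  also have "\<dots> = (LINT v|\<nu>. f (u * inverse v))" by (rule integral_distr) simp_all
  finally show ?thesis by simp
qed

lemma integral_nu_mult:
  fixes f :: "'a \<Rightarrow> complex"
  assumes [measurable]: "f \<in> borel_measurable borel" and u: "u \<in> int_units"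
  shows "(LINT v|\<nu>. f (u * v)) = (LINT v|\<nu>. f v)"
  using integral_nu_div[of "\<lambda>v. f (u * v)" 1] integral_nu_div[of f u] u by simp

lemma integral_nu_cong:
  fixes f g :: "'a \<Rightarrow> complex"
  assumes "f \<in> borel_measurable borel" "g \<in> borel_measurable borel" "\<And>u. u \<in> int_units \<Longrightarrow> f u = g u"
  shows "(LINT u|\<nu>. f u) = (LINT u|\<nu>. g u)"
  using assms AE_nu by (intro integral_cong_AE) auto

lemma integrable_nu_bounded:
  fixes f :: "'a \<Rightarrow> complex"
  assumes "f \<in> borel_measurable borel" "\<And>u. u \<in> int_units \<Longrightarrow> cmod (f u) \<le> B"
  shows "integrable \<nu> f"
  using assms AE_nu by (intro nu.integrable_const_bound[of _ B]) auto

lemma integral_nu_eq: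
  fixes f :: "'a \<Rightarrow> complex"
  assumes "f \<in> borel_measurable borel"
  shows "(LINT u|\<nu>. f u) = (LINT u|dx. indicator int_units u * f u)"
proof -
  have "\<nu> = density dx (\<lambda>u. ennreal (indicator int_units u))"
    by (simp add: \<nu>_def ennreal_indicator)
  moreover have "(\<lambda>u. indicator int_units u *\<^sub>R f u) = (\<lambda>u. indicator int_units u * f u)"
    by (auto simp: indicator_def)
  ultimately show ?thesis using assms by (simp add: integral_density)
qed

lemma integrable_nu_iff:
  fixes f :: "'a \<Rightarrow> complex"
  assumes "f \<in> borel_measurable borel"
  shows "integrable \<nu> f \<longleftrightarrow> integrable dx (\<lambda>u. indicator int_units u * f u)"
proof -
  have "\<nu> = density dx (\<lambda>u. ennreal (indicator int_units u))"
    by (simp add: \<nu>_def ennreal_indicator)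
  moreover have "(\<lambda>u. indicator int_units u *\<^sub>R f u) = (\<lambda>u. indicator int_units u * f u)"
    by (auto simp: indicator_def)
  ultimately show ?thesis using assms by (simp add: integrable_density)
qed

lemma borel_measurable_fabs [measurable]: "fabs \<in> borel_measurable (borel :: 'a measure)"
proof -
  have "(\<lambda>x::'a. dist x 0) \<in> borel_measurable borel" by measurable
  then show ?thesis by (simp add: dist_eq_fabs)
qed

lemma set_integral_shell_dx:
  fixes f :: "'a \<Rightarrow> complex"
  assumes [measurable]: "f \<in> borel_measurable borel"
  shows "set_lebesgue_integral (mult_measure dx) (shell n) f = q powi n * (LINT x|dx. indicator (shell n) x * f x)"
    and "set_integrable (mult_measure dx) (shell n) f \<longleftrightarrow> integrable dx (\<lambda>x. indicator (shell n) x * f x)"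
proof -
  have eq: "(1 / fabs x) *\<^sub>R (indicator (shell n) x *\<^sub>R f x) = of_real (q powi n) * (indicator (shell n) x * f x)" for x :: 'a
    by (auto simp: indicator_def fabs_shell power_int_minus scaleR_conv_of_real divide_inverse)
  show "set_lebesgue_integral (mult_measure dx) (shell n) f = q powi n * (LINT x|dx. indicator (shell n) x * f x)"
    unfolding set_lebesgue_integral_def mult_measure_def
    by (subst integral_density) (simp_all only: eq, simp_all)
  show "set_integrable (mult_measure dx) (shell n) f \<longleftrightarrow> integrable dx (\<lambda>x. indicator (shell n) x * f x)"
    unfolding set_integrable_def mult_measure_def
    by (subst integrable_density) (simp_all only: eq, simp_all add: power_int_not_zero complex_integrable_mult_iff)
qed

lemma shell_indicator_nu:
  fixes f :: "'a \<Rightarrow> complex"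
  assumes [measurable]: "f \<in> borel_measurable borel" and c: "c \<in> shell n"
  shows "(LINT u|\<nu>. f (c * u)) = q powi n * (LINT x|dx. indicator (shell n) x * f x)"
    and "integrable \<nu> (\<lambda>u. f (c * u)) \<longleftrightarrow> integrable dx (\<lambda>x. indicator (shell n) x * f x)"
proof -
  have c': "c \<noteq> 0" "fval c = n" using c by (auto simp: shell_iff)
  have ind: "indicator int_units u * f (c * u) = indicator (shell n) (c * u) * f (c * u)" for u
    using c' by (auto simp: indicator_def shell_iff fval_mult)
  show "(LINT u|\<nu>. f (c * u)) = q powi n * (LINT x|dx. indicator (shell n) x * f x)"
    using integral_dx_scale[of "\<lambda>x. indicator (shell n) x * f x" c] c' by (simp add: integral_nu_eq ind)
  show "integrable \<nu> (\<lambda>u. f (c * u)) \<longleftrightarrow> integrable dx (\<lambda>x. indicator (shell n) x * f x)"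
    using integrable_dx_scale[of "\<lambda>x. indicator (shell n) x * f x" c] c' by (simp add: integrable_nu_iff ind)
qed

text \<open>The factor \<open>q powi n\<close> coming from \<open>1 / fabs x\<close> cancels the
  Jacobian of \<open>u \<mapsto> c u\<close>; hence every \<open>c\<close> in the shell gives the
  same value.\<close>

lemma set_integral_shell:
  fixes f :: "'a \<Rightarrow> complex"
  assumes "f \<in> borel_measurable borel" and "c \<in> shell n"
  shows "set_lebesgue_integral (mult_measure dx) (shell n) f = (LINT u|\<nu>. f (c * u))"
    and "set_integrable (mult_measure dx) (shell n) f \<longleftrightarrow> integrable \<nu> (\<lambda>u. f (c * u))"
  using set_integral_shell_dx[OF assms(1), of n] shell_indicator_nu[OF assms] by simp_all

lemma p_powi_shell [simp]: "p powi n \<in> shell n"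
  by (simp add: shell_iff fval_power_int)

end

section \<open>Locally constant functions on the units and their convolution\<close>

lemma unit_cancel:
  fixes u v :: "'a::nonarch_local_field"
  assumes "u \<in> int_units"
  shows "u * (v * inverse u) = v" "u * v * inverse u = v" "v * u * inverse u = v" "v * inverse u * u = v"
    "u * inverse (u * inverse v) = v" "u * (inverse u * v) = v" "inverse u * (u * v) = v"
  using assms by (simp_all add: shell_iff field_simps)

text \<open>The filtration of the unit group. Intersecting with the units makes \<open>M = 0\<close>
  the whole group.\<close>

definition one_units :: "nat \<Rightarrow> 'a::nonarch_local_field set"
  where "one_units M = {w. w \<in> int_units \<and> w \<in> coset 1 (int M)}"

definition level :: "nat \<Rightarrow> ('a::nonarch_local_field \<Rightarrow> complex) set"
  where "level M = {a. (\<forall>u. u \<notin> int_units \<longrightarrow> a u = 0) \<and> (\<forall>u\<in>int_units. \<forall>w\<in>one_units M. a (u * w) = a u)}"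

definition loc_const :: "('a::nonarch_local_field \<Rightarrow> complex) set"
  where "loc_const = (\<Union>M. level M)"

lemma one_units_mono: "M \<le> K \<Longrightarrow> one_units K \<subseteq> one_units M"
  using coset_mono[of "int M" "int K" 1] by (auto simp: one_units_def)

lemma one_units_units: "w \<in> one_units M \<Longrightarrow> w \<in> int_units"
  by (simp add: one_units_def)

lemma one_in_one_units [simp]: "1 \<in> one_units M"
  by (simp add: one_units_def)

text \<open>By \<open>v - u = u (v / u - 1)\<close>, multiplicative and additive congruence modulo
  \<open>P^M\<close> coincide for units. This is the link between \<open>level\<close> and
  cosets.\<close>

lemma quotient_one_units:
  assumes "u \<in> int_units" "v \<in> int_units"
  shows "v * inverse u \<in> one_units M \<longleftrightarrow> v \<in> coset u (int M)"
proof -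
  have "v - u = u * (v * inverse u - 1)" using assms by (simp add: shell_iff field_simps)
  moreover have "v * inverse u \<in> int_units" using assms by (simp add: int_units_mult)
  ultimately show ?thesis using assms by (simp add: one_units_def coset_iff frac_ideal_mult_iff shell_iff)
qed

lemma one_units_inverse: "w \<in> one_units M \<Longrightarrow> inverse w \<in> one_units M"
  using quotient_one_units[of w 1 M] coset_sym[of 1 w "int M"] by (auto simp: one_units_def)

lemma one_units_mult: "w \<in> one_units M \<Longrightarrow> v \<in> one_units M \<Longrightarrow> w * v \<in> one_units M"
proof -
  assume wv: "w \<in> one_units M" "v \<in> one_units M"
  then have "w * (v - 1) \<in> frac_ideal (int M)" "w - 1 \<in> frac_ideal (int M)"
    using frac_ideal_mult[of w 0 "v - 1" "int M"] shell_subset[of 0]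
    by (auto simp: one_units_def coset_iff)
  then have "w * (v - 1) + (w - 1) \<in> frac_ideal (int M)" by (rule frac_ideal_add)
  moreover have "w * (v - 1) + (w - 1) = w * v - 1" by (simp add: algebra_simps)
  ultimately have "w * v \<in> coset 1 (int M)" by (simp only: coset_iff)
  then show ?thesis using wv by (simp add: one_units_def int_units_mult)
qed

lemma levD: "a \<in> level M \<Longrightarrow> u \<in> int_units \<Longrightarrow> w \<in> one_units M \<Longrightarrow> a (u * w) = a u"
  and level_off: "a \<in> level M \<Longrightarrow> u \<notin> int_units \<Longrightarrow> a u = 0"
  by (auto simp: level_def)

lemma levI: "(\<And>u. u \<notin> int_units \<Longrightarrow> a u = 0) \<Longrightarrow> (\<And>u w. u \<in> int_units \<Longrightarrow> w \<in> one_units M \<Longrightarrow> a (u * w) = a u) \<Longrightarrow> a \<in> level M"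
  by (auto simp: level_def)

lemma level_mono: "M \<le> K \<Longrightarrow> level M \<subseteq> level K"
  using one_units_mono[of M K] by (fastforce simp: level_def)

lemma level_loc_const: "a \<in> level M \<Longrightarrow> a \<in> loc_const"
  by (auto simp: loc_const_def)

lemma loc_const_off: "a \<in> loc_const \<Longrightarrow> u \<notin> int_units \<Longrightarrow> a u = 0"
  by (auto simp: loc_const_def level_def)

lemma loc_const_common:
  assumes "a \<in> loc_const" "b \<in> loc_const" obtains M where "a \<in> level M" "b \<in> level M"
proof -
  obtain M K where "a \<in> level M" "b \<in> level K" using assms by (auto simp: loc_const_def)
  then have "a \<in> level (max M K)" "b \<in> level (max M K)" using level_mono[of M "max M K"] level_mono[of K "max M K"] by auto
  then show ?thesis by (rule that)
qed

lemma level_zero [simp]: "0 \<in> level M"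
  by (simp add: level_def)

lemma level_add: "a \<in> level M \<Longrightarrow> b \<in> level M \<Longrightarrow> a + b \<in> level M"
  by (auto simp: level_def)

lemma level_scale: "a \<in> level M \<Longrightarrow> (\<lambda>u. c * a u) \<in> level M"
  by (auto simp: level_def)

lemma level_times: "a \<in> level M \<Longrightarrow> b \<in> level M \<Longrightarrow> (\<lambda>u. a u * b u) \<in> level M"
  by (auto simp: level_def)

lemma level_sum: "(\<And>i. i \<in> I \<Longrightarrow> f i \<in> level M) \<Longrightarrow> sum f I \<in> level M"
  by (induction I rule: infinite_finite_induct) (auto intro: level_add)

lemma loc_const_zero [simp]: "0 \<in> loc_const"
  by (auto simp: loc_const_def)

lemma loc_const_add: "a \<in> loc_const \<Longrightarrow> b \<in> loc_const \<Longrightarrow> a + b \<in> loc_const"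
  by (metis loc_const_common level_loc_const level_add)

lemma loc_const_scale: "a \<in> loc_const \<Longrightarrow> (\<lambda>u. c * a u) \<in> loc_const"
  by (auto simp: loc_const_def intro: level_scale)

lemma loc_const_times: "a \<in> loc_const \<Longrightarrow> b \<in> loc_const \<Longrightarrow> (\<lambda>u. a u * b u) \<in> loc_const"
  by (metis loc_const_common level_loc_const level_times)

lemma loc_const_sum: "(\<And>i. i \<in> I \<Longrightarrow> f i \<in> loc_const) \<Longrightarrow> sum f I \<in> loc_const"
  by (induction I rule: infinite_finite_induct) (auto intro: loc_const_add)

lemma level_coset:
  assumes "a \<in> level M" "u \<in> int_units" "v \<in> int_units" "v \<in> coset u (int M)"
  shows "a v = a u"
  using levD[OF assms(1,2) iffD2[OF quotient_one_units[OF assms(2,3)] assms(4)]]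
  unfolding unit_cancel(1)[OF assms(2)] .

lemma level_reflect: "a \<in> level M \<Longrightarrow> (\<lambda>u. a (inverse u)) \<in> level M"
  by (intro levI) (auto simp: level_off levD one_units_inverse)

lemma loc_const_locally_constant:
  assumes "a \<in> loc_const" "u \<in> int_units" shows "\<forall>\<^sub>F v in nhds u. a v = a u"
proof -
  obtain M where M: "a \<in> level M" using assms by (auto simp: loc_const_def)
  have "a v = a u" if "v \<in> coset u (int (Suc M))" for v
  proof (rule level_coset[OF M assms(2)])
    show "v \<in> int_units" using coset_shell[OF assms(2), of "int (Suc M)"] that by auto
    show "v \<in> coset u (int M)" using coset_mono[of "int M" "int (Suc M)" u] that by auto
  qed
  then show ?thesis by (rule eventually_mono[OF eventually_in_coset])
qed

text \<open>Compactness of the units gives one exponent valid at all points;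
  \<open>quotient_one_units\<close> turns it into invariance under a subgroup.\<close>

lemma locally_constant_loc_const:
  assumes off: "\<And>u. u \<notin> int_units \<Longrightarrow> a u = (0::complex)"
    and loc: "\<And>u::'a::nonarch_local_field. u \<in> int_units \<Longrightarrow> \<forall>\<^sub>F v in nhds u. a v = a u"
  shows "a \<in> loc_const"
proof -
  obtain n where n: "n \<ge> 0" "\<And>u v. u \<in> int_units \<Longrightarrow> v \<in> coset u n \<Longrightarrow> a v = a u"
    using locally_constant_compact[OF compact_shell loc, of 0 0] by blast
  have "a \<in> level (nat n)"
  proof (rule levI)
    fix u w :: 'a assume u: "u \<in> int_units" "w \<in> one_units (nat n)"
    then have "u * w \<in> int_units" by (auto intro: int_units_mult one_units_units)
    then have "u * w \<in> coset u n" using quotient_one_units[of u "u * w" "nat n"] u n(1) by (simp add: unit_cancel)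
    then show "a (u * w) = a u" using n u by blast
  qed (rule off)
  then show ?thesis by (rule level_loc_const)
qed

lemma loc_const_continuous_on: "a \<in> loc_const \<Longrightarrow> continuous_on int_units a"
proof (unfold continuous_on_def, intro ballI)
  fix u :: 'a assume "a \<in> loc_const" "u \<in> int_units"
  then have "\<forall>\<^sub>F v in nhds u. a v = a u" by (rule loc_const_locally_constant)
  then have "(a \<longlongrightarrow> a u) (nhds u)" by (rule tendsto_eventually)
  then show "(a \<longlongrightarrow> a u) (at u within int_units)"
    by (rule tendsto_mono[rotated]) (simp add: at_within_def)
qed

lemma loc_const_measurable: "a \<in> loc_const \<Longrightarrow> a \<in> borel_measurable borel"
proof -
  assume a: "a \<in> loc_const"
  have "(\<lambda>x. if x \<in> int_units then a x else 0) \<in> borel_measurable borel"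
    using loc_const_continuous_on[OF a] by (intro borel_measurable_continuous_on_if) auto
  moreover have "(\<lambda>x. if x \<in> int_units then a x else 0) = a" using loc_const_off[OF a] by auto
  ultimately show ?thesis by simp
qed

lemma loc_const_bounded: "a \<in> loc_const \<Longrightarrow> \<exists>B\<ge>0. \<forall>u. cmod (a u) \<le> B"
proof -
  assume a: "a \<in> loc_const"
  have "compact (a ` int_units)"
    by (intro compact_continuous_image loc_const_continuous_on compact_shell a)
  then obtain B where "B > 0" "\<forall>y\<in>a ` int_units. cmod y \<le> B"
    using compact_imp_bounded bounded_pos by blast
  moreover have "cmod (a u) \<le> B" for u
    using calculation loc_const_off[OF a, of u] by (cases "u \<in> int_units") auto
  ultimately show ?thesis by (intro exI[of _ B]) auto
qed

context haar_field
begin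

lemma fubini_nu:
  fixes f :: "'a \<Rightarrow> 'a \<Rightarrow> complex"
  assumes [measurable]: "case_prod f \<in> borel_measurable (borel \<Otimes>\<^sub>M borel)" and b: "\<And>u v. cmod (f u v) \<le> B"
  shows "(LINT u|\<nu>. LINT v|\<nu>. f u v) = (LINT v|\<nu>. LINT u|\<nu>. f u v)"
proof -
  interpret P: pair_sigma_finite \<nu> \<nu> by standard
  interpret F: finite_measure "\<nu> \<Otimes>\<^sub>M \<nu>"
    by (rule finite_measure_pair_measure) (rule nu.finite_measure_axioms)+
  have "integrable (\<nu> \<Otimes>\<^sub>M \<nu>) (case_prod f)"
    using b by (intro F.integrable_const_bound[of _ B]) auto
  then show ?thesis by (rule P.Fubini_integral[symmetric])
qed

definition uconv :: "('a \<Rightarrow> complex) \<Rightarrow> ('a \<Rightarrow> complex) \<Rightarrow> 'a \<Rightarrow> complex"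
  where "uconv a b u = (if u \<in> int_units then LINT v|\<nu>. a (u * inverse v) * b v else 0)"

lemma uconv_off: "u \<notin> int_units \<Longrightarrow> uconv a b u = 0"
  by (simp add: uconv_def)

lemma loc_const_integrable: "a \<in> loc_const \<Longrightarrow> integrable \<nu> a"
  using loc_const_bounded[of a] loc_const_measurable[of a] by (auto intro: integrable_nu_bounded)

lemma uconv_measurable:
  assumes "a \<in> loc_const" "b \<in> loc_const" shows "(\<lambda>v. a (u * inverse v) * b v) \<in> borel_measurable borel"
proof -
  note [measurable] = loc_const_measurable[OF assms(1)] loc_const_measurable[OF assms(2)]
  show ?thesis by measurable
qed

lemma uconv_integrable:
  assumes "a \<in> loc_const" "b \<in> loc_const" shows "integrable \<nu> (\<lambda>v. a (u * inverse v) * b v)"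
proof -
  obtain A where "A \<ge> 0" "\<And>u. cmod (a u) \<le> A" using loc_const_bounded[OF assms(1)] by blast
  moreover obtain B where "B \<ge> 0" "\<And>u. cmod (b u) \<le> B" using loc_const_bounded[OF assms(2)] by blast
  ultimately show ?thesis using uconv_measurable[OF assms]
    by (intro integrable_nu_bounded[of _ "A * B"]) (auto simp: norm_mult intro!: mult_mono)
qed

lemma uconv_commute:
  assumes "a \<in> loc_const" "b \<in> loc_const" shows "uconv a b = uconv b a"
proof
  fix u show "uconv a b u = uconv b a u"
  proof (cases "u \<in> int_units")
    case True
    note [measurable] = loc_const_measurable[OF assms(1)] loc_const_measurable[OF assms(2)]
    have "(LINT v|\<nu>. b (u * inverse v) * a v) = (LINT v|\<nu>. a (u * inverse (u * inverse v)) * b (u * inverse v))"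
    proof (rule integral_nu_cong)
      fix v :: 'a assume "v \<in> int_units"
      show "b (u * inverse v) * a v = a (u * inverse (u * inverse v)) * b (u * inverse v)"
        unfolding unit_cancel(5)[OF True] by (rule mult.commute)
    qed measurable
    also have "\<dots> = (LINT v|\<nu>. a (u * inverse v) * b v)"
      using integral_nu_div[OF uconv_measurable[OF assms, of u] True] .
    finally show ?thesis using True by (simp add: uconv_def)
  qed (simp add: uconv_def)
qed

lemma uconv_level_left:
  assumes "a \<in> level M" "b \<in> loc_const" shows "uconv a b \<in> level M"
proof (rule levI)
  fix u w :: 'a assume u: "u \<in> int_units" and w: "w \<in> one_units M"
  have "(LINT v|\<nu>. a (u * w * inverse v) * b v) = (LINT v|\<nu>. a (u * inverse v) * b v)"
  proof (rule integral_nu_cong)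
    fix v :: 'a assume "v \<in> int_units"
    then have "u * inverse v \<in> int_units" using u by (simp add: int_units_mult)
    then have "a ((u * inverse v) * w) = a (u * inverse v)" using w by (rule levD[OF assms(1)])
    moreover have "u * w * inverse v = (u * inverse v) * w" by (simp add: ac_simps)
    ultimately show "a (u * w * inverse v) * b v = a (u * inverse v) * b v" by (simp only:)
  qed (rule uconv_measurable[OF level_loc_const[OF assms(1)] assms(2)])+
  then show "uconv a b (u * w) = uconv a b u"
    using u int_units_mult[OF u one_units_units[OF w]] by (simp add: uconv_def)
qed (rule uconv_off)

text \<open>Together with \<open>uconv_level_left\<close>: a convolution inherits the level of
  either factor, hence the smaller one. In this way a component of bounded level absorbs the
  unbounded levels of the germs.\<close>

lemma uconv_level_right: "a \<in> loc_const \<Longrightarrow> b \<in> level M \<Longrightarrow> uconv a b \<in> level M"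
  using uconv_level_left[of b M a] uconv_commute[of a b] level_loc_const[of b M] by simp

lemma uconv_loc_const: "a \<in> loc_const \<Longrightarrow> b \<in> loc_const \<Longrightarrow> uconv a b \<in> loc_const"
proof -
  assume "a \<in> loc_const" "b \<in> loc_const"
  then obtain M where "a \<in> level M" by (auto simp: loc_const_def)
  from uconv_level_left[OF this \<open>b \<in> loc_const\<close>] show ?thesis by (rule level_loc_const)
qed

text \<open>A substitution in the inner variable turns the left side into the double integral of
  \<open>a (u / w) b (w / v) c v\<close>; exchanging the order exposes \<open>uconv b c\<close>
  inside. Boundedness of locally constant functions justifies Fubini.\<close>

lemma uconv_assoc:
  assumes "a \<in> loc_const" "b \<in> loc_const" "c \<in> loc_const" shows "uconv (uconv a b) c = uconv a (uconv b c)"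
proof
  fix u show "uconv (uconv a b) c u = uconv a (uconv b c) u"
  proof (cases "u \<in> int_units")
    case True
    note [measurable] = loc_const_measurable[OF assms(1)] loc_const_measurable[OF assms(2)] loc_const_measurable[OF assms(3)]
      loc_const_measurable[OF uconv_loc_const[OF assms(1,2)]] loc_const_measurable[OF uconv_loc_const[OF assms(2,3)]]
    obtain A where A: "A \<ge> 0" "\<And>u. cmod (a u) \<le> A" using loc_const_bounded[OF assms(1)] by blast
    obtain B where B: "B \<ge> 0" "\<And>u. cmod (b u) \<le> B" using loc_const_bounded[OF assms(2)] by blast
    obtain C where C: "C \<ge> 0" "\<And>u. cmod (c u) \<le> C" using loc_const_bounded[OF assms(3)] by blast
    have "uconv (uconv a b) c u = (LINT v|\<nu>. uconv a b (u * inverse v) * c v)"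
      using True by (simp add: uconv_def)
    also have "\<dots> = (LINT v|\<nu>. LINT w|\<nu>. a (u * inverse w) * (b (w * inverse v) * c v))"
    proof (rule integral_nu_cong)
      fix v :: 'a assume v: "v \<in> int_units"
      have m: "(\<lambda>w. a (u * inverse w) * (b (w * inverse v) * c v)) \<in> borel_measurable borel" by measurable
      have "uconv a b (u * inverse v) * c v = (LINT w|\<nu>. a (u * inverse v * inverse w) * b w) * c v"
        using True v by (simp add: uconv_def int_units_mult)
      also have "\<dots> = (LINT w|\<nu>. a (u * inverse v * inverse w) * b w * c v)" by simp
      also have "\<dots> = (LINT w|\<nu>. a (u * inverse (v * w)) * (b ((v * w) * inverse v) * c v))"
      proof (rule Bochner_Integration.integral_cong)
        fix w
        have "v * w * inverse v = w" using v by (rule unit_cancel)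
        moreover have "u * inverse v * inverse w = u * inverse (v * w)" by (simp add: mult.assoc mult.commute[of v])
        ultimately show "a (u * inverse v * inverse w) * b w * c v = a (u * inverse (v * w)) * (b (v * w * inverse v) * c v)"
          by (simp only: mult.assoc)
      qed simp
      also have "\<dots> = (LINT w|\<nu>. a (u * inverse w) * (b (w * inverse v) * c v))"
        using integral_nu_mult[OF m v] .
      finally show "uconv a b (u * inverse v) * c v = (LINT w|\<nu>. a (u * inverse w) * (b (w * inverse v) * c v))" .
    qed measurable
    also have "\<dots> = (LINT w|\<nu>. LINT v|\<nu>. a (u * inverse w) * (b (w * inverse v) * c v))"
    proof (rule fubini_nu[where B = "A * (B * C)"])
      show "cmod (a (u * inverse w) * (b (w * inverse v) * c v)) \<le> A * (B * C)" for v w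
        using A B C by (auto simp: norm_mult intro!: mult_mono)
    qed measurable
    also have "\<dots> = (LINT w|\<nu>. a (u * inverse w) * uconv b c w)"
    proof (rule integral_nu_cong)
      fix w :: 'a assume "w \<in> int_units"
      then show "(LINT v|\<nu>. a (u * inverse w) * (b (w * inverse v) * c v)) = a (u * inverse w) * uconv b c w"
        by (simp add: uconv_def)
    qed measurable
    finally show ?thesis using True by (simp add: uconv_def)
  qed (simp add: uconv_def)
qed

lemma uconv_left_commute:
  assumes "a \<in> loc_const" "b \<in> loc_const" "c \<in> loc_const" shows "uconv a (uconv b c) = uconv b (uconv a c)"
proof -
  have "uconv (uconv a b) c = uconv (uconv b a) c" using uconv_commute[OF assms(1,2)] by simp
  then show ?thesis using uconv_assoc[OF assms] uconv_assoc[OF assms(2,1,3)] by simp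
qed

lemma uconv_add_left: "a \<in> loc_const \<Longrightarrow> a' \<in> loc_const \<Longrightarrow> b \<in> loc_const \<Longrightarrow> uconv (a + a') b = uconv a b + uconv a' b"
  using uconv_integrable[of a b] uconv_integrable[of a' b] by (auto simp: uconv_def fun_eq_iff distrib_right)

lemma uconv_add_right: "a \<in> loc_const \<Longrightarrow> b \<in> loc_const \<Longrightarrow> b' \<in> loc_const \<Longrightarrow> uconv a (b + b') = uconv a b + uconv a b'"
  using uconv_integrable[of a b] uconv_integrable[of a b'] by (auto simp: uconv_def fun_eq_iff distrib_left)

lemma uconv_scale_left: "uconv (\<lambda>u. c * a u) b = (\<lambda>u. c * uconv a b u)"
  by (auto simp: uconv_def fun_eq_iff mult.assoc)

lemma uconv_scale_right: "uconv a (\<lambda>u. c * b u) = (\<lambda>u. c * uconv a b u)"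
  by (auto simp: uconv_def fun_eq_iff mult.left_commute)

lemma uconv_zero_left [simp]: "uconv 0 b = 0"
  by (auto simp: uconv_def fun_eq_iff)

lemma uconv_zero_right [simp]: "uconv a 0 = 0"
  by (auto simp: uconv_def fun_eq_iff)

lemma uconv_sum_right: "a \<in> loc_const \<Longrightarrow> (\<And>i. i \<in> I \<Longrightarrow> f i \<in> loc_const) \<Longrightarrow> uconv a (sum f I) = (\<Sum>i\<in>I. uconv a (f i))"
  by (induction I rule: infinite_finite_induct) (auto simp: uconv_add_right loc_const_sum)

lemma uconv_sum_left: "b \<in> loc_const \<Longrightarrow> (\<And>i. i \<in> I \<Longrightarrow> f i \<in> loc_const) \<Longrightarrow> uconv (sum f I) b = (\<Sum>i\<in>I. uconv (f i) b)"
  by (induction I rule: infinite_finite_induct) (auto simp: uconv_add_left loc_const_sum)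

section \<open>Averaging over the subgroups \<open>1 + P^M\<close>\<close>

lemma sets_one_units [simp, measurable]: "(one_units M :: 'a set) \<in> sets borel"
proof -
  have "one_units M = int_units \<inter> coset (1::'a) (int M)" by (auto simp: one_units_def)
  then show ?thesis by simp
qed

lemma measure_one_units: "measure \<nu> (one_units M) > 0"
proof -
  \<comment> \<open>\<open>Suc M\<close> and not \<open>M\<close>: for \<open>M = 0\<close> the
    coset of 1 would be the whole ring of integers, which is not contained in the units.\<close>
  have sub: "coset (1::'a) (int (Suc M)) \<subseteq> one_units M \<inter> int_units"
    using coset_shell[of "1::'a" 0 "int (Suc M)"] coset_mono[of "int M" "int (Suc M)" "1::'a"]
    by (auto simp: one_units_def)
  have "0 < emeasure dx (coset (1::'a) (int (Suc M)))" by (simp add: dx_coset dx_ideal_pos)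
  also have "\<dots> \<le> emeasure \<nu> (one_units M)" using sub by (simp add: emeasure_nu emeasure_mono)
  finally show ?thesis by (simp add: nu.emeasure_eq_measure)
qed

text \<open>The normalized indicator of \<open>1 + P^M\<close>. It is an idempotent for
  \<open>uconv\<close>, and convolution with it is the projection onto \<open>level M\<close>, i.e.
  averaging over \<open>1 + P^M\<close>.\<close>

definition proj :: "nat \<Rightarrow> 'a \<Rightarrow> complex"
  where "proj M u = (if u \<in> one_units M then 1 / measure \<nu> (one_units M) else 0)"

lemma proj_level: "proj M \<in> level M"
proof (rule levI)
  show "proj M u = 0" if "u \<notin> int_units" for u using that by (auto simp: proj_def one_units_units)
  fix u w :: 'a assume u: "u \<in> int_units" and w: "w \<in> one_units M"
  have "u * w \<in> one_units M \<longleftrightarrow> u \<in> one_units M"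
  proof
    assume "u * w \<in> one_units M"
    from one_units_mult[OF this one_units_inverse[OF w]] show "u \<in> one_units M"
      using one_units_units[OF w] by (simp add: unit_cancel)
  qed (simp add: one_units_mult w)
  then show "proj M (u * w) = proj M u" by (simp add: proj_def)
qed

lemma proj_loc_const [simp]: "proj M \<in> loc_const"
  using proj_level by (rule level_loc_const)

lemma integral_proj: "(LINT u|\<nu>. proj M u) = 1"
proof -
  have "proj M = (\<lambda>u. indicator (one_units M) u *\<^sub>R (1 / measure \<nu> (one_units M)))"
    by (auto simp: proj_def fun_eq_iff)
  then show ?thesis using measure_one_units[of M] by simp
qed

lemma proj_uconv: assumes "a \<in> level M" shows "uconv (proj M) a = a"
proof
  fix u show "uconv (proj M) a u = a u"
  proof (cases "u \<in> int_units")
    case True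
    note [measurable] = loc_const_measurable[OF proj_loc_const] loc_const_measurable[OF level_loc_const[OF assms]]
    have "uconv (proj M) a u = (LINT v|\<nu>. a (u * inverse v) * proj M v)"
      using True uconv_commute[OF proj_loc_const level_loc_const[OF assms]] by (simp add: uconv_def)
    also have "\<dots> = (LINT v|\<nu>. a u * proj M v)"
    proof (rule integral_nu_cong)
      fix v :: 'a
      have "a (u * inverse v) = a u" if "v \<in> one_units M"
        using levD[OF assms True one_units_inverse[OF that]] .
      then show "a (u * inverse v) * proj M v = a u * proj M v" by (auto simp: proj_def)
    qed measurable
    finally show ?thesis by (simp add: integral_proj)
  qed (simp add: uconv_def level_off[OF assms])
qed

lemma proj_idem: "uconv (proj M) (proj M) = proj M"
  by (rule proj_uconv) (rule proj_level)

lemma proj_min: "M \<le> K \<Longrightarrow> uconv (proj K) (proj M) = proj M"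
  using level_mono[of M K] proj_level[of M] by (intro proj_uconv) auto

text \<open>Averaging over the larger group \<open>1 + P^M\<close> factors through averaging over
  the smaller group \<open>1 + P^K\<close>.\<close>

lemma proj_zero_mono:
  assumes "a \<in> loc_const" "uconv (proj K) a = 0" "M \<le> K" shows "uconv (proj M) a = 0"
proof -
  have "uconv (proj M) a = uconv (uconv (proj M) (proj K)) a"
    using proj_min[OF assms(3)] uconv_commute[of "proj M" "proj K"] by simp
  also have "\<dots> = uconv (proj M) (uconv (proj K) a)" using assms(1) by (simp add: uconv_assoc)
  finally show ?thesis using assms(2) by simp
qed

text \<open>As \<open>proj M\<close> is idempotent, one copy of it can be spent on each
  factor.\<close>

lemma proj_uconv_uconv:
  assumes "a \<in> loc_const" "b \<in> loc_const" shows "uconv (proj M) (uconv a b) = uconv (uconv (proj M) a) (uconv (proj M) b)"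
proof -
  have "uconv (uconv (proj M) a) (uconv (proj M) b) = uconv (proj M) (uconv a (uconv (proj M) b))"
    by (intro uconv_assoc uconv_loc_const proj_loc_const assms)
  also have "uconv a (uconv (proj M) b) = uconv (proj M) (uconv a b)"
    by (intro uconv_left_commute proj_loc_const assms)
  also have "uconv (proj M) (uconv (proj M) (uconv a b)) = uconv (uconv (proj M) (proj M)) (uconv a b)"
    by (intro uconv_assoc[symmetric] uconv_loc_const proj_loc_const assms)
  finally show ?thesis by (simp add: proj_idem)
qed

text \<open>Write \<open>b\<close> as its own average and move the average over to \<open>a\<close>.
  This orthogonality is the source of every vanishing statement about products of
  components.\<close>

lemma uconv_zero_if_proj:
  assumes "a \<in> loc_const" "uconv (proj M) a = 0" "b \<in> level M" shows "uconv a b = 0"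
proof -
  have "uconv a b = uconv a (uconv (proj M) b)" using assms by (simp add: proj_uconv)
  also have "\<dots> = uconv (uconv (proj M) a) b"
    using uconv_left_commute[OF assms(1) proj_loc_const level_loc_const[OF assms(3)]] uconv_assoc[OF proj_loc_const assms(1) level_loc_const[OF assms(3)]] by simp
  finally show ?thesis using assms by simp
qed

text \<open>The pairing of \<open>a\<close> with \<open>b\<close> is the value at 1 of the
  convolution of \<open>a\<close> with the reflection of \<open>b\<close>, which has the same
  level.\<close>

lemma integral_zero_if_proj:
  assumes "a \<in> loc_const" "uconv (proj M) a = 0" "b \<in> level M" shows "(LINT u|\<nu>. a u * b u) = 0"
proof -
  note [measurable] = loc_const_measurable[OF assms(1)] loc_const_measurable[OF level_loc_const[OF assms(3)]]
  have "uconv a (\<lambda>u. b (inverse u)) 1 = 0"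
    using uconv_zero_if_proj[OF assms(1,2) level_reflect[OF assms(3)]] by simp
  then have "(LINT v|\<nu>. a (1 * inverse v) * b (1 * inverse v)) = 0" by (simp add: uconv_def)
  then show ?thesis using integral_nu_div[of "\<lambda>v. a v * b v" 1] by simp
qed

end

section \<open>Convolution of sequences of functions on the units\<close>

lemma sum_fun_apply: "(sum f I :: 'a \<Rightarrow> complex) x = (\<Sum>i\<in>I. f i x)"
  by (induction I rule: infinite_finite_induct) auto

context haar_field
begin

text \<open>The bound \<open>K\<close> depends on \<open>M\<close>: the component of a germ on shell
  \<open>- l d\<close> has vanishing average over \<open>1 + P^M\<close> only once
  \<open>l > M\<close>. On the side of large indices a single level has to serve all
  components.\<close>

definition arrays :: "(int \<Rightarrow> 'a \<Rightarrow> complex) set"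
  where "arrays = {F. (\<forall>n. F n \<in> loc_const) \<and> (\<forall>M. \<exists>K. \<forall>n<K. uconv (proj M) (F n) = 0)
    \<and> (\<exists>M n0. \<forall>n\<ge>n0. F n \<in> level M)}"

text \<open>For arrays the sum has finite support by \<open>array_conv_finite_support\<close>;
  \<open>Sum_any\<close> spares naming a range of summation, which would depend on both
  factors.\<close>

definition array_conv :: "(int \<Rightarrow> 'a \<Rightarrow> complex) \<Rightarrow> (int \<Rightarrow> 'a \<Rightarrow> complex) \<Rightarrow> int \<Rightarrow> 'a \<Rightarrow> complex"
  where "array_conv F G m = Sum_any (\<lambda>n. uconv (F (m - n)) (G n))"

definition array_bound :: "nat \<Rightarrow> int \<Rightarrow> int \<Rightarrow> (int \<Rightarrow> 'a \<Rightarrow> complex) \<Rightarrow> bool"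
  where "array_bound M n0 K F \<longleftrightarrow> K \<le> n0 \<and> (\<forall>n\<ge>n0. F n \<in> level M) \<and> (\<forall>n<K. uconv (proj M) (F n) = 0)"

lemma arrays_loc_const: "F \<in> arrays \<Longrightarrow> F n \<in> loc_const"
  by (simp add: arrays_def)

lemma arrays_bnd3:
  assumes "F \<in> arrays" "G \<in> arrays" "H \<in> arrays"
  obtains M n0 K where "array_bound M n0 K F" "array_bound M n0 K G" "array_bound M n0 K H"
proof -
  obtain M1 n1 where 1: "\<And>n. n \<ge> n1 \<Longrightarrow> F n \<in> level M1" using assms(1) unfolding arrays_def by blast
  obtain M2 n2 where 2: "\<And>n. n \<ge> n2 \<Longrightarrow> G n \<in> level M2" using assms(2) unfolding arrays_def by blast
  obtain M3 n3 where 3: "\<And>n. n \<ge> n3 \<Longrightarrow> H n \<in> level M3" using assms(3) unfolding arrays_def by blast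
  define M where "M = max M1 (max M2 M3)"
  define n0 where "n0 = max n1 (max n2 n3)"
  obtain K1 where K1: "\<And>n. n < K1 \<Longrightarrow> uconv (proj M) (F n) = 0" using assms(1) unfolding arrays_def by blast
  obtain K2 where K2: "\<And>n. n < K2 \<Longrightarrow> uconv (proj M) (G n) = 0" using assms(2) unfolding arrays_def by blast
  obtain K3 where K3: "\<And>n. n < K3 \<Longrightarrow> uconv (proj M) (H n) = 0" using assms(3) unfolding arrays_def by blast
  have "level M1 \<subseteq> (level M :: ('a \<Rightarrow> complex) set)" "level M2 \<subseteq> (level M :: ('a \<Rightarrow> complex) set)"
    "level M3 \<subseteq> (level M :: ('a \<Rightarrow> complex) set)"
    by (rule level_mono, simp add: M_def)+
  then have "array_bound M n0 (min n0 (min K1 (min K2 K3))) F" "array_bound M n0 (min n0 (min K1 (min K2 K3))) G"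
    "array_bound M n0 (min n0 (min K1 (min K2 K3))) H"
    using 1 2 3 K1 K2 K3 unfolding array_bound_def by (auto simp: n0_def)
  then show ?thesis by (rule that)
qed

lemma arrays_bnd2:
  assumes "F \<in> arrays" "G \<in> arrays" obtains M n0 K where "array_bound M n0 K F" "array_bound M n0 K G"
  by (rule arrays_bnd3[OF assms assms(2)]) (rule that)

text \<open>A component of index at least \<open>n0\<close> has level \<open>M\<close> and so
  annihilates every component of index below \<open>K\<close>, whose average over
  \<open>1 + P^M\<close> is 0. Since \<open>K \<le> n0\<close>, excluding this mixed case leaves the
  two alternatives, and each of them is a bounded range once \<open>i + j\<close> is fixed.\<close>

lemma uconv_support:
  assumes "F \<in> arrays" "G \<in> arrays" "array_bound M n0 K F" "array_bound M n0 K G" "uconv (F i) (G j) \<noteq> 0"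
  shows "(i \<ge> K \<and> j \<ge> K) \<or> (i < n0 \<and> j < n0)"
proof (rule ccontr)
  assume "\<not> ?thesis"
  then consider "i \<ge> n0" "j < K" | "j \<ge> n0" "i < K" using assms(3) unfolding array_bound_def by linarith
  then show False
  proof cases
    case 1
    then have "F i \<in> level M" "uconv (proj M) (G j) = 0" using assms(3,4) by (simp_all add: array_bound_def)
    then have "uconv (G j) (F i) = 0" by (intro uconv_zero_if_proj[OF arrays_loc_const[OF assms(2)]])
    then show False using assms(5) uconv_commute[OF arrays_loc_const[OF assms(1)] arrays_loc_const[OF assms(2)], of i j] by simp
  next
    case 2
    then have "G j \<in> level M" "uconv (proj M) (F i) = 0" using assms(3,4) by (simp_all add: array_bound_def)
    then have "uconv (F i) (G j) = 0" by (intro uconv_zero_if_proj[OF arrays_loc_const[OF assms(1)]])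
    then show False using assms(5) by simp
  qed
qed

text \<open>If a triple convolution is nonzero then so is the convolution of any two of its factors,
  by commutativity and associativity; the three pairwise statements then combine.\<close>

lemma uconv_support3:
  assumes A: "F \<in> arrays" "G \<in> arrays" "H \<in> arrays" and b: "array_bound M n0 K F" "array_bound M n0 K G" "array_bound M n0 K H"
    and nz: "uconv (uconv (F i) (G j)) (H k) \<noteq> 0"
  shows "(i \<ge> K \<and> j \<ge> K \<and> k \<ge> K) \<or> (i < n0 \<and> j < n0 \<and> k < n0)"
proof -
  note L = arrays_loc_const[OF A(1), of i] arrays_loc_const[OF A(2), of j] arrays_loc_const[OF A(3), of k]
  have 1: "uconv (F i) (G j) \<noteq> 0"
  proof
    assume "uconv (F i) (G j) = 0"
    then show False using nz by simp
  qed
  have 2: "uconv (G j) (H k) \<noteq> 0"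
  proof
    assume "uconv (G j) (H k) = 0"
    then show False using nz uconv_assoc[OF L] by simp
  qed
  have 3: "uconv (F i) (H k) \<noteq> 0"
  proof
    assume "uconv (F i) (H k) = 0"
    then have "uconv (uconv (F i) (H k)) (G j) = 0" by simp
    then show False
      using nz uconv_assoc[OF L] uconv_assoc[OF L(1,3,2)] uconv_commute[OF L(2,3)] by simp
  qed
  have "K \<le> n0" using b(1) by (simp add: array_bound_def)
  then show ?thesis
    using uconv_support[OF A(1,2) b(1,2) 1] uconv_support[OF A(2,3) b(2,3) 2] uconv_support[OF A(1,3) b(1,3) 3]
    by linarith
qed

lemma array_conv_finite_support:
  assumes "F \<in> arrays" "G \<in> arrays" shows "finite {n. uconv (F (m - n)) (G n) \<noteq> 0}"
proof -
  obtain M n0 K where b: "array_bound M n0 K F" "array_bound M n0 K G" using arrays_bnd2[OF assms] .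
  \<comment> \<open>With \<open>i = m - n\<close> and \<open>j = n\<close> the first alternative
    reads \<open>K \<le> n \<le> m - K\<close>, the second \<open>m - n0 < n < n0\<close>.\<close>
  have "{n. uconv (F (m - n)) (G n) \<noteq> 0} \<subseteq> {min K (m - n0)..max (m - K) n0}"
    using uconv_support[OF assms b] by fastforce
  then show ?thesis by (rule finite_subset) simp
qed

lemma array_conv_eq_sum:
  assumes "finite A" "\<And>n. uconv (F (m - n)) (G n) \<noteq> 0 \<Longrightarrow> n \<in> A"
  shows "array_conv F G m = (\<Sum>n\<in>A. uconv (F (m - n)) (G n))"
  unfolding array_conv_def using assms by (intro Sum_any.expand_superset) auto

lemma array_conv_arrays:
  assumes "F \<in> arrays" "G \<in> arrays" shows "array_conv F G \<in> arrays"
proof -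
  note fin = array_conv_finite_support[OF assms]
  note LF = arrays_loc_const[OF assms(1)] and LG = arrays_loc_const[OF assms(2)]
  have eq: "array_conv F G m = (\<Sum>n | uconv (F (m - n)) (G n) \<noteq> 0. uconv (F (m - n)) (G n))" for m
    by (rule array_conv_eq_sum) (use fin in auto)
  have "array_conv F G m \<in> loc_const" for m unfolding eq by (intro loc_const_sum uconv_loc_const LF LG)
  moreover have "\<exists>K. \<forall>m<K. uconv (proj M) (array_conv F G m) = 0" for M
  proof -
    obtain K1 where K1: "\<And>n. n < K1 \<Longrightarrow> uconv (proj M) (F n) = 0" using assms(1) unfolding arrays_def by blast
    obtain K2 where K2: "\<And>n. n < K2 \<Longrightarrow> uconv (proj M) (G n) = 0" using assms(2) unfolding arrays_def by blast
    \<comment> \<open>In each term one of the indices \<open>m - n < K1\<close>,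
      \<open>n < K2\<close> is small enough for the average of that factor to vanish.\<close>
    have "uconv (proj M) (array_conv F G m) = 0" if "m < K1 + K2" for m
    proof -
      have "uconv (proj M) (uconv (F (m - n)) (G n)) = 0" for n
        using K1[of "m - n"] K2[of n] that unfolding proj_uconv_uconv[OF LF LG] by (cases "n < K2") simp_all
      then show ?thesis unfolding eq by (subst uconv_sum_right) (simp_all add: uconv_loc_const LF LG)
    qed
    then show ?thesis by blast
  qed
  moreover have "\<exists>M n0. \<forall>n\<ge>n0. array_conv F G n \<in> level M"
  proof -
    obtain M n0 K where b: "array_bound M n0 K F" "array_bound M n0 K G" using arrays_bnd2[OF assms] .
    \<comment> \<open>In each term one index is at least \<open>n0\<close>, and the level of one
      factor suffices for the product.\<close>
    have "array_conv F G m \<in> level M" if "m \<ge> 2 * n0" for m unfolding eq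
    proof (rule level_sum)
      fix n show "uconv (F (m - n)) (G n) \<in> level M"
      proof (cases "n \<ge> n0")
        case True
        then have "G n \<in> level M" using b by (simp add: array_bound_def)
        then show ?thesis by (intro uconv_level_right LF)
      next
        case False
        then have "F (m - n) \<in> level M" using b that by (simp add: array_bound_def)
        then show ?thesis by (intro uconv_level_left LG)
      qed
    qed
    then show ?thesis by blast
  qed
  ultimately show ?thesis by (simp add: arrays_def)
qed

lemma array_conv_commute:
  assumes "F \<in> arrays" "G \<in> arrays" shows "array_conv F G = array_conv G F"
proof
  fix m
  show "array_conv F G m = array_conv G F m" unfolding array_conv_def
  proof (rule Sum_any.reindex_cong[of "\<lambda>n. m - n"])
    show "bij (\<lambda>n. m - n)" by (rule bij_betw_byWitness[of _ "\<lambda>n. m - n"]) auto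
    show "(\<lambda>n. uconv (F (m - n)) (G n)) \<circ> (\<lambda>n. m - n) = (\<lambda>n. uconv (G (m - n)) (F n))"
      by (rule ext) (simp add: uconv_commute[OF arrays_loc_const[OF assms(1)] arrays_loc_const[OF assms(2)]])
  qed
qed

lemma array_conv_assoc:
  assumes A: "F \<in> arrays" "G \<in> arrays" "H \<in> arrays" shows "array_conv (array_conv F G) H = array_conv F (array_conv G H)"
proof
  fix m
  note L = arrays_loc_const[OF A(1)] arrays_loc_const[OF A(2)] arrays_loc_const[OF A(3)]
  define T where "T i j k = uconv (uconv (F i) (G j)) (H k)" for i j k
  obtain M n0 K where b: "array_bound M n0 K F" "array_bound M n0 K G" "array_bound M n0 K H" using arrays_bnd3[OF A] .
  \<comment> \<open>A rectangle for \<open>(k, n)\<close> containing both alternatives of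
    \<open>uconv_support3\<close> with \<open>i = m - n\<close> and \<open>j = n - k\<close>. If all
    indices are \<open>\<ge> K\<close>, then \<open>K \<le> k \<le> m - 2 K\<close> and
    \<open>2 K \<le> n \<le> m - K\<close>; if all are \<open>< n0\<close>, then
    \<open>m - 2 n0 < k < n0\<close> and \<open>m - n0 < n < 2 n0\<close>.\<close>
  define B where "B = {min K (m - 2 * n0)..max (m - 2 * K) n0} \<times> {min (2 * K) (m - n0)..max (m - K) (2 * n0)}"
  have sup: "(k, n) \<in> B" if "T (m - n) (n - k) k \<noteq> 0" for k n
    using uconv_support3[OF A b that[unfolded T_def]] unfolding B_def by auto
  have finB: "finite B" by (simp add: B_def)
  have "array_conv (array_conv F G) H m = Sum_any (\<lambda>k. Sum_any (\<lambda>j. T (m - k - j) j k))"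
    unfolding array_conv_def[of "array_conv F G"]
  proof (rule Sum_any.cong)
    fix k
    have fin: "finite {j. uconv (F (m - k - j)) (G j) \<noteq> 0}" (is "finite ?S") by (rule array_conv_finite_support[OF A(1,2)])
    have "uconv (array_conv F G (m - k)) (H k) = uconv (\<Sum>j\<in>?S. uconv (F (m - k - j)) (G j)) (H k)"
      using fin by (subst array_conv_eq_sum[of ?S]) auto
    also have "\<dots> = (\<Sum>j\<in>?S. T (m - k - j) j k)"
      unfolding T_def by (rule uconv_sum_left) (simp_all add: uconv_loc_const L)
    also have "\<dots> = Sum_any (\<lambda>j. T (m - k - j) j k)"
      using fin by (intro Sum_any.expand_superset[symmetric]) (auto simp: T_def)
    finally show "uconv (array_conv F G (m - k)) (H k) = Sum_any (\<lambda>j. T (m - k - j) j k)" .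
  qed
  also have "\<dots> = Sum_any (\<lambda>k. Sum_any (\<lambda>n. T (m - n) (n - k) k))"
  proof (rule Sum_any.cong)
    fix k
    show "Sum_any (\<lambda>j. T (m - k - j) j k) = Sum_any (\<lambda>n. T (m - n) (n - k) k)"
    proof (rule Sum_any.reindex_cong[of "\<lambda>n. n - k"])
      show "bij (\<lambda>n. n - k)" by (rule bij_betw_byWitness[of _ "\<lambda>n. n + k"]) auto
    qed (auto simp: fun_eq_iff)
  qed
  also have "\<dots> = Sum_any (\<lambda>n. Sum_any (\<lambda>k. T (m - n) (n - k) k))"
  proof (rule Sum_any.swap[of "fst ` B \<times> snd ` B"])
    show "{k. \<exists>n. T (m - n) (n - k) k \<noteq> 0} \<times> {n. \<exists>k. T (m - n) (n - k) k \<noteq> 0} \<subseteq> fst ` B \<times> snd ` B"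
      using sup by force
  qed (use finB in simp)
  also have "\<dots> = array_conv F (array_conv G H) m"
    unfolding array_conv_def[of F]
  proof (rule Sum_any.cong)
    fix n
    have fin: "finite {k. uconv (G (n - k)) (H k) \<noteq> 0}" (is "finite ?S") by (rule array_conv_finite_support[OF A(2,3)])
    have T: "T (m - n) (n - k) k = uconv (F (m - n)) (uconv (G (n - k)) (H k))" for k
      unfolding T_def by (rule uconv_assoc) (rule L)+
    have "uconv (F (m - n)) (array_conv G H n) = uconv (F (m - n)) (\<Sum>k\<in>?S. uconv (G (n - k)) (H k))"
      using fin by (subst array_conv_eq_sum[of ?S]) auto
    also have "\<dots> = (\<Sum>k\<in>?S. T (m - n) (n - k) k)"
      unfolding T by (rule uconv_sum_right) (simp_all add: uconv_loc_const L)
    also have "\<dots> = Sum_any (\<lambda>k. T (m - n) (n - k) k)"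
      using fin by (intro Sum_any.expand_superset[symmetric]) (auto simp: T)
    finally show "Sum_any (\<lambda>k. T (m - n) (n - k) k) = uconv (F (m - n)) (array_conv G H n)" by simp
  qed
  finally show "array_conv (array_conv F G) H m = array_conv F (array_conv G H) m" .
qed

lemma arrays_add:
  assumes "F \<in> arrays" "G \<in> arrays" shows "F + G \<in> arrays"
proof -
  obtain M n0 K where b: "array_bound M n0 K F" "array_bound M n0 K G" using arrays_bnd2[OF assms] .
  have "\<exists>K. \<forall>n<K. uconv (proj M) ((F + G) n) = 0" for M
  proof -
    obtain K1 where K1: "\<And>n. n < K1 \<Longrightarrow> uconv (proj M) (F n) = 0" using assms(1) unfolding arrays_def by blast
    obtain K2 where K2: "\<And>n. n < K2 \<Longrightarrow> uconv (proj M) (G n) = 0" using assms(2) unfolding arrays_def by blast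
    show ?thesis using K1 K2 by (intro exI[of _ "min K1 K2"]) (simp add: uconv_add_right[OF proj_loc_const arrays_loc_const[OF assms(1)] arrays_loc_const[OF assms(2)]])
  qed
  moreover have "\<exists>M n0. \<forall>n\<ge>n0. (F + G) n \<in> level M"
    using b by (intro exI[of _ M] exI[of _ n0]) (simp add: array_bound_def level_add)
  ultimately show ?thesis using loc_const_add[OF arrays_loc_const[OF assms(1)] arrays_loc_const[OF assms(2)]] by (simp add: arrays_def)
qed

lemma arrays_scale: assumes "F \<in> arrays" shows "(\<lambda>n u. c * F n u) \<in> arrays"
proof -
  have "\<exists>K. \<forall>n<K. uconv (proj M) (\<lambda>u. c * F n u) = 0" for M
  proof -
    obtain K1 where K1: "\<And>n. n < K1 \<Longrightarrow> uconv (proj M) (F n) = 0" using assms(1) unfolding arrays_def by blast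
    then show ?thesis by (intro exI[of _ K1]) (simp add: uconv_scale_right zero_fun_def)
  qed
  moreover have "\<exists>M n0. \<forall>n\<ge>n0. (\<lambda>u. c * F n u) \<in> level M"
  proof -
    obtain M n0 where "\<And>n. n \<ge> n0 \<Longrightarrow> F n \<in> level M" using assms unfolding arrays_def by blast
    then show ?thesis by (intro exI[of _ M] exI[of _ n0]) (simp add: level_scale)
  qed
  ultimately show ?thesis using loc_const_scale[OF arrays_loc_const[OF assms]] by (simp add: arrays_def)
qed

lemma arrays_zero [simp]: "0 \<in> arrays"
  by (simp add: arrays_def)

lemma array_conv_add_left:
  assumes "F \<in> arrays" "F' \<in> arrays" "G \<in> arrays" shows "array_conv (F + F') G = array_conv F G + array_conv F' G"
proof
  fix m
  have "array_conv (F + F') G m = Sum_any (\<lambda>n. uconv (F (m - n)) (G n) + uconv (F' (m - n)) (G n))"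
    unfolding array_conv_def using assms by (intro Sum_any.cong) (simp add: uconv_add_left arrays_loc_const)
  then show "array_conv (F + F') G m = (array_conv F G + array_conv F' G) m"
    using assms by (simp add: array_conv_def Sum_any.distrib array_conv_finite_support)
qed

lemma array_conv_scale_left:
  assumes "F \<in> arrays" "G \<in> arrays" shows "array_conv (\<lambda>n u. c * F n u) G = (\<lambda>m u. c * array_conv F G m u)"
proof
  fix m
  let ?S = "{n. uconv (F (m - n)) (G n) \<noteq> 0}"
  have "array_conv (\<lambda>n u. c * F n u) G m = (\<Sum>n\<in>?S. uconv (\<lambda>u. c * F (m - n) u) (G n))"
    using array_conv_finite_support[OF assms] by (intro array_conv_eq_sum) (auto simp: uconv_scale_left fun_eq_iff)
  also have "\<dots> = (\<lambda>u. c * array_conv F G m u)"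
    using array_conv_finite_support[OF assms]
    by (subst array_conv_eq_sum[of ?S]) (auto simp: uconv_scale_left fun_eq_iff sum_fun_apply sum_distrib_left)
  finally show "array_conv (\<lambda>n u. c * F n u) G m = (\<lambda>u. c * array_conv F G m u)" .
qed

end

section \<open>Linear recurrences and finite functions\<close>

text \<open>The action of the polynomial \<open>D\<close> in the shift
  \<open>s \<mapsto> (\<lambda>n. s (n - 1))\<close>, or equivalently the \<open>n\<close>-th
  coefficient of \<open>D(T)\<close> times the formal series with coefficients \<open>s n\<close>.
  Composition of actions is multiplication of polynomials.\<close>

definition poly_rec :: "complex poly \<Rightarrow> (int \<Rightarrow> complex) \<Rightarrow> int \<Rightarrow> complex"
  where "poly_rec D s n = (\<Sum>i\<le>degree D. coeff D i * s (n - int i))"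

lemma poly_rec_bound: "degree D \<le> N \<Longrightarrow> poly_rec D s n = (\<Sum>i\<le>N. coeff D i * s (n - int i))"
  unfolding poly_rec_def by (rule sum.mono_neutral_left) (auto simp: coeff_eq_0)

lemma poly_rec_0 [simp]: "poly_rec 0 s n = 0"
  by (simp add: poly_rec_def)

lemma poly_rec_1 [simp]: "poly_rec 1 s n = s n"
  by (simp add: poly_rec_def)

lemma poly_rec_pCons: "poly_rec (pCons c D) s n = c * s n + poly_rec D s (n - 1)"
proof -
  have "poly_rec (pCons c D) s n = (\<Sum>i\<le>Suc (degree D). coeff (pCons c D) i * s (n - int i))"
    by (rule poly_rec_bound) (simp add: degree_pCons_le)
  also have "\<dots> = c * s n + (\<Sum>i\<le>degree D. coeff D i * s (n - int (Suc i)))"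
    by (subst sum.atMost_Suc_shift) simp
  also have "(\<Sum>i\<le>degree D. coeff D i * s (n - int (Suc i))) = poly_rec D s (n - 1)"
    unfolding poly_rec_def by (intro sum.cong) (auto simp: algebra_simps)
  finally show ?thesis .
qed

lemma poly_rec_add: "poly_rec (D + E) s n = poly_rec D s n + poly_rec E s n"
proof -
  have "degree (D + E) \<le> max (degree D) (degree E)" by (rule degree_add_le_max)
  then show ?thesis
    by (simp add: poly_rec_bound[of _ "max (degree D) (degree E)"] sum.distrib distrib_right)
qed

lemma poly_rec_smult: "poly_rec (smult c D) s n = c * poly_rec D s n"
  by (cases "c = 0") (auto simp: poly_rec_def sum_distrib_left mult.assoc)

lemma poly_rec_mult: "poly_rec (D * E) s n = poly_rec D (poly_rec E s) n"
proof (induction D arbitrary: n)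
  case (pCons c D)
  then show ?case by (simp add: poly_rec_add poly_rec_smult poly_rec_pCons)
qed simp

lemma poly_rec_fun_add: "poly_rec D (\<lambda>k. s k + t k) n = poly_rec D s n + poly_rec D t n"
  by (simp add: poly_rec_def distrib_left sum.distrib)

lemma poly_rec_fun_scale: "poly_rec D (\<lambda>k. c * s k) n = c * poly_rec D s n"
  by (simp add: poly_rec_def sum_distrib_left mult.left_commute)

lemma poly_rec_fun_sum: "poly_rec D (\<lambda>k. \<Sum>i\<in>I. s i k) n = (\<Sum>i\<in>I. poly_rec D (s i) n)"
  by (simp add: poly_rec_def sum_distrib_left sum.swap[of _ I])

lemma poly_rec_shift: "poly_rec D (\<lambda>k. s (k + m)) n = poly_rec D s (n + m)"
  by (simp add: poly_rec_def algebra_simps)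

text \<open>The constant coefficient lets the recurrence be solved for the newest term and the
  leading coefficient for the oldest one, so zeros on a window of length \<open>degree D\<close>
  spread in both directions.\<close>

lemma recurrence_unique:
  assumes D: "coeff D 0 \<noteq> 0" and rec: "\<And>n. poly_rec D s n = 0"
    and win: "\<And>n. n0 \<le> n \<Longrightarrow> n < n0 + int (degree D) \<Longrightarrow> s n = 0"
  shows "s n = 0"
proof -
  have D': "lead_coeff D \<noteq> 0" using D by auto
  have up: "s (n0 + int k) = 0" for k
  proof (induction k rule: less_induct)
    case (less k)
    show ?case
    proof (cases "k < degree D")
      case False
      have "poly_rec D s (n0 + int k) = (\<Sum>i\<in>{0}. coeff D i * s (n0 + int k - int i))"
        unfolding poly_rec_def
      proof (rule sum.mono_neutral_right)
        show "\<forall>i\<in>{..degree D} - {0}. coeff D i * s (n0 + int k - int i) = 0"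
        proof
          fix i assume "i \<in> {..degree D} - {0}"
          then have "k - i < k" "n0 + int k - int i = n0 + int (k - i)" using False by auto
          then have "s (n0 + int (k - i)) = 0" "n0 + int k - int i = n0 + int (k - i)"
            using less by blast+
          then show "coeff D i * s (n0 + int k - int i) = 0" by (simp only: mult_zero_right)
        qed
      qed auto
      then show ?thesis using rec D by simp
    qed (simp add: win)
  qed
  have down: "s (n0 - int k) = 0" for k
  proof (induction k rule: less_induct)
    case (less k)
    show ?case
    proof (cases "k = 0")
      case False
      define m where "m = n0 - int k + int (degree D)"
      have "poly_rec D s m = (\<Sum>i\<in>{degree D}. coeff D i * s (m - int i))"
        unfolding poly_rec_def
      proof (rule sum.mono_neutral_right)
        show "\<forall>i\<in>{..degree D} - {degree D}. coeff D i * s (m - int i) = 0"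
        proof
          fix i assume i: "i \<in> {..degree D} - {degree D}"
          have "s (m - int i) = 0"
          proof (cases "m - int i \<ge> n0")
            case True
            then show ?thesis using up[of "nat (m - int i - n0)"] by simp
          next
            case False
            then have "m - int i = n0 - int (nat (n0 - m + int i))" "nat (n0 - m + int i) < k"
              using i \<open>k \<noteq> 0\<close> by (auto simp: m_def)
            with less show ?thesis by metis
          qed
          then show "coeff D i * s (m - int i) = 0" by simp
        qed
      qed auto
      then show ?thesis using rec D' by (simp add: m_def)
    qed (use up[of 0] in simp)
  qed
  show ?thesis using up[of "nat (n - n0)"] down[of "nat (n0 - n)"] by (cases "n \<ge> n0") auto
qed

text \<open>Extends a sequence to the left of \<open>n0\<close> by solving the recurrence for its
  oldest term. A sequence that satisfies the recurrence eventually thus becomes a solution on all of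
  the integers, as a finite function requires.\<close>

function rec_ext :: "complex poly \<Rightarrow> int \<Rightarrow> (int \<Rightarrow> complex) \<Rightarrow> int \<Rightarrow> complex"
  where "rec_ext D n0 s n = (if n \<ge> n0 then s n
    else - (\<Sum>i<degree D. coeff D i * rec_ext D n0 s (n + int (degree D) - int i)) / lead_coeff D)"
  by pat_completeness auto
termination by (relation "Wellfounded.measure (\<lambda>(D, n0, s, n). nat (n0 - n))") auto

declare rec_ext.simps [simp del]

lemma rec_ext_ge: "n \<ge> n0 \<Longrightarrow> rec_ext D n0 s n = s n"
  by (simp add: rec_ext.simps)

lemma rec_ext_rec:
  assumes "coeff D 0 \<noteq> 0" "\<And>n. n \<ge> n0 + int (degree D) \<Longrightarrow> poly_rec D s n = 0"
  shows "poly_rec D (rec_ext D n0 s) n = 0"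
proof (cases "n \<ge> n0 + int (degree D)")
  case True
  have "poly_rec D (rec_ext D n0 s) n = poly_rec D s n"
    unfolding poly_rec_def using True by (intro sum.cong) (auto simp: rec_ext_ge)
  then show ?thesis using assms True by simp
next
  case False
  have "lead_coeff D \<noteq> 0" using assms by auto
  then show ?thesis using False
    by (simp add: poly_rec_def lessThan_Suc_atMost[symmetric] rec_ext.simps[of D n0 s "n - int (degree D)"])
qed

text \<open>Stated for an indexed family of \<open>card B + 1\<close> vectors, since the translates
  it is applied to need not be distinct; a repetition already gives the relation
  \<open>v i - v j = 0\<close>.\<close>

lemma linear_relation_in_span:
  fixes v :: "nat \<Rightarrow> 'b \<Rightarrow> complex"
  assumes B: "finite B" and v: "\<And>i. v i \<in> fun_space.span B"
  shows "\<exists>c. (\<exists>i\<le>card B. c i \<noteq> 0) \<and> (\<forall>x. (\<Sum>i\<le>card B. c i * v i x) = 0)"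
proof (cases "inj_on v {..card B}")
  case True
  have "fun_space.dependent (v ` {..card B})"
  proof (rule ccontr)
    assume "\<not> fun_space.dependent (v ` {..card B})"
    then have "card (v ` {..card B}) \<le> card B"
      using fun_space.independent_span_bound[OF B] v by blast
    then show False using card_image[OF True] by simp
  qed
  then obtain u where u: "\<exists>w\<in>v ` {..card B}. u w \<noteq> 0" "(\<Sum>w\<in>v ` {..card B}. (\<lambda>x. u w * w x)) = 0"
    using fun_space.dependent_finite[of "v ` {..card B}"] by auto
  have "(\<Sum>i\<le>card B. u (v i) * v i x) = 0" for x
  proof -
    have "(\<Sum>w\<in>v ` {..card B}. (\<lambda>x. u w * w x)) x = (\<Sum>w\<in>v ` {..card B}. u w * w x)"
      by (rule sum_fun_apply)
    also have "\<dots> = (\<Sum>i\<le>card B. u (v i) * v i x)" by (simp add: sum.reindex[OF True])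
    finally show ?thesis using u(2) by simp
  qed
  then show ?thesis using u(1) by (intro exI[of _ "\<lambda>i. u (v i)"]) auto
next
  case False
  then obtain i j where ij: "i \<le> card B" "j \<le> card B" "i \<noteq> j" "v i = v j" by (auto simp: inj_on_def)
  define c :: "nat \<Rightarrow> complex" where "c k = (if k = i then 1 else 0) - (if k = j then 1 else 0)" for k
  have "(\<Sum>k\<le>card B. c k * v k x) = 0" for x
  proof -
    have "(\<Sum>k\<le>card B. c k * v k x) = (\<Sum>k\<le>card B. if k = i then v k x else 0) - (\<Sum>k\<le>card B. if k = j then v k x else 0)"
      unfolding sum_subtractf[symmetric] by (intro sum.cong) (auto simp: c_def)
    also have "\<dots> = 0" using ij by simp
    finally show ?thesis .
  qed
  moreover have "c i \<noteq> 0" using ij by (simp add: c_def)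
  ultimately show ?thesis using ij by blast
qed

text \<open>More translates by powers of \<open>inverse p\<close> than the dimension of their span
  must satisfy a linear relation. The relation holds at every point, so its first nonzero
  coefficient, of index \<open>i0\<close>, can be shifted to the position 0; this makes the constant
  coefficient of \<open>D\<close> nonzero.\<close>

lemma finite_function_recurrence:
  fixes p :: "'a::nonarch_local_field"
  assumes \<phi>: "\<phi> \<in> finite_functions" and p: "p \<noteq> 0"
  obtains D where "coeff D 0 \<noteq> 0" "\<And>n u. poly_rec D (\<lambda>k. \<phi> (p powi k * u)) n = 0"
proof -
  obtain B where B: "finite B" "fun_space.span {(\<lambda>x. \<phi> (a * x)) | a. a \<noteq> 0} = fun_space.span B"
    using \<phi> unfolding finite_functions_def by blast
  have span: "(\<lambda>x. \<phi> (p powi (- int i) * x)) \<in> fun_space.span B" for i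
    unfolding B(2)[symmetric] by (rule fun_space.span_base) (use p in auto)
  from linear_relation_in_span[where v = "\<lambda>i x. \<phi> (p powi (- int i) * x)", OF B(1) span]
  obtain c where c0: "(\<exists>i\<le>card B. c i \<noteq> 0) \<and> (\<forall>x. (\<Sum>i\<le>card B. c i * \<phi> (p powi (- int i) * x)) = 0)"
    by (rule exE)
  note c = conjunct1[OF c0] conjunct2[OF c0]
  define i0 where "i0 = (LEAST i. c i \<noteq> 0)"
  obtain i1 where i1: "i1 \<le> card B" "c i1 \<noteq> 0" using c(1) by blast
  have i0: "c i0 \<noteq> 0" "i0 \<le> card B" "\<And>i. i < i0 \<Longrightarrow> c i = 0"
    using LeastI[of "\<lambda>i. c i \<noteq> 0", OF i1(2)] Least_le[of "\<lambda>i. c i \<noteq> 0", OF i1(2)] i1(1)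
      not_less_Least[of _ "\<lambda>i. c i \<noteq> 0"]
    unfolding i0_def[symmetric] by (simp, linarith, blast)
  define D where "D = (\<Sum>j\<le>card B - i0. monom (c (i0 + j)) j)"
  have coeff: "coeff D j = (if j \<le> card B - i0 then c (i0 + j) else 0)" for j
    by (simp add: D_def coeff_sum)
  then have deg: "degree D \<le> card B - i0" by (intro degree_le) auto
  have "poly_rec D (\<lambda>k. \<phi> (p powi k * u)) n = 0" for n u
  proof -
    \<comment> \<open>The point at which the relation is evaluated: its term of index
      \<open>i0 + j\<close> is then the value of \<open>\<phi>\<close> at
      \<open>p powi (n - int j) * u\<close>.\<close>
    define x where "x = p powi (n + int i0) * u"
    have "poly_rec D (\<lambda>k. \<phi> (p powi k * u)) n = (\<Sum>j\<le>card B - i0. c (i0 + j) * \<phi> (p powi (n - int j) * u))"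
      by (simp add: poly_rec_bound[OF deg] coeff)
    also have "\<dots> = (\<Sum>i\<in>{i0..card B}. c i * \<phi> (p powi (- int i) * x))"
    proof (rule sum.reindex_bij_witness[of _ "\<lambda>i. i - i0" "\<lambda>j. i0 + j"])
      fix j
      have "p powi (- int (i0 + j)) * x = p powi (- int (i0 + j) + (n + int i0)) * u"
        unfolding x_def using p by (subst power_int_add) (auto simp: mult.assoc)
      then show "c (i0 + j) * \<phi> (p powi (- int (i0 + j)) * x) = c (i0 + j) * \<phi> (p powi (n - int j) * u)"
        by simp
    qed (use i0 in auto)
    also have "\<dots> = (\<Sum>i\<le>card B. c i * \<phi> (p powi (- int i) * x))"
      by (rule sum.mono_neutral_left) (use i0 in auto)
    finally show ?thesis using c(2)[rule_format, of x] by (rule trans)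
  qed
  moreover have "coeff D 0 \<noteq> 0" using i0 by (simp add: coeff)
  ultimately show ?thesis by (rule that[rotated])
qed

section \<open>Shell components and finite functions\<close>

context haar_field
begin

definition shell_comp :: "('a \<Rightarrow> complex) \<Rightarrow> int \<Rightarrow> 'a \<Rightarrow> complex"
  where "shell_comp f n u = (if u \<in> int_units then f (p powi n * u) else 0)"

lemma shell_comp_off: "u \<notin> int_units \<Longrightarrow> shell_comp f n u = 0"
  by (simp add: shell_comp_def)

lemma shell_decomp:
  assumes "x \<noteq> 0"
  shows "x * p powi (- fval x) \<in> int_units" "p powi fval x * (x * p powi (- fval x)) = x"
  using assms by (auto simp: shell_iff fval_mult fval_power_int power_int_minus fval_inverse)

lemma eq_shell_comp: "x \<noteq> 0 \<Longrightarrow> f x = shell_comp f (fval x) (x * p powi (- fval x))"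
proof -
  assume x: "x \<noteq> 0"
  show ?thesis using shell_decomp(1)[OF x] by (simp add: shell_comp_def shell_decomp(2)[OF x])
qed

lemma shell_comp_eqI:
  assumes "f 0 = g 0" "\<And>n. shell_comp f n = shell_comp g n" shows "f = g"
proof
  fix x show "f x = g x" using assms eq_shell_comp[of x f] eq_shell_comp[of x g] by (cases "x = 0") auto
qed

lemma smooth_shell_comp_loc_const:
  assumes "f \<in> smooth_functions" shows "shell_comp f n \<in> loc_const"
proof (rule locally_constant_loc_const)
  fix u :: 'a assume u: "u \<in> int_units"
  then have "p powi n * u \<noteq> 0" by (simp add: shell_iff)
  then have "\<forall>\<^sub>F y in nhds (p powi n * u). f y = f (p powi n * u)"
    using assms by (simp add: smooth_functions_def)
  moreover have "((\<lambda>v. p powi n * v) \<longlongrightarrow> p powi n * u) (nhds u)"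
    by (intro tendsto_intros filterlim_ident)
  ultimately have "\<forall>\<^sub>F v in nhds u. f (p powi n * v) = f (p powi n * u)"
    by (rule eventually_compose_filterlim)
  moreover have "\<forall>\<^sub>F v in nhds u. v \<in> int_units"
    using u open_shell by (rule eventually_nhds_in_open[rotated])
  ultimately show "\<forall>\<^sub>F v in nhds u. shell_comp f n v = shell_comp f n u"
    by eventually_elim (use u in \<open>simp add: shell_comp_def\<close>)
qed (rule shell_comp_off)

lemma shell_comp_loc_const_smooth:
  assumes "f 0 = 0" "\<And>n. shell_comp f n \<in> loc_const" shows "f \<in> smooth_functions"
  unfolding smooth_functions_def
proof (intro CollectI conjI allI impI)
  fix x :: 'a assume x: "x \<noteq> 0"
  define n where "n = fval x"
  define u where "u = x * p powi (- n)"
  have u: "u \<in> int_units" "p powi n * u = x" using shell_decomp[OF x] by (auto simp: u_def n_def)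
  have lim: "((\<lambda>y. y * p powi (- n)) \<longlongrightarrow> u) (nhds x)"
    unfolding u_def by (intro tendsto_intros filterlim_ident)
  have "\<forall>\<^sub>F v in nhds u. shell_comp f n v = shell_comp f n u" by (rule loc_const_locally_constant[OF assms(2) u(1)])
  from eventually_compose_filterlim[OF this lim]
  have "\<forall>\<^sub>F y in nhds x. shell_comp f n (y * p powi (- n)) = shell_comp f n u" .
  moreover have "\<forall>\<^sub>F y in nhds x. y \<in> shell n"
    using x open_shell by (intro eventually_nhds_in_open) (auto simp: shell_iff n_def)
  ultimately show "\<forall>\<^sub>F y in nhds x. f y = f x"
  proof eventually_elim
    case (elim y)
    then show ?case using eq_shell_comp[of y f] eq_shell_comp[of x f] x by (simp add: shell_iff n_def u_def)
  qed
qed (rule assms)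

lemma smooth_measurable:
  fixes f :: "'a \<Rightarrow> complex"
  assumes "f \<in> smooth_functions" shows "f \<in> borel_measurable borel"
proof -
  have "continuous_on (- {0}) f"
    unfolding continuous_on_def
  proof
    fix x :: 'a assume "x \<in> - {0}"
    then have "\<forall>\<^sub>F y in nhds x. f y = f x" using assms by (simp add: smooth_functions_def)
    then have "(f \<longlongrightarrow> f x) (nhds x)" by (rule tendsto_eventually)
    then show "(f \<longlongrightarrow> f x) (at x within - {0})"
      by (rule tendsto_mono[rotated]) (simp add: at_within_def)
  qed
  then have "(\<lambda>x. if x \<in> - {0} then f x else 0) \<in> borel_measurable borel"
    by (intro borel_measurable_continuous_on_if) (auto simp: borel_open)
  moreover have "(\<lambda>x. if x \<in> - {0} then f x else 0) = f"
    using assms by (auto simp: smooth_functions_def fun_eq_iff)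
  ultimately show ?thesis by simp
qed

lemma smooth_iff_shell_comp: "f \<in> smooth_functions \<longleftrightarrow> f 0 = 0 \<and> (\<forall>n. shell_comp f n \<in> loc_const)"
  using smooth_shell_comp_loc_const shell_comp_loc_const_smooth by (auto simp: smooth_functions_def)

definition array_rec :: "complex poly \<Rightarrow> (int \<Rightarrow> 'a \<Rightarrow> complex) \<Rightarrow> int \<Rightarrow> 'a \<Rightarrow> complex"
  where "array_rec D F n u = poly_rec D (\<lambda>k. F k u) n"

text \<open>The condition \<open>coeff D 0 \<noteq> 0\<close> makes the recurrence determine the later components from the earlier ones.\<close>

definition rec_zero :: "(int \<Rightarrow> 'a \<Rightarrow> complex) \<Rightarrow> bool"
  where "rec_zero F \<longleftrightarrow> (\<exists>D n1. coeff D 0 \<noteq> 0 \<and> (\<forall>n\<ge>n1. array_rec D F n = 0))"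

lemma finite_near_zero_imp_rec:
  assumes "finite_near_zero f" shows "rec_zero (shell_comp f)"
proof -
  obtain \<phi> r where \<phi>: "\<phi> \<in> finite_functions" "r > 0" "\<And>y. y \<noteq> 0 \<Longrightarrow> fabs y < r \<Longrightarrow> f y = \<phi> y"
    using assms unfolding finite_near_zero_def by blast
  obtain D where D: "coeff D 0 \<noteq> 0" "\<And>n u. poly_rec D (\<lambda>k. \<phi> (p powi k * u)) n = 0"
    using finite_function_recurrence[OF \<phi>(1) p_nz] by metis
  obtain n0 where n0: "q powi (- n0) < r" using ex_q_powi_less[OF \<phi>(2), where 'a='a] by auto
  \<comment> \<open>The recurrence at \<open>n\<close> looks back \<open>degree D\<close> shells,
    all of which must lie in the region where \<open>f\<close> agrees with
    \<open>\<phi>\<close>.\<close>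
  have "array_rec D (shell_comp f) n u = 0" if n: "n \<ge> n0 + int (degree D)" for n u
  proof (cases "u \<in> int_units")
    case True
    have "f (p powi k * u) = \<phi> (p powi k * u)" if "k \<ge> n0" for k
    proof (rule \<phi>(3))
      show "p powi k * u \<noteq> 0" using True by (simp add: shell_iff)
      have "p powi k * u \<in> shell k" using shell_mult[OF p_powi_shell True] by simp
      then have "fabs (p powi k * u) = q powi (- k)" by (simp add: fabs_shell)
      also have "\<dots> \<le> q powi (- n0)" using that by (simp add: powi_le_iff)
      finally show "fabs (p powi k * u) < r" using n0 by simp
    qed
    then have "array_rec D (shell_comp f) n u = poly_rec D (\<lambda>k. \<phi> (p powi k * u)) n"
      unfolding array_rec_def poly_rec_def using n True by (intro sum.cong) (auto simp: shell_comp_def)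
    then show ?thesis using D by simp
  qed (simp add: array_rec_def poly_rec_def shell_comp_off)
  then show ?thesis using D(1) unfolding rec_zero_def by (intro exI[of _ D] exI[of _ "n0 + int (degree D)"]) (auto simp: fun_eq_iff)
qed

lemma unit_representatives:
  obtains R where "finite R" "R \<subseteq> int_units" "\<And>u. u \<in> int_units \<Longrightarrow> \<exists>r\<in>R. u \<in> coset (r::'a) n"
proof -
  obtain R where R: "R \<subseteq> int_units" "finite R" "int_units \<subseteq> (\<Union>r\<in>R. coset (r::'a) n)"
  proof (rule compactE_image[OF compact_shell[of 0], of int_units "\<lambda>r::'a. coset r n"])
    show "int_units \<subseteq> (\<Union>c\<in>int_units. coset (c::'a) n)" by (auto intro!: coset_self)
  qed auto
  then show ?thesis by (intro that[of R]) auto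
qed

text \<open>By recurrence and level, a combination of members of \<open>T\<close> is determined by
  its values on the finite set \<open>Y\<close>. From an infinite independent set one could form a
  nontrivial combination vanishing on \<open>Y\<close>, hence everywhere.\<close>

lemma level_recurrence_span_finite:
  fixes T :: "('a \<Rightarrow> complex) set"
  assumes D: "coeff D 0 \<noteq> 0"
    and T0: "\<And>w. w \<in> T \<Longrightarrow> w 0 = 0" and level: "\<And>w n. w \<in> T \<Longrightarrow> shell_comp w n \<in> level M"
    and rec: "\<And>w n u. w \<in> T \<Longrightarrow> array_rec D (shell_comp w) n u = 0"
  shows "\<exists>B. finite B \<and> fun_space.span T = fun_space.span B"
proof -
  obtain B where B: "B \<subseteq> T" "\<not> fun_space.dependent B" "T \<subseteq> fun_space.span B"
    using fun_space.maximal_independent_subset[of T] .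
  obtain R where R: "finite R" "R \<subseteq> int_units" "\<And>u. u \<in> int_units \<Longrightarrow> \<exists>r\<in>R. u \<in> coset (r::'a) (int M)"
    by (rule unit_representatives[of "int M"]) (rule that)
  \<comment> \<open>Representatives of the units modulo \<open>1 + P^M\<close> on
    \<open>degree D\<close> consecutive shells: the window on which a solution of the recurrence is
    determined.\<close>
  define Y where "Y = (\<lambda>(k, r). p powi k * r) ` ({0..<int (degree D)} \<times> R)"
  have Y: "finite Y" using R by (simp add: Y_def)
  \<comment> \<open>The indicators of the points of \<open>Y\<close>, which span the restrictions of
    functions to \<open>Y\<close>.\<close>
  define E where "E = (\<lambda>y x. if x = y then 1 else 0 :: complex) ` Y"
  have E: "finite E" using Y by (simp add: E_def)
  have "finite B"
  proof (rule ccontr)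
    assume "infinite B"
    then obtain v :: "nat \<Rightarrow> 'a \<Rightarrow> complex" where v: "inj v" "range v \<subseteq> B"
      using infinite_countable_subset by blast
    have vT: "v i \<in> T" for i using v B by blast
    have span: "(\<lambda>x. if x \<in> Y then v i x else 0) \<in> fun_space.span E" for i
    proof -
      have "(\<lambda>x. if x \<in> Y then v i x else 0) = (\<Sum>y\<in>Y. (\<lambda>x. v i y * (if x = y then 1 else 0)))"
      proof
        fix x
        have "(\<Sum>y\<in>Y. (\<lambda>x. v i y * (if x = y then 1 else 0))) x = (\<Sum>y\<in>Y. if x = y then v i y else 0)"
          unfolding sum_fun_apply by (intro sum.cong) auto
        then show "(if x \<in> Y then v i x else 0) = (\<Sum>y\<in>Y. (\<lambda>x. v i y * (if x = y then 1 else 0))) x"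
          using Y by simp
      qed
      also have "\<dots> \<in> fun_space.span E"
        by (intro fun_space.span_sum fun_space.span_scale fun_space.span_base) (auto simp: E_def)
      finally show ?thesis .
    qed
    from linear_relation_in_span[where v = "\<lambda>i x. if x \<in> Y then v i x else 0", OF E span]
    obtain c where c0: "(\<exists>i\<le>card E. c i \<noteq> 0) \<and> (\<forall>x. (\<Sum>i\<le>card E. c i * (if x \<in> Y then v i x else 0)) = 0)"
      by (rule exE)
    note c = conjunct1[OF c0] conjunct2[OF c0]
    define w where "w x = (\<Sum>i\<le>card E. c i * v i x)" for x
    have wY: "w y = 0" if "y \<in> Y" for y using c(2)[rule_format, of y] that by (simp add: w_def)
    have w0: "w 0 = 0" using T0[OF vT] by (simp add: w_def)
    have cw: "shell_comp w n u = (\<Sum>i\<le>card E. c i * shell_comp (v i) n u)" for n u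
      by (simp add: shell_comp_def w_def)
    have wlev: "shell_comp w n \<in> level M" for n
    proof -
      have "shell_comp w n = (\<Sum>i\<le>card E. (\<lambda>u. c i * shell_comp (v i) n u))"
        by (rule ext) (simp add: cw sum_fun_apply)
      then show ?thesis using level[OF vT] by (simp add: level_sum level_scale)
    qed
    have wrec: "poly_rec D (\<lambda>k. shell_comp w k u) n = 0" for n u
      using rec[OF vT] by (simp add: cw poly_rec_fun_sum poly_rec_fun_scale array_rec_def)
    have "shell_comp w n u = 0" for n u
    proof (cases "u \<in> int_units")
      case True
      then obtain r where r: "r \<in> R" "u \<in> coset r (int M)" using R by blast
      have "shell_comp w n r = 0"
      proof (rule recurrence_unique[OF D wrec, of 0])
        fix k assume "0 \<le> k" "k < 0 + int (degree D)"
        then have "p powi k * r \<in> Y" using r by (force simp: Y_def)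
        then show "shell_comp w k r = 0" using wY r R by (auto simp: shell_comp_def)
      qed
      then show ?thesis using level_coset[OF wlev _ True r(2), of n] r R by auto
    qed (simp add: shell_comp_off)
    moreover have "shell_comp (\<lambda>x. 0) n u = 0" for n u by (simp add: shell_comp_def)
    ultimately have "shell_comp w n = shell_comp (\<lambda>x. 0) n" for n by (intro ext) (simp only:)
    then have "w = (\<lambda>x. 0)" by (rule shell_comp_eqI[rotated]) (rule w0)
    then have sum0: "(\<Sum>i\<le>card E. (\<lambda>x. c i * v i x)) = 0"
      by (intro ext) (simp add: sum_fun_apply w_def fun_eq_iff)
    have inj: "inj_on v {..card E}" using v by (auto intro: inj_on_subset)
    define u where "u = (\<lambda>f. c (inv v f))"
    have "(\<Sum>f\<in>v ` {..card E}. (\<lambda>x. u f * f x)) = 0"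
      using sum0 v by (simp add: sum.reindex[OF inj] u_def)
    moreover obtain i where i: "i \<le> card E" "c i \<noteq> 0" using c(1) by blast
    ultimately have "fun_space.dependent (v ` {..card E})"
      using v by (subst fun_space.dependent_finite) (auto simp: u_def intro!: exI[of _ u])
    then show False using B(2) v fun_space.dependent_mono by blast
  qed
  moreover have "fun_space.span T = fun_space.span B"
    using B(1,3) unfolding fun_space.span_eq by (blast intro: fun_space.span_base)
  ultimately show ?thesis by blast
qed

text \<open>The two-sided solution \<open>\<phi>\<close> that agrees with \<open>f\<close> from
  shell \<open>n0\<close> on is a finite function: its components have a common level, because the
  recurrence carries invariance from one window to all shells, and its translates share recurrence
  and level, so \<open>level_recurrence_span_finite\<close> applies to them.\<close>

lemma rec_imp_finite_near_zero:
  assumes f: "f \<in> smooth_functions" and rec: "rec_zero (shell_comp f)" shows "finite_near_zero f"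
proof -
  obtain D n1 where D: "coeff D 0 \<noteq> 0" "\<And>n. n \<ge> n1 \<Longrightarrow> array_rec D (shell_comp f) n = 0"
    using rec unfolding rec_zero_def by blast
  define n0 where "n0 = n1 - int (degree D)"
  define \<phi> where "\<phi> x = (if x = 0 then 0 else rec_ext D n0 (\<lambda>k. shell_comp f k (x * p powi (- fval x))) (fval x))" for x
  have comp_phi: "shell_comp \<phi> n u = rec_ext D n0 (\<lambda>k. shell_comp f k u) n" if "u \<in> int_units" for n u
  proof -
    have "fval (p powi n * u) = n" "p powi n * u \<noteq> 0" "p powi n * u * p powi (- n) = u"
      using that by (auto simp: shell_iff fval_mult fval_power_int power_int_minus)
    then show ?thesis using that unfolding shell_comp_def[of \<phi>] \<phi>_def by (simp only: if_True if_False)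
  qed
  have rec_phi: "array_rec D (shell_comp \<phi>) n u = 0" for n u
  proof (cases "u \<in> int_units")
    case True
    have "poly_rec D (rec_ext D n0 (\<lambda>k. shell_comp f k u)) n = 0"
      by (rule rec_ext_rec[OF D(1)]) (use D(2) in \<open>simp add: n0_def array_rec_def fun_eq_iff\<close>)
    then show ?thesis using True by (simp add: array_rec_def comp_phi)
  qed (simp add: array_rec_def shell_comp_off poly_rec_def)
  obtain M where M: "\<And>n. n0 \<le> n \<Longrightarrow> n < n0 + int (degree D) \<Longrightarrow> shell_comp f n \<in> level M"
  proof -
    have "\<exists>m. \<forall>n. shell_comp f n \<in> level (m n)"
      using smooth_shell_comp_loc_const[OF f] unfolding loc_const_def by (intro choice) blast
    then obtain m where m: "\<And>n. shell_comp f n \<in> level (m n)" by blast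
    define M where "M = Max (insert 0 (m ` {n0..<n0 + int (degree D)}))"
    have "shell_comp f n \<in> level M" if "n0 \<le> n" "n < n0 + int (degree D)" for n
    proof -
      have "m n \<le> M" using that by (auto simp: M_def intro!: Max_ge)
      then show ?thesis using level_mono m by blast
    qed
    then show ?thesis by (rule that)
  qed
  have lev_phi: "shell_comp \<phi> n \<in> level M" for n
  proof (rule levI)
    fix u w :: 'a assume u: "u \<in> int_units" and w: "w \<in> one_units M"
    have uw: "u * w \<in> int_units" using int_units_mult[OF u one_units_units[OF w]] .
    \<comment> \<open>The difference is again a solution in \<open>n\<close> and vanishes on the
      window, where the components are those of \<open>f\<close>.\<close>
    have "shell_comp \<phi> n (u * w) + (-1) * shell_comp \<phi> n u = 0"
    proof (rule recurrence_unique[OF D(1), of _ n0])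
      show "poly_rec D (\<lambda>n. shell_comp \<phi> n (u * w) + (-1) * shell_comp \<phi> n u) n = 0" for n
        unfolding poly_rec_fun_add poly_rec_fun_scale using rec_phi[unfolded array_rec_def] by simp
      fix n assume "n0 \<le> n" "n < n0 + int (degree D)"
      then show "shell_comp \<phi> n (u * w) + (-1) * shell_comp \<phi> n u = 0"
        using levD[OF M u w] by (simp add: comp_phi u uw rec_ext_ge)
    qed
    then show "shell_comp \<phi> n (u * w) = shell_comp \<phi> n u" by simp
  qed (rule shell_comp_off)
  have phi0: "\<phi> 0 = 0" by (simp add: \<phi>_def)
  have smooth: "\<phi> \<in> smooth_functions" using lev_phi level_loc_const phi0 by (intro shell_comp_loc_const_smooth) auto
  let ?T = "{(\<lambda>x. \<phi> (a * x)) | a. a \<noteq> 0}"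
  have "\<exists>B. finite B \<and> fun_space.span ?T = fun_space.span B"
  proof (rule level_recurrence_span_finite[OF D(1)])
    fix w assume "w \<in> ?T"
    then obtain a where a: "a \<noteq> 0" "w = (\<lambda>x. \<phi> (a * x))" by blast
    show "w 0 = 0" by (simp add: a phi0)
    define v where "v = a * p powi (- fval a)"
    have v: "v \<in> int_units" "p powi fval a * v = a" using shell_decomp[OF a(1)] by (auto simp: v_def)
    \<comment> \<open>Translation by \<open>a\<close> shifts the shells by \<open>fval a\<close> and
      multiplies the units by \<open>v\<close>; neither affects the recurrence or the level.\<close>
    have cw: "shell_comp w n u = (if u \<in> int_units then shell_comp \<phi> (n + fval a) (v * u) else 0)" for n u
    proof -
      have "a * (p powi n * u) = p powi (n + fval a) * (v * u)"
        by (subst v(2)[symmetric]) (simp add: power_int_add ac_simps)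
      then show ?thesis using int_units_mult[OF v(1), of u] by (cases "u \<in> int_units") (simp_all only: shell_comp_def a if_True if_False)
    qed
    show "shell_comp w n \<in> level M" for n
    proof (rule levI)
      fix u w' :: 'a assume u: "u \<in> int_units" and w': "w' \<in> one_units M"
      have "u * w' \<in> int_units" using int_units_mult[OF u one_units_units[OF w']] .
      then show "shell_comp w n (u * w') = shell_comp w n u"
        using levD[OF lev_phi int_units_mult[OF v(1) u] w'] u by (simp add: cw mult.assoc)
    qed (rule shell_comp_off)
    show "array_rec D (shell_comp w) n u = 0" for n u
      using rec_phi[of "n + fval a" "v * u"] poly_rec_shift[of D "\<lambda>k. shell_comp \<phi> k (v * u)" "fval a" n]
      by (cases "u \<in> int_units") (simp_all add: array_rec_def cw poly_rec_def)
  qed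
  moreover have "continuous_on (- {0}) \<phi>"
    unfolding continuous_on_def
  proof
    fix x :: 'a assume "x \<in> - {0}"
    then have "\<forall>\<^sub>F y in nhds x. \<phi> y = \<phi> x" using smooth by (simp add: smooth_functions_def)
    then have "(\<phi> \<longlongrightarrow> \<phi> x) (nhds x)" by (rule tendsto_eventually)
    then show "(\<phi> \<longlongrightarrow> \<phi> x) (at x within - {0})"
      by (rule tendsto_mono[rotated]) (simp add: at_within_def)
  qed
  ultimately have "\<phi> \<in> finite_functions" using phi0 by (simp add: finite_functions_def)
  moreover have "f y = \<phi> y" if y: "y \<noteq> 0" "fabs y < q powi (- n0)" for y
  proof -
    have "fval y \<ge> n0"
      using y fabs_less_iff[of y n0] by (simp add: frac_ideal_iff)
    then show ?thesis using y eq_shell_comp[of y f] by (simp add: \<phi>_def rec_ext_ge)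
  qed
  moreover have "q powi (- n0) > 0" by simp
  ultimately show ?thesis unfolding finite_near_zero_def by blast
qed

end

section \<open>The convolution algebra\<close>

context haar_field
begin

lemma array_rec_pCons: "array_rec (pCons c D) F = (\<lambda>n u. c * F n u) + (\<lambda>n. array_rec D F (n - 1))"
  by (intro ext) (simp add: array_rec_def poly_rec_pCons)

lemma array_rec_zero: "array_rec 0 F = 0"
  by (intro ext) (simp add: array_rec_def)

lemma array_rec_array_rec: "array_rec D (array_rec E F) = array_rec (D * E) F"
  by (intro ext) (simp add: array_rec_def poly_rec_mult)

lemma array_rec_add: "array_rec D (F + G) = array_rec D F + array_rec D G"
  by (intro ext) (simp add: array_rec_def poly_rec_fun_add)

lemma array_rec_scale: "array_rec D (\<lambda>n u. c * F n u) = (\<lambda>n u. c * array_rec D F n u)"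
  by (intro ext) (simp add: array_rec_def poly_rec_fun_scale)

lemma array_rec_vanish:
  assumes "\<And>n. n \<ge> n1 \<Longrightarrow> F n = 0" "n \<ge> n1 + int (degree D)" shows "array_rec D F n = 0"
  using assms by (auto simp: array_rec_def poly_rec_def fun_eq_iff intro!: sum.neutral)

lemma arrays_shift: assumes "F \<in> arrays" shows "(\<lambda>n. F (n - k)) \<in> arrays"
proof -
  have "\<exists>K. \<forall>n<K. uconv (proj M) (F (n - k)) = 0" for M
  proof -
    obtain K1 where "\<And>n. n < K1 \<Longrightarrow> uconv (proj M) (F n) = 0" using assms(1) unfolding arrays_def by blast
    then show ?thesis by (intro exI[of _ "K1 + k"]) simp
  qed
  moreover have "\<exists>M n0. \<forall>n\<ge>n0. F (n - k) \<in> level M"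
  proof -
    obtain M n0 where "\<And>n. n \<ge> n0 \<Longrightarrow> F n \<in> level M" using assms unfolding arrays_def by blast
    then show ?thesis by (intro exI[of _ M] exI[of _ "n0 + k"]) simp
  qed
  ultimately show ?thesis using arrays_loc_const[OF assms] by (simp add: arrays_def)
qed

lemma arrays_array_rec: assumes "F \<in> arrays" shows "array_rec D F \<in> arrays"
proof (induction D)
  case (pCons c D)
  then show ?case unfolding array_rec_pCons by (intro arrays_add arrays_scale assms arrays_shift)
qed (simp only: array_rec_zero arrays_zero)

lemma array_conv_shift_left: "array_conv (\<lambda>n. F (n - k)) G m = array_conv F G (m - k)"
  unfolding array_conv_def by (intro Sum_any.cong) (simp add: algebra_simps)

lemma array_conv_zero_left [simp]: "array_conv 0 G = 0"
  by (simp add: array_conv_def fun_eq_iff)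

lemma array_conv_array_rec_left:
  assumes "F \<in> arrays" "G \<in> arrays" shows "array_conv (array_rec D F) G = array_rec D (array_conv F G)"
proof (induction D)
  case (pCons c D)
  have "array_conv (array_rec (pCons c D) F) G = array_conv (\<lambda>n u. c * F n u) G + array_conv (\<lambda>n. array_rec D F (n - 1)) G"
    unfolding array_rec_pCons by (rule array_conv_add_left[OF arrays_scale[OF assms(1)] arrays_shift[OF arrays_array_rec[OF assms(1)]] assms(2)])
  also have "\<dots> = array_rec (pCons c D) (array_conv F G)"
    unfolding array_rec_pCons using pCons array_conv_shift_left[of "array_rec D F" 1 G]
    by (simp add: array_conv_scale_left[OF assms] fun_eq_iff)
  finally show ?case .
qed (simp only: array_rec_zero array_conv_zero_left)

lemma array_conv_array_rec_right:
  assumes "F \<in> arrays" "G \<in> arrays" shows "array_conv F (array_rec D G) = array_rec D (array_conv F G)"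
  using array_conv_array_rec_left[OF assms(2,1), of D] array_conv_commute[OF assms] array_conv_commute[OF assms(1) arrays_array_rec[OF assms(2)], of D]
  by simp

text \<open>The product \<open>D1 * D2\<close> acts on the convolution as \<open>D1\<close> on one
  factor and \<open>D2\<close> on the other. Both results vanish for large indices, and then so does
  their convolution.\<close>

lemma rec_zero_array_conv:
  assumes A: "F \<in> arrays" "G \<in> arrays" and r: "rec_zero F" "rec_zero G" shows "rec_zero (array_conv F G)"
proof -
  obtain D1 n1 where D1: "coeff D1 0 \<noteq> 0" "\<And>n. n \<ge> n1 \<Longrightarrow> array_rec D1 F n = 0"
    using r(1) unfolding rec_zero_def by blast
  obtain D2 n2 where D2: "coeff D2 0 \<noteq> 0" "\<And>n. n \<ge> n2 \<Longrightarrow> array_rec D2 G n = 0"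
    using r(2) unfolding rec_zero_def by blast
  have eq: "array_rec (D1 * D2) (array_conv F G) = array_conv (array_rec D1 F) (array_rec D2 G)"
    by (simp add: array_conv_array_rec_left[OF A(1) arrays_array_rec[OF A(2)]] array_conv_array_rec_right[OF A] array_rec_array_rec)
  have "array_conv (array_rec D1 F) (array_rec D2 G) m = 0" if "m \<ge> n1 + n2" for m
  proof -
    have "uconv (array_rec D1 F (m - n)) (array_rec D2 G n) = 0" for n
      using D1(2)[of "m - n"] D2(2)[of n] that by (cases "n \<ge> n2") auto
    then show ?thesis by (simp add: array_conv_def)
  qed
  then show ?thesis unfolding rec_zero_def using D1(1) D2(1)
    by (intro exI[of _ "D1 * D2"] exI[of _ "n1 + n2"]) (simp add: eq coeff_mult)
qed

lemma rec_zero_add: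
  assumes r: "rec_zero F" "rec_zero G" shows "rec_zero (F + G)"
proof -
  obtain D1 n1 where D1: "coeff D1 0 \<noteq> 0" "\<And>n. n \<ge> n1 \<Longrightarrow> array_rec D1 F n = 0"
    using r(1) unfolding rec_zero_def by blast
  obtain D2 n2 where D2: "coeff D2 0 \<noteq> 0" "\<And>n. n \<ge> n2 \<Longrightarrow> array_rec D2 G n = 0"
    using r(2) unfolding rec_zero_def by blast
  have eq: "array_rec (D1 * D2) (F + G) = array_rec D2 (array_rec D1 F) + array_rec D1 (array_rec D2 G)"
    by (simp add: array_rec_add array_rec_array_rec mult.commute)
  have "array_rec (D1 * D2) (F + G) n = 0"
    if "n \<ge> max (n1 + int (degree D2)) (n2 + int (degree D1))" for n
    using array_rec_vanish[of n1 "array_rec D1 F" D2 n] array_rec_vanish[of n2 "array_rec D2 G" D1 n] D1 D2 that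
    by (simp add: eq)
  then show ?thesis unfolding rec_zero_def using D1(1) D2(1)
    by (intro exI[of _ "D1 * D2"] exI[of _ "max (n1 + int (degree D2)) (n2 + int (degree D1))"]) (simp add: coeff_mult)
qed

lemma rec_zero_scale: "rec_zero F \<Longrightarrow> rec_zero (\<lambda>n u. c * F n u)"
  unfolding rec_zero_def by (force simp: array_rec_scale fun_eq_iff)

lemma rec_zero_vanish: "(\<And>n. n \<ge> n1 \<Longrightarrow> F n = 0) \<Longrightarrow> rec_zero F"
  unfolding rec_zero_def by (intro exI[of _ 1] exI[of _ n1]) (auto simp: array_rec_def fun_eq_iff)

lemma loc_const_common_range:
  assumes "\<And>n. F n \<in> loc_const" obtains M where "\<And>n::int. a \<le> n \<Longrightarrow> n < b \<Longrightarrow> F n \<in> level M"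
proof -
  have "\<exists>m. \<forall>n. F n \<in> level (m n)"
    using assms unfolding loc_const_def by (intro choice) blast
  then obtain m where m: "\<And>n. F n \<in> level (m n)" by blast
  define M where "M = Max (insert 0 (m ` {a..<b}))"
  have "F n \<in> level M" if "a \<le> n" "n < b" for n
  proof -
    have "m n \<le> M" using that by (auto simp: M_def intro!: Max_ge)
    then show ?thesis using level_mono m by blast
  qed
  then show ?thesis by (rule that)
qed

text \<open>Solving the recurrence for the newest term writes it as a combination of earlier ones,
  so the level of \<open>degree D\<close> consecutive components persists. Thus the last condition
  in \<open>arrays\<close> follows from the recurrence.\<close>

lemma rec_zero_level:
  assumes loc_const: "\<And>n. F n \<in> loc_const" and r: "rec_zero F"
  shows "\<exists>M n0. \<forall>n\<ge>n0. F n \<in> level M"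
proof -
  obtain D n1 where D: "coeff D 0 \<noteq> 0" "\<And>n. n \<ge> n1 \<Longrightarrow> array_rec D F n = 0"
    using r unfolding rec_zero_def by blast
  define n0 where "n0 = n1 - int (degree D)"
  obtain M where M: "\<And>n. n0 \<le> n \<Longrightarrow> n < n1 \<Longrightarrow> F n \<in> level M" by (rule loc_const_common_range[of F n0 n1, OF loc_const]) (rule that)
  have "F (n0 + int k) \<in> level M" for k
  proof (induction k rule: less_induct)
    case (less k)
    show ?case
    proof (cases "k < degree D")
      case True
      then show ?thesis by (intro M) (simp_all add: n0_def)
    next
      case False
      define n where "n = n0 + int k"
      have eqF: "F n = (\<lambda>u. (- 1 / coeff D 0) * (\<Sum>i\<in>{1..degree D}. (\<lambda>u. coeff D i * F (n - int i) u)) u)"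
      proof
        fix u
        have "n \<ge> n1" using False by (simp add: n_def n0_def)
        then have "poly_rec D (\<lambda>k. F k u) n = 0" using D(2)[of n] by (simp add: array_rec_def fun_eq_iff)
        moreover have "poly_rec D (\<lambda>k. F k u) n = coeff D 0 * F n u + (\<Sum>i\<in>{1..degree D}. coeff D i * F (n - int i) u)"
          unfolding poly_rec_def by (simp add: sum.atMost_shift sum.atLeast1_atMost_eq)
        ultimately have "coeff D 0 * F n u = - (\<Sum>i\<in>{1..degree D}. coeff D i * F (n - int i) u)"
          by (simp add: eq_neg_iff_add_eq_0)
        then show "F n u = (- 1 / coeff D 0) * (\<Sum>i\<in>{1..degree D}. (\<lambda>u. coeff D i * F (n - int i) u)) u"
          using D(1) by (simp add: sum_fun_apply field_simps)
      qed
      have mem: "(\<Sum>i\<in>{1..degree D}. (\<lambda>u. coeff D i * F (n - int i) u)) \<in> level M"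
      proof (intro level_sum level_scale)
        fix i assume i: "i \<in> {1..degree D}"
        then have "n - int i = n0 + int (k - i)" "k - i < k" using False by (auto simp: n_def)
        then show "F (n - int i) \<in> level M" using less by metis
      qed
      have "F n \<in> level M" by (subst eqF) (rule level_scale[OF mem])
      then show ?thesis by (simp only: n_def)
    qed
  qed
  note * = this
  have "F n \<in> level M" if "n \<ge> n0" for n using *[of "nat (n - n0)"] that by simp
  then show ?thesis by blast
qed

text \<open>A common home for all the spaces \<open>S_sis_deg\<close>, closed under convolution, on
  which the algebra laws are proved once. The recurrence encodes finiteness near 0; far from 0 only
  the vanishing of averages is demanded.\<close>

definition conv_space :: "('a \<Rightarrow> complex) set"
  where "conv_space = {f. f 0 = 0 \<and> shell_comp f \<in> arrays \<and> rec_zero (shell_comp f)}"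

lemma conv_space_smooth: "f \<in> conv_space \<Longrightarrow> f \<in> smooth_functions"
  using arrays_loc_const[of "shell_comp f"] by (auto simp: conv_space_def smooth_iff_shell_comp)

lemma conv_space_I:
  assumes "f \<in> smooth_functions" "finite_near_zero f" "\<And>M. \<exists>K. \<forall>n<K. uconv (proj M) (shell_comp f n) = 0"
  shows "f \<in> conv_space"
proof -
  have loc_const: "shell_comp f n \<in> loc_const" for n using assms(1) by (rule smooth_shell_comp_loc_const)
  have r: "rec_zero (shell_comp f)" using assms by (simp add: finite_near_zero_imp_rec)
  then show ?thesis using loc_const rec_zero_level[OF loc_const r] assms
    by (simp add: conv_space_def arrays_def smooth_functions_def)
qed

lemma shell_comp_add: "shell_comp (f + g) = shell_comp f + shell_comp g"
  by (intro ext) (simp add: shell_comp_def)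

lemma shell_comp_scale: "shell_comp (\<lambda>x. c * f x) = (\<lambda>n u. c * shell_comp f n u)"
  by (intro ext) (simp add: shell_comp_def)

lemma conv_space_add: "f \<in> conv_space \<Longrightarrow> g \<in> conv_space \<Longrightarrow> f + g \<in> conv_space"
  by (simp add: conv_space_def shell_comp_add arrays_add rec_zero_add)

lemma conv_space_scale: "f \<in> conv_space \<Longrightarrow> (\<lambda>x. c * f x) \<in> conv_space"
  by (simp add: conv_space_def shell_comp_scale arrays_scale rec_zero_scale)

lemma conv_space_zero: "0 \<in> conv_space"
proof -
  have "shell_comp 0 = 0" by (intro ext) (simp add: shell_comp_def)
  moreover have "rec_zero 0" by (rule rec_zero_vanish) simp
  ultimately show ?thesis by (simp add: conv_space_def)
qed

lemma conv_space_subspace: "fun_space.subspace conv_space"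
  by (rule fun_space.subspaceI) (simp_all add: conv_space_add conv_space_scale conv_space_zero)

lemma conv_shell:
  assumes f: "f \<in> smooth_functions" and g: "g \<in> smooth_functions" and u: "u \<in> int_units"
  shows "set_lebesgue_integral (mult_measure dx) (shell n) (\<lambda>y. f (p powi m * u * inverse y) * g y)
      = uconv (shell_comp f (m - n)) (shell_comp g n) u"
    and "set_integrable (mult_measure dx) (shell n) (\<lambda>y. f (p powi m * u * inverse y) * g y)"
proof -
  note [measurable] = smooth_measurable[OF f] smooth_measurable[OF g]
    loc_const_measurable[OF smooth_shell_comp_loc_const[OF f]] loc_const_measurable[OF smooth_shell_comp_loc_const[OF g]]
  have m: "(\<lambda>y. f (p powi m * u * inverse y) * g y) \<in> borel_measurable borel" by measurable
  have eq: "f (p powi m * u * inverse (p powi n * v)) * g (p powi n * v) = shell_comp f (m - n) (u * inverse v) * shell_comp g n v"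
    if "v \<in> int_units" for v
  proof -
    have "p powi m * u * inverse (p powi n * v) = p powi (m - n) * (u * inverse v)"
      by (simp add: power_int_diff divide_inverse ac_simps)
    moreover have "u * inverse v \<in> int_units" using u that by (simp add: int_units_mult)
    ultimately show ?thesis using that by (simp only: shell_comp_def if_True)
  qed
  show "set_lebesgue_integral (mult_measure dx) (shell n) (\<lambda>y. f (p powi m * u * inverse y) * g y)
      = uconv (shell_comp f (m - n)) (shell_comp g n) u"
  proof -
    have "(LINT v|\<nu>. f (p powi m * u * inverse (p powi n * v)) * g (p powi n * v))
        = (LINT v|\<nu>. shell_comp f (m - n) (u * inverse v) * shell_comp g n v)"
      by (rule integral_nu_cong[OF _ _ eq]) measurable
    then show ?thesis using u unfolding set_integral_shell(1)[OF m p_powi_shell] by (simp only: uconv_def if_True)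
  qed
  have "integrable \<nu> (\<lambda>v. shell_comp f (m - n) (u * inverse v) * shell_comp g n v)"
    by (intro uconv_integrable smooth_shell_comp_loc_const f g)
  moreover have "AE v in \<nu>. shell_comp f (m - n) (u * inverse v) * shell_comp g n v
      = f (p powi m * u * inverse (p powi n * v)) * g (p powi n * v)"
    using AE_nu by eventually_elim (rule eq[symmetric])
  ultimately have "integrable \<nu> (\<lambda>v. f (p powi m * u * inverse (p powi n * v)) * g (p powi n * v))"
    by (subst (asm) integrable_cong_AE) auto
  then show "set_integrable (mult_measure dx) (shell n) (\<lambda>y. f (p powi m * u * inverse y) * g y)"
    using set_integral_shell(2)[OF m p_powi_shell] by simp
qed

text \<open>The integral over shell \<open>n\<close> is a single term of the array convolution, and
  only finitely many terms are nonzero; the truncated integrals are constant once the range of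
  shells contains them all.\<close>

lemma pv_conv_shell:
  assumes f: "f \<in> conv_space" and g: "g \<in> conv_space" and u: "u \<in> int_units"
  shows "pv_exists dx (\<lambda>y. f (p powi m * u * inverse y) * g y)"
    and "pv_integral dx (\<lambda>y. f (p powi m * u * inverse y) * g y) = array_conv (shell_comp f) (shell_comp g) m u"
proof -
  let ?h = "\<lambda>y. f (p powi m * u * inverse y) * g y"
  note sm = conv_space_smooth[OF f] conv_space_smooth[OF g]
  have A: "shell_comp f \<in> arrays" "shell_comp g \<in> arrays" using f g by (simp_all add: conv_space_def)
  let ?S = "{n. uconv (shell_comp f (m - n)) (shell_comp g n) \<noteq> 0}"
  have fin: "finite ?S" by (rule array_conv_finite_support[OF A])
  define L where "L = Max (insert 0 ((\<lambda>n. nat \<bar>n\<bar>) ` ?S))"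
  have L: "nat \<bar>n\<bar> \<le> L" if "n \<in> ?S" for n using fin that unfolding L_def by (intro Max_ge) auto
  have part: "pv_partial dx ?h N = array_conv (shell_comp f) (shell_comp g) m u" if "N \<ge> L" for N
  proof -
    have "pv_partial dx ?h N = (\<Sum>n\<in>{- int N..int N}. uconv (shell_comp f (m - n)) (shell_comp g n) u)"
      unfolding pv_partial_def by (simp add: conv_shell(1)[OF sm u])
    also have "\<dots> = (\<Sum>n\<in>{- int N..int N}. uconv (shell_comp f (m - n)) (shell_comp g n)) u"
      by (simp add: sum_fun_apply)
    also have "(\<Sum>n\<in>{- int N..int N}. uconv (shell_comp f (m - n)) (shell_comp g n)) = array_conv (shell_comp f) (shell_comp g) m"
    proof (rule array_conv_eq_sum[symmetric])
      fix n assume "uconv (shell_comp f (m - n)) (shell_comp g n) \<noteq> 0"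
      then have "nat \<bar>n\<bar> \<le> N" using L[of n] that by simp
      then show "n \<in> {- int N..int N}" by auto
    qed simp
    finally show ?thesis .
  qed
  have lim: "pv_partial dx ?h \<longlonglongrightarrow> array_conv (shell_comp f) (shell_comp g) m u"
    by (rule tendsto_eventually, rule eventually_mono[OF eventually_ge_at_top[of L]]) (rule part)
  then show "pv_exists dx ?h" using conv_shell(2)[OF sm u] by (auto simp: pv_exists_def convergent_def)
  show "pv_integral dx ?h = array_conv (shell_comp f) (shell_comp g) m u" unfolding pv_integral_def using lim by (rule limI)
qed

lemma pv_conv_defined_conv_space: assumes "f \<in> conv_space" "g \<in> conv_space" shows "pv_conv_defined dx f g"
  unfolding pv_conv_defined_def
proof (intro allI impI)
  fix x :: 'a assume x: "x \<noteq> 0"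
  show "pv_exists dx (\<lambda>y. f (x * inverse y) * g y)"
    using pv_conv_shell(1)[OF assms shell_decomp(1)[OF x], of "fval x"] unfolding shell_decomp(2)[OF x] .
qed

lemma shell_comp_pv_conv:
  assumes "f \<in> conv_space" "g \<in> conv_space" shows "shell_comp (pv_conv dx f g) = array_conv (shell_comp f) (shell_comp g)"
proof (intro ext)
  fix m u
  show "shell_comp (pv_conv dx f g) m u = array_conv (shell_comp f) (shell_comp g) m u"
  proof (cases "u \<in> int_units")
    case True
    then have "p powi m * u \<noteq> 0" by (simp add: shell_iff)
    then show ?thesis using True pv_conv_shell(2)[OF assms True, of m] by (simp add: shell_comp_def pv_conv_def)
  next
    case False
    have "array_conv (shell_comp f) (shell_comp g) \<in> arrays" using assms by (intro array_conv_arrays) (simp_all add: conv_space_def)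
    then show ?thesis using False loc_const_off[OF arrays_loc_const] by (simp add: shell_comp_off)
  qed
qed

lemma pv_conv_0 [simp]: "pv_conv dx f g 0 = 0"
  by (simp add: pv_conv_def)

lemma pv_conv_conv_space: "f \<in> conv_space \<Longrightarrow> g \<in> conv_space \<Longrightarrow> pv_conv dx f g \<in> conv_space"
  using shell_comp_pv_conv[of f g] by (simp add: conv_space_def array_conv_arrays rec_zero_array_conv)

lemma pv_conv_commute:
  assumes "f \<in> conv_space" "g \<in> conv_space" shows "pv_conv dx f g = pv_conv dx g f"
proof -
  have "array_conv (shell_comp f) (shell_comp g) = array_conv (shell_comp g) (shell_comp f)" using assms by (intro array_conv_commute) (simp_all add: conv_space_def)
  then show ?thesis by - (rule shell_comp_eqI, simp_all add: shell_comp_pv_conv assms)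
qed

lemma pv_conv_assoc:
  assumes "f \<in> conv_space" "g \<in> conv_space" "h \<in> conv_space"
  shows "pv_conv dx (pv_conv dx f g) h = pv_conv dx f (pv_conv dx g h)"
proof -
  have "array_conv (array_conv (shell_comp f) (shell_comp g)) (shell_comp h) = array_conv (shell_comp f) (array_conv (shell_comp g) (shell_comp h))"
    using assms by (intro array_conv_assoc) (simp_all add: conv_space_def)
  then show ?thesis by - (rule shell_comp_eqI, simp_all add: shell_comp_pv_conv pv_conv_conv_space assms)
qed

lemma pv_conv_add_left:
  assumes "f \<in> conv_space" "f' \<in> conv_space" "g \<in> conv_space"
  shows "pv_conv dx (f + f') g = pv_conv dx f g + pv_conv dx f' g"
proof -
  have "array_conv (shell_comp f + shell_comp f') (shell_comp g) = array_conv (shell_comp f) (shell_comp g) + array_conv (shell_comp f') (shell_comp g)"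
    using assms by (intro array_conv_add_left) (simp_all add: conv_space_def)
  then show ?thesis by - (rule shell_comp_eqI, simp_all add: shell_comp_pv_conv pv_conv_conv_space conv_space_add shell_comp_add assms)
qed

lemma pv_conv_scale_left:
  assumes "f \<in> conv_space" "g \<in> conv_space" shows "pv_conv dx (\<lambda>x. c * f x) g = (\<lambda>x. c * pv_conv dx f g x)"
proof -
  have "array_conv (\<lambda>n u. c * shell_comp f n u) (shell_comp g) = (\<lambda>n u. c * array_conv (shell_comp f) (shell_comp g) n u)"
    using assms by (intro array_conv_scale_left) (simp_all add: conv_space_def)
  then show ?thesis by - (rule shell_comp_eqI, simp_all add: shell_comp_pv_conv pv_conv_conv_space conv_space_scale shell_comp_scale assms)
qed

lemma pv_conv_bilinear:
  assumes "S \<subseteq> conv_space" "T \<subseteq> conv_space" "fun_space.subspace S" "fun_space.subspace T" "fun_space.subspace U"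
    and closed: "\<And>f g. f \<in> S \<Longrightarrow> g \<in> T \<Longrightarrow> pv_conv dx f g \<in> U"
  shows "bilinear_map_on S T U (pv_conv dx)"
proof -
  have S: "f \<in> conv_space" if "f \<in> S" for f using assms(1) that by blast
  have T: "f \<in> conv_space" if "f \<in> T" for f using assms(2) that by blast
  have r1: "pv_conv dx f (g + g') = pv_conv dx f g + pv_conv dx f g'" if "f \<in> S" "g \<in> T" "g' \<in> T" for f g g'
    using that pv_conv_add_left[of g g' f]
    by (simp add: pv_conv_commute[of f] S T conv_space_add)
  have r2: "pv_conv dx f (\<lambda>x. c * g x) = (\<lambda>x. c * pv_conv dx f g x)" if "f \<in> S" "g \<in> T" for c f g
    using that pv_conv_scale_left[of g f c]
    by (simp add: pv_conv_commute[of f] S T conv_space_scale)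
  show ?thesis unfolding bilinear_map_on_def
    using assms by (simp add: r1 r2 pv_conv_add_left pv_conv_scale_left S T)
qed

section \<open>The ideal of functions vanishing far from 0\<close>

lemma vanish_far_iff:
  "(\<exists>R. \<forall>y. R < fabs y \<longrightarrow> f y = 0) \<longleftrightarrow> (\<exists>K. \<forall>n<K. shell_comp f n = 0)"
proof
  assume "\<exists>R. \<forall>y. R < fabs y \<longrightarrow> f y = 0"
  then obtain R where R: "\<And>y. R < fabs y \<Longrightarrow> f y = 0" by blast
  obtain K where K: "R < q powi (- K)" using ex_q_powi_greater[of _ R, where 'a='a] by auto
  have "shell_comp f n u = 0" if "n < K" for n u
  proof (cases "u \<in> int_units")
    case True
    have "p powi n * u \<in> shell n" using shell_mult[OF p_powi_shell True] by simp
    then have "fabs (p powi n * u) = q powi (- n)" by (simp add: fabs_shell)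
    moreover have "q powi (- K) \<le> q powi (- n)" using that by (simp add: powi_le_iff)
    ultimately show ?thesis using R[of "p powi n * u"] K True by (simp add: shell_comp_def)
  qed (rule shell_comp_off)
  then show "\<exists>K. \<forall>n<K. shell_comp f n = 0" by (intro exI[of _ K]) (auto simp: fun_eq_iff)
next
  assume "\<exists>K. \<forall>n<K. shell_comp f n = 0"
  then obtain K where K: "\<And>n. n < K \<Longrightarrow> shell_comp f n = 0" by blast
  have "f y = 0" if "q powi (- K) < fabs y" for y
  proof -
    have y: "y \<noteq> 0" using that by (auto simp: fabs_eq) (use order.asym[of 0 "q powi (- K)"] in simp)
    have "fval y < K" using that fabs_le_iff[of y K] y by (force simp: frac_ideal_iff)
    then show ?thesis using eq_shell_comp[OF y, of f] K by simp
  qed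
  then show "\<exists>R. \<forall>y. R < fabs y \<longrightarrow> f y = 0" by blast
qed

lemma S_sis_iff: "f \<in> S_sis \<longleftrightarrow> f \<in> conv_space \<and> (\<exists>K. \<forall>n<K. shell_comp f n = 0)"
proof
  assume f: "f \<in> S_sis"
  then have K: "\<exists>K. \<forall>n<K. shell_comp f n = 0" unfolding S_sis_def vanish_far_iff by blast
  then obtain K where "\<And>n. n < K \<Longrightarrow> shell_comp f n = 0" by blast
  then have "f \<in> conv_space" using f by (intro conv_space_I) (auto simp: S_sis_def intro!: exI[of _ K])
  with K show "f \<in> conv_space \<and> (\<exists>K. \<forall>n<K. shell_comp f n = 0)" by simp
next
  assume "f \<in> conv_space \<and> (\<exists>K. \<forall>n<K. shell_comp f n = 0)"
  then show "f \<in> S_sis" unfolding S_sis_def vanish_far_iff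
    using conv_space_smooth[of f] rec_imp_finite_near_zero[of f] by (simp add: conv_space_def)
qed

lemma S_sis_conv_space: "S_sis \<subseteq> conv_space"
  using S_sis_iff by blast

text \<open>The components are 0 far to the left and share a level far to the right, so only
  finitely many shells remain, and these have a common level too.\<close>

lemma S_sis_level:
  assumes "f \<in> S_sis" obtains M where "\<And>n. shell_comp f n \<in> level M"
proof -
  obtain K where K: "\<And>n. n < K \<Longrightarrow> shell_comp f n = 0" and A: "shell_comp f \<in> arrays"
    using assms unfolding S_sis_iff by (auto simp: conv_space_def)
  obtain M1 n0 where M1: "\<And>n. n \<ge> n0 \<Longrightarrow> shell_comp f n \<in> level M1" using A unfolding arrays_def by blast
  obtain M2 where M2: "\<And>n. K \<le> n \<Longrightarrow> n < n0 \<Longrightarrow> shell_comp f n \<in> level M2"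
    by (rule loc_const_common_range[of "shell_comp f" K n0, OF arrays_loc_const[OF A]]) (rule that)
  have "shell_comp f n \<in> level (max M1 M2)" for n
  proof -
    consider "n < K" | "n \<ge> n0" | "K \<le> n" "n < n0" by linarith
    then show ?thesis
    proof cases
      case 1 then show ?thesis using K by simp
    next
      case 2 then show ?thesis using M1 level_mono[of M1 "max M1 M2"] by auto
    next
      case 3 then show ?thesis using M2 level_mono[of M2 "max M1 M2"] by auto
    qed
  qed
  then show ?thesis by (rule that)
qed

text \<open>All components of \<open>f\<close> have one level \<open>M\<close>, so they annihilate
  the components of \<open>g\<close> whose average over \<open>1 + P^M\<close> is 0, that is, all of
  index below \<open>K2\<close>. Relative to such an \<open>f\<close>, the element \<open>g\<close>
  behaves as if it vanished far from 0.\<close>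

lemma S_sis_ideal:
  assumes f: "f \<in> S_sis" and g: "g \<in> conv_space" shows "pv_conv dx f g \<in> S_sis"
proof -
  have fA: "f \<in> conv_space" using f S_sis_conv_space by blast
  obtain M where M: "\<And>n. shell_comp f n \<in> level M" by (rule S_sis_level[OF f]) (rule that)
  obtain K1 where K1: "\<And>n. n < K1 \<Longrightarrow> shell_comp f n = 0" using f unfolding S_sis_iff by blast
  have A: "shell_comp g \<in> arrays" "shell_comp f \<in> arrays" using g fA by (simp_all add: conv_space_def)
  obtain K2 where K2: "\<And>n. n < K2 \<Longrightarrow> uconv (proj M) (shell_comp g n) = 0" using A unfolding arrays_def by blast
  have "array_conv (shell_comp f) (shell_comp g) m = 0" if "m < K1 + K2" for m
  proof -
    have "uconv (shell_comp f (m - n)) (shell_comp g n) = 0" for n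
    proof (cases "n < K2")
      case True
      then have "uconv (shell_comp g n) (shell_comp f (m - n)) = 0"
        using uconv_zero_if_proj[OF arrays_loc_const[OF A(1)] K2[OF True] M] by simp
      then show ?thesis using uconv_commute[OF arrays_loc_const[OF A(1)] arrays_loc_const[OF A(2)]] by simp
    next
      case False
      then show ?thesis using K1[of "m - n"] that by simp
    qed
    then show ?thesis by (simp add: array_conv_def)
  qed
  then show ?thesis unfolding S_sis_iff using pv_conv_conv_space[OF fA g] shell_comp_pv_conv[OF fA g] by auto
qed

lemma S_sis_subspace: "fun_space.subspace (S_sis :: ('a \<Rightarrow> complex) set)"
proof (rule fun_space.subspaceI)
  have "shell_comp 0 = 0" by (intro ext) (simp add: shell_comp_def)
  then show "(0 :: 'a \<Rightarrow> complex) \<in> S_sis" by (simp add: S_sis_iff conv_space_zero)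
next
  fix f g :: "'a \<Rightarrow> complex" assume fg: "f \<in> S_sis" "g \<in> S_sis"
  obtain K1 where "\<And>n. n < K1 \<Longrightarrow> shell_comp f n = 0" using fg unfolding S_sis_iff by blast
  moreover obtain K2 where "\<And>n. n < K2 \<Longrightarrow> shell_comp g n = 0" using fg unfolding S_sis_iff by blast
  ultimately have "\<forall>n<min K1 K2. shell_comp (f + g) n = 0" by (simp add: shell_comp_add)
  then show "f + g \<in> S_sis" using fg conv_space_add unfolding S_sis_iff by blast
next
  fix c and f :: "'a \<Rightarrow> complex" assume f: "f \<in> S_sis"
  then show "(\<lambda>x. c * f x) \<in> S_sis"
    unfolding S_sis_iff shell_comp_scale using conv_space_scale by (force simp: fun_eq_iff)
qed

end

lemma borel_measurable_diff_field [measurable (raw)]: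
  fixes f g :: "_ \<Rightarrow> 'a::nonarch_local_field"
  assumes "f \<in> borel_measurable M" "g \<in> borel_measurable M"
  shows "(\<lambda>x. f x - g x) \<in> borel_measurable M"
  using assms by (rule borel_measurable_continuous_Pair) (intro continuous_intros)

section \<open>Conductors and additive characters\<close>

lemma one_units_eq: "((+) 1 ` frac_ideal (int m)) \<inter> int_units = (one_units m :: 'a::nonarch_local_field set)"
  unfolding coset_translate[symmetric] by (auto simp: one_units_def)

text \<open>The multiplicative group of the complex numbers has no small subgroups.\<close>

lemma no_small_subgroups:
  fixes z :: complex
  assumes "\<And>n. cmod (z ^ (2 ^ n) - 1) < 1 / 2"
  shows "z = 1"
proof (rule ccontr)
  assume "z \<noteq> 1"
  have "cmod (z ^ (2 ^ n) - 1) \<ge> (3 / 2) ^ n * cmod (z - 1)" for n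
  proof (induction n)
    case (Suc n)
    define w where "w = z ^ (2 ^ n)"
    \<comment> \<open>Since \<open>w\<close> is within 1/2 of 1, this gives
      \<open>cmod (w + 1) \<ge> 3 / 2\<close>, and squaring expands the distance to 1 by at least
      that factor.\<close>
    have "2 \<le> cmod (w + 1) + cmod (w - 1)" using norm_triangle_ineq4[of "w + 1" "w - 1"] by simp
    then have "cmod (w + 1) \<ge> 3 / 2" using assms[of n] by (simp add: w_def)
    then have "(3 / 2) * cmod (w - 1) \<le> cmod (w + 1) * cmod (w - 1)" by (intro mult_right_mono) auto
    also have "\<dots> = cmod (w ^ 2 - 1)" by (simp flip: norm_mult) (simp add: algebra_simps power2_eq_square)
    also have "w ^ 2 = z ^ (2 ^ Suc n)" by (simp add: w_def power_mult[symmetric] mult.commute)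
    finally show ?case using Suc by (simp add: w_def)
  qed simp
  moreover obtain n where "1 / cmod (z - 1) < (3 / 2) ^ n"
    using real_arch_pow[of "3/2" "1 / cmod (z - 1)"] by auto
  then have "1 < (3 / 2) ^ n * cmod (z - 1)" using \<open>z \<noteq> 1\<close> by (simp add: field_simps)
  ultimately show False using assms[of n] by (smt (verit) field_sum_of_halves)
qed

text \<open>Continuity keeps the values on some \<open>1 + P^n\<close> within 1/2 of 1. This set is
  closed under multiplication, so all the powers \<open>w ^ (2 ^ k)\<close> stay there and
  \<open>no_small_subgroups\<close> applies.\<close>

lemma trivial_on_one_units:
  fixes \<eta> :: "'a::nonarch_local_field \<Rightarrow> complex"
  assumes cont: "continuous_on int_units \<eta>" and one: "\<eta> 1 = 1"
    and mult: "\<And>x y. x \<in> int_units \<Longrightarrow> y \<in> int_units \<Longrightarrow> \<eta> (x * y) = \<eta> x * \<eta> y"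
  shows "\<exists>m. \<forall>w\<in>one_units m. \<eta> w = 1"
proof -
  have "(\<eta> \<longlongrightarrow> \<eta> 1) (at 1 within int_units)" using cont unfolding continuous_on_def by simp
  then have "(\<eta> \<longlongrightarrow> 1) (at 1)" using at_within_open[OF _ open_shell, of "1::'a" 0] one by simp
  then have "\<forall>\<^sub>F w in at 1. dist (\<eta> w) 1 < 1 / 2" by (rule tendstoD) simp
  then have "\<forall>\<^sub>F w in nhds 1. dist (\<eta> w) 1 < 1 / 2"
    unfolding eventually_at_filter by (rule eventually_mono) (use one in auto)
  then obtain n where n: "n \<ge> 0" "\<And>w. w \<in> coset 1 n \<Longrightarrow> dist (\<eta> w) 1 < 1 / 2"
    unfolding eventually_nhds_coset[where k=0] by blast
  have "\<eta> w = 1" if w: "w \<in> one_units (nat n)" for w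
  proof (rule no_small_subgroups)
    fix k
    have pow: "w ^ j \<in> one_units (nat n) \<and> \<eta> (w ^ j) = \<eta> w ^ j" for j
    proof (induction j)
      case (Suc j)
      then have wj: "w ^ j \<in> one_units (nat n)" "\<eta> (w ^ j) = \<eta> w ^ j" by simp_all
      then show ?case using one_units_mult[OF w wj(1)] mult[of w "w ^ j"] one_units_units[OF w] one_units_units[OF wj(1)]
        by simp
    qed (simp add: one)
    then have "w ^ (2 ^ k) \<in> coset 1 n" using n(1) by (simp add: one_units_def)
    then show "cmod (\<eta> w ^ (2 ^ k) - 1) < 1 / 2" using n(2) pow[of "2 ^ k"] by (metis dist_norm)
  qed
  then show ?thesis by blast
qed

lemma conductor_trivial:
  assumes "\<exists>m. \<forall>w\<in>one_units m. \<eta> w = 1" "w \<in> one_units (conductor_exp \<eta>)" shows "\<eta> w = 1"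
  using LeastI_ex[OF assms(1)] assms(2) unfolding conductor_exp_def one_units_eq by blast

lemma conductor_le:
  assumes "\<forall>w\<in>one_units m. \<eta> w = 1" shows "conductor_exp \<eta> \<le> m"
  using assms unfolding conductor_exp_def one_units_eq by (rule Least_le)

lemma qc_one: "\<omega> \<in> quasi_characters \<Longrightarrow> \<omega> 1 = 1"
  unfolding quasi_characters_def
  by (metis (mono_tags, lifting) mem_Collect_eq mult_cancel_left2 mult_1 one_neq_zero)

lemma qc_mult: "\<omega> \<in> quasi_characters \<Longrightarrow> x \<noteq> 0 \<Longrightarrow> y \<noteq> 0 \<Longrightarrow> \<omega> (x * y) = \<omega> x * \<omega> y"
  by (simp add: quasi_characters_def)

lemma qc_nz: "\<omega> \<in> quasi_characters \<Longrightarrow> x \<noteq> 0 \<Longrightarrow> \<omega> x \<noteq> 0"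
  by (simp add: quasi_characters_def)

lemma qc_continuous: "\<omega> \<in> quasi_characters \<Longrightarrow> continuous_on (- {0}) \<omega>"
  by (simp add: quasi_characters_def)

lemma qc_zero: "\<omega> \<in> quasi_characters \<Longrightarrow> \<omega> 0 = 0"
  by (simp add: quasi_characters_def)

lemma qc_times:
  assumes "\<omega>1 \<in> quasi_characters" "\<omega>2 \<in> quasi_characters" shows "(\<lambda>x. \<omega>1 x * \<omega>2 x) \<in> quasi_characters"
  using assms by (auto simp: quasi_characters_def intro!: continuous_intros)

lemma qc_conductor:
  assumes "\<omega> \<in> quasi_characters" "w \<in> one_units m" "m \<ge> conductor_exp \<omega>" shows "\<omega> w = 1"
proof (rule conductor_trivial)
  have "continuous_on int_units \<omega>"
    by (rule continuous_on_subset[OF qc_continuous[OF assms(1)]]) (auto simp: shell_iff)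
  then show "\<exists>m. \<forall>w\<in>one_units m. \<omega> w = 1"
    by (rule trivial_on_one_units) (use assms in \<open>auto simp: qc_one qc_mult shell_iff\<close>)
  show "w \<in> one_units (conductor_exp \<omega>)" using one_units_mono[OF assms(3)] assms(2) by blast
qed

lemma conductor_times_le:
  assumes "\<omega>1 \<in> quasi_characters" "\<omega>2 \<in> quasi_characters"
  shows "conductor_exp (\<lambda>x. \<omega>1 x * \<omega>2 x) \<le> max (conductor_exp \<omega>1) (conductor_exp \<omega>2)"
  by (rule conductor_le) (auto simp: qc_conductor[OF assms(1)] qc_conductor[OF assms(2)])

definition triv_char :: "'a::nonarch_local_field \<Rightarrow> complex"
  where "triv_char x = (if x = 0 then 0 else 1)"

lemma triv_char_qc: "triv_char \<in> quasi_characters"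
proof -
  have "continuous_on (- {0::'a}) triv_char \<longleftrightarrow> continuous_on (- {0::'a}) (\<lambda>_. 1 :: complex)"
    by (rule continuous_on_cong) (auto simp: triv_char_def)
  then show ?thesis by (auto simp: quasi_characters_def triv_char_def)
qed

lemma conductor_triv: "conductor_exp (triv_char :: 'a::nonarch_local_field \<Rightarrow> complex) = 0"
proof -
  have "\<forall>w\<in>(one_units 0 :: 'a set). triv_char w = 1" by (auto simp: triv_char_def one_units_def shell_iff)
  then show ?thesis using conductor_le by force
qed

locale additive_char_field = haar_field p dx q for p :: "'a::nonarch_local_field" and dx q +
  fixes \<psi> :: "'a \<Rightarrow> complex"
  assumes char: "additive_character \<psi>"
    and psi_O: "x \<in> ring_of_integers \<Longrightarrow> \<psi> x = 1"
    and psi_nontriv: "\<exists>x\<in>frac_ideal (- 1). \<psi> x \<noteq> 1"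
begin

lemma psi_add: "\<psi> (x + y) = \<psi> x * \<psi> y"
  using char by (simp add: additive_character_def)

lemma psi_norm [simp]: "cmod (\<psi> x) = 1"
  using char by (simp add: additive_character_def)

lemma psi_nz [simp]: "\<psi> x \<noteq> 0"
  using psi_norm[of x] by force

lemma psi_continuous: "continuous_on UNIV \<psi>"
  using char by (simp add: additive_character_def)

lemma psi_measurable [measurable]: "\<psi> \<in> borel_measurable borel"
  by (rule borel_measurable_continuous_onI) (rule psi_continuous)

lemma psi_cong: "x - y \<in> ring_of_integers \<Longrightarrow> \<psi> x = \<psi> y"
  using psi_add[of y "x - y"] psi_O[of "x - y"] by simp

text \<open>The character \<open>z \<mapsto> \<psi> (z a)\<close> is nontrivial on
  \<open>P^k\<close>: as \<open>fval a + k \<le> - 1\<close>, a point of \<open>P^(- 1)\<close> with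
  \<open>\<psi> x \<noteq> 1\<close> has the form \<open>z0 a\<close> with \<open>z0\<close> in
  \<open>P^k\<close>. Translation by \<open>z0\<close> multiplies the integral by
  \<open>\<psi> x\<close>.\<close>

lemma psi_integral_ideal:
  assumes a: "a \<noteq> 0" "fval a + k < 0"
  shows "(LINT z|dx. indicator (frac_ideal k) z * \<psi> (z * a)) = 0"
proof -
  obtain x where x: "x \<in> frac_ideal (- 1)" "\<psi> x \<noteq> 1" using psi_nontriv by blast
  define z0 where "z0 = inverse a * x"
  have z0: "z0 \<in> frac_ideal k"
    using frac_ideal_mono[OF x(1), of "k + fval a"] a by (simp add: z0_def frac_ideal_mult_iff fval_inverse)
  let ?f = "\<lambda>z. indicator (frac_ideal k) z * \<psi> (z * a)"
  have [measurable]: "?f \<in> borel_measurable borel" by measurable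
  have "?f (z0 + z) = \<psi> x * ?f z" for z
  proof -
    have "z0 + z \<in> frac_ideal k \<longleftrightarrow> z \<in> frac_ideal k"
      using frac_ideal_cancel_right[OF z0, of z] by (simp add: add.commute)
    moreover have "(z0 + z) * a = x + z * a" using a by (simp add: z0_def field_simps)
    ultimately show ?thesis by (simp add: indicator_def psi_add)
  qed
  then have "(LINT z|dx. ?f z) = \<psi> x * (LINT z|dx. ?f z)"
    using integral_dx_translate[of ?f z0] by simp
  then show ?thesis using x(2) by simp
qed

text \<open>For \<open>K \<ge> 1\<close> the group \<open>1 + P^K\<close> is a full additive coset,
  and \<open>w = 1 + z\<close> turns the integral into that of a nontrivial additive character of
  \<open>P^K\<close>.\<close>

lemma psi_integral_one_units:
  assumes a: "a \<noteq> 0" "fval a + int K < 0" and K: "K \<ge> 1"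
  shows "(LINT w|\<nu>. proj K w * \<psi> ((w - 1) * a)) = 0"
proof -
  have [measurable]: "proj K \<in> borel_measurable borel" by (rule loc_const_measurable) simp
  have ou: "one_units K = coset (1::'a) (int K)"
    using coset_shell[of 1 0 "int K"] K by (auto simp: one_units_def)
  have "(LINT w|\<nu>. proj K w * \<psi> ((w - 1) * a)) = (LINT w|dx. indicator int_units w * (proj K w * \<psi> ((w - 1) * a)))"
    by (rule integral_nu_eq) measurable
  also have "\<dots> = (LINT z|dx. indicator int_units (1 + z) * (proj K (1 + z) * \<psi> ((1 + z - 1) * a)))"
    by (rule integral_dx_translate[symmetric]) measurable
  also have "\<dots> = (LINT z|dx. (1 / measure \<nu> (one_units K)) * (indicator (frac_ideal (int K)) z * \<psi> (z * a)))"
  proof (rule Bochner_Integration.integral_cong)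
    fix z :: 'a
    have "1 + z \<in> one_units K \<longleftrightarrow> z \<in> frac_ideal (int K)" unfolding ou by (simp add: coset_iff)
    then show "indicator int_units (1 + z) * (proj K (1 + z) * \<psi> ((1 + z - 1) * a))
        = (1 / measure \<nu> (one_units K)) * (indicator (frac_ideal (int K)) z * \<psi> (z * a))"
      using one_units_units[of "1 + z" K] by (auto simp: proj_def indicator_def)
  qed simp
  also have "\<dots> = 0" using psi_integral_ideal[OF a] by simp
  finally show ?thesis .
qed

section \<open>Germs as iterated convolutions\<close>

text \<open>The component on shell \<open>- l\<close> of the function
  \<open>\<psi> \<omega>\<close>; this is the germ of degree 1 and the building block of the
  others.\<close>

definition psi_twist :: "nat \<Rightarrow> ('a \<Rightarrow> complex) \<Rightarrow> 'a \<Rightarrow> complex"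
  where "psi_twist l \<omega> u = (if u \<in> int_units then \<psi> (u / p ^ l) * \<omega> (u / p ^ l) else 0)"

lemma psi_twist_level:
  assumes "\<omega> \<in> quasi_characters" "conductor_exp \<omega> \<le> l" shows "psi_twist l \<omega> \<in> level l"
proof (rule levI)
  fix u w :: 'a assume u: "u \<in> int_units" and w: "w \<in> one_units l"
  have uw: "u * w \<in> int_units" using int_units_mult[OF u one_units_units[OF w]] .
  have "u * w / p ^ l - u / p ^ l = (u / p ^ l) * (w - 1)" by (simp add: field_simps)
  moreover have "(u / p ^ l) * (w - 1) \<in> ring_of_integers"
  proof -
    have "u / p ^ l \<in> frac_ideal (- int l)" using u by (simp add: frac_ideal_iff shell_iff fval_divide fval_power)
    moreover have "w - 1 \<in> frac_ideal (int l)" using w by (simp add: one_units_def coset_iff)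
    ultimately show ?thesis using frac_ideal_mult[of "u / p ^ l" "- int l" "w - 1" "int l"] by (simp only: add.left_inverse)
  qed
  ultimately have "\<psi> (u * w / p ^ l) = \<psi> (u / p ^ l)" by (intro psi_cong) simp
  moreover have "\<omega> (u * w / p ^ l) = \<omega> (u / p ^ l)"
    using qc_mult[OF assms(1), of "u / p ^ l" w] qc_conductor[OF assms(1) w assms(2)] u one_units_units[OF w]
    by (simp add: shell_iff)
  ultimately show "psi_twist l \<omega> (u * w) = psi_twist l \<omega> u" using u uw by (simp add: psi_twist_def)
qed (simp add: psi_twist_def)

text \<open>On \<open>1 + P^K\<close> with \<open>conductor_exp \<omega> \<le> K < l\<close> the
  factor \<open>\<omega>\<close> is constant, while the additive character still oscillates because
  \<open>u / p ^ l\<close> has valuation \<open>- l\<close>. The average is therefore 0, and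
  \<open>proj_zero_mono\<close> descends to \<open>M\<close>.\<close>

lemma proj_psi_twist:
  assumes \<omega>: "\<omega> \<in> quasi_characters" "conductor_exp \<omega> < l" and l: "1 < l" and M: "M < l"
  shows "uconv (proj M) (psi_twist l \<omega>) = 0"
proof -
  \<comment> \<open>At least 1, so that \<open>1 + P^K\<close> is an additive coset; at least the
    conductor, so that \<open>\<omega>\<close> is trivial on it; at least \<open>M\<close>, for
    monotonicity. Keeping all this below \<open>l\<close> is what the lower bound on
    \<open>l\<close> in the germs provides.\<close>
  define K where "K = max 1 (max M (conductor_exp \<omega>))"
  have K: "K \<ge> 1" "K < l" "M \<le> K" "conductor_exp \<omega> \<le> K" using assms by (auto simp: K_def)
  have loc_const: "psi_twist l \<omega> \<in> loc_const" using psi_twist_level[OF \<omega>(1), of l] \<omega>(2) by (intro level_loc_const[of _ l]) simp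
  have "uconv (proj K) (psi_twist l \<omega>) u = 0" if u: "u \<in> int_units" for u
  proof -
    note [measurable] = loc_const_measurable[OF loc_const] loc_const_measurable[OF proj_loc_const]
    define a where "a = u / p ^ l"
    have a: "a \<noteq> 0" "fval a = - int l" using u by (auto simp: a_def shell_iff fval_divide fval_power)
    have "uconv (proj K) (psi_twist l \<omega>) u = (LINT v|\<nu>. psi_twist l \<omega> (u * inverse v) * proj K v)"
      using u uconv_commute[OF proj_loc_const loc_const] by (simp add: uconv_def)
    also have "\<dots> = (LINT v|\<nu>. psi_twist l \<omega> (u * inverse (1 * inverse v)) * proj K (1 * inverse v))"
      by (rule integral_nu_div[symmetric, OF uconv_measurable[OF loc_const proj_loc_const] one_in_units])
    also have "\<dots> = (LINT v|\<nu>. (\<psi> a * \<omega> a) * (proj K v * \<psi> ((v - 1) * a)))"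
    proof (rule integral_nu_cong)
      fix v :: 'a assume v: "v \<in> int_units"
      have inv: "inverse v \<in> one_units K \<longleftrightarrow> v \<in> one_units K"
        using one_units_inverse[of v K] one_units_inverse[of "inverse v" K] by auto
      have "psi_twist l \<omega> (u * v) = \<psi> a * \<omega> a * \<psi> ((v - 1) * a)" if vK: "v \<in> one_units K"
      proof -
        have "u * v / p ^ l = a + (v - 1) * a" by (simp add: a_def field_simps)
        then have "\<psi> (u * v / p ^ l) = \<psi> a * \<psi> ((v - 1) * a)" by (simp only: psi_add)
        moreover have "u * v / p ^ l = a * v" by (simp add: a_def)
        then have "\<omega> (u * v / p ^ l) = \<omega> a * \<omega> v" using qc_mult[OF \<omega>(1), of a v] a v by (simp add: shell_iff)
        moreover have "\<omega> v = 1" using qc_conductor[OF \<omega>(1) vK K(4)] .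
        ultimately show ?thesis using int_units_mult[OF u v] by (simp add: psi_twist_def)
      qed
      then show "psi_twist l \<omega> (u * inverse (1 * inverse v)) * proj K (1 * inverse v)
          = (\<psi> a * \<omega> a) * (proj K v * \<psi> ((v - 1) * a))"
        using inv by (simp add: proj_def)
    qed measurable
    also have "\<dots> = 0" using psi_integral_one_units[of a K] a K by simp
    finally show ?thesis .
  qed
  then have "uconv (proj K) (psi_twist l \<omega>) = 0" by (intro ext) (metis uconv_off zero_fun_apply)
  from proj_zero_mono[OF loc_const this K(3)] show ?thesis .
qed

text \<open>Stationary phase: averaging over \<open>v \<mapsto> v w\<close> with \<open>w \<in> 1 + \<P>\<^sup>k\<close>, \<open>2 k \<ge> l\<close>, localizes
  the convolution integral at \<open>u / v \<in> v (1 + \<P>\<^sup>l\<^sup>-\<^sup>k)\<close>, where \<open>\<omega>1 (u / v) = \<omega>1 v\<close>.\<close>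

lemma psi_twist_uconv_psi_twist:
  assumes \<omega>1: "\<omega>1 \<in> quasi_characters" "conductor_exp \<omega>1 \<le> l div 2"
    and \<omega>2: "\<omega>2 \<in> quasi_characters" "conductor_exp \<omega>2 \<le> l div 2" and l: "l \<ge> 2"
  shows "uconv (psi_twist l \<omega>1) (psi_twist l \<omega>2) = uconv (psi_twist l triv_char) (psi_twist l (\<lambda>x. \<omega>1 x * \<omega>2 x))"
proof
  fix u
  show "uconv (psi_twist l \<omega>1) (psi_twist l \<omega>2) u = uconv (psi_twist l triv_char) (psi_twist l (\<lambda>x. \<omega>1 x * \<omega>2 x)) u"
  proof (cases "u \<in> int_units")
    case u: True
    \<comment> \<open>Half of \<open>l\<close>, rounded up: \<open>2 k \<ge> l\<close> makes the
      second-order term of the phase integral, and \<open>l - k = l div 2\<close> still bounds both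
      conductors.\<close>
    define k where "k = (l + 1) div 2"
    have k: "k \<ge> 1" "2 * k \<ge> l" "l - k = l div 2" "l div 2 \<le> k" "k \<le> l" using l by (auto simp: k_def)
    have \<omega>12: "(\<lambda>x. \<omega>1 x * \<omega>2 x) \<in> quasi_characters" "conductor_exp (\<lambda>x. \<omega>1 x * \<omega>2 x) \<le> l"
      using qc_times[OF \<omega>1(1) \<omega>2(1)] conductor_times_le[OF \<omega>1(1) \<omega>2(1)] \<omega>1 \<omega>2 by auto
    have loc_const: "psi_twist l \<omega>1 \<in> loc_const" "psi_twist l \<omega>2 \<in> loc_const" "psi_twist l triv_char \<in> loc_const" "psi_twist l (\<lambda>x. \<omega>1 x * \<omega>2 x) \<in> loc_const"
      using psi_twist_level[OF \<omega>1(1), of l] psi_twist_level[OF \<omega>2(1), of l] psi_twist_level[OF \<omega>12] psi_twist_level[OF triv_char_qc, of l]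
        \<omega>1(2) \<omega>2(2) conductor_triv[where 'a='a] by (auto intro!: level_loc_const[of _ l])
    note [measurable] = loc_const[THEN loc_const_measurable] loc_const_measurable[OF proj_loc_const]
    \<comment> \<open>The difference of the two integrands; the claim is that its integral over the
      units is 0.\<close>
    define h where "h v = psi_twist l \<omega>1 (u * inverse v) * psi_twist l \<omega>2 v
        - psi_twist l triv_char (u * inverse v) * psi_twist l (\<lambda>x. \<omega>1 x * \<omega>2 x) v" for v
    have h_meas [measurable]: "h \<in> borel_measurable borel" unfolding h_def by measurable
    have h_off: "h v = 0" if "v \<notin> int_units" for v using that by (simp add: h_def psi_twist_def)
    obtain B where B: "\<And>v. cmod (h v) \<le> B"
    proof -
      obtain B1 where B1: "B1 \<ge> 0" "\<And>u. cmod (psi_twist l \<omega>1 u) \<le> B1" using loc_const_bounded[OF loc_const(1)] by blast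
      obtain B2 where B2: "B2 \<ge> 0" "\<And>u. cmod (psi_twist l \<omega>2 u) \<le> B2" using loc_const_bounded[OF loc_const(2)] by blast
      obtain B3 where B3: "B3 \<ge> 0" "\<And>u. cmod (psi_twist l triv_char u) \<le> B3" using loc_const_bounded[OF loc_const(3)] by blast
      obtain B4 where B4: "B4 \<ge> 0" "\<And>u. cmod (psi_twist l (\<lambda>x. \<omega>1 x * \<omega>2 x) u) \<le> B4" using loc_const_bounded[OF loc_const(4)] by blast
      have "cmod (h v) \<le> B1 * B2 + B3 * B4" for v
      proof -
        have "cmod (h v) \<le> cmod (psi_twist l \<omega>1 (u * inverse v) * psi_twist l \<omega>2 v)
            + cmod (psi_twist l triv_char (u * inverse v) * psi_twist l (\<lambda>x. \<omega>1 x * \<omega>2 x) v)"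
          unfolding h_def by (rule norm_triangle_ineq4)
        also have "\<dots> \<le> B1 * B2 + B3 * B4"
          unfolding norm_mult using B1 B2 B3 B4 by (intro add_mono mult_mono) auto
        finally show ?thesis .
      qed
      then show ?thesis by (rule that)
    qed
    define C where "C v = \<psi> (u / (v * p ^ l) + v / p ^ l) * \<omega>2 (v / p ^ l) * (\<omega>1 (u / (v * p ^ l)) - \<omega>1 (v / p ^ l))" for v
    have hC: "h v = C v" if v: "v \<in> int_units" for v
    proof -
      have "u * inverse v \<in> int_units" using u v by (simp add: int_units_mult)
      moreover have "u * inverse v / p ^ l = u / (v * p ^ l)" by (simp add: divide_inverse)
      moreover have "u / (v * p ^ l) \<noteq> 0" using u v by (simp add: shell_iff)
      ultimately show ?thesis using v by (simp add: h_def psi_twist_def C_def psi_add triv_char_def algebra_simps)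
    qed
    have trans: "h (v * w) = h v * \<psi> ((w - 1) * ((v - u * inverse v) / p ^ l))"
      if v: "v \<in> int_units" and w: "w \<in> one_units k" for v w
    proof -
      have wu: "w \<in> int_units" and w1: "w - 1 \<in> frac_ideal (int k)" using w by (auto simp: one_units_def coset_iff)
      have nz: "u \<noteq> 0" "v \<noteq> 0" "w \<noteq> 0" using u v wu by (auto simp: shell_iff)
      have vw: "v * w \<in> int_units" using int_units_mult[OF v wu] .
      have c1: "\<omega>1 w = 1" "\<omega>2 w = 1" using qc_conductor[OF \<omega>1(1) w] qc_conductor[OF \<omega>2(1) w] \<omega>1 \<omega>2 k by auto
      have c2: "\<omega>1 (inverse w) = 1"
        using qc_conductor[OF \<omega>1(1) one_units_inverse[OF w]] \<omega>1(2) k by simp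
      have o2: "\<omega>2 (v * w / p ^ l) = \<omega>2 (v / p ^ l)"
        using qc_mult[OF \<omega>2(1), of "v / p ^ l" w] nz c1 by simp
      have o1: "\<omega>1 (v * w / p ^ l) = \<omega>1 (v / p ^ l)"
        using qc_mult[OF \<omega>1(1), of "v / p ^ l" w] nz c1 by simp
      have "u / (v * w * p ^ l) = u / (v * p ^ l) * inverse w" using nz by (simp add: field_simps)
      then have o1': "\<omega>1 (u / (v * w * p ^ l)) = \<omega>1 (u / (v * p ^ l))"
        using qc_mult[OF \<omega>1(1), of "u / (v * p ^ l)" "inverse w"] nz c2 by simp
      \<comment> \<open>Taylor expansion of the phase \<open>u / v + v\<close> under
        \<open>v \<mapsto> v w\<close>. With \<open>z = w - 1\<close> the exact identity
        \<open>1 / w = 1 - z + z^2 / w\<close> leaves only a quadratic remainder, which is integral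
        after division by \<open>p ^ l\<close> since \<open>2 k \<ge> l\<close>.\<close>
      have "u / (v * w * p ^ l) + v * w / p ^ l - (u / (v * p ^ l) + v / p ^ l + (w - 1) * ((v - u * inverse v) / p ^ l))
          = (u / (v * w * p ^ l)) * ((w - 1) * (w - 1))"
        using nz by (simp add: field_simps)
      moreover have "(u / (v * w * p ^ l)) * ((w - 1) * (w - 1)) \<in> ring_of_integers"
      proof -
        have "(w - 1) * (w - 1) \<in> frac_ideal (int k + int k)" using frac_ideal_mult[OF w1 w1] .
        then have "(w - 1) * (w - 1) \<in> frac_ideal (int l)" by (rule frac_ideal_mono) (use k in simp)
        moreover have "u / (v * w * p ^ l) \<in> frac_ideal (- int l)"
          using u v wu by (auto simp: frac_ideal_iff shell_iff fval_divide fval_mult fval_power)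
        ultimately show ?thesis
          using frac_ideal_mult[of "u / (v * w * p ^ l)" "- int l" "(w - 1) * (w - 1)" "int l"] by (simp only: add.left_inverse)
      qed
      ultimately have "\<psi> (u / (v * w * p ^ l) + v * w / p ^ l)
          = \<psi> (u / (v * p ^ l) + v / p ^ l + (w - 1) * ((v - u * inverse v) / p ^ l))"
        by (intro psi_cong) (simp only:)
      then have "C (v * w) = C v * \<psi> ((w - 1) * ((v - u * inverse v) / p ^ l))"
        unfolding C_def o1 o2 o1' by (simp add: psi_add)
      then show ?thesis using hC[OF v] hC[OF vw] by simp
    qed
    have inner: "(LINT w|\<nu>. proj k w * h (v * w)) = 0" if v: "v \<in> int_units" for v
    proof -
      \<comment> \<open>The derivative of the phase. Where it has valuation below
        \<open>- k\<close>, averaging over \<open>w\<close> gives 0. Elsewhere \<open>v\<close> and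
        \<open>u / v\<close> agree modulo \<open>P^(l - k)\<close>, so \<open>\<omega>1\<close>
        takes the same value on \<open>u / v\<close> and \<open>v\<close>, and the integrand itself
        vanishes.\<close>
      define b where "b = (v - u * inverse v) / p ^ l"
      have eq: "(LINT w|\<nu>. proj k w * h (v * w)) = (LINT w|\<nu>. h v * (proj k w * \<psi> ((w - 1) * b)))"
      proof (rule integral_nu_cong)
        fix w :: 'a
        show "proj k w * h (v * w) = h v * (proj k w * \<psi> ((w - 1) * b))"
          using trans[OF v, of w] by (cases "w \<in> one_units k") (simp_all add: proj_def b_def)
      qed measurable
      show ?thesis
      proof (cases "b \<noteq> 0 \<and> fval b + int k < 0")
        case True
        then show ?thesis unfolding eq using psi_integral_one_units[of b k] k by simp
      next
        case False
        then have "b \<in> frac_ideal (- int k)" by (auto simp: frac_ideal_iff)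
        have "v - u * inverse v = p ^ l * b" by (simp add: b_def)
        moreover have "p ^ l * b \<in> frac_ideal (int l + - int k)"
          by (rule frac_ideal_mult) (use \<open>b \<in> frac_ideal (- int k)\<close> in \<open>simp_all add: frac_ideal_iff fval_power\<close>)
        moreover have "int l + - int k = int (l div 2)" using k by linarith
        ultimately have "v - u * inverse v \<in> frac_ideal (int (l div 2))" by simp
        then have "u * inverse v \<in> coset v (int (l div 2))"
          using coset_sym[of v "u * inverse v" "int (l div 2)"] by (simp add: coset_iff)
        moreover have uv: "u * inverse v \<in> int_units" using u v by (simp add: int_units_mult)
        ultimately have *: "u * inverse v * inverse v \<in> one_units (l div 2)"
          using quotient_one_units[OF v uv] by blast
        have nz: "u \<noteq> 0" "v \<noteq> 0" using u v by (auto simp: shell_iff)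
        have "\<omega>1 (u / (v * p ^ l)) = \<omega>1 (v / p ^ l * (u * inverse v * inverse v))"
          using nz by (simp add: field_simps)
        also have "\<dots> = \<omega>1 (v / p ^ l) * \<omega>1 (u * inverse v * inverse v)"
          by (rule qc_mult[OF \<omega>1(1)]) (use nz in simp_all)
        also have "\<omega>1 (u * inverse v * inverse v) = 1" using qc_conductor[OF \<omega>1(1) * \<omega>1(2)] .
        finally have "C v = 0" by (simp add: C_def)
        then show ?thesis unfolding eq using hC[OF v] by simp
      qed
    qed
    \<comment> \<open>Insert the total mass 1 of \<open>proj k\<close> and replace \<open>v\<close>
      by \<open>v w\<close>; after Fubini the integral over \<open>w\<close> is the one in
      \<open>inner\<close>.\<close>
    have "(LINT v|\<nu>. h v) = (LINT w|\<nu>. proj k w * (LINT v|\<nu>. h v))"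
      by (simp add: integral_proj)
    also have "\<dots> = (LINT w|\<nu>. LINT v|\<nu>. proj k w * h (v * w))"
    proof (rule integral_nu_cong)
      fix w :: 'a assume w: "w \<in> int_units"
      have "(LINT v|\<nu>. h v) = (LINT v|\<nu>. h (w * v))" by (rule integral_nu_mult[symmetric]) (use w in simp_all)
      then show "proj k w * (LINT v|\<nu>. h v) = (LINT v|\<nu>. proj k w * h (v * w))" by (simp add: mult.commute)
    qed measurable
    also have "\<dots> = (LINT v|\<nu>. LINT w|\<nu>. proj k w * h (v * w))"
    proof -
      obtain P where P: "P \<ge> 0" "\<And>w. cmod (proj k w) \<le> P" using loc_const_bounded[OF proj_loc_const[of k]] by blast
      have "B \<ge> 0" using B[of 1] norm_ge_zero order_trans by blast
      show ?thesis
      proof (rule fubini_nu[where B = "P * B"])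
        show "cmod (proj k w * h (v * w)) \<le> P * B" for w v
          unfolding norm_mult using P B \<open>B \<ge> 0\<close> by (intro mult_mono) auto
      qed measurable
    qed
    also have "\<dots> = (LINT v|\<nu>. 0)"
      by (rule integral_nu_cong) (use inner in measurable)
    finally have "(LINT v|\<nu>. h v) = 0" by simp
    then show ?thesis
      using u uconv_integrable[OF loc_const(1,2), of u] uconv_integrable[OF loc_const(3,4), of u]
      by (simp add: uconv_def h_def)
  qed (simp add: uconv_off)
qed

end

section \<open>Iterated integrals over the units\<close>

lemma borel_measurable_prod_component:
  assumes "finite J" "J \<subseteq> I"
  shows "(\<lambda>t. \<Prod>j\<in>J. t j :: 'a::nonarch_local_field) \<in> borel_measurable (Pi\<^sub>M I (\<lambda>_. borel))"
  using assms by (induction J rule: finite_induct) auto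

lemma prod_units: "(\<And>j. j \<in> J \<Longrightarrow> t j \<in> int_units) \<Longrightarrow> (\<Prod>j\<in>J. t j) \<in> int_units"
  by (induction J rule: infinite_finite_induct) (auto intro: int_units_mult)

context haar_field
begin

lemma loc_const_integral_dx:
  assumes "b \<in> loc_const" shows "integrable dx b" "(LINT v|dx. b v) = (LINT v|\<nu>. b v)"
proof -
  have eq: "(\<lambda>u. indicator int_units u * b u) = b" by (intro ext) (auto simp: indicator_def loc_const_off[OF assms])
  show "integrable dx b" using integrable_nu_iff[OF loc_const_measurable[OF assms]] loc_const_integrable[OF assms] unfolding eq by blast
  show "(LINT v|dx. b v) = (LINT v|\<nu>. b v)" using integral_nu_eq[OF loc_const_measurable[OF assms]] unfolding eq by (rule sym)
qed

lemma pv_conv_0_left: "a \<in> conv_space \<Longrightarrow> pv_conv dx 0 a = 0"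
  using pv_conv_scale_left[OF conv_space_zero, of a 0] by (simp add: zero_fun_def)

sublocale PF: product_sigma_finite "\<lambda>_. dx"
  by standard

text \<open>The integrand of a germ in a form suited to induction on \<open>J\<close>:
  \<open>a\<close> sits on the dependent variable \<open>y\<close> divided by the product of the
  \<open>t j\<close>, and \<open>b j\<close> on the free variable \<open>t j\<close>. Integrating
  out one variable keeps this form and changes only \<open>a\<close>.\<close>

definition germ_integrand :: "'a \<Rightarrow> (nat \<Rightarrow> 'a \<Rightarrow> complex) \<Rightarrow> nat set \<Rightarrow> ('a \<Rightarrow> complex) \<Rightarrow> (nat \<Rightarrow> 'a) \<Rightarrow> complex"
  where "germ_integrand y b J a t = a (y * inverse (\<Prod>j\<in>J. t j)) * (\<Prod>j\<in>J. b j (t j))"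

lemma germ_integrand_integrable:
  assumes J: "finite J" and a: "a \<in> loc_const" and b: "\<And>j. j \<in> J \<Longrightarrow> b j \<in> loc_const"
  shows "integrable (Pi\<^sub>M J (\<lambda>_. dx)) (germ_integrand y b J a)"
proof -
  obtain A where A: "A \<ge> 0" "\<And>u. cmod (a u) \<le> A" using loc_const_bounded[OF a] by blast
  have sets: "sets (Pi\<^sub>M J (\<lambda>_. dx)) = sets (Pi\<^sub>M J (\<lambda>_. borel))" by (rule sets_PiM_cong) simp_all
  note [measurable] = loc_const_measurable[OF a] borel_measurable_prod_component[OF J order_refl]
  have m1: "(\<lambda>t. a (y * inverse (\<Prod>j\<in>J. t j))) \<in> borel_measurable (Pi\<^sub>M J (\<lambda>_. borel))" by measurable
  have m2: "(\<lambda>t. \<Prod>j\<in>J. b j (t j)) \<in> borel_measurable (Pi\<^sub>M J (\<lambda>_. borel))"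
  proof (rule borel_measurable_prod)
    fix j assume j: "j \<in> J"
    note [measurable] = loc_const_measurable[OF b[OF j]] measurable_component_singleton[OF j]
    show "(\<lambda>t. b j (t j)) \<in> borel_measurable (Pi\<^sub>M J (\<lambda>_. borel))" by measurable
  qed
  have int: "integrable (Pi\<^sub>M J (\<lambda>_. dx)) (\<lambda>t. A * (\<Prod>j\<in>J. b j (t j)))"
    by (intro integrable_mult_right PF.product_integrable_prod J loc_const_integral_dx b)
  show ?thesis
  proof (rule Bochner_Integration.integrable_bound[OF int])
    show "germ_integrand y b J a \<in> borel_measurable (Pi\<^sub>M J (\<lambda>_. dx))"
      unfolding germ_integrand_def measurable_cong_sets[OF sets refl] using m1 m2 by (rule borel_measurable_times)
    show "AE t in Pi\<^sub>M J (\<lambda>_. dx). norm (germ_integrand y b J a t) \<le> norm (A * (\<Prod>j\<in>J. b j (t j)))"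
      using A by (auto simp: germ_integrand_def norm_mult intro!: AE_I2 mult_right_mono)
  qed
qed

text \<open>With \<open>z\<close> equal to \<open>y\<close> divided by the product of the remaining
  variables, the inner integral is \<open>uconv a (b i) z\<close>. This needs \<open>z\<close> to be
  a unit; when some remaining variable is not one, both sides vanish through its factor
  \<open>b j\<close>.\<close>

lemma germ_integrand_step:
  assumes J: "finite J" "i \<notin> J" and a: "a \<in> loc_const" and b: "\<And>j. j \<in> insert i J \<Longrightarrow> b j \<in> loc_const" and y: "y \<in> int_units"
  shows "(LINT t|Pi\<^sub>M (insert i J) (\<lambda>_. dx). germ_integrand y b (insert i J) a t)
    = (LINT t|Pi\<^sub>M J (\<lambda>_. dx). germ_integrand y b J (uconv a (b i)) t)"
proof -
  have "finite (insert i J)" using J by simp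
  from PF.product_integral_insert[OF J germ_integrand_integrable[OF this a b]]
  have "(LINT t|Pi\<^sub>M (insert i J) (\<lambda>_. dx). germ_integrand y b (insert i J) a t)
    = (LINT x|Pi\<^sub>M J (\<lambda>_. dx). LINT s|dx. germ_integrand y b (insert i J) a (x(i := s)))" by simp
  also have "\<dots> = (LINT t|Pi\<^sub>M J (\<lambda>_. dx). germ_integrand y b J (uconv a (b i)) t)"
  proof (rule Bochner_Integration.integral_cong)
    fix x :: "nat \<Rightarrow> 'a"
    define z where "z = y * inverse (\<Prod>j\<in>J. x j)"
    define P where "P = (\<Prod>j\<in>J. b j (x j))"
    have upd: "germ_integrand y b (insert i J) a (x(i := s)) = P * (a (z * inverse s) * b i s)" for s
    proof -
      have "(\<Prod>j\<in>J. (x(i := s)) j) = (\<Prod>j\<in>J. x j)" "(\<Prod>j\<in>J. b j ((x(i := s)) j)) = P"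
        unfolding P_def using J by (auto intro!: prod.cong)
      then show ?thesis using J unfolding germ_integrand_def z_def by (simp add: ac_simps)
    qed
    show "(LINT s|dx. germ_integrand y b (insert i J) a (x(i := s))) = germ_integrand y b J (uconv a (b i)) x"
    proof (cases "\<forall>j\<in>J. x j \<in> int_units")
      case True
      then have z: "z \<in> int_units" unfolding z_def using y prod_units[of J x] by (simp add: int_units_mult)
      have loc_const: "(\<lambda>s. a (z * inverse s) * b i s) \<in> loc_const"
      proof -
        obtain M where M: "a \<in> level M" "b i \<in> level M" using loc_const_common[OF a b[of i]] by blast
        have "(\<lambda>s. a (z * inverse s) * b i s) \<in> level M"
        proof (rule levI)
          fix u w :: 'a assume u: "u \<in> int_units" and w: "w \<in> one_units M"
          have zu: "z * inverse u \<in> int_units" using z u by (simp add: int_units_mult)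
          have "z * inverse (u * w) = z * inverse u * inverse w" by simp
          then have "a (z * inverse (u * w)) = a (z * inverse u)"
            using levD[OF M(1) zu one_units_inverse[OF w]] by (simp only:)
          then show "a (z * inverse (u * w)) * b i (u * w) = a (z * inverse u) * b i u"
            using levD[OF M(2) u w] by (simp only:)
        qed (simp add: level_off[OF M(2)])
        then show ?thesis by (rule level_loc_const)
      qed
      have "(LINT s|dx. germ_integrand y b (insert i J) a (x(i := s))) = P * (LINT s|dx. a (z * inverse s) * b i s)"
        unfolding upd by simp
      also have "\<dots> = P * uconv a (b i) z" using z by (simp add: loc_const_integral_dx(2)[OF loc_const] uconv_def)
      finally show ?thesis by (simp add: germ_integrand_def z_def P_def)
    next
      case False
      then have "P = 0" using J b loc_const_off unfolding P_def by (auto intro!: prod_zero)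
      then show ?thesis unfolding upd by (simp add: germ_integrand_def P_def)
    qed
  qed simp
  finally show ?thesis .
qed

lemma germ_integrand_power:
  assumes J: "finite J" and g: "g \<in> loc_const" and y: "y \<in> int_units" and b: "\<And>j. j \<in> J \<Longrightarrow> b j = g" and a: "a \<in> loc_const"
  shows "(LINT t|Pi\<^sub>M J (\<lambda>_. dx). germ_integrand y b J a t) = ((uconv g) ^^ card J) a y"
  using J b a
proof (induction J arbitrary: a rule: finite_induct)
  case empty
  interpret E: finite_measure "Pi\<^sub>M ({}::nat set) (\<lambda>_. dx)"
    by standard (simp add: space_PiM)
  show ?case by (simp add: germ_integrand_def space_PiM measure_def)
next
  case (insert i J)
  have loc_const: "b j \<in> loc_const" if "j \<in> insert i J" for j using insert.prems(1)[OF that] g by simp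
  have "(LINT t|Pi\<^sub>M (insert i J) (\<lambda>_. dx). germ_integrand y b (insert i J) a t) = ((uconv g) ^^ card J) (uconv a g) y"
    using germ_integrand_step[OF insert.hyps(1,2) insert.prems(2) loc_const y] insert.IH[of "uconv a g"] insert.prems
      uconv_loc_const[OF insert.prems(2) g] by simp
  also have "uconv a g = uconv g a" by (rule uconv_commute[OF insert.prems(2) g])
  also have "((uconv g) ^^ card J) (uconv g a) = ((uconv g) ^^ card (insert i J)) a"
    using insert.hyps by (simp add: funpow_swap1)
  finally show ?case .
qed

lemma funpow_uconv_loc_const: "g \<in> loc_const \<Longrightarrow> a \<in> loc_const \<Longrightarrow> (uconv g ^^ n) a \<in> loc_const"
  by (induction n) (auto intro: uconv_loc_const)

lemma funpow_uconv_level: "g \<in> loc_const \<Longrightarrow> a \<in> level M \<Longrightarrow> (uconv g ^^ n) a \<in> level M"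
  by (induction n) (auto intro: uconv_level_right)

lemma funpow_uconv_assoc:
  assumes "g \<in> loc_const" "a \<in> loc_const" "b \<in> loc_const" shows "uconv ((uconv g ^^ n) a) b = (uconv g ^^ n) (uconv a b)"
  by (induction n) (simp_all add: uconv_assoc assms funpow_uconv_loc_const)

lemma funpow_uconv_right:
  assumes "g \<in> loc_const" "a \<in> loc_const" "b \<in> loc_const" shows "uconv a ((uconv g ^^ n) b) = (uconv g ^^ n) (uconv a b)"
  using funpow_uconv_assoc[OF assms(1,3,2), of n] uconv_commute[OF assms(2) funpow_uconv_loc_const[OF assms(1,3)], of n]
    uconv_commute[OF assms(2,3)] by simp

end

context additive_char_field
begin

text \<open>The component on shell \<open>- l d\<close> of the germ of degree \<open>d\<close>, as
  \<open>germ_shell\<close> shows.\<close>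

definition germ_units :: "nat \<Rightarrow> ('a \<Rightarrow> complex) \<Rightarrow> nat \<Rightarrow> 'a \<Rightarrow> complex"
  where "germ_units l \<omega> d = (uconv (psi_twist l triv_char) ^^ (d - 1)) (psi_twist l \<omega>)"

lemma psi_twist_triv_level: "psi_twist l triv_char \<in> level l"
  by (rule psi_twist_level[OF triv_char_qc]) (simp add: conductor_triv)

lemma germ_units_level:
  assumes "\<omega> \<in> quasi_characters" "conductor_exp \<omega> \<le> l" shows "germ_units l \<omega> d \<in> level l"
  unfolding germ_units_def by (intro funpow_uconv_level psi_twist_level assms level_loc_const[OF psi_twist_triv_level])

text \<open>The average can be moved past the copies of \<open>\<psi>\<close> onto the twisted
  factor, where \<open>proj_psi_twist\<close> kills it.\<close>

lemma proj_germ_units: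
  assumes "\<omega> \<in> quasi_characters" "max (conductor_exp \<omega>) 1 < l" "M < l"
  shows "uconv (proj M) (germ_units l \<omega> d) = 0"
proof -
  have loc_const: "psi_twist l \<omega> \<in> loc_const" "psi_twist l triv_char \<in> loc_const"
    using psi_twist_level[OF assms(1), of l] assms(2) psi_twist_triv_level[of l] by (auto intro: level_loc_const)
  have "uconv (proj M) (germ_units l \<omega> d) = (uconv (psi_twist l triv_char) ^^ (d - 1)) (uconv (proj M) (psi_twist l \<omega>))"
    unfolding germ_units_def by (rule funpow_uconv_right[OF loc_const(2) proj_loc_const loc_const(1)])
  also have "uconv (proj M) (psi_twist l \<omega>) = 0" using assms by (intro proj_psi_twist) auto
  also have "(uconv (psi_twist l triv_char) ^^ n) 0 = 0" for n
    by (induction n) (simp_all only: funpow.simps id_apply o_apply uconv_zero_right)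
  finally show ?thesis .
qed

lemma psi_sum: "finite J \<Longrightarrow> \<psi> (sum f J) = (\<Prod>j\<in>J. \<psi> (f j))"
  by (induction J rule: finite_induct) (simp_all add: psi_add psi_O)

text \<open>By additivity of \<open>\<psi>\<close> the exponential of the sum splits into one factor
  per variable and one for the dependent variable. The variable \<open>t d\<close>, the only one
  that carries \<open>\<omega>\<close>, is integrated out first; all others contribute the same
  factor.\<close>

lemma germ_shell:
  assumes \<omega>: "\<omega> \<in> quasi_characters" "conductor_exp \<omega> \<le> l" and d: "d \<ge> 1" and u: "u \<in> int_units"
  shows "germ p \<psi> dx l \<omega> d (p powi (- int (l * d)) * u) = germ_units l \<omega> d u"
proof -
  have sh: "p powi (- int (l * d)) * u \<in> shell (- int (l * d))"
    using shell_mult[OF p_powi_shell u, of "- int (l * d)"] by simp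
  show ?thesis
  proof (cases "d = 1")
    case True
    have "p powi (- int l) * u = u / p ^ l" by (simp add: power_int_minus field_simps)
    moreover have "p powi (- int l) * u \<in> shell (- int l)" using sh True by simp
    ultimately show ?thesis using True u by (simp add: germ_def germ_units_def psi_twist_def)
  next
    case False
    then have d2: "d \<ge> 2" using d by simp
    have "p powi (- int n) * u * p ^ n = u" for n by (simp add: power_int_minus field_simps)
    then have y: "p powi (- int (l * d)) * u * p ^ (l * d) = u" .
    define g where "g = psi_twist l triv_char"
    define b where "b j = (if j = d then psi_twist l \<omega> else g)" for j
    have loc_const: "g \<in> loc_const" "psi_twist l \<omega> \<in> loc_const" "\<And>j. b j \<in> loc_const"
      using psi_twist_level[OF \<omega>] psi_twist_triv_level[of l] by (auto intro: level_loc_const simp: b_def g_def)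
    \<comment> \<open>Points of the product space are extensional, which makes membership in the
      domain of integration a condition on the coordinates alone; off that domain some factor
      \<open>b j\<close> vanishes.\<close>
    have pt: "indicator (\<Pi>\<^sub>E i\<in>{2..d}. int_units) t *\<^sub>R
         (\<psi> ((u * inverse (\<Prod>i\<in>{2..d}. t i) + (\<Sum>i\<in>{2..d}. t i)) / p ^ l) * \<omega> (t d / p ^ l)) = germ_integrand u b {2..d} g t"
      if t: "t \<in> extensional {2..d}" for t
    proof (cases "\<forall>j\<in>{2..d}. t j \<in> int_units")
      case True
      then have tin: "t \<in> (\<Pi>\<^sub>E i\<in>{2..d}. int_units)" using t by (auto simp: PiE_iff)
      have z: "u * inverse (\<Prod>i\<in>{2..d}. t i) \<in> int_units"
        using prod_units[of "{2..d}" t] True u by (simp add: int_units_mult)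
      have "(\<Prod>j\<in>{2..d}. b j (t j)) = (\<Prod>j\<in>{2..d}. \<psi> (t j / p ^ l) * (if j = d then \<omega> (t d / p ^ l) else 1))"
      proof (rule prod.cong)
        fix j assume "j \<in> {2..d}"
        then have "t j \<in> int_units" using True by blast
        then show "b j (t j) = \<psi> (t j / p ^ l) * (if j = d then \<omega> (t d / p ^ l) else 1)"
          by (auto simp: b_def g_def psi_twist_def triv_char_def shell_iff)
      qed simp
      also have "\<dots> = \<psi> (\<Sum>j\<in>{2..d}. t j / p ^ l) * \<omega> (t d / p ^ l)"
        using d2 by (simp add: prod.distrib psi_sum)
      finally have P: "(\<Prod>j\<in>{2..d}. b j (t j)) = \<psi> ((\<Sum>j\<in>{2..d}. t j) / p ^ l) * \<omega> (t d / p ^ l)"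
        by (simp add: sum_divide_distrib)
      have "g (u * inverse (\<Prod>i\<in>{2..d}. t i)) = \<psi> (u * inverse (\<Prod>i\<in>{2..d}. t i) / p ^ l)"
        using z by (simp add: g_def psi_twist_def triv_char_def shell_iff)
      then show ?thesis unfolding germ_integrand_def P using tin by (simp add: psi_add add_divide_distrib)
    next
      case False
      then have "t \<notin> (\<Pi>\<^sub>E i\<in>{2..d}. int_units)" by (auto simp: PiE_iff)
      moreover have "(\<Prod>j\<in>{2..d}. b j (t j)) = 0"
        using False loc_const_off[OF loc_const(3)] by (auto intro!: prod_zero)
      ultimately show ?thesis by (simp add: germ_integrand_def)
    qed
    have "germ p \<psi> dx l \<omega> d (p powi (- int (l * d)) * u)
        = (LINT t|Pi\<^sub>M {2..d} (\<lambda>_. dx). indicator (\<Pi>\<^sub>E i\<in>{2..d}. int_units) t *\<^sub>R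
         (\<psi> ((u * inverse (\<Prod>i\<in>{2..d}. t i) + (\<Sum>i\<in>{2..d}. t i)) / p ^ l) * \<omega> (t d / p ^ l)))"
      unfolding germ_def Let_def y set_lebesgue_integral_def
      by (simp only: sh False if_False not_True_eq_False)
    also have "\<dots> = (LINT t|Pi\<^sub>M {2..d} (\<lambda>_. dx). germ_integrand u b {2..d} g t)"
      by (rule Bochner_Integration.integral_cong[OF refl pt]) (simp add: space_PiM PiE_def)
    also have "{2..d} = insert d {2..<d}" using d2 by auto
    also have "(LINT t|Pi\<^sub>M (insert d {2..<d}) (\<lambda>_. dx). germ_integrand u b (insert d {2..<d}) g t)
        = (LINT t|Pi\<^sub>M {2..<d} (\<lambda>_. dx). germ_integrand u b {2..<d} (uconv g (b d)) t)"
      by (rule germ_integrand_step) (use loc_const u in auto)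
    also have "\<dots> = ((uconv g) ^^ card {2..<d}) (uconv g (b d)) u"
      by (rule germ_integrand_power) (use loc_const u uconv_loc_const in \<open>auto simp: b_def\<close>)
    also have "\<dots> = ((uconv g) ^^ Suc (d - 2)) (psi_twist l \<omega>) u"
      by (simp add: b_def funpow_swap1)
    also have "Suc (d - 2) = d - 1" using d2 by simp
    finally show ?thesis by (simp add: germ_units_def g_def)
  qed
qed

section \<open>Sums of germs and the spaces \<open>S_sis_deg\<close>\<close>

lemma germ_ge_eq:
  assumes "d \<ge> 1" "x \<in> shell (- int (l * d))"
  shows "germ_ge p \<psi> dx N \<omega> d x = (if N \<le> l then germ p \<psi> dx l \<omega> d x else 0)"
proof -
  have z: "germ p \<psi> dx k \<omega> d x = 0" if "k \<noteq> l" for k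
    using assms that by (auto simp: germ_def shell_iff)
  have "germ_ge p \<psi> dx N \<omega> d x = (\<Sum>\<^sub>\<infinity>k\<in>(if N \<le> l then {l} else {}). germ p \<psi> dx k \<omega> d x)"
    unfolding germ_ge_def by (rule infsum_cong_neutral) (use z in \<open>auto split: if_splits\<close>)
  then show ?thesis by simp
qed

lemma germ_ge_zero:
  assumes "\<And>l. l \<ge> N \<Longrightarrow> x \<notin> shell (- int (l * d))" shows "germ_ge p \<psi> dx N \<omega> d x = 0"
  unfolding germ_ge_def by (rule infsum_0) (use assms in \<open>simp add: germ_def\<close>)

lemma shell_comp_germ_ge:
  assumes \<omega>: "\<omega> \<in> quasi_characters" and d: "d \<ge> 1" and N: "max (conductor_exp \<omega>) 1 < N" and l: "l \<ge> N"
  shows "shell_comp (germ_ge p \<psi> dx N \<omega> d) (- int (l * d)) = germ_units l \<omega> d"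
proof
  fix u show "shell_comp (germ_ge p \<psi> dx N \<omega> d) (- int (l * d)) u = germ_units l \<omega> d u"
  proof (cases "u \<in> int_units")
    case True
    have "p powi (- int (l * d)) * u \<in> shell (- int (l * d))"
      using shell_mult[OF p_powi_shell True, of "- int (l * d)"] by simp
    from germ_ge_eq[OF d this, of N \<omega>] show ?thesis
      using germ_shell[OF \<omega> _ d True, of l] N l True by (simp add: shell_comp_def)
  next
    case False
    then show ?thesis using level_off[OF germ_units_level[OF \<omega>, of l d]] N l by (simp add: shell_comp_off)
  qed
qed

lemma shell_comp_germ_ge_zero:
  assumes "\<And>l. l \<ge> N \<Longrightarrow> n \<noteq> - int (l * d)"
  shows "shell_comp (germ_ge p \<psi> dx N \<omega> d) n = 0"
proof
  fix u show "shell_comp (germ_ge p \<psi> dx N \<omega> d) n u = 0 u"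
  proof (cases "u \<in> int_units")
    case True
    have "p powi n * u \<in> shell n" using shell_mult[OF p_powi_shell True] by simp
    then have "germ_ge p \<psi> dx N \<omega> d (p powi n * u) = 0"
      by (intro germ_ge_zero) (use assms in \<open>auto simp: shell_iff\<close>)
    then show ?thesis using True by (simp add: shell_comp_def)
  qed (simp add: shell_comp_off)
qed

lemma germ_ge_at_0: "germ_ge p \<psi> dx N \<omega> d 0 = 0"
  by (rule germ_ge_zero) (simp add: shell_iff)

lemma germ_ge_conv_space:
  assumes \<omega>: "\<omega> \<in> quasi_characters" and d: "d \<ge> 1" and N: "max (conductor_exp \<omega>) 1 < N"
  shows "germ_ge p \<psi> dx N \<omega> d \<in> conv_space"
proof -
  let ?G = "germ_ge p \<psi> dx N \<omega> d"
  have dich: "shell_comp ?G n = 0 \<or> (\<exists>l\<ge>N. n = - int (l * d) \<and> shell_comp ?G n = germ_units l \<omega> d)" for n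
  proof (cases "\<exists>l\<ge>N. n = - int (l * d)")
    case True
    then show ?thesis using shell_comp_germ_ge[OF \<omega> d N] by blast
  next
    case False
    then show ?thesis using shell_comp_germ_ge_zero[of N n d \<omega>] by blast
  qed
  have zero: "shell_comp ?G n = 0" if "n \<ge> 1" for n
    using dich[of n]
  proof (elim disjE exE conjE)
    fix l assume "n = - int (l * d)"
    then have "n \<le> 0" by (simp only: neg_le_0_iff_le of_nat_0_le_iff)
    with that show ?thesis by simp
  qed
  have "shell_comp ?G n \<in> loc_const" for n
  proof -
    have "germ_units l \<omega> d \<in> loc_const" if "l \<ge> N" for l using germ_units_level[OF \<omega>, of l d] N that by (intro level_loc_const[of _ l]) simp
    then show ?thesis using dich[of n] by (metis loc_const_zero)
  qed
  moreover have "\<exists>K. \<forall>n<K. uconv (proj M) (shell_comp ?G n) = 0" for M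
  \<comment> \<open>For \<open>n = - l d\<close> the condition \<open>n < - M d\<close> says
    \<open>M < l\<close>, which is when averaging over \<open>1 + P^M\<close> kills the
    component.\<close>
  proof (intro exI[of _ "- int (M * d)"] allI impI)
    fix n assume n: "n < - int (M * d)"
    have "uconv (proj M) (germ_units l \<omega> d) = 0" if "l \<ge> N" "n = - int (l * d)" for l
    proof (rule proj_germ_units[OF \<omega>])
      show "max (conductor_exp \<omega>) 1 < l" using N that by simp
      have "M * d < l * d" using n that by linarith
      then show "M < l" by simp
    qed
    then show "uconv (proj M) (shell_comp ?G n) = 0" using dich[of n] by (metis uconv_zero_right)
  qed
  moreover have "\<exists>M n0. \<forall>n\<ge>n0. shell_comp ?G n \<in> level M"
    using zero by (intro exI[of _ 0] exI[of _ 1]) simp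
  moreover have "rec_zero (shell_comp ?G)" using zero by (rule rec_zero_vanish)
  ultimately show ?thesis by (simp add: conv_space_def arrays_def germ_ge_at_0)
qed

lemma S_sis_I:
  assumes "f \<in> smooth_functions" "rec_zero (shell_comp f)" "\<And>n. n < K \<Longrightarrow> shell_comp f n = 0" shows "f \<in> S_sis"
  unfolding S_sis_def vanish_far_iff using assms rec_imp_finite_near_zero by blast

text \<open>Raising \<open>N\<close> to \<open>N'\<close> removes only the shells
  \<open>- l d\<close> with \<open>N \<le> l < N'\<close>, and these lie to the right of
  \<open>- N' d\<close>.\<close>

lemma germ_ge_change:
  assumes \<omega>: "\<omega> \<in> quasi_characters" and d: "d \<ge> 1" and N: "max (conductor_exp \<omega>) 1 < N" "N \<le> N'"
    and n: "n \<le> - int (N' * d)"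
  shows "shell_comp (germ_ge p \<psi> dx N \<omega> d) n = shell_comp (germ_ge p \<psi> dx N' \<omega> d) n"
proof (cases "\<exists>l\<ge>N'. n = - int (l * d)")
  case True
  then obtain l where l: "l \<ge> N'" "n = - int (l * d)" by blast
  then show ?thesis using shell_comp_germ_ge[OF \<omega> d N(1), of l] shell_comp_germ_ge[OF \<omega> d _ l(1)] N by simp
next
  case False
  have "n \<noteq> - int (l * d)" if "l \<ge> N" for l
  proof
    assume "n = - int (l * d)"
    then have "N' * d \<le> l * d" using n by linarith
    then have "N' \<le> l" using d by simp
    with False \<open>n = - int (l * d)\<close> show False by blast
  qed
  then show ?thesis using shell_comp_germ_ge_zero[of N n d \<omega>] shell_comp_germ_ge_zero[of N' n d \<omega>] False by auto
qed

lemma far_germ_iff: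
  assumes "\<omega> \<in> quasi_characters" "d \<ge> 1" "max (conductor_exp \<omega>) 1 < N"
  shows "(\<forall>y. y \<noteq> 0 \<longrightarrow> fval y \<le> - int (N * d) \<longrightarrow> f y = C * germ_ge p \<psi> dx N \<omega> d y) \<longleftrightarrow>
    (\<forall>n\<le>- int (N * d). \<forall>u. shell_comp f n u = C * shell_comp (germ_ge p \<psi> dx N \<omega> d) n u)"
proof
  assume *: "\<forall>y. y \<noteq> 0 \<longrightarrow> fval y \<le> - int (N * d) \<longrightarrow> f y = C * germ_ge p \<psi> dx N \<omega> d y"
  show "\<forall>n\<le>- int (N * d). \<forall>u. shell_comp f n u = C * shell_comp (germ_ge p \<psi> dx N \<omega> d) n u"
  proof (intro allI impI)
    fix n u assume n: "n \<le> - int (N * d)"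
    show "shell_comp f n u = C * shell_comp (germ_ge p \<psi> dx N \<omega> d) n u"
    proof (cases "u \<in> int_units")
      case True
      then have "p powi n * u \<noteq> 0" "fval (p powi n * u) = n" by (auto simp: shell_iff fval_mult fval_power_int)
      then show ?thesis using * n True by (simp add: shell_comp_def)
    qed (simp add: shell_comp_off)
  qed
next
  assume "\<forall>n\<le>- int (N * d). \<forall>u. shell_comp f n u = C * shell_comp (germ_ge p \<psi> dx N \<omega> d) n u"
  then show "\<forall>y. y \<noteq> 0 \<longrightarrow> fval y \<le> - int (N * d) \<longrightarrow> f y = C * germ_ge p \<psi> dx N \<omega> d y"
    using eq_shell_comp[of _ f] eq_shell_comp[of _ "germ_ge p \<psi> dx N \<omega> d"] by simp
qed

text \<open>In the definition of the space \<open>N\<close> may depend on the function. Since a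
  change of \<open>N\<close> alters the sum of germs on finitely many shells only, the difference is
  absorbed by an element of \<open>S_sis\<close>, and a single \<open>N\<close> chosen in advance
  serves the whole space.\<close>

lemma S_sis_deg_iff:
  assumes \<omega>: "\<omega> \<in> quasi_characters" and d: "d \<ge> 1" and N: "max (conductor_exp \<omega>) 1 < N"
  shows "f \<in> S_sis_deg p \<psi> dx d \<omega> \<longleftrightarrow> (\<exists>C. \<exists>s\<in>S_sis. f = s + (\<lambda>x. C * germ_ge p \<psi> dx N \<omega> d x))"
proof
  let ?G = "germ_ge p \<psi> dx N \<omega> d"
  assume "f \<in> S_sis_deg p \<psi> dx d \<omega>"
  then obtain N1 C where f: "f \<in> smooth_functions" "finite_near_zero f" and N1: "max (conductor_exp \<omega>) 1 < N1"
      "\<forall>y. y \<noteq> 0 \<longrightarrow> fval y \<le> - int (N1 * d) \<longrightarrow> f y = C * germ_ge p \<psi> dx N1 \<omega> d y"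
    using d by (auto simp: S_sis_deg_def)
  define N2 where "N2 = max N N1"
  define s where "s = f + (\<lambda>x. (- C) * ?G x)"
  have G: "?G \<in> conv_space" by (rule germ_ge_conv_space[OF \<omega> d N])
  have comps: "shell_comp s n u = shell_comp f n u - C * shell_comp ?G n u" for n u
    unfolding s_def shell_comp_add shell_comp_scale by simp
  have "s \<in> S_sis"
  proof (rule S_sis_I)
    show "s \<in> smooth_functions" unfolding smooth_iff_shell_comp
    proof
      show "s 0 = 0" using f(1) by (simp add: s_def germ_ge_at_0 smooth_functions_def)
      show "\<forall>n. shell_comp s n \<in> loc_const"
      proof
        fix n
        have "shell_comp s n = shell_comp f n + (\<lambda>u. (- C) * shell_comp ?G n u)" by (intro ext) (simp add: comps)
        then show "shell_comp s n \<in> loc_const" by (simp only: loc_const_add loc_const_scale smooth_shell_comp_loc_const f conv_space_smooth G)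
      qed
    qed
    show "rec_zero (shell_comp s)" unfolding s_def shell_comp_add shell_comp_scale
      using G by (intro rec_zero_add rec_zero_scale finite_near_zero_imp_rec[OF f(2)]) (simp add: conv_space_def)
    fix n assume n: "n < - int (N2 * d)"
    have "N * d \<le> N2 * d" "N1 * d \<le> N2 * d" by (simp_all add: N2_def)
    then have le: "int (N * d) \<le> int (N2 * d)" "int (N1 * d) \<le> int (N2 * d)" by (simp_all only: of_nat_le_iff)
    then have nN: "n \<le> - int (N2 * d)" "n \<le> - int (N1 * d)" using n by linarith+
    then have "shell_comp ?G n = shell_comp (germ_ge p \<psi> dx N2 \<omega> d) n" "shell_comp (germ_ge p \<psi> dx N1 \<omega> d) n = shell_comp (germ_ge p \<psi> dx N2 \<omega> d) n"
      using germ_ge_change[OF \<omega> d N _ nN(1)] germ_ge_change[OF \<omega> d N1(1) _ nN(1)] by (simp_all add: N2_def)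
    then show "shell_comp s n = 0" using N1(2)[unfolded far_germ_iff[OF \<omega> d N1(1)]] nN(2) by (intro ext) (simp add: comps)
  qed
  moreover have "f = s + (\<lambda>x. C * ?G x)" by (intro ext) (simp add: s_def)
  ultimately show "\<exists>C. \<exists>s\<in>S_sis. f = s + (\<lambda>x. C * ?G x)" by blast
next
  let ?G = "germ_ge p \<psi> dx N \<omega> d"
  assume "\<exists>C. \<exists>s\<in>S_sis. f = s + (\<lambda>x. C * ?G x)"
  then obtain C s where s: "s \<in> S_sis" and f: "f = s + (\<lambda>x. C * ?G x)" by blast
  have sA: "s \<in> conv_space" using s S_sis_conv_space by blast
  obtain K where K: "\<And>n. n < K \<Longrightarrow> shell_comp s n = 0" using s unfolding S_sis_iff by blast
  have fA: "f \<in> conv_space" unfolding f by (intro conv_space_add conv_space_scale sA germ_ge_conv_space[OF \<omega> d N])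
  \<comment> \<open>Large enough that \<open>- N' d < K\<close>, so that \<open>s\<close> vanishes
    on all the shells to be compared.\<close>
  define N' where "N' = max N (nat (- K) + 1)"
  have N': "max (conductor_exp \<omega>) 1 < N'" "N \<le> N'" using N by (auto simp: N'_def)
  have NK: "- int (N' * d) < K"
  proof -
    have "int N' * 1 \<le> int N' * int d" using d by (intro mult_left_mono) auto
    then show ?thesis by (simp add: N'_def)
  qed
  have "\<forall>n\<le>- int (N' * d). \<forall>u. shell_comp f n u = C * shell_comp (germ_ge p \<psi> dx N' \<omega> d) n u"
  proof (intro allI impI)
    fix n u assume n: "n \<le> - int (N' * d)"
    then have "shell_comp s n = 0" using K NK by simp
    then show "shell_comp f n u = C * shell_comp (germ_ge p \<psi> dx N' \<omega> d) n u"
      unfolding f shell_comp_add shell_comp_scale using germ_ge_change[OF \<omega> d N N'(2) n] by simp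
  qed
  then have "\<forall>y. y \<noteq> 0 \<longrightarrow> fval y \<le> - int (N' * d) \<longrightarrow> f y = C * germ_ge p \<psi> dx N' \<omega> d y"
    unfolding far_germ_iff[OF \<omega> d N'(1)] .
  moreover have "f \<in> smooth_functions" "finite_near_zero f"
    using conv_space_smooth[OF fA] rec_imp_finite_near_zero[OF conv_space_smooth[OF fA]] fA by (simp_all add: conv_space_def)
  ultimately show "f \<in> S_sis_deg p \<psi> dx d \<omega>" using d N'(1) unfolding S_sis_deg_def by auto
qed

lemma ex_large: "\<exists>N. max (conductor_exp \<omega>) 1 < N"
  by (rule exI[of _ "Suc (max (conductor_exp \<omega>) 1)"]) simp

lemma S_sis_deg_conv_space: assumes "\<omega> \<in> quasi_characters" shows "S_sis_deg p \<psi> dx d \<omega> \<subseteq> conv_space"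
proof (cases "d = 0")
  case True
  then show ?thesis using S_sis_conv_space by (simp add: S_sis_deg_def)
next
  case False
  then have d: "d \<ge> 1" by simp
  obtain N where N: "max (conductor_exp \<omega>) 1 < N" using ex_large by blast
  show ?thesis
  proof
    fix f assume "f \<in> S_sis_deg p \<psi> dx d \<omega>"
    then obtain C s where s: "s \<in> S_sis" "f = s + (\<lambda>x. C * germ_ge p \<psi> dx N \<omega> d x)"
      unfolding S_sis_deg_iff[OF assms d N] by blast
    moreover have "s \<in> conv_space" using s S_sis_conv_space by blast
    ultimately show "f \<in> conv_space" using conv_space_add[OF _ conv_space_scale[OF germ_ge_conv_space[OF assms d N]]] by blast
  qed
qed

lemma S_sis_deg_subspace:
  assumes "\<omega> \<in> quasi_characters" shows "fun_space.subspace (S_sis_deg p \<psi> dx d \<omega>)"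
proof (cases "d = 0")
  case True
  then show ?thesis using S_sis_subspace by (simp add: S_sis_deg_def)
next
  case False
  then have d: "d \<ge> 1" by simp
  obtain N where N: "max (conductor_exp \<omega>) 1 < N" using ex_large by blast
  note iff = S_sis_deg_iff[OF assms d N]
  note sub = S_sis_subspace[THEN fun_space.subspace_0] S_sis_subspace[THEN fun_space.subspace_add] S_sis_subspace[THEN fun_space.subspace_scale]
  let ?G = "germ_ge p \<psi> dx N \<omega> d"
  show ?thesis
  proof (rule fun_space.subspaceI)
    have "0 = 0 + (\<lambda>x. 0 * ?G x)" by (intro ext) simp
    then show "0 \<in> S_sis_deg p \<psi> dx d \<omega>" unfolding iff using sub(1) by blast
  next
    fix f g assume "f \<in> S_sis_deg p \<psi> dx d \<omega>" "g \<in> S_sis_deg p \<psi> dx d \<omega>"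
    then obtain C s C' s' where s: "s \<in> S_sis" "s' \<in> S_sis" and fg: "f = s + (\<lambda>x. C * ?G x)" "g = s' + (\<lambda>x. C' * ?G x)"
      unfolding iff by blast
    have "f + g = (s + s') + (\<lambda>x. (C + C') * ?G x)" unfolding fg by (intro ext) (simp add: distrib_right)
    then show "f + g \<in> S_sis_deg p \<psi> dx d \<omega>" unfolding iff using sub(2)[OF s] by blast
  next
    fix c f assume "f \<in> S_sis_deg p \<psi> dx d \<omega>"
    then obtain C s where s: "s \<in> S_sis" and f: "f = s + (\<lambda>x. C * ?G x)"
      unfolding iff by blast
    have "(\<lambda>x. c * f x) = (\<lambda>x. c * s x) + (\<lambda>x. (c * C) * ?G x)" unfolding f by (intro ext) (simp add: distrib_left)
    then show "(\<lambda>x. c * f x) \<in> S_sis_deg p \<psi> dx d \<omega>" unfolding iff using sub(3)[OF s] by blast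
  qed
qed

text \<open>Stationary phase collects both twists in one factor at the price of one more copy of
  \<open>\<psi>\<close>: the copies number \<open>(d1 - 1) + (d2 - 1) + 1\<close>, as in degree
  \<open>d1 + d2\<close>.\<close>

lemma germ_units_uconv_germ_units:
  assumes \<omega>1: "\<omega>1 \<in> quasi_characters" "conductor_exp \<omega>1 \<le> l div 2"
    and \<omega>2: "\<omega>2 \<in> quasi_characters" "conductor_exp \<omega>2 \<le> l div 2" and l: "l \<ge> 2" and d: "d1 \<ge> 1" "d2 \<ge> 1"
  shows "uconv (germ_units l \<omega>1 d1) (germ_units l \<omega>2 d2) = germ_units l (\<lambda>x. \<omega>1 x * \<omega>2 x) (d1 + d2)"
proof -
  define g where "g = psi_twist l triv_char"
  have loc_const: "g \<in> loc_const" "psi_twist l \<omega>1 \<in> loc_const" "psi_twist l \<omega>2 \<in> loc_const"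
    using psi_twist_level[OF \<omega>1(1), of l] psi_twist_level[OF \<omega>2(1), of l] psi_twist_triv_level[of l] \<omega>1 \<omega>2 by (auto simp: g_def intro!: level_loc_const[of _ l])
  have "uconv (germ_units l \<omega>1 d1) (germ_units l \<omega>2 d2) = (uconv g ^^ (d1 - 1)) (uconv (psi_twist l \<omega>1) ((uconv g ^^ (d2 - 1)) (psi_twist l \<omega>2)))"
    unfolding germ_units_def g_def[symmetric] by (intro funpow_uconv_assoc funpow_uconv_loc_const loc_const)
  also have "\<dots> = (uconv g ^^ (d1 - 1)) ((uconv g ^^ (d2 - 1)) (uconv (psi_twist l \<omega>1) (psi_twist l \<omega>2)))"
    by (simp add: funpow_uconv_right loc_const)
  also have "uconv (psi_twist l \<omega>1) (psi_twist l \<omega>2) = uconv g (psi_twist l (\<lambda>x. \<omega>1 x * \<omega>2 x))"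
    unfolding g_def by (rule psi_twist_uconv_psi_twist) (use assms in auto)
  also have "(uconv g ^^ (d1 - 1)) ((uconv g ^^ (d2 - 1)) (uconv g (psi_twist l (\<lambda>x. \<omega>1 x * \<omega>2 x))))
      = (uconv g ^^ ((d1 - 1) + ((d2 - 1) + 1))) (psi_twist l (\<lambda>x. \<omega>1 x * \<omega>2 x))"
    unfolding funpow_add by simp
  also have "(d1 - 1) + ((d2 - 1) + 1) = d1 + d2 - 1" using d by simp
  finally show ?thesis by (simp add: germ_units_def g_def)
qed

text \<open>Components of different depths annihilate each other, since the deeper one has vanishing
  average at the level of the shallower one. So only equal depths \<open>l\<close> contribute, on
  shell \<open>- l (d1 + d2)\<close>. The bound on \<open>N\<close> makes \<open>l div 2\<close> at
  least as large as both conductors, as stationary phase requires.\<close>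

lemma germ_ge_conv:
  assumes \<omega>1: "\<omega>1 \<in> quasi_characters" and \<omega>2: "\<omega>2 \<in> quasi_characters" and d: "d1 \<ge> 1" "d2 \<ge> 1"
    and N: "N \<ge> 2 * max (conductor_exp \<omega>1) (conductor_exp \<omega>2) + 2"
  shows "pv_conv dx (germ_ge p \<psi> dx N \<omega>1 d1) (germ_ge p \<psi> dx N \<omega>2 d2)
      = germ_ge p \<psi> dx N (\<lambda>x. \<omega>1 x * \<omega>2 x) (d1 + d2)"
proof -
  let ?G1 = "germ_ge p \<psi> dx N \<omega>1 d1" and ?G2 = "germ_ge p \<psi> dx N \<omega>2 d2"
  let ?G = "germ_ge p \<psi> dx N (\<lambda>x. \<omega>1 x * \<omega>2 x) (d1 + d2)"
  have N1: "max (conductor_exp \<omega>1) 1 < N" and N2: "max (conductor_exp \<omega>2) 1 < N"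
    and N12: "max (conductor_exp (\<lambda>x. \<omega>1 x * \<omega>2 x)) 1 < N"
    using N conductor_times_le[OF \<omega>1 \<omega>2] by auto
  have A: "?G1 \<in> conv_space" "?G2 \<in> conv_space" using germ_ge_conv_space[OF \<omega>1 d(1) N1] germ_ge_conv_space[OF \<omega>2 d(2) N2] by auto
  have level: "germ_units l \<omega>1 d1 \<in> level l" "germ_units l \<omega>2 d2 \<in> level l" if "l \<ge> N" for l
    using germ_units_level[OF \<omega>1, of l] germ_units_level[OF \<omega>2, of l] N1 N2 that by auto
  have cross: "uconv (germ_units l \<omega>1 d1) (germ_units k \<omega>2 d2) = 0" if l: "l \<ge> N" "k \<ge> N" "l \<noteq> k" for l k
  proof (cases "l < k")
    case True
    have "uconv (germ_units k \<omega>2 d2) (germ_units l \<omega>1 d1) = 0"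
      by (rule uconv_zero_if_proj[OF level_loc_const[OF level(2)[OF l(2)]] proj_germ_units[OF \<omega>2 _ True] level(1)[OF l(1)]]) (use N2 l in auto)
    then show ?thesis using uconv_commute[OF level_loc_const[OF level(1)[OF l(1)]] level_loc_const[OF level(2)[OF l(2)]]] by simp
  next
    case False
    then have kl: "k < l" using l by simp
    show ?thesis
      by (rule uconv_zero_if_proj[OF level_loc_const[OF level(1)[OF l(1)]] proj_germ_units[OF \<omega>1 _ kl] level(2)[OF l(2)]]) (use N1 l in auto)
  qed
  have nz: "\<exists>l\<ge>N. n = - int (l * d2) \<and> m - n = - int (l * d1)" if "uconv (shell_comp ?G1 (m - n)) (shell_comp ?G2 n) \<noteq> 0" for m n
  proof -
    have "shell_comp ?G1 (m - n) \<noteq> 0"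
    proof
      assume "shell_comp ?G1 (m - n) = 0" then show False using that by simp
    qed
    then obtain l where l: "l \<ge> N" "m - n = - int (l * d1)" using shell_comp_germ_ge_zero[of N "m - n" d1 \<omega>1] by blast
    have "shell_comp ?G2 n \<noteq> 0"
    proof
      assume "shell_comp ?G2 n = 0" then show False using that by simp
    qed
    then obtain k where k: "k \<ge> N" "n = - int (k * d2)" using shell_comp_germ_ge_zero[of N n d2 \<omega>2] by blast
    have "l = k"
    proof (rule ccontr)
      assume "l \<noteq> k"
      then have "uconv (shell_comp ?G1 (m - n)) (shell_comp ?G2 n) = 0"
        unfolding l(2) unfolding k(2) shell_comp_germ_ge[OF \<omega>1 d(1) N1 l(1)] shell_comp_germ_ge[OF \<omega>2 d(2) N2 k(1)]
        using cross[OF l(1) k(1)] by simp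
      then show False using that by simp
    qed
    then show ?thesis using l k by blast
  qed
  have d12: "d1 + d2 \<ge> 1" using d by simp
  have "array_conv (shell_comp ?G1) (shell_comp ?G2) m = shell_comp ?G m" for m
  proof (cases "\<exists>l\<ge>N. m = - int (l * (d1 + d2))")
    case True
    then obtain l where l: "l \<ge> N" "m = - int (l * (d1 + d2))" by blast
    have "array_conv (shell_comp ?G1) (shell_comp ?G2) m = (\<Sum>n\<in>{- int (l * d2)}. uconv (shell_comp ?G1 (m - n)) (shell_comp ?G2 n))"
    proof (rule array_conv_eq_sum)
      fix n assume "uconv (shell_comp ?G1 (m - n)) (shell_comp ?G2 n) \<noteq> 0"
      then obtain k where k: "n = - int (k * d2)" "m - n = - int (k * d1)" using nz by blast
      then have "l * (d1 + d2) = k * (d1 + d2)" using l(2) by (simp add: distrib_left flip: of_nat_add of_nat_mult of_nat_eq_iff)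
      then have "l = k" using d12 by auto
      then show "n \<in> {- int (l * d2)}" using k by simp
    qed simp
    also have "\<dots> = uconv (shell_comp ?G1 (- int (l * d1))) (shell_comp ?G2 (- int (l * d2)))"
      using l(2) by (simp add: distrib_left)
    also have "\<dots> = germ_units l (\<lambda>x. \<omega>1 x * \<omega>2 x) (d1 + d2)"
      unfolding shell_comp_germ_ge[OF \<omega>1 d(1) N1 l(1)] shell_comp_germ_ge[OF \<omega>2 d(2) N2 l(1)]
      by (rule germ_units_uconv_germ_units) (use \<omega>1 \<omega>2 d N l in auto)
    also have "\<dots> = shell_comp ?G m"
      unfolding l(2) by (rule shell_comp_germ_ge[OF qc_times[OF \<omega>1 \<omega>2] d12 N12 l(1), symmetric])
    finally show ?thesis .
  next
    case False
    have "array_conv (shell_comp ?G1) (shell_comp ?G2) m = (\<Sum>n\<in>{}. uconv (shell_comp ?G1 (m - n)) (shell_comp ?G2 n))"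
    proof (rule array_conv_eq_sum)
      fix n assume "uconv (shell_comp ?G1 (m - n)) (shell_comp ?G2 n) \<noteq> 0"
      then obtain k where k: "k \<ge> N" "n = - int (k * d2)" "m - n = - int (k * d1)" using nz by blast
      then have "m = - int (k * (d1 + d2))" by (simp add: distrib_left)
      with False k(1) show "n \<in> {}" by blast
    qed simp
    also have "\<dots> = shell_comp ?G m" by (subst shell_comp_germ_ge_zero) (use False in auto)
    finally show ?thesis .
  qed
  then show ?thesis
    by - (rule shell_comp_eqI, simp_all add: shell_comp_pv_conv A germ_ge_at_0)
qed

text \<open>Split each factor as an element of \<open>S_sis\<close> plus a multiple of a sum of
  germs, with the same \<open>N\<close>. Every product with an \<open>S_sis\<close> part lies in the
  ideal, and the product of the germ parts is a germ sum of degree \<open>d1 + d2\<close>.\<close>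

lemma S_sis_deg_conv:
  assumes \<omega>1: "\<omega>1 \<in> quasi_characters" and \<omega>2: "\<omega>2 \<in> quasi_characters" and d: "d1 \<ge> 1" "d2 \<ge> 1"
    and f: "f \<in> S_sis_deg p \<psi> dx d1 \<omega>1" and g: "g \<in> S_sis_deg p \<psi> dx d2 \<omega>2"
  shows "pv_conv dx f g \<in> S_sis_deg p \<psi> dx (d1 + d2) (\<lambda>x. \<omega>1 x * \<omega>2 x)"
proof -
  define N where "N = 2 * max (conductor_exp \<omega>1) (conductor_exp \<omega>2) + 2"
  have N1: "max (conductor_exp \<omega>1) 1 < N" and N2: "max (conductor_exp \<omega>2) 1 < N"
    and N12: "max (conductor_exp (\<lambda>x. \<omega>1 x * \<omega>2 x)) 1 < N"
    using conductor_times_le[OF \<omega>1 \<omega>2] by (auto simp: N_def)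
  have d12: "d1 + d2 \<ge> 1" using d by simp
  let ?G1 = "germ_ge p \<psi> dx N \<omega>1 d1" and ?G2 = "germ_ge p \<psi> dx N \<omega>2 d2"
  have GA: "?G1 \<in> conv_space" "?G2 \<in> conv_space" using germ_ge_conv_space[OF \<omega>1 d(1) N1] germ_ge_conv_space[OF \<omega>2 d(2) N2] by auto
  obtain C1 s1 where s1: "s1 \<in> S_sis" "f = s1 + (\<lambda>x. C1 * ?G1 x)" using f unfolding S_sis_deg_iff[OF \<omega>1 d(1) N1] by blast
  obtain C2 s2 where s2: "s2 \<in> S_sis" "g = s2 + (\<lambda>x. C2 * ?G2 x)" using g unfolding S_sis_deg_iff[OF \<omega>2 d(2) N2] by blast
  have A: "s1 \<in> conv_space" "s2 \<in> conv_space" "g \<in> conv_space" "(\<lambda>x. C2 * ?G2 x) \<in> conv_space"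
    using s1 s2 S_sis_conv_space S_sis_deg_conv_space[OF \<omega>2] g conv_space_scale[OF GA(2)] by auto
  have e1: "pv_conv dx f g = pv_conv dx s1 g + (\<lambda>x. C1 * pv_conv dx ?G1 g x)"
    unfolding s1(2) using A GA by (simp add: pv_conv_add_left conv_space_scale pv_conv_scale_left)
  have e2: "pv_conv dx ?G1 g = pv_conv dx s2 ?G1 + (\<lambda>x. C2 * pv_conv dx ?G1 ?G2 x)"
    unfolding s2(2) using A GA pv_conv_scale_left[OF GA(2,1), of C2] pv_conv_add_left[OF A(2,4) GA(1)]
    by (simp add: pv_conv_commute[of ?G1] conv_space_add)
  have e3: "pv_conv dx ?G1 ?G2 = germ_ge p \<psi> dx N (\<lambda>x. \<omega>1 x * \<omega>2 x) (d1 + d2)"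
    by (rule germ_ge_conv[OF \<omega>1 \<omega>2 d]) (simp add: N_def)
  have eq: "pv_conv dx f g = (pv_conv dx s1 g + (\<lambda>x. C1 * pv_conv dx s2 ?G1 x))
      + (\<lambda>x. (C1 * C2) * germ_ge p \<psi> dx N (\<lambda>x. \<omega>1 x * \<omega>2 x) (d1 + d2) x)"
    unfolding e1 e2 e3 by (intro ext) (simp only: plus_fun_apply distrib_left mult.assoc add.assoc)
  have "pv_conv dx s1 g + (\<lambda>x. C1 * pv_conv dx s2 ?G1 x) \<in> S_sis"
    by (intro fun_space.subspace_add[OF S_sis_subspace] fun_space.subspace_scale[OF S_sis_subspace] S_sis_ideal s1 s2 A GA)
  then show ?thesis unfolding S_sis_deg_iff[OF qc_times[OF \<omega>1 \<omega>2] d12 N12] using eq by blast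
qed

section \<open>The algebra spanned by all the spaces\<close>

lemma S_sis_total_subspace: "fun_space.subspace (S_sis_total p \<psi> dx)"
  unfolding S_sis_total_def by (rule fun_space.subspace_span)

lemma S_sis_deg_total: "\<omega> \<in> quasi_characters \<Longrightarrow> S_sis_deg p \<psi> dx d \<omega> \<subseteq> S_sis_total p \<psi> dx"
  unfolding S_sis_total_def by (rule order_trans[OF _ fun_space.span_superset]) blast

lemma S_sis_total: "S_sis \<subseteq> S_sis_total p \<psi> dx"
  using S_sis_deg_total[OF triv_char_qc, of 0] by (simp add: S_sis_deg_def)

lemma S_sis_total_conv_space: "S_sis_total p \<psi> dx \<subseteq> conv_space"
  unfolding S_sis_total_def
  by (rule fun_space.span_minimal[OF _ conv_space_subspace]) (use S_sis_deg_conv_space in blast)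

text \<open>On generators, degree 0 in either factor is covered by the ideal property and positive
  degrees by \<open>S_sis_deg_conv\<close>. The passage to the span is made in one argument at a
  time, since the elements whose product with a fixed one lies in the span form a subspace.\<close>

lemma S_sis_total_conv:
  assumes f: "f \<in> S_sis_total p \<psi> dx" and g: "g \<in> S_sis_total p \<psi> dx"
  shows "pv_conv dx f g \<in> S_sis_total p \<psi> dx"
proof -
  let ?T = "S_sis_total p \<psi> dx" and ?U = "\<Union>d. \<Union>\<omega>\<in>quasi_characters. S_sis_deg p \<psi> dx d \<omega>"
  note T0 = S_sis_total_subspace[THEN fun_space.subspace_0] and Tadd = S_sis_total_subspace[THEN fun_space.subspace_add]
    and Tscale = S_sis_total_subspace[THEN fun_space.subspace_scale]
  have UA: "h \<in> conv_space" if "h \<in> ?U" for h using S_sis_deg_conv_space that by blast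
  have base: "pv_conv dx a b \<in> ?T" if "a \<in> ?U" "b \<in> ?U" for a b
  proof -
    obtain d1 \<omega>1 where a: "\<omega>1 \<in> quasi_characters" "a \<in> S_sis_deg p \<psi> dx d1 \<omega>1" using \<open>a \<in> ?U\<close> by blast
    obtain d2 \<omega>2 where b: "\<omega>2 \<in> quasi_characters" "b \<in> S_sis_deg p \<psi> dx d2 \<omega>2" using \<open>b \<in> ?U\<close> by blast
    consider "d1 = 0" | "d2 = 0" | "d1 \<ge> 1" "d2 \<ge> 1" by linarith
    then show ?thesis
    proof cases
      case 1
      then have "a \<in> S_sis" using a by (simp add: S_sis_deg_def)
      then show ?thesis using S_sis_ideal[OF _ UA[OF that(2)]] S_sis_total by blast
    next
      case 2
      then have "b \<in> S_sis" using b by (simp add: S_sis_deg_def)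
      then have "pv_conv dx b a \<in> ?T" using S_sis_ideal[OF _ UA[OF that(1)]] S_sis_total by blast
      then show ?thesis using pv_conv_commute[OF UA[OF that(1)] UA[OF that(2)]] by simp
    next
      case 3
      then show ?thesis using S_sis_deg_conv[OF a(1) b(1) 3 a(2) b(2)] S_sis_deg_total[OF qc_times[OF a(1) b(1)]] by blast
    qed
  qed
  have step: "pv_conv dx a g \<in> ?T" if a: "a \<in> ?U" for a
  proof -
    have "fun_space.subspace {b \<in> conv_space. pv_conv dx b a \<in> ?T}"
    proof (rule fun_space.subspaceI)
      have "pv_conv dx 0 a = 0" by (rule pv_conv_0_left[OF UA[OF a]])
      then show "0 \<in> {b \<in> conv_space. pv_conv dx b a \<in> ?T}" using T0 conv_space_zero by simp
    qed (auto simp: conv_space_add conv_space_scale pv_conv_add_left pv_conv_scale_left UA[OF a] Tadd Tscale)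
    moreover have "?U \<subseteq> {b \<in> conv_space. pv_conv dx b a \<in> ?T}"
    proof
      fix b assume "b \<in> ?U"
      from UA[OF this] base[OF this a] show "b \<in> {b \<in> conv_space. pv_conv dx b a \<in> ?T}" by simp
    qed
    ultimately have "?T \<subseteq> {b \<in> conv_space. pv_conv dx b a \<in> ?T}"
      unfolding S_sis_total_def by (intro fun_space.span_minimal)
    then have "pv_conv dx g a \<in> ?T" using g by blast
    moreover have "g \<in> conv_space" using g S_sis_total_conv_space by blast
    ultimately show ?thesis using pv_conv_commute[OF _ UA[OF a]] by simp
  qed
  have gA: "g \<in> conv_space" using g S_sis_total_conv_space by blast
  have "fun_space.subspace {b \<in> conv_space. pv_conv dx b g \<in> ?T}"
  proof (rule fun_space.subspaceI)
    have "pv_conv dx 0 g = 0" by (rule pv_conv_0_left[OF gA])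
    then show "0 \<in> {b \<in> conv_space. pv_conv dx b g \<in> ?T}" using T0 conv_space_zero by simp
  qed (auto simp: conv_space_add conv_space_scale pv_conv_add_left pv_conv_scale_left gA Tadd Tscale)
  moreover have "?U \<subseteq> {b \<in> conv_space. pv_conv dx b g \<in> ?T}"
  proof
    fix b assume "b \<in> ?U"
    from UA[OF this] step[OF this] show "b \<in> {b \<in> conv_space. pv_conv dx b g \<in> ?T}" by simp
  qed
  ultimately have "?T \<subseteq> {b \<in> conv_space. pv_conv dx b g \<in> ?T}"
    unfolding S_sis_total_def by (intro fun_space.span_minimal)
  then show ?thesis using f by blast
qed

lemma algebra_part:
  "commutative_algebra_on (S_sis_total p \<psi> dx) (pv_conv dx)" (is ?A)
  "algebra_ideal S_sis (S_sis_total p \<psi> dx) (pv_conv dx)" (is ?B)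
proof -
  have T: "f \<in> conv_space" if "f \<in> S_sis_total p \<psi> dx" for f using that S_sis_total_conv_space by blast
  show ?A unfolding commutative_algebra_on_def
    using pv_conv_bilinear[OF S_sis_total_conv_space S_sis_total_conv_space S_sis_total_subspace S_sis_total_subspace S_sis_total_subspace S_sis_total_conv]
    by (auto simp: T pv_conv_assoc intro: pv_conv_commute)
  have S: "f \<in> conv_space" if "f \<in> S_sis" for f :: "'a \<Rightarrow> complex" using that S_sis_conv_space by blast
  show ?B unfolding algebra_ideal_def
  proof (intro conjI ballI)
    fix f g :: "'a \<Rightarrow> complex" assume fg: "f \<in> S_sis" "g \<in> S_sis_total p \<psi> dx"
    show "pv_conv dx f g \<in> S_sis" by (rule S_sis_ideal[OF fg(1) T[OF fg(2)]])
    then show "pv_conv dx g f \<in> S_sis" unfolding pv_conv_commute[OF T[OF fg(2)] S[OF fg(1)]] .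
  qed (rule S_sis_subspace S_sis_total)+
qed

end

section \<open>Meromorphic continuation of rational functions in \<open>q\<^sup>-\<^sup>s\<close>\<close>

lemma remove_sings_nicely_meromorphic_eq:
  assumes "h nicely_meromorphic_on UNIV" shows "remove_sings h = h"
proof
  fix z
  have "is_pole h z \<and> h z = 0 \<or> h \<midarrow>z\<rightarrow> h z" using assms by (simp add: nicely_meromorphic_on_def)
  then show "remove_sings h z = h z" by auto
qed

lemma remove_sings_cong_cosparse:
  assumes "\<forall>\<^sub>\<approx>z\<in>UNIV. f z = g z" shows "remove_sings f = remove_sings g"
proof
  fix z show "remove_sings f z = remove_sings g z"
    by (rule remove_sings_cong) (use assms in \<open>auto simp: eventually_cosparse_open_eq\<close>)
qed

text \<open>A meromorphic function on a connected set either vanishes off a sparse set or is nonzero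
  off one; a half-plane of zeros excludes the latter. Equality off a sparse set is full equality
  here because \<open>remove_sings\<close> fixes both functions.\<close>

lemma nicely_meromorphic_unique:
  assumes h: "h nicely_meromorphic_on UNIV" and k: "k nicely_meromorphic_on UNIV"
    and eq: "\<And>s. \<sigma> < Re s \<Longrightarrow> h s = k s"
  shows "h = k"
proof -
  have "(\<lambda>s. h s - k s) meromorphic_on UNIV"
    using h k by (intro meromorphic_intros) (simp_all add: nicely_meromorphic_on_def)
  from meromorphic_imp_constant_or_avoid[OF this open_UNIV connected_UNIV, of 0]
  have "(\<forall>\<^sub>\<approx>s\<in>UNIV. h s - k s = 0) \<or> (\<forall>\<^sub>\<approx>s\<in>UNIV. h s - k s \<noteq> 0)" by simp
  moreover have "\<not> (\<forall>\<^sub>\<approx>s\<in>UNIV. h s - k s \<noteq> 0)"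
  proof
    assume *: "\<forall>\<^sub>\<approx>s\<in>UNIV. h s - k s \<noteq> 0"
    define z where "z = complex_of_real (\<sigma> + 1)"
    have "eventually (\<lambda>s. h s - k s \<noteq> 0) (at z)" using * by (simp add: eventually_cosparse_open_eq)
    moreover have "eventually (\<lambda>s. s \<in> {s. \<sigma> < Re s} - {z}) (at z)"
      by (rule eventually_at_in_open) (auto simp: z_def open_halfspace_Re_gt)
    ultimately have "eventually (\<lambda>s. False) (at z)"
      by eventually_elim (use eq in auto)
    then show False by simp
  qed
  ultimately have "\<forall>\<^sub>\<approx>s\<in>UNIV. h s = k s" by simp
  then have "remove_sings h = remove_sings k" by (rule remove_sings_cong_cosparse)
  then show ?thesis using remove_sings_nicely_meromorphic_eq h k by metis
qed

lemma mero_continuation_the: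
  assumes "mero_continuation D g h" shows "(THE h. mero_continuation D g h) = h"
proof (rule the_equality[of "mero_continuation D g", OF assms])
  fix k assume "mero_continuation D g k"
  then obtain \<sigma>1 where k: "k nicely_meromorphic_on UNIV" "\<And>s. \<sigma>1 < Re s \<Longrightarrow> k s = g s"
    unfolding mero_continuation_def by blast
  obtain \<sigma>2 where h: "h nicely_meromorphic_on UNIV" "\<And>s. \<sigma>2 < Re s \<Longrightarrow> h s = g s"
    using assms unfolding mero_continuation_def by blast
  show "k = h" by (rule nicely_meromorphic_unique[OF k(1) h(1), of "max \<sigma>1 \<sigma>2"]) (use k(2) h(2) in simp)
qed

section \<open>Generating functions of recurrent sequences\<close>

text \<open>Principal values use symmetric ranges of shells. As the coefficients vanish below
  \<open>K\<close>, these ranges eventually give ordinary partial sums of a power series.\<close>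

lemma laurent_partial_limit:
  fixes a :: "int \<Rightarrow> complex"
  assumes a: "\<And>n. n < K \<Longrightarrow> a n = 0" and T: "T \<noteq> 0" and s: "(\<lambda>j. a (int j + K) * T ^ j) sums S"
  shows "(\<lambda>N. \<Sum>n\<in>{- int N..int N}. a n * T powi n) \<longlonglongrightarrow> T powi K * S"
proof -
  have "(\<lambda>N. \<Sum>j<nat (int N - K + 1). a (int j + K) * T ^ j) \<longlonglongrightarrow> S"
  proof (rule filterlim_compose[OF s[unfolded sums_def]])
    have "filterlim (\<lambda>N. N - nat K) at_top sequentially" by (rule filterlim_minus_const_nat_at_top)
    then show "filterlim (\<lambda>N. nat (int N - K + 1)) at_top sequentially"
      by (rule filterlim_at_top_mono) (auto intro: always_eventually)
  qed
  then have lim: "(\<lambda>N. T powi K * (\<Sum>j<nat (int N - K + 1). a (int j + K) * T ^ j)) \<longlonglongrightarrow> T powi K * S"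
    by (intro tendsto_intros)
  have eqN: "(\<Sum>n\<in>{- int N..int N}. a n * T powi n) = T powi K * (\<Sum>j<nat (int N - K + 1). a (int j + K) * T ^ j)"
    if N: "N \<ge> nat \<bar>K\<bar>" for N
  proof -
    have "(\<Sum>n\<in>{- int N..int N}. a n * T powi n) = (\<Sum>n\<in>{K..int N}. a n * T powi n)"
      by (rule sum.mono_neutral_right) (use N a in auto)
    also have "\<dots> = (\<Sum>j<nat (int N - K + 1). a (int j + K) * T powi (int j + K))"
      by (rule sum.reindex_bij_witness[of _ "\<lambda>j. int j + K" "\<lambda>n. nat (n - K)"]) (use N in auto)
    also have "\<dots> = T powi K * (\<Sum>j<nat (int N - K + 1). a (int j + K) * T ^ j)"
      unfolding sum_distrib_left using T by (intro sum.cong) (auto simp: power_int_add)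
    finally show ?thesis .
  qed
  have "eventually (\<lambda>N. T powi K * (\<Sum>j<nat (int N - K + 1). a (int j + K) * T ^ j)
      = (\<Sum>n\<in>{- int N..int N}. a n * T powi n)) sequentially"
    by (rule eventually_mono[OF eventually_ge_at_top[of "nat \<bar>K\<bar>"]]) (rule eqN[symmetric])
  from Lim_transform_eventually[OF lim this] show ?thesis .
qed

text \<open>Solving for the newest term bounds it by \<open>R\<close> times the largest of the
  preceding ones. With \<open>R \<ge> 1\<close> the bound \<open>C * R ^ j\<close> is monotone in
  \<open>j\<close>, so the one for index \<open>j - 1\<close> covers all of them.\<close>

lemma recurrent_growth:
  fixes a :: "int \<Rightarrow> complex"
  assumes D: "coeff D 0 \<noteq> 0" and a: "\<And>n. n < K \<Longrightarrow> a n = 0" and rec: "\<And>n. n \<ge> n1 \<Longrightarrow> poly_rec D a n = 0"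
  shows "\<exists>C\<ge>0. \<exists>R\<ge>1. \<forall>j. cmod (a (int j + K)) \<le> C * R ^ j"
proof -
  define r where "r i = cmod (coeff D i / coeff D 0)" for i
  define R where "R = max 1 (\<Sum>i\<in>{1..degree D}. r i)"
  have R: "R \<ge> 1" "(\<Sum>i\<in>{1..degree D}. r i) \<le> R" by (auto simp: R_def)
  \<comment> \<open>The successor makes the initial range nonempty, so that its maximum exists, and
    guarantees \<open>j \<ge> 1\<close> beyond it.\<close>
  define N1 where "N1 = Suc (nat (n1 - K))"
  define C where "C = Max ((\<lambda>j. cmod (a (int j + K))) ` {..<N1})"
  have C: "cmod (a (int j + K)) \<le> C" if "j < N1" for j using that by (auto simp: C_def intro!: Max_ge)
  have "N1 > 0" by (simp add: N1_def)
  then have C0: "C \<ge> 0" using C[of 0] norm_ge_zero order_trans by blast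
  have "cmod (a (int j + K)) \<le> C * R ^ j" for j
  proof (induction j rule: less_induct)
    case (less j)
    show ?case
    proof (cases "j < N1")
      case True
      have "C * 1 \<le> C * R ^ j" using C0 R by (intro mult_left_mono) auto
      then show ?thesis using C[OF True] by simp
    next
      case False
      define n where "n = int j + K"
      have j: "j \<ge> 1" "n \<ge> n1" using False by (auto simp: n_def N1_def)
      have "0 = poly_rec D a n" using rec j by simp
      also have "\<dots> = coeff D 0 * a n + (\<Sum>i\<in>{1..degree D}. coeff D i * a (n - int i))"
        unfolding poly_rec_def by (simp add: sum.atMost_shift sum.atLeast1_atMost_eq)
      finally have "a n = - (\<Sum>i\<in>{1..degree D}. coeff D i * a (n - int i)) / coeff D 0"
        using D by (simp add: field_simps eq_neg_iff_add_eq_0)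
      then have "a n = - (\<Sum>i\<in>{1..degree D}. (coeff D i / coeff D 0) * a (n - int i))"
        by (simp add: sum_divide_distrib)
      then have "cmod (a n) \<le> (\<Sum>i\<in>{1..degree D}. r i * cmod (a (n - int i)))"
        by (simp only: norm_minus_cancel) (rule order_trans[OF norm_sum], simp add: r_def norm_mult norm_divide)
      also have "\<dots> \<le> (\<Sum>i\<in>{1..degree D}. r i * (C * R ^ (j - 1)))"
      proof (intro sum_mono mult_left_mono)
        fix i assume i: "i \<in> {1..degree D}"
        show "cmod (a (n - int i)) \<le> C * R ^ (j - 1)"
        proof (cases "i \<le> j")
          case True
          have "cmod (a (int (j - i) + K)) \<le> C * R ^ (j - i)" using less[of "j - i"] i True by simp
          also have "\<dots> \<le> C * R ^ (j - 1)" using C0 R i by (intro mult_left_mono power_increasing) auto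
          also have "int (j - i) + K = n - int i" using True by (simp add: n_def)
          finally show ?thesis .
        next
          case False
          then have "a (n - int i) = 0" by (intro a) (simp add: n_def)
          then show ?thesis using C0 R by simp
        qed
      qed (simp add: r_def)
      also have "\<dots> = (\<Sum>i\<in>{1..degree D}. r i) * (C * R ^ (j - 1))" by (simp add: sum_distrib_right)
      also have "\<dots> \<le> R * (C * R ^ (j - 1))" using C0 R by (intro mult_right_mono) auto
      also have "\<dots> = C * R ^ j" using j by (cases j) auto
      finally show ?thesis by (simp add: n_def)
    qed
  qed
  then show ?thesis using C0 R(1) by blast
qed

text \<open>Multiplying the series by \<open>D(T)\<close> produces the coefficients
  \<open>poly_rec D a\<close>, which vanish from \<open>n1\<close> on, so the product is a
  polynomial. The radius is limited both by convergence and by the zeros of \<open>D\<close>, which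
  stay away from 0 as \<open>coeff D 0 \<noteq> 0\<close>.\<close>

lemma recurrent_series:
  fixes a :: "int \<Rightarrow> complex"
  assumes D: "coeff D 0 \<noteq> 0" and a: "\<And>n. n < K \<Longrightarrow> a n = 0" and rec: "\<And>n. n \<ge> n1 \<Longrightarrow> poly_rec D a n = 0"
  shows "\<exists>B \<rho>. \<rho> > 0 \<and> (\<forall>T. cmod T < \<rho> \<longrightarrow> summable (\<lambda>j. cmod (a (int j + K) * T ^ j))
    \<and> poly D T \<noteq> 0 \<and> (\<lambda>j. a (int j + K) * T ^ j) sums (poly B T / poly D T))"
proof -
  obtain C R where CR: "C \<ge> 0" "R \<ge> 1" "\<And>j. cmod (a (int j + K)) \<le> C * R ^ j"
    using recurrent_growth[OF assms] by blast
  define N1 where "N1 = nat (n1 - K)"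
  define B where "B = (\<Sum>m<N1. monom (poly_rec D a (int m + K)) m)"
  have "poly D 0 \<noteq> 0" using D by (simp add: poly_0_coeff_0)
  moreover have "isCont (poly D) 0" by simp
  ultimately have "\<forall>\<^sub>F T in nhds 0. poly D T \<noteq> 0"
    using tendsto_imp_eventually_ne[of "poly D" "poly D 0" "nhds 0" 0] by (simp add: isCont_def tendsto_at_iff_tendsto_nhds)
  then obtain \<rho>0 where \<rho>0: "\<rho>0 > 0" "\<And>T. cmod T < \<rho>0 \<Longrightarrow> poly D T \<noteq> 0"
    unfolding eventually_nhds_metric by (auto simp: dist_norm)
  define \<rho> where "\<rho> = min \<rho>0 (1 / R)"
  have \<rho>: "\<rho> > 0" using \<rho>0 CR by (simp add: \<rho>_def)
  have "summable (\<lambda>j. cmod (a (int j + K) * T ^ j)) \<and> poly D T \<noteq> 0 \<and> (\<lambda>j. a (int j + K) * T ^ j) sums (poly B T / poly D T)"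
    if T: "cmod T < \<rho>" for T
  proof -
    have DT: "poly D T \<noteq> 0" using T \<rho>0 by (simp add: \<rho>_def)
    have "R * cmod T < 1" using T CR by (simp add: \<rho>_def field_simps)
    then have "summable (\<lambda>j. (R * cmod T) ^ j)" using CR by (intro summable_geometric) (simp add: abs_mult)
    then have "summable (\<lambda>j. C * (R * cmod T) ^ j)" by (rule summable_mult)
    then have sm: "summable (\<lambda>j. cmod (a (int j + K) * T ^ j))"
    proof (rule summable_comparison_test_ev[rotated])
      have "norm (cmod (a (int j + K) * T ^ j)) \<le> C * (R * cmod T) ^ j" for j
        using mult_right_mono[OF CR(3)[of j], of "cmod T ^ j"] by (simp add: norm_mult norm_power power_mult_distrib mult.assoc)
      then show "\<forall>\<^sub>F j in sequentially. norm (cmod (a (int j + K) * T ^ j)) \<le> C * (R * cmod T) ^ j"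
        by (intro always_eventually) blast
    qed
    define S where "S = (suminf (\<lambda>j. a (int j + K) * T ^ j))"
    have S: "(\<lambda>j. a (int j + K) * T ^ j) sums S"
      unfolding S_def using summable_norm_cancel[OF sm] by (rule summable_sums)
    have shift: "(\<lambda>m. a (int m + K - int i) * T ^ m) sums (T ^ i * S)" for i
    proof -
      have "(\<lambda>j. a (int (j + i) + K - int i) * T ^ (j + i)) sums (T ^ i * S)"
        using sums_mult[OF S, of "T ^ i"] by (simp add: power_add mult.left_commute mult.commute algebra_simps)
      moreover have "(\<Sum>j<i. a (int j + K - int i) * T ^ j) = 0" by (intro sum.neutral) (auto simp: a)
      ultimately show ?thesis using sums_iff_shift[of "\<lambda>m. a (int m + K - int i) * T ^ m" i] by simp
    qed
    have "(\<lambda>m. \<Sum>i\<le>degree D. coeff D i * (a (int m + K - int i) * T ^ m)) sums (\<Sum>i\<le>degree D. coeff D i * (T ^ i * S))"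
      by (intro sums_sum sums_mult shift)
    moreover have "(\<Sum>i\<le>degree D. coeff D i * (a (int m + K - int i) * T ^ m)) = poly_rec D a (int m + K) * T ^ m" for m
      by (simp add: poly_rec_def sum_distrib_right mult.assoc)
    moreover have "(\<Sum>i\<le>degree D. coeff D i * (T ^ i * S)) = poly D T * S"
      by (simp add: poly_altdef sum_distrib_right mult.assoc)
    ultimately have "(\<lambda>m. poly_rec D a (int m + K) * T ^ m) sums (poly D T * S)" by simp
    moreover have "(\<lambda>m. poly_rec D a (int m + K) * T ^ m) sums (\<Sum>m<N1. poly_rec D a (int m + K) * T ^ m)"
      by (rule sums_finite) (auto simp: N1_def intro: rec)
    ultimately have "poly D T * S = poly B T"
      using sums_unique2 by (force simp: B_def poly_sum poly_monom)
    then have "S = poly B T / poly D T" using DT by (simp add: field_simps)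
    then show ?thesis using sm DT S by simp
  qed
  then show ?thesis using \<rho> by blast
qed

section \<open>The Mellin transform\<close>

lemma unit_char_one:
  assumes "\<xi> \<in> unit_characters" shows "\<xi> 1 = 1"
proof -
  have "\<xi> (1 * 1) = \<xi> 1 * \<xi> 1" using assms one_in_units unfolding unit_characters_def by blast
  moreover have "cmod (\<xi> 1) = 1" using assms one_in_units unfolding unit_characters_def by blast
  then have "\<xi> 1 \<noteq> 0" by auto
  ultimately show ?thesis by simp
qed

lemma unit_char_mult: "\<xi> \<in> unit_characters \<Longrightarrow> x \<in> int_units \<Longrightarrow> y \<in> int_units \<Longrightarrow> \<xi> (x * y) = \<xi> x * \<xi> y"
  by (simp add: unit_characters_def)

lemma unit_char_off: "\<xi> \<in> unit_characters \<Longrightarrow> x \<notin> int_units \<Longrightarrow> \<xi> x = 0"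
  by (simp add: unit_characters_def)

lemma unit_char_conductor:
  assumes "\<xi> \<in> unit_characters" "w \<in> one_units m" "m \<ge> conductor_exp \<xi>" shows "\<xi> w = 1"
proof (rule conductor_trivial)
  show "\<exists>m. \<forall>w\<in>one_units m. \<xi> w = 1"
    by (rule trivial_on_one_units) (use assms in \<open>auto simp: unit_char_one unit_char_mult\<close>, simp add: unit_characters_def)
  show "w \<in> one_units (conductor_exp \<xi>)" using one_units_mono[OF assms(3)] assms(2) by blast
qed

lemma unit_char_level: "\<xi> \<in> unit_characters \<Longrightarrow> m \<ge> conductor_exp \<xi> \<Longrightarrow> \<xi> \<in> level m"
  by (intro levI) (simp_all add: unit_char_off unit_char_mult one_units_units unit_char_conductor)

lemma unit_char_loc_const: "\<xi> \<in> unit_characters \<Longrightarrow> \<xi> \<in> loc_const"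
  using unit_char_level level_loc_const by blast

context haar_field
begin

text \<open>The coefficient of \<open>q^(- n s)\<close> in the Mellin transform at
  \<open>\<xi>\<close>: the Fourier coefficient at \<open>\<xi>\<close> of the component on shell
  \<open>n\<close>.\<close>

definition mellin_coeff :: "(int \<Rightarrow> 'a \<Rightarrow> complex) \<Rightarrow> ('a \<Rightarrow> complex) \<Rightarrow> int \<Rightarrow> complex"
  where "mellin_coeff F \<xi> n = (LINT u|\<nu>. F n u * \<xi> u)"

definition qpow :: "complex \<Rightarrow> complex"
  where "qpow s = exp (- s * of_real (ln q))"

lemma q_power_eq: "q_power TYPE('a) s = qpow s"
proof -
  have "of_nat (residue_card TYPE('a)) = complex_of_real q" by (simp add: q_def del: q_simp)
  moreover have "Ln (complex_of_real q) = of_real (ln q)" by (rule Ln_of_real) simp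
  ultimately show ?thesis by (simp add: q_power_def qpow_def powr_def del: q_simp)
qed

lemma qpow_nz [simp]: "qpow s \<noteq> 0"
  by (simp add: qpow_def)

lemma qpow_holomorphic: "qpow holomorphic_on A"
  unfolding qpow_def[abs_def] by (intro holomorphic_intros)

lemma norm_qpow_less:
  assumes "\<rho> > 0" shows "\<exists>\<sigma>. \<forall>s. \<sigma> < Re s \<longrightarrow> cmod (qpow s) < \<rho>"
proof (intro exI allI impI)
  fix s assume s: "- ln \<rho> / ln q < Re s"
  have "ln q > 0" by simp
  then have "- Re s * ln q < ln \<rho>" using s by (simp add: field_simps)
  then have "exp (- Re s * ln q) < \<rho>" using assms by (metis exp_less_cancel_iff exp_ln)
  then show "cmod (qpow s) < \<rho>" by (simp add: qpow_def)
qed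

lemma fabs_powr: "(x::'a) \<in> shell n \<Longrightarrow> of_real (fabs x) powr s = qpow s powi n"
proof -
  assume x: "x \<in> shell n"
  then have f: "fabs x = q powi (- n)" by (simp add: fabs_shell)
  have "Ln (complex_of_real (fabs x)) = of_real (ln (fabs x))"
    using x fabs_pos[of x] by (intro Ln_of_real) (simp add: shell_iff)
  also have "ln (fabs x) = - real_of_int n * ln q" unfolding f
    using powr_real_of_int'[of q "- n"] ln_powr[of q "of_int (- n)"] by simp
  finally have "of_real (fabs x) powr s = exp (of_int n * (- s * of_real (ln q)))"
    using f by (simp add: powr_def mult_ac)
  then show ?thesis unfolding qpow_def by (simp only: exp_power_int)
qed

lemma shell_comp_mellin_integrand:
  assumes "\<xi> \<in> unit_characters"
  shows "shell_comp (mellin_integrand p f \<xi> s) n = (\<lambda>u. qpow s powi n * (shell_comp f n u * \<xi> u))"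
proof
  fix u
  show "shell_comp (mellin_integrand p f \<xi> s) n u = qpow s powi n * (shell_comp f n u * \<xi> u)"
  proof (cases "u \<in> int_units")
    case True
    have sh: "p powi n * u \<in> shell n" using shell_mult[OF p_powi_shell True] by simp
    then have "p powi n * u * p powi (- fval (p powi n * u)) = u" by (simp add: shell_iff power_int_minus)
    then have "unit_char_ext p \<xi> (p powi n * u) = \<xi> u" by (simp only: unit_char_ext_def)
    then show ?thesis using True by (simp add: shell_comp_def mellin_integrand_def fabs_powr[OF sh])
  qed (simp add: shell_comp_off)
qed

lemma smooth_set_integral:
  assumes "h \<in> smooth_functions"
  shows "set_lebesgue_integral (mult_measure dx) (shell n) h = (LINT u|\<nu>. shell_comp h n u)"
    and "set_integrable (mult_measure dx) (shell n) h"
proof -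
  note m = smooth_measurable[OF assms] and loc_const = smooth_shell_comp_loc_const[OF assms, of n]
  note [measurable] = m loc_const_measurable[OF loc_const]
  have "(LINT u|\<nu>. h (p powi n * u)) = (LINT u|\<nu>. shell_comp h n u)"
    by (rule integral_nu_cong) (measurable, simp add: shell_comp_def)
  then show "set_lebesgue_integral (mult_measure dx) (shell n) h = (LINT u|\<nu>. shell_comp h n u)"
    using set_integral_shell(1)[OF m p_powi_shell] by simp
  have "integrable \<nu> (shell_comp h n)" by (rule loc_const_integrable[OF loc_const])
  moreover have "AE u in \<nu>. shell_comp h n u = h (p powi n * u)" using AE_nu by eventually_elim (simp add: shell_comp_def)
  ultimately have "integrable \<nu> (\<lambda>u. h (p powi n * u))" by (subst (asm) integrable_cong_AE) auto
  then show "set_integrable (mult_measure dx) (shell n) h" using set_integral_shell(2)[OF m p_powi_shell] by simp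
qed

lemma mellin_integrand_smooth:
  assumes "f \<in> smooth_functions" "\<xi> \<in> unit_characters" shows "mellin_integrand p f \<xi> s \<in> smooth_functions"
proof (rule shell_comp_loc_const_smooth)
  show "mellin_integrand p f \<xi> s 0 = 0" using assms by (simp add: mellin_integrand_def smooth_functions_def)
  show "shell_comp (mellin_integrand p f \<xi> s) n \<in> loc_const" for n
    unfolding shell_comp_mellin_integrand[OF assms(2)] by (intro loc_const_scale loc_const_times smooth_shell_comp_loc_const assms unit_char_loc_const)
qed

lemma mellin_partial:
  assumes "f \<in> smooth_functions" "\<xi> \<in> unit_characters"
  shows "pv_partial dx (mellin_integrand p f \<xi> s) N = (\<Sum>n\<in>{- int N..int N}. mellin_coeff (shell_comp f) \<xi> n * qpow s powi n)"
  unfolding pv_partial_def smooth_set_integral(1)[OF mellin_integrand_smooth[OF assms]] shell_comp_mellin_integrand[OF assms(2)]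
  by (simp add: mellin_coeff_def mult.commute)

lemma mellin_coeff_zero_below:
  assumes "f \<in> conv_space" "\<xi> \<in> unit_characters" obtains K where "\<And>n. n < K \<Longrightarrow> mellin_coeff (shell_comp f) \<xi> n = 0"
proof -
  have A: "shell_comp f \<in> arrays" using assms by (simp add: conv_space_def)
  then obtain K where "\<And>n. n < K \<Longrightarrow> uconv (proj (conductor_exp \<xi>)) (shell_comp f n) = 0" unfolding arrays_def by blast
  then have "mellin_coeff (shell_comp f) \<xi> n = 0" if "n < K" for n
    unfolding mellin_coeff_def by (intro integral_zero_if_proj[OF arrays_loc_const[OF A] _ unit_char_level[OF assms(2) order_refl]]) (use that in blast)
  then show ?thesis by (rule that)
qed

lemma mellin_coeff_recurrence:
  assumes "f \<in> conv_space" "\<xi> \<in> unit_characters"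
  obtains D n1 where "coeff D 0 \<noteq> 0" "\<And>n. n \<ge> n1 \<Longrightarrow> poly_rec D (mellin_coeff (shell_comp f) \<xi>) n = 0"
proof -
  have A: "shell_comp f \<in> arrays" "rec_zero (shell_comp f)" using assms by (simp_all add: conv_space_def)
  obtain D n1 where D: "coeff D 0 \<noteq> 0" "\<And>n. n \<ge> n1 \<Longrightarrow> array_rec D (shell_comp f) n = 0" using A(2) unfolding rec_zero_def by blast
  have int: "integrable \<nu> (\<lambda>u. shell_comp f n u * \<xi> u)" for n
    by (intro loc_const_integrable loc_const_times arrays_loc_const[OF A(1)] unit_char_loc_const assms)
  have "poly_rec D (mellin_coeff (shell_comp f) \<xi>) n = 0" if "n \<ge> n1" for n
  proof -
    have "poly_rec D (mellin_coeff (shell_comp f) \<xi>) n = (LINT u|\<nu>. (\<Sum>i\<le>degree D. coeff D i * (shell_comp f (n - int i) u * \<xi> u)))"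
      unfolding poly_rec_def mellin_coeff_def using int by (subst Bochner_Integration.integral_sum) auto
    also have "\<dots> = (LINT u|\<nu>. array_rec D (shell_comp f) n u * \<xi> u)"
      by (simp add: array_rec_def poly_rec_def sum_distrib_right mult.assoc)
    finally show ?thesis using D(2)[OF that] by simp
  qed
  with D(1) show ?thesis by (rule that)
qed

text \<open>Fubini and the substitution \<open>u \<mapsto> v u\<close> separate the variables
  because \<open>\<xi>\<close> is multiplicative. This is the source of multiplicativity of the
  Mellin transform.\<close>

lemma integral_uconv_char:
  assumes "a \<in> loc_const" "b \<in> loc_const" "\<xi> \<in> unit_characters"
  shows "(LINT u|\<nu>. uconv a b u * \<xi> u) = (LINT u|\<nu>. a u * \<xi> u) * (LINT u|\<nu>. b u * \<xi> u)"
proof -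
  note loc_const = assms(1,2) unit_char_loc_const[OF assms(3)]
  note [measurable] = loc_const[THEN loc_const_measurable] loc_const_measurable[OF uconv_loc_const[OF assms(1,2)]]
  obtain A where A: "A \<ge> 0" "\<And>u. cmod (a u) \<le> A" using loc_const_bounded[OF loc_const(1)] by blast
  obtain B where B: "B \<ge> 0" "\<And>u. cmod (b u) \<le> B" using loc_const_bounded[OF loc_const(2)] by blast
  obtain X where X: "X \<ge> 0" "\<And>u. cmod (\<xi> u) \<le> X" using loc_const_bounded[OF loc_const(3)] by blast
  have "(LINT u|\<nu>. uconv a b u * \<xi> u) = (LINT u|\<nu>. LINT v|\<nu>. a (u * inverse v) * b v * \<xi> u)"
    by (rule integral_nu_cong) (measurable, simp add: uconv_def)
  also have "\<dots> = (LINT v|\<nu>. LINT u|\<nu>. a (u * inverse v) * b v * \<xi> u)"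
  proof (rule fubini_nu[where B = "A * B * X"])
    show "cmod (a (u * inverse v) * b v * \<xi> u) \<le> A * B * X" for u v
      unfolding norm_mult using A B X by (intro mult_mono) auto
  qed measurable
  also have "\<dots> = (LINT v|\<nu>. (LINT u|\<nu>. a u * \<xi> u) * (b v * \<xi> v))"
  proof (rule integral_nu_cong)
    fix v :: 'a assume v: "v \<in> int_units"
    have m: "(\<lambda>u. a (u * inverse v) * b v * \<xi> u) \<in> borel_measurable borel" by measurable
    have "(LINT u|\<nu>. a (u * inverse v) * b v * \<xi> u) = (LINT u|\<nu>. a (v * u * inverse v) * b v * \<xi> (v * u))"
      by (rule integral_nu_mult[OF m v, symmetric])
    also have "\<dots> = (LINT u|\<nu>. (a u * \<xi> u) * (b v * \<xi> v))"
    proof (rule integral_nu_cong)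
      fix u :: 'a assume "u \<in> int_units"
      then have "\<xi> (v * u) = \<xi> v * \<xi> u" by (rule unit_char_mult[OF assms(3) v])
      then show "a (v * u * inverse v) * b v * \<xi> (v * u) = (a u * \<xi> u) * (b v * \<xi> v)"
        unfolding unit_cancel(2)[OF v] by (simp only: mult_ac)
    qed measurable
    finally show "(LINT u|\<nu>. a (u * inverse v) * b v * \<xi> u) = (LINT u|\<nu>. a u * \<xi> u) * (b v * \<xi> v)" by simp
  qed measurable
  finally show ?thesis by simp
qed

lemma mellin_coeff_array_conv:
  assumes A: "F \<in> arrays" "G \<in> arrays" and \<xi>: "\<xi> \<in> unit_characters"
    and K: "\<And>n. n < K1 \<Longrightarrow> mellin_coeff F \<xi> n = 0" "\<And>n. n < K2 \<Longrightarrow> mellin_coeff G \<xi> n = 0"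
  shows "mellin_coeff (array_conv F G) \<xi> m = (\<Sum>n\<in>{K2..m - K1}. mellin_coeff F \<xi> (m - n) * mellin_coeff G \<xi> n)"
proof -
  note L = arrays_loc_const[OF A(1)] arrays_loc_const[OF A(2)]
  let ?S = "{n. uconv (F (m - n)) (G n) \<noteq> 0}"
  \<comment> \<open>A common finite range: it contains the support of the functions, needed to
    expand the convolution, and the interval outside which the products of coefficients
    vanish.\<close>
  define S where "S = ?S \<union> {K2..m - K1}"
  have fin: "finite S" unfolding S_def using array_conv_finite_support[OF A] by simp
  have int: "integrable \<nu> (\<lambda>u. uconv (F (m - n)) (G n) u * \<xi> u)" for n
    by (intro loc_const_integrable loc_const_times uconv_loc_const L unit_char_loc_const \<xi>)
  have "array_conv F G m = (\<Sum>n\<in>S. uconv (F (m - n)) (G n))" by (rule array_conv_eq_sum[OF fin]) (simp add: S_def)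
  then have "mellin_coeff (array_conv F G) \<xi> m = (LINT u|\<nu>. (\<Sum>n\<in>S. uconv (F (m - n)) (G n) u * \<xi> u))"
    by (simp add: mellin_coeff_def sum_fun_apply sum_distrib_right)
  also have "\<dots> = (\<Sum>n\<in>S. mellin_coeff F \<xi> (m - n) * mellin_coeff G \<xi> n)"
    by (subst Bochner_Integration.integral_sum[OF int]) (simp add: integral_uconv_char[OF L \<xi>] mellin_coeff_def)
  also have "\<dots> = (\<Sum>n\<in>{K2..m - K1}. mellin_coeff F \<xi> (m - n) * mellin_coeff G \<xi> n)"
  proof (rule sum.mono_neutral_right[OF fin])
    show "\<forall>n\<in>S - {K2..m - K1}. mellin_coeff F \<xi> (m - n) * mellin_coeff G \<xi> n = 0"
    proof
      fix n assume "n \<in> S - {K2..m - K1}"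
      then have "n < K2 \<or> m - n < K1" by auto
      then show "mellin_coeff F \<xi> (m - n) * mellin_coeff G \<xi> n = 0" using K by auto
    qed
  qed (simp add: S_def)
  finally show ?thesis .
qed

text \<open>\<open>P\<close> and \<open>Q\<close> describe the Mellin transform of \<open>f\<close> at \<open>\<xi>\<close> as a rational function of \<open>q\<^sup>-\<^sup>s\<close>.\<close>

definition mellin_rational :: "('a \<Rightarrow> complex) \<Rightarrow> ('a \<Rightarrow> complex) \<Rightarrow> complex poly \<Rightarrow> complex poly \<Rightarrow> bool"
  where "mellin_rational f \<xi> P Q \<longleftrightarrow> Q \<noteq> 0 \<and> (\<exists>\<sigma>. \<forall>s. \<sigma> < Re s \<longrightarrow> poly Q (qpow s) \<noteq> 0
    \<and> pv_partial dx (mellin_integrand p f \<xi> s) \<longlonglongrightarrow> poly P (qpow s) / poly Q (qpow s))"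

lemma rational_series:
  assumes f: "f \<in> conv_space" and \<xi>: "\<xi> \<in> unit_characters"
  obtains K P Q \<sigma> where "\<And>n. n < K \<Longrightarrow> mellin_coeff (shell_comp f) \<xi> n = 0" "Q \<noteq> 0"
    "\<And>s. \<sigma> < Re s \<Longrightarrow> summable (\<lambda>j. cmod (mellin_coeff (shell_comp f) \<xi> (int j + K) * qpow s ^ j))"
    "\<And>s. \<sigma> < Re s \<Longrightarrow> poly Q (qpow s) \<noteq> 0"
    "\<And>s. \<sigma> < Re s \<Longrightarrow> qpow s powi K * (suminf (\<lambda>j. mellin_coeff (shell_comp f) \<xi> (int j + K) * qpow s ^ j)) = poly P (qpow s) / poly Q (qpow s)"
proof -
  obtain K0 where K0: "\<And>n. n < K0 \<Longrightarrow> mellin_coeff (shell_comp f) \<xi> n = 0" using mellin_coeff_zero_below[OF assms] by blast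
  \<comment> \<open>Taken nonpositive, so that \<open>T powi K\<close> can be moved into the
    denominator as the polynomial \<open>T ^ nat (- K)\<close>.\<close>
  define K where "K = min K0 0"
  have K: "K \<le> 0" "\<And>n. n < K \<Longrightarrow> mellin_coeff (shell_comp f) \<xi> n = 0" using K0 by (auto simp: K_def)
  obtain D n1 where D: "coeff D 0 \<noteq> 0" "\<And>n. n \<ge> n1 \<Longrightarrow> poly_rec D (mellin_coeff (shell_comp f) \<xi>) n = 0"
    by (rule mellin_coeff_recurrence[OF assms]) (rule that)
  have "\<exists>B \<rho>. \<rho> > 0 \<and> (\<forall>T. cmod T < \<rho> \<longrightarrow> summable (\<lambda>j. cmod (mellin_coeff (shell_comp f) \<xi> (int j + K) * T ^ j))
      \<and> poly D T \<noteq> 0 \<and> (\<lambda>j. mellin_coeff (shell_comp f) \<xi> (int j + K) * T ^ j) sums (poly B T / poly D T))"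
    by (rule recurrent_series[OF D(1)]) (erule K(2), erule D(2))
  then obtain B \<rho> where B1: "\<rho> > 0" and B0: "\<forall>T. cmod T < \<rho> \<longrightarrow> summable (\<lambda>j. cmod (mellin_coeff (shell_comp f) \<xi> (int j + K) * T ^ j))
      \<and> poly D T \<noteq> 0 \<and> (\<lambda>j. mellin_coeff (shell_comp f) \<xi> (int j + K) * T ^ j) sums (poly B T / poly D T)"
    by (elim exE conjE)
  have B: "\<rho> > 0" "\<And>T. cmod T < \<rho> \<Longrightarrow> summable (\<lambda>j. cmod (mellin_coeff (shell_comp f) \<xi> (int j + K) * T ^ j))"
      "\<And>T. cmod T < \<rho> \<Longrightarrow> poly D T \<noteq> 0"
      "\<And>T. cmod T < \<rho> \<Longrightarrow> (\<lambda>j. mellin_coeff (shell_comp f) \<xi> (int j + K) * T ^ j) sums (poly B T / poly D T)"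
    using B1 B0 by simp_all
  define Q where "Q = monom 1 (nat (- K)) * D"
  have Q: "Q \<noteq> 0" using D(1) by (auto simp: Q_def)
  have PQ: "poly Q T = T powi (- K) * poly D T" for T using K(1) by (simp add: Q_def poly_monom power_int_def)
  obtain \<sigma> where \<sigma>: "\<And>s. \<sigma> < Re s \<Longrightarrow> cmod (qpow s) < \<rho>" using norm_qpow_less[OF B(1)] by blast
  show ?thesis
  proof (rule that[OF K(2) Q])
    fix s assume s: "\<sigma> < Re s"
    show "summable (\<lambda>j. cmod (mellin_coeff (shell_comp f) \<xi> (int j + K) * qpow s ^ j))" by (rule B(2)[OF \<sigma>[OF s]])
    show "poly Q (qpow s) \<noteq> 0" using B(3)[OF \<sigma>[OF s]] by (simp add: PQ)
    show "qpow s powi K * (suminf (\<lambda>j. mellin_coeff (shell_comp f) \<xi> (int j + K) * qpow s ^ j)) = poly B (qpow s) / poly Q (qpow s)"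
      unfolding sums_unique[OF B(4)[OF \<sigma>[OF s]], symmetric] by (simp add: PQ power_int_minus field_simps)
  qed
qed

lemma mellin_partial_limit:
  assumes f: "f \<in> smooth_functions" and \<xi>: "\<xi> \<in> unit_characters" and K: "\<And>n. n < K \<Longrightarrow> mellin_coeff (shell_comp f) \<xi> n = 0"
    and s: "(\<lambda>j. mellin_coeff (shell_comp f) \<xi> (int j + K) * qpow s ^ j) sums S"
  shows "pv_partial dx (mellin_integrand p f \<xi> s) \<longlonglongrightarrow> qpow s powi K * S"
  unfolding mellin_partial[OF f \<xi>, abs_def] by (rule laurent_partial_limit[OF K _ s]) simp_all

lemma ex_mellin_rational:
  assumes f: "f \<in> conv_space" and \<xi>: "\<xi> \<in> unit_characters" shows "\<exists>P Q. mellin_rational f \<xi> P Q"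
proof -
  obtain K P Q \<sigma> where *: "\<And>n. n < K \<Longrightarrow> mellin_coeff (shell_comp f) \<xi> n = 0" "Q \<noteq> 0"
    "\<And>s. \<sigma> < Re s \<Longrightarrow> summable (\<lambda>j. cmod (mellin_coeff (shell_comp f) \<xi> (int j + K) * qpow s ^ j))"
    "\<And>s. \<sigma> < Re s \<Longrightarrow> poly Q (qpow s) \<noteq> 0"
    "\<And>s. \<sigma> < Re s \<Longrightarrow> qpow s powi K * (suminf (\<lambda>j. mellin_coeff (shell_comp f) \<xi> (int j + K) * qpow s ^ j)) = poly P (qpow s) / poly Q (qpow s)"
    by (rule rational_series[OF assms]) (rule that)
  have "mellin_rational f \<xi> P Q" unfolding mellin_rational_def
  proof (intro conjI exI[of _ \<sigma>] allI impI)
    fix s assume s: "\<sigma> < Re s"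
    show "pv_partial dx (mellin_integrand p f \<xi> s) \<longlonglongrightarrow> poly P (qpow s) / poly Q (qpow s)"
      using mellin_partial_limit[OF conv_space_smooth[OF f] \<xi> *(1) summable_sums[OF summable_norm_cancel[OF *(3)[OF s]]]] *(5)[OF s] by simp
  qed (use * in auto)
  then show ?thesis by blast
qed

text \<open>For large \<open>Re s\<close> both series converge absolutely, and the coefficients of
  the convolution are those of their Cauchy product. The same \<open>P\<close> and \<open>Q\<close>
  appear for factors and product, so multiplicativity can be read off from the rational
  functions.\<close>

lemma mellin_rational_conv:
  assumes f: "f \<in> conv_space" and g: "g \<in> conv_space" and \<xi>: "\<xi> \<in> unit_characters"
  shows "\<exists>P1 Q1 P2 Q2. mellin_rational f \<xi> P1 Q1 \<and> mellin_rational g \<xi> P2 Q2 \<and> mellin_rational (pv_conv dx f g) \<xi> (P1 * P2) (Q1 * Q2)"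
proof -
  obtain K1 P1 Q1 \<sigma>1 where 1: "\<And>n. n < K1 \<Longrightarrow> mellin_coeff (shell_comp f) \<xi> n = 0" "Q1 \<noteq> 0"
    "\<And>s. \<sigma>1 < Re s \<Longrightarrow> summable (\<lambda>j. cmod (mellin_coeff (shell_comp f) \<xi> (int j + K1) * qpow s ^ j))"
    "\<And>s. \<sigma>1 < Re s \<Longrightarrow> poly Q1 (qpow s) \<noteq> 0"
    "\<And>s. \<sigma>1 < Re s \<Longrightarrow> qpow s powi K1 * (suminf (\<lambda>j. mellin_coeff (shell_comp f) \<xi> (int j + K1) * qpow s ^ j)) = poly P1 (qpow s) / poly Q1 (qpow s)"
    by (rule rational_series[OF f \<xi>]) (rule that)
  obtain K2 P2 Q2 \<sigma>2 where 2: "\<And>n. n < K2 \<Longrightarrow> mellin_coeff (shell_comp g) \<xi> n = 0" "Q2 \<noteq> 0"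
    "\<And>s. \<sigma>2 < Re s \<Longrightarrow> summable (\<lambda>j. cmod (mellin_coeff (shell_comp g) \<xi> (int j + K2) * qpow s ^ j))"
    "\<And>s. \<sigma>2 < Re s \<Longrightarrow> poly Q2 (qpow s) \<noteq> 0"
    "\<And>s. \<sigma>2 < Re s \<Longrightarrow> qpow s powi K2 * (suminf (\<lambda>j. mellin_coeff (shell_comp g) \<xi> (int j + K2) * qpow s ^ j)) = poly P2 (qpow s) / poly Q2 (qpow s)"
    by (rule rational_series[OF g \<xi>]) (rule that)
  have A: "shell_comp f \<in> arrays" "shell_comp g \<in> arrays" using f g by (simp_all add: conv_space_def)
  have mellin_coeff: "mellin_coeff (shell_comp (pv_conv dx f g)) \<xi> m = (\<Sum>n\<in>{K2..m - K1}. mellin_coeff (shell_comp f) \<xi> (m - n) * mellin_coeff (shell_comp g) \<xi> n)" for m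
    unfolding shell_comp_pv_conv[OF f g] by (rule mellin_coeff_array_conv[OF A \<xi> 1(1) 2(1)])
  have mc0: "mellin_coeff (shell_comp (pv_conv dx f g)) \<xi> m = 0" if "m < K1 + K2" for m
    using that by (simp add: mellin_coeff)
  have mc_nat: "mellin_coeff (shell_comp (pv_conv dx f g)) \<xi> (int k + (K1 + K2))
      = (\<Sum>i\<le>k. mellin_coeff (shell_comp f) \<xi> (int i + K1) * mellin_coeff (shell_comp g) \<xi> (int (k - i) + K2))" for k
    unfolding mellin_coeff
    by (rule sum.reindex_bij_witness[of _ "\<lambda>i. int (k - i) + K2" "\<lambda>n. k - nat (n - K2)"])
      (auto simp: algebra_simps of_nat_diff)
  have R1: "mellin_rational f \<xi> P1 Q1" unfolding mellin_rational_def
  proof (intro conjI exI[of _ \<sigma>1] allI impI)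
    fix s assume s: "\<sigma>1 < Re s"
    show "pv_partial dx (mellin_integrand p f \<xi> s) \<longlonglongrightarrow> poly P1 (qpow s) / poly Q1 (qpow s)"
      using mellin_partial_limit[OF conv_space_smooth[OF f] \<xi> 1(1) summable_sums[OF summable_norm_cancel[OF 1(3)[OF s]]]] 1(5)[OF s] by simp
  qed (use 1 in auto)
  have R2: "mellin_rational g \<xi> P2 Q2" unfolding mellin_rational_def
  proof (intro conjI exI[of _ \<sigma>2] allI impI)
    fix s assume s: "\<sigma>2 < Re s"
    show "pv_partial dx (mellin_integrand p g \<xi> s) \<longlonglongrightarrow> poly P2 (qpow s) / poly Q2 (qpow s)"
      using mellin_partial_limit[OF conv_space_smooth[OF g] \<xi> 2(1) summable_sums[OF summable_norm_cancel[OF 2(3)[OF s]]]] 2(5)[OF s] by simp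
  qed (use 2 in auto)
  have "mellin_rational (pv_conv dx f g) \<xi> (P1 * P2) (Q1 * Q2)" unfolding mellin_rational_def
  proof (intro conjI exI[of _ "max \<sigma>1 \<sigma>2"] allI impI)
    fix s assume "max \<sigma>1 \<sigma>2 < Re s"
    then have s: "\<sigma>1 < Re s" "\<sigma>2 < Re s" by auto
    let ?T = "qpow s"
    let ?S1 = "suminf (\<lambda>j. mellin_coeff (shell_comp f) \<xi> (int j + K1) * ?T ^ j)" and ?S2 = "suminf (\<lambda>j. mellin_coeff (shell_comp g) \<xi> (int j + K2) * ?T ^ j)"
    have "(\<lambda>k. \<Sum>i\<le>k. (mellin_coeff (shell_comp f) \<xi> (int i + K1) * ?T ^ i) * (mellin_coeff (shell_comp g) \<xi> (int (k - i) + K2) * ?T ^ (k - i))) sums (?S1 * ?S2)"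
      by (rule Cauchy_product_sums[OF 1(3)[OF s(1)] 2(3)[OF s(2)]])
    moreover have "(\<Sum>i\<le>k. (mellin_coeff (shell_comp f) \<xi> (int i + K1) * ?T ^ i) * (mellin_coeff (shell_comp g) \<xi> (int (k - i) + K2) * ?T ^ (k - i)))
        = mellin_coeff (shell_comp (pv_conv dx f g)) \<xi> (int k + (K1 + K2)) * ?T ^ k" for k
      unfolding mc_nat sum_distrib_right
    proof (rule sum.cong)
      fix i assume "i \<in> {..k}"
      then have "?T ^ k = ?T ^ i * ?T ^ (k - i)" by (simp flip: power_add)
      then show "(mellin_coeff (shell_comp f) \<xi> (int i + K1) * ?T ^ i) * (mellin_coeff (shell_comp g) \<xi> (int (k - i) + K2) * ?T ^ (k - i))
          = mellin_coeff (shell_comp f) \<xi> (int i + K1) * mellin_coeff (shell_comp g) \<xi> (int (k - i) + K2) * ?T ^ k" by (simp add: mult_ac)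
    qed simp
    ultimately have sums: "(\<lambda>k. mellin_coeff (shell_comp (pv_conv dx f g)) \<xi> (int k + (K1 + K2)) * ?T ^ k) sums (?S1 * ?S2)" by simp
    have "pv_partial dx (mellin_integrand p (pv_conv dx f g) \<xi> s) \<longlonglongrightarrow> ?T powi (K1 + K2) * (?S1 * ?S2)"
      by (rule mellin_partial_limit[OF conv_space_smooth[OF pv_conv_conv_space[OF f g]] \<xi> mc0 sums])
    moreover have "?T powi (K1 + K2) * (?S1 * ?S2) = (?T powi K1 * ?S1) * (?T powi K2 * ?S2)"
      by (simp add: power_int_add mult_ac)
    ultimately show "pv_partial dx (mellin_integrand p (pv_conv dx f g) \<xi> s) \<longlonglongrightarrow> poly (P1 * P2) ?T / poly (Q1 * Q2) ?T"
      unfolding 1(5)[OF s(1)] 2(5)[OF s(2)] by simp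
    show "poly (Q1 * Q2) ?T \<noteq> 0" using 1(4)[OF s(1)] 2(4)[OF s(2)] by simp
  qed (use 1(2) 2(2) in simp)
  with R1 R2 show ?thesis by blast
qed

definition rational_q :: "complex poly \<Rightarrow> complex poly \<Rightarrow> complex \<Rightarrow> complex"
  where "rational_q P Q s = poly P (qpow s) / poly Q (qpow s)"

lemma poly_qpow_holomorphic: "(\<lambda>s. poly P (qpow s)) holomorphic_on A"
  by (induction P) (auto intro!: holomorphic_intros qpow_holomorphic)

lemma rational_q_meromorphic: "rational_q P Q meromorphic_on UNIV"
  unfolding rational_q_def[abs_def]
  by (intro meromorphic_on_divide analytic_on_imp_meromorphic_on) (simp_all add: analytic_on_open poly_qpow_holomorphic)

lemma rational_q_remove_sings:
  assumes "poly Q (qpow s) \<noteq> 0" shows "remove_sings (rational_q P Q) s = rational_q P Q s"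
proof (rule remove_sings_at_analytic)
  have "(\<lambda>s. poly P (qpow s)) analytic_on {s}" "(\<lambda>s. poly Q (qpow s)) analytic_on {s}"
    using poly_qpow_holomorphic[of _ UNIV] by (auto simp: analytic_on_open intro: analytic_on_subset[of _ UNIV])
  then show "rational_q P Q analytic_on {s}"
    unfolding rational_q_def[abs_def] using assms by (intro analytic_on_divide) auto
qed

lemma mellin_rational_is_mellin:
  assumes R: "mellin_rational f \<xi> P Q" and f: "f \<in> conv_space" and \<xi>: "\<xi> \<in> unit_characters"
  shows "is_mellin p dx f \<xi> (remove_sings (rational_q P Q))" and "mellin p dx f \<xi> = remove_sings (rational_q P Q)"
proof -
  obtain \<sigma> where \<sigma>: "\<And>s. \<sigma> < Re s \<Longrightarrow> poly Q (qpow s) \<noteq> 0"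
    "\<And>s. \<sigma> < Re s \<Longrightarrow> pv_partial dx (mellin_integrand p f \<xi> s) \<longlonglongrightarrow> rational_q P Q s"
    using R unfolding mellin_rational_def rational_q_def by blast
  show ism: "is_mellin p dx f \<xi> (remove_sings (rational_q P Q))"
    unfolding is_mellin_def mero_continuation_def
  proof (intro conjI exI[of _ \<sigma>] allI impI)
    show "remove_sings (rational_q P Q) nicely_meromorphic_on UNIV"
      by (intro remove_sings_nicely_meromorphic rational_q_meromorphic)
    fix s assume s: "\<sigma> < Re s"
    show "pv_exists dx (mellin_integrand p f \<xi> s)"
      using smooth_set_integral(2)[OF mellin_integrand_smooth[OF conv_space_smooth[OF f] \<xi>]] \<sigma>(2)[OF s]
      by (auto simp: pv_exists_def convergent_def)
    show "remove_sings (rational_q P Q) s = pv_integral dx (mellin_integrand p f \<xi> s)"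
      unfolding pv_integral_def rational_q_remove_sings[OF \<sigma>(1)[OF s]] by (rule limI[OF \<sigma>(2)[OF s], symmetric])
  qed
  from ism show "mellin p dx f \<xi> = remove_sings (rational_q P Q)"
    using \<xi> unfolding mellin_def is_mellin_def by (simp add: mero_continuation_the)
qed

lemma mellin_defined_conv_space: "f \<in> conv_space \<Longrightarrow> mellin_defined p dx f"
  unfolding mellin_defined_def using ex_mellin_rational mellin_rational_is_mellin(1) by blast

lemma mellin_rational_in_q:
  assumes "f \<in> conv_space" "\<xi> \<in> unit_characters" shows "mellin p dx f \<xi> \<in> rational_in_q_power TYPE('a)"
proof -
  obtain P Q where R: "mellin_rational f \<xi> P Q" using ex_mellin_rational[OF assms] by blast
  then have "Q \<noteq> 0" by (simp add: mellin_rational_def)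
  then show ?thesis
    unfolding mellin_rational_is_mellin(2)[OF R assms] rational_in_q_power_def q_power_eq rational_q_def[abs_def] by blast
qed

lemma mellin_nicely_meromorphic:
  assumes "f \<in> conv_space" "\<xi> \<in> unit_characters" shows "mellin p dx f \<xi> nicely_meromorphic_on UNIV"
proof -
  obtain P Q where R: "mellin_rational f \<xi> P Q" using ex_mellin_rational[OF assms] by blast
  show ?thesis unfolding mellin_rational_is_mellin(2)[OF R assms]
    by (intro remove_sings_nicely_meromorphic rational_q_meromorphic)
qed

text \<open>The identity of rational functions holds pointwise off the singularities of the two
  factors, and this is all that \<open>remove_sings\<close> depends on.\<close>

lemma mellin_conv:
  assumes f: "f \<in> conv_space" and g: "g \<in> conv_space" and \<xi>: "\<xi> \<in> unit_characters"
  shows "mellin p dx (pv_conv dx f g) \<xi> = remove_sings (\<lambda>s. mellin p dx f \<xi> s * mellin p dx g \<xi> s)"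
proof -
  obtain P1 Q1 P2 Q2 where R: "mellin_rational f \<xi> P1 Q1" "mellin_rational g \<xi> P2 Q2"
    "mellin_rational (pv_conv dx f g) \<xi> (P1 * P2) (Q1 * Q2)"
    using mellin_rational_conv[OF assms] by blast
  have "\<forall>\<^sub>\<approx>s\<in>UNIV. rational_q (P1 * P2) (Q1 * Q2) s = remove_sings (rational_q P1 Q1) s * remove_sings (rational_q P2 Q2) s"
    using eventually_remove_sings_eq[OF rational_q_meromorphic[of P1 Q1]] eventually_remove_sings_eq[OF rational_q_meromorphic[of P2 Q2]]
    by eventually_elim (simp add: rational_q_def)
  then show ?thesis
    unfolding mellin_rational_is_mellin(2)[OF R(1) f \<xi>] mellin_rational_is_mellin(2)[OF R(2) g \<xi>]
      mellin_rational_is_mellin(2)[OF R(3) pv_conv_conv_space[OF f g] \<xi>]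
    by (rule remove_sings_cong_cosparse)
qed

end

section \<open>Schwartz--Bruhat functions\<close>

text \<open>A quantitative form of the Schwartz--Bruhat condition: invariance under
  \<open>P^k\<close> and support in \<open>P^K\<close>. The Fourier transform exchanges the two
  exponents up to sign.\<close>

definition test_fun :: "int \<Rightarrow> int \<Rightarrow> ('a::nonarch_local_field \<Rightarrow> complex) \<Rightarrow> bool"
  where "test_fun k K \<Phi> \<longleftrightarrow> (\<forall>x y. y \<in> coset x k \<longrightarrow> \<Phi> y = \<Phi> x) \<and> (\<forall>x. x \<notin> frac_ideal K \<longrightarrow> \<Phi> x = 0)"

lemma schwartz_bruhat_test_fun:
  fixes \<Phi> :: "'a::nonarch_local_field \<Rightarrow> complex"
  assumes "\<Phi> \<in> schwartz_bruhat" obtains k K where "test_fun k K \<Phi>"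
proof -
  obtain C where C: "compact C" "\<And>x. x \<notin> C \<Longrightarrow> \<Phi> x = 0" and loc: "\<And>x. \<forall>\<^sub>F y in nhds x. \<Phi> y = \<Phi> x"
    using assms by (auto simp: schwartz_bruhat_def)
  obtain e where e: "\<And>x. x \<in> C \<Longrightarrow> dist 0 x \<le> e" using compact_imp_bounded[OF C(1)] unfolding bounded_any_center[where a=0] by blast
  obtain K where K: "e < q_of TYPE('a) powi (- K)" using ex_q_powi_greater by blast
  have sub: "\<Phi> x = 0" if "x \<notin> frac_ideal K" for x
  proof (rule C(2), rule notI)
    assume "x \<in> C"
    then have "dist x 0 \<le> q_of TYPE('a) powi (- K)" using e[of x] K by (simp add: dist_commute)
    then show False using that by (simp add: dist_le_iff coset_zero)
  qed
  \<comment> \<open>With \<open>k \<ge> K\<close> the ideal \<open>P^K\<close> is a union of cosets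
    of \<open>P^k\<close>, so constancy on cosets extends to points outside it.\<close>
  obtain k where k: "k \<ge> K" "\<forall>x\<in>frac_ideal K. \<forall>y\<in>coset x k. \<Phi> y = \<Phi> x"
    using locally_constant_compact[OF compact_frac_ideal loc, of K K] by blast
  have "\<Phi> y = \<Phi> x" if "y \<in> coset x k" for x y
  proof (cases "x \<in> frac_ideal K")
    case True
    then show ?thesis using k that by blast
  next
    case False
    have "y \<notin> frac_ideal K"
    proof
      assume y: "y \<in> frac_ideal K"
      have "x - y \<in> frac_ideal K" using that coset_sym[of y x k] k(1) by (auto simp: coset_iff intro: frac_ideal_mono)
      from frac_ideal_add[OF this y] False show False by simp
    qed
    then show ?thesis using sub False by simp
  qed
  then have "test_fun k K \<Phi>" using sub by (simp add: test_fun_def)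
  then show ?thesis by (rule that)
qed

lemma test_fun_locally_constant: "test_fun k K \<Phi> \<Longrightarrow> \<forall>\<^sub>F y in nhds x. \<Phi> y = \<Phi> x"
  by (rule eventually_mono[OF eventually_in_coset[of x k]]) (simp add: test_fun_def)

lemma test_fun_continuous: "test_fun k K \<Phi> \<Longrightarrow> continuous_on S \<Phi>"
  unfolding continuous_on_def
proof
  fix x assume "test_fun k K \<Phi>"
  then have "(\<Phi> \<longlongrightarrow> \<Phi> x) (nhds x)" by (intro tendsto_eventually test_fun_locally_constant)
  then show "(\<Phi> \<longlongrightarrow> \<Phi> x) (at x within S)"
    by (rule tendsto_mono[rotated]) (simp add: at_within_def)
qed

lemma test_fun_measurable: "test_fun k K \<Phi> \<Longrightarrow> \<Phi> \<in> borel_measurable borel"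
  by (intro borel_measurable_continuous_onI test_fun_continuous)

lemma test_fun_bounded: assumes "test_fun k K \<Phi>" obtains B where "B \<ge> 0" "\<And>x. cmod (\<Phi> x) \<le> B"
proof -
  from compact_continuous_image[OF test_fun_continuous[OF assms] compact_frac_ideal[of K]]
  obtain B where B: "B > 0" "\<forall>y\<in>\<Phi> ` frac_ideal K. cmod y \<le> B" using compact_imp_bounded bounded_pos by blast
  have "cmod (\<Phi> x) \<le> B" for x
    using B assms by (cases "x \<in> frac_ideal K") (auto simp: test_fun_def)
  then show ?thesis using B(1) by (intro that[of B]) auto
qed

lemma qc_inverse: "\<eta> \<in> quasi_characters \<Longrightarrow> (\<lambda>x. inverse (\<eta> x)) \<in> quasi_characters"
  by (auto simp: quasi_characters_def intro!: continuous_intros)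

lemma conductor_cong:
  assumes "\<And>m. (\<forall>w\<in>one_units m. \<eta> w = 1) \<longleftrightarrow> (\<forall>w\<in>one_units m. \<eta>' w = 1)"
  shows "conductor_exp \<eta> = conductor_exp \<eta>'"
  unfolding conductor_exp_def one_units_eq using assms by simp

lemma conductor_inverse: "conductor_exp (\<lambda>x. inverse (\<eta> x)) = conductor_exp \<eta>"
  by (rule conductor_cong) simp

section \<open>Zeta integrals and epsilon factors of ramified characters\<close>

context haar_field
begin

lemma smooth_continuous:
  assumes "f \<in> smooth_functions" shows "continuous_on (- {0::'a}) f"
  unfolding continuous_on_def
proof
  fix x :: 'a assume "x \<in> - {0}"
  then have "\<forall>\<^sub>F y in nhds x. f y = f x" using assms by (simp add: smooth_functions_def)
  then have "(f \<longlongrightarrow> f x) (nhds x)" by (rule tendsto_eventually)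
  then show "(f \<longlongrightarrow> f x) (at x within - {0})"
    by (rule tendsto_mono[rotated]) (simp add: at_within_def)
qed

lemma test_fun_integrable: assumes "test_fun k K \<Phi>" shows "integrable dx \<Phi>"
proof -
  obtain B where B: "B \<ge> 0" "\<And>x. cmod (\<Phi> x) \<le> B" using test_fun_bounded[OF assms] by blast
  have "integrable dx (\<lambda>x. indicator (frac_ideal K) x *\<^sub>R B)"
    using dx_ideal_finite[of K] by (intro integrable_scaleR_left integrable_real_indicator) simp_all
  then show ?thesis
  proof (rule Bochner_Integration.integrable_bound)
    show "\<Phi> \<in> borel_measurable dx" using test_fun_measurable[OF assms] by simp
    show "AE x in dx. norm (\<Phi> x) \<le> norm (indicator (frac_ideal K) x *\<^sub>R B)"
      using B assms by (intro AE_I2) (auto simp: test_fun_def indicator_def)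
  qed
qed

definition zeta_coeff :: "('a \<Rightarrow> complex) \<Rightarrow> ('a \<Rightarrow> complex) \<Rightarrow> int \<Rightarrow> complex"
  where "zeta_coeff \<Phi> \<eta> n = (LINT u|\<nu>. shell_comp (\<lambda>x. \<Phi> x * \<eta> x) n u)"

lemma qc_p_powi:
  assumes "\<eta> \<in> quasi_characters" "u \<in> int_units" shows "\<eta> (p powi n * u) = \<eta> p powi n * \<eta> u"
proof -
  have pow: "\<eta> (p ^ k) = \<eta> p ^ k" for k
    by (induction k) (simp_all add: qc_one qc_mult assms)
  have "\<eta> (p powi n) = \<eta> p powi n"
  proof (cases "n \<ge> 0")
    case False
    define k where "k = nat (- n)"
    have "\<eta> (p ^ k) * \<eta> (inverse (p ^ k)) = 1"
      using qc_mult[OF assms(1), of "p ^ k" "inverse (p ^ k)"] qc_one[OF assms(1)] by simp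
    then have "\<eta> (inverse (p ^ k)) = inverse (\<eta> p ^ k)" using pow[of k] inverse_unique by metis
    then show ?thesis using False by (simp add: power_int_def k_def power_inverse)
  qed (simp add: power_int_def pow)
  then show ?thesis using qc_mult[OF assms(1), of "p powi n" u] assms(2) by (simp add: shell_iff)
qed

lemma test_fun_qc_smooth:
  fixes \<Phi> :: "'a \<Rightarrow> complex"
  assumes \<Phi>: "test_fun k K \<Phi>" and \<eta>: "\<eta> \<in> quasi_characters" shows "(\<lambda>x. \<Phi> x * \<eta> x) \<in> smooth_functions"
proof (rule shell_comp_loc_const_smooth)
  show "\<Phi> 0 * \<eta> 0 = 0" using qc_zero[OF \<eta>] by simp
  fix n
  define M where "M = max (conductor_exp \<eta>) (nat (k - n))"
  have "shell_comp (\<lambda>x. \<Phi> x * \<eta> x) n \<in> level M"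
  proof (rule levI)
    fix u w :: 'a assume u: "u \<in> int_units" and w: "w \<in> one_units M"
    have uw: "u * w \<in> int_units" using int_units_mult[OF u one_units_units[OF w]] .
    have "p powi n * u * (w - 1) \<in> frac_ideal (n + int M)"
      by (rule frac_ideal_mult) (use u w in \<open>simp_all add: frac_ideal_iff shell_iff fval_mult fval_power_int one_units_def coset_iff\<close>)
    then have "p powi n * (u * w) \<in> coset (p powi n * u) k"
      by (auto simp: coset_iff M_def algebra_simps intro: frac_ideal_mono)
    then have "\<Phi> (p powi n * (u * w)) = \<Phi> (p powi n * u)" using \<Phi> by (simp add: test_fun_def)
    moreover have "\<eta> (u * w) = \<eta> u"
      using qc_mult[OF \<eta>, of u w] qc_conductor[OF \<eta> w] u one_units_units[OF w] by (simp add: M_def shell_iff)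
    ultimately show "shell_comp (\<lambda>x. \<Phi> x * \<eta> x) n (u * w) = shell_comp (\<lambda>x. \<Phi> x * \<eta> x) n u"
      using u uw by (simp add: shell_comp_def qc_p_powi[OF \<eta>])
  qed (rule shell_comp_off)
  then show "shell_comp (\<lambda>x. \<Phi> x * \<eta> x) n \<in> loc_const" by (rule level_loc_const)
qed

text \<open>The substitution \<open>u \<mapsto> w u\<close> preserves \<open>a\<close> and
  multiplies the integral by \<open>\<eta> w \<noteq> 1\<close>.\<close>

lemma integral_char_zero:
  assumes \<eta>: "\<eta> \<in> quasi_characters" and w: "w \<in> one_units M" "\<eta> w \<noteq> 1" and a: "a \<in> level M"
  shows "(LINT u|\<nu>. a u * \<eta> u) = 0"
proof -
  have [measurable]: "(\<lambda>u. a u * \<eta> u) \<in> borel_measurable borel"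
  proof -
    have "(\<lambda>u. a u * \<eta> u) \<in> loc_const"
    proof -
      have "(\<lambda>u. a u * \<eta> u) \<in> level (max M (conductor_exp \<eta>))"
      proof (rule levI)
        fix u w' :: 'a assume u: "u \<in> int_units" and w': "w' \<in> one_units (max M (conductor_exp \<eta>))"
        have "w' \<in> one_units M" using one_units_mono[of M "max M (conductor_exp \<eta>)"] w' by auto
        then show "a (u * w') * \<eta> (u * w') = a u * \<eta> u"
          using levD[OF a u] qc_mult[OF \<eta>, of u w'] qc_conductor[OF \<eta> w'] u one_units_units[OF w'] by (simp add: shell_iff)
      qed (simp add: level_off[OF a])
      then show ?thesis by (rule level_loc_const)
    qed
    then show ?thesis by (rule loc_const_measurable)
  qed
  have wu: "w \<in> int_units" by (rule one_units_units[OF w(1)])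
  have "(LINT u|\<nu>. a u * \<eta> u) = (LINT u|\<nu>. a (w * u) * \<eta> (w * u))"
    by (rule integral_nu_mult[symmetric]) (simp_all add: wu)
  also have "\<dots> = (LINT u|\<nu>. \<eta> w * (a u * \<eta> u))"
  proof (rule integral_nu_cong)
    fix u :: 'a assume u: "u \<in> int_units"
    show "a (w * u) * \<eta> (w * u) = \<eta> w * (a u * \<eta> u)"
      using levD[OF a u w(1)] qc_mult[OF \<eta>, of w u] u wu by (simp add: mult.commute[of w u] shell_iff)
  qed measurable
  finally show ?thesis using w(2) by simp
qed

lemma ramified_witness:
  assumes "m < conductor_exp \<eta>" obtains w where "w \<in> one_units m" "\<eta> w \<noteq> 1"
  using conductor_le[of m \<eta>] assms by force

text \<open>Below \<open>K\<close> the shell misses the support of \<open>\<Phi>\<close>. From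
  \<open>k\<close> on \<open>\<Phi>\<close> is constant on the shell, and a ramified character
  integrates to 0 over the units. Hence the zeta integral is a Laurent polynomial in
  \<open>q^-s\<close>.\<close>

lemma zeta_coeff_zero:
  assumes \<Phi>: "test_fun k K \<Phi>" and \<eta>: "\<eta> \<in> quasi_characters" "conductor_exp \<eta> > 0" and n: "n \<notin> {K..<k}"
  shows "zeta_coeff \<Phi> \<eta> n = 0"
proof (cases "n < K")
  case True
  have "shell_comp (\<lambda>x. \<Phi> x * \<eta> x) n u = 0" for u
  proof (cases "u \<in> int_units")
    case u: True
    have "p powi n * u \<notin> frac_ideal K" using u True by (simp add: frac_ideal_iff shell_iff fval_mult fval_power_int)
    then show ?thesis using \<Phi> by (simp add: shell_comp_def test_fun_def)
  qed (rule shell_comp_off)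
  then show ?thesis by (simp add: zeta_coeff_def)
next
  case False
  then have nk: "n \<ge> k" using n by auto
  obtain w where w: "w \<in> one_units 0" "\<eta> w \<noteq> 1" using ramified_witness[OF \<eta>(2)] by blast
  define a :: "'a \<Rightarrow> complex" where "a u = (if u \<in> int_units then 1 else 0)" for u
  have a: "a \<in> level 0" by (rule levI) (auto simp: a_def int_units_mult one_units_units)
  have "shell_comp (\<lambda>x. \<Phi> x * \<eta> x) n u = (\<Phi> 0 * \<eta> p powi n) * (a u * \<eta> u)" for u
  proof (cases "u \<in> int_units")
    case u: True
    have "p powi n * u \<in> coset 0 k" using u nk by (simp add: coset_zero frac_ideal_iff shell_iff fval_mult fval_power_int)
    then have "\<Phi> (p powi n * u) = \<Phi> 0" using \<Phi> unfolding test_fun_def by blast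
    then show ?thesis using u by (simp add: shell_comp_def qc_p_powi[OF \<eta>(1)] a_def)
  qed (simp add: shell_comp_off a_def)
  then show ?thesis using integral_char_zero[OF \<eta>(1) w a] by (simp add: zeta_coeff_def)
qed

lemma zeta_integrand_shell_comp:
  "shell_comp (zeta_integrand \<Phi> \<eta> s) n = (\<lambda>u. qpow s powi n * shell_comp (\<lambda>x. \<Phi> x * \<eta> x) n u)"
proof
  fix u
  show "shell_comp (zeta_integrand \<Phi> \<eta> s) n u = qpow s powi n * shell_comp (\<lambda>x. \<Phi> x * \<eta> x) n u"
  proof (cases "u \<in> int_units")
    case True
    have "p powi n * u \<in> shell n" using shell_mult[OF p_powi_shell True] by simp
    from fabs_powr[OF this, of s] show ?thesis using True by (simp add: shell_comp_def zeta_integrand_def)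
  qed (simp add: shell_comp_off)
qed

text \<open>The integral is summed over shells. Absolute convergence must be checked separately from
  the vanishing of coefficients: on deep shells the integral of the norm is geometric with ratio
  \<open>cmod (qpow s) * cmod (\<eta> p)\<close>, and this is where the restriction on
  \<open>s\<close> enters.\<close>

lemma zeta_integral:
  assumes \<Phi>: "test_fun k K \<Phi>" and \<eta>: "\<eta> \<in> quasi_characters" "conductor_exp \<eta> > 0" and s: "cmod (qpow s) * cmod (\<eta> p) < 1"
  shows "integrable (mult_measure dx) (zeta_integrand \<Phi> \<eta> s)"
    and "(LINT x|mult_measure dx. zeta_integrand \<Phi> \<eta> s x) = (\<Sum>n\<in>{K..<k}. zeta_coeff \<Phi> \<eta> n * qpow s powi n)"
proof -
  let ?Z = "zeta_integrand \<Phi> \<eta> s"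
  let ?F = "shell_comp (\<lambda>x. \<Phi> x * \<eta> x)"
  note smF = test_fun_qc_smooth[OF \<Phi> \<eta>(1)]
  have LCF: "?F n \<in> loc_const" for n by (rule smooth_shell_comp_loc_const[OF smF])
  have smZ: "?Z \<in> smooth_functions"
  proof (rule shell_comp_loc_const_smooth)
    show "?Z 0 = 0" by (simp add: zeta_integrand_def qc_zero[OF \<eta>(1)])
    show "shell_comp ?Z n \<in> loc_const" for n unfolding zeta_integrand_shell_comp by (intro loc_const_scale LCF)
  qed
  define f where "f i x = indicator (shell (K + int i)) x *\<^sub>R ?Z x" for i :: nat and x
  have int: "integrable (mult_measure dx) (f i)" for i
    using smooth_set_integral(2)[OF smZ, of "K + int i"] unfolding set_integrable_def f_def[abs_def] .
  have val: "(LINT x|mult_measure dx. f i x) = zeta_coeff \<Phi> \<eta> (K + int i) * qpow s powi (K + int i)" for i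
    using smooth_set_integral(1)[OF smZ, of "K + int i"]
    by (simp add: set_lebesgue_integral_def f_def zeta_integrand_shell_comp zeta_coeff_def mult.commute)
  have single: "f i x = (if fval x = K + int i then ?Z x else 0)" for i x
    using smZ by (auto simp: f_def indicator_def shell_iff smooth_functions_def)
  have finsupp: "finite {i. f i x \<noteq> 0}" for x
    by (rule finite_subset[of _ "{nat (fval x - K)}"]) (auto simp: single)
  have sumx: "(\<lambda>i. f i x) sums ?Z x" for x
  proof -
    have "?Z x = 0" if "fval x < K \<or> x = 0"
    proof (cases "x = 0")
      case False
      then have "x \<notin> frac_ideal K" using that by (simp add: frac_ideal_iff)
      then show ?thesis using \<Phi> by (simp add: zeta_integrand_def test_fun_def)
    qed (use smZ in \<open>simp add: smooth_functions_def\<close>)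
    moreover have "(\<lambda>i. f i x) sums (\<Sum>i\<in>{nat (fval x - K)}. f i x)"
      by (rule sums_finite) (auto simp: single)
    moreover have "(\<Sum>i\<in>{nat (fval x - K)}. f i x) = (if K \<le> fval x then ?Z x else 0)" by (simp add: single)
    ultimately show ?thesis by (cases "K \<le> fval x") auto
  qed
  define C where "C = (LINT u|\<nu>. cmod (\<eta> u) * indicator int_units u)"
  have norm: "(LINT x|mult_measure dx. norm (f i x)) = cmod (qpow s) powi (K + int i) * (LINT u|\<nu>. cmod (?F (K + int i) u))" for i
  proof -
    \<comment> \<open>The norm is regarded as a complex function so that the shell formula
      \<open>smooth_set_integral\<close> applies to it.\<close>
    let ?h = "\<lambda>x. complex_of_real (cmod (?Z x))"
    have smh: "?h \<in> smooth_functions" using smZ by (auto simp: smooth_functions_def elim!: eventually_mono)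
    have "complex_of_real (LINT x|mult_measure dx. norm (f i x)) = (LINT x|mult_measure dx. complex_of_real (norm (f i x)))"
      by (rule integral_complex_of_real[symmetric])
    also have "\<dots> = set_lebesgue_integral (mult_measure dx) (shell (K + int i)) ?h"
      unfolding set_lebesgue_integral_def
      by (intro Bochner_Integration.integral_cong refl) (auto simp: f_def indicator_def)
    also have "\<dots> = (LINT u|\<nu>. shell_comp ?h (K + int i) u)" by (rule smooth_set_integral(1)[OF smh])
    also have "\<dots> = (LINT u|\<nu>. complex_of_real (cmod (qpow s) powi (K + int i) * cmod (?F (K + int i) u)))"
    proof (intro Bochner_Integration.integral_cong refl)
      fix u
      have "shell_comp ?h (K + int i) u = complex_of_real (cmod (shell_comp ?Z (K + int i) u))" by (simp add: shell_comp_def)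
      then show "shell_comp ?h (K + int i) u = complex_of_real (cmod (qpow s) powi (K + int i) * cmod (?F (K + int i) u))"
        by (simp add: zeta_integrand_shell_comp norm_mult norm_power_int)
    qed
    also have "\<dots> = complex_of_real (LINT u|\<nu>. cmod (qpow s) powi (K + int i) * cmod (?F (K + int i) u))"
      by (rule integral_complex_of_real)
    finally show ?thesis by (simp only: of_real_eq_iff) simp
  qed
  have tail: "(LINT u|\<nu>. cmod (?F n u)) = (cmod (\<Phi> 0) * C) * cmod (\<eta> p) powi n" if n: "n \<ge> k" for n
  proof -
    have "cmod (?F n u) = (cmod (\<Phi> 0) * cmod (\<eta> p) powi n) * (cmod (\<eta> u) * indicator int_units u)" for u
    proof (cases "u \<in> int_units")
      case u: True
      have "p powi n * u \<in> coset 0 k" using u n by (simp add: coset_zero frac_ideal_iff shell_iff fval_mult fval_power_int)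
      then have "\<Phi> (p powi n * u) = \<Phi> 0" using \<Phi> unfolding test_fun_def by blast
      then show ?thesis using u by (simp add: shell_comp_def qc_p_powi[OF \<eta>(1)] norm_mult norm_power_int)
    qed (simp add: shell_comp_off)
    then show ?thesis by (simp add: C_def)
  qed
  define r where "r = cmod (qpow s) * cmod (\<eta> p)"
  have r: "0 < r" "r < 1" using s qc_nz[OF \<eta>(1) p_nz] by (auto simp: r_def)
  have summ: "summable (\<lambda>i. LINT x|mult_measure dx. norm (f i x))"
  proof -
    have teq: "(LINT x|mult_measure dx. norm (f i x)) = (cmod (\<Phi> 0) * C * r powi K) * r ^ i" if "i \<ge> nat (k - K)" for i
    proof -
      have "K + int i \<ge> k" using that by simp
      moreover have "cmod (qpow s) powi (K + int i) * cmod (\<eta> p) powi (K + int i) = r powi K * r ^ i"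
        unfolding power_int_mult_distrib[symmetric] r_def[symmetric] using r by (simp add: power_int_add)
      ultimately show ?thesis unfolding norm by (simp add: tail mult_ac)
    qed
    have "eventually (\<lambda>i. (LINT x|mult_measure dx. norm (f i x)) = (cmod (\<Phi> 0) * C * r powi K) * r ^ i) sequentially"
      by (rule eventually_mono[OF eventually_ge_at_top[of "nat (k - K)"]]) (rule teq)
    from summable_cong[OF this] show ?thesis
      by (rule iffD2) (intro summable_mult summable_geometric, use r in simp)
  qed
  have AEs: "AE x in mult_measure dx. summable (\<lambda>i. norm (f i x))"
  proof (intro AE_I2)
    fix x show "summable (\<lambda>i. norm (f i x))"
      by (rule summable_finite[OF finsupp[of x]]) auto
  qed
  have Z: "?Z = (\<lambda>x. suminf (\<lambda>i. f i x))" using sumx by (intro ext) (rule sums_unique)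
  show "integrable (mult_measure dx) ?Z" unfolding Z by (rule integrable_suminf[OF int AEs summ])
  have "(LINT x|mult_measure dx. ?Z x) = suminf (\<lambda>i. LINT x|mult_measure dx. f i x)"
    unfolding Z by (rule integral_suminf[OF int AEs summ])
  also have "\<dots> = suminf (\<lambda>i. zeta_coeff \<Phi> \<eta> (K + int i) * qpow s powi (K + int i))" by (simp add: val)
  also have "\<dots> = (\<Sum>i<nat (k - K). zeta_coeff \<Phi> \<eta> (K + int i) * qpow s powi (K + int i))"
    by (rule suminf_finite) (auto intro!: zeta_coeff_zero[OF \<Phi> \<eta>])
  also have "\<dots> = (\<Sum>n\<in>{K..<k}. zeta_coeff \<Phi> \<eta> n * qpow s powi n)"
    by (rule sum.reindex_bij_witness[of _ "\<lambda>n. nat (n - K)" "\<lambda>i. K + int i"]) auto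
  finally show "(LINT x|mult_measure dx. ?Z x) = (\<Sum>n\<in>{K..<k}. zeta_coeff \<Phi> \<eta> n * qpow s powi n)" .
qed

lemma qpow_powi_holomorphic: "(\<lambda>s. qpow s powi n) holomorphic_on A"
  by (intro holomorphic_intros qpow_holomorphic) simp_all

text \<open>The use of \<open>Sum_any\<close> removes \<open>k\<close> and \<open>K\<close> from the
  formula; they differ between \<open>\<Phi>\<close> and its Fourier transform.\<close>

lemma zeta_ramified:
  assumes \<Phi>: "test_fun k K \<Phi>" and \<eta>: "\<eta> \<in> quasi_characters" "conductor_exp \<eta> > 0"
  shows "zeta dx \<Phi> \<eta> s = Sum_any (\<lambda>n. zeta_coeff \<Phi> \<eta> n * qpow s powi n)"
proof -
  define h where "h s = (\<Sum>n\<in>{K..<k}. zeta_coeff \<Phi> \<eta> n * qpow s powi n)" for s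
  have "cmod (\<eta> p) > 0" using qc_nz[OF \<eta>(1) p_nz] by simp
  then obtain \<sigma> where \<sigma>: "\<And>s. \<sigma> < Re s \<Longrightarrow> cmod (qpow s) < 1 / cmod (\<eta> p)"
    using norm_qpow_less[of "1 / cmod (\<eta> p)"] by auto
  have "h holomorphic_on UNIV" unfolding h_def[abs_def] by (intro holomorphic_intros qpow_powi_holomorphic)
  then have "h nicely_meromorphic_on UNIV"
    by (intro analytic_on_imp_nicely_meromorphic_on) (simp add: analytic_on_open)
  moreover have "integrable (mult_measure dx) (zeta_integrand \<Phi> \<eta> s) \<and> h s = (LINT x|mult_measure dx. zeta_integrand \<Phi> \<eta> s x)"
    if "\<sigma> < Re s" for s
  proof -
    have "cmod (qpow s) * cmod (\<eta> p) < 1" using \<sigma>[OF that] \<open>cmod (\<eta> p) > 0\<close> by (simp add: field_simps)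
    from zeta_integral[OF \<Phi> \<eta> this] show ?thesis by (simp add: h_def)
  qed
  ultimately have "mero_continuation (\<lambda>s. integrable (mult_measure dx) (zeta_integrand \<Phi> \<eta> s))
      (\<lambda>s. LINT x|mult_measure dx. zeta_integrand \<Phi> \<eta> s x) h"
    unfolding mero_continuation_def by blast
  then have "zeta dx \<Phi> \<eta> = h" unfolding zeta_def by (rule mero_continuation_the)
  then show ?thesis unfolding h_def
    by (simp only:) (rule Sum_any.expand_superset[symmetric], use zeta_coeff_zero[OF \<Phi> \<eta>] in force, use zeta_coeff_zero[OF \<Phi> \<eta>] in force)
qed

end

section \<open>Fourier transforms and Gauss sums\<close>

context additive_char_field
begin

text \<open>Constancy: \<open>\<psi>\<close> is trivial on \<open>P^K P^(- K)\<close>. Support: if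
  \<open>y\<close> lies outside \<open>P^(- k)\<close>, some \<open>a\<close> in \<open>P^k\<close>
  has \<open>\<psi> (a y) \<noteq> 1\<close>, and translation by \<open>a\<close>, which preserves
  \<open>\<Phi>\<close>, multiplies the transform by this number.\<close>

lemma fourier_test_fun:
  assumes \<Phi>: "test_fun k K \<Phi>" shows "test_fun (- K) (- k) (fourier \<psi> dx \<Phi>)"
  unfolding test_fun_def
proof (intro conjI allI impI)
  fix x y :: 'a assume y: "y \<in> coset x (- K)"
  have eq: "\<Phi> t * \<psi> (t * y) = \<Phi> t * \<psi> (t * x)" for t
  proof (cases "t \<in> frac_ideal K")
    case True
    have "t * y - t * x = t * (y - x)" by (simp add: algebra_simps)
    moreover have "t * (y - x) \<in> frac_ideal (K + - K)" using True y by (intro frac_ideal_mult) (simp_all add: coset_iff)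
    ultimately have "\<psi> (t * y) = \<psi> (t * x)" by (intro psi_cong) simp
    then show ?thesis by simp
  qed (use \<Phi> in \<open>simp add: test_fun_def\<close>)
  show "fourier \<psi> dx \<Phi> y = fourier \<psi> dx \<Phi> x" unfolding fourier_def eq ..
next
  fix y :: 'a assume y: "y \<notin> frac_ideal (- k)"
  then have y0: "y \<noteq> 0" "fval y < - k" by (auto simp: frac_ideal_iff)
  obtain x where x: "x \<in> frac_ideal (- 1)" "\<psi> x \<noteq> 1" using psi_nontriv by blast
  define a where "a = x / y"
  have "a * y = x" using y0 by (simp add: a_def)
  have a: "a \<in> frac_ideal k"
    using x(1) y0 by (cases "x = 0") (auto simp: a_def frac_ideal_iff fval_divide)
  note [measurable] = test_fun_measurable[OF \<Phi>]
  have "\<Phi> (a + t) = \<Phi> t" for t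
  proof -
    have "a + t \<in> coset t k" using a by (simp add: coset_iff)
    then show ?thesis using \<Phi> by (simp add: test_fun_def)
  qed
  then have trans: "\<Phi> (a + t) * \<psi> ((a + t) * y) = \<psi> x * (\<Phi> t * \<psi> (t * y))" for t
    unfolding distrib_right \<open>a * y = x\<close> psi_add by simp
  have "(LINT t|dx. \<Phi> (a + t) * \<psi> ((a + t) * y)) = (LINT t|dx. \<psi> x * (\<Phi> t * \<psi> (t * y)))"
    by (intro Bochner_Integration.integral_cong refl trans)
  moreover have "(LINT t|dx. \<Phi> (a + t) * \<psi> ((a + t) * y)) = (LINT t|dx. \<Phi> t * \<psi> (t * y))"
    by (rule integral_dx_translate) measurable
  ultimately have "fourier \<psi> dx \<Phi> y = \<psi> x * fourier \<psi> dx \<Phi> y" by (simp add: fourier_def)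
  then show "fourier \<psi> dx \<Phi> y = 0" using x(2) by simp
qed

text \<open>The Gauss sum in the form of the integral of \<open>\<psi> \<eta>\<close> over shell
  \<open>j\<close>. For ramified \<open>\<eta>\<close> it can be nonzero for one value of
  \<open>j\<close> only.\<close>

definition gauss :: "('a \<Rightarrow> complex) \<Rightarrow> int \<Rightarrow> complex"
  where "gauss \<eta> j = (LINT u|\<nu>. shell_comp (\<lambda>x. \<psi> x * \<eta> x) j u)"

lemma psi_qc_smooth:
  assumes "\<eta> \<in> quasi_characters" shows "(\<lambda>x. \<psi> x * \<eta> x) \<in> smooth_functions"
proof (rule shell_comp_loc_const_smooth)
  show "\<psi> 0 * \<eta> 0 = 0" using qc_zero[OF assms] by simp
  fix n
  define M where "M = max (conductor_exp \<eta>) (nat (- n))"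
  have "shell_comp (\<lambda>x. \<psi> x * \<eta> x) n \<in> level M"
  proof (rule levI)
    fix u w :: 'a assume u: "u \<in> int_units" and w: "w \<in> one_units M"
    have uw: "u * w \<in> int_units" using int_units_mult[OF u one_units_units[OF w]] .
    have "p powi n * u * (w - 1) \<in> frac_ideal (n + int M)"
      by (rule frac_ideal_mult) (use u w in \<open>simp_all add: frac_ideal_iff shell_iff fval_mult fval_power_int one_units_def coset_iff\<close>)
    then have "p powi n * (u * w) - p powi n * u \<in> ring_of_integers"
      by (auto simp: M_def algebra_simps intro: frac_ideal_mono)
    then have "\<psi> (p powi n * (u * w)) = \<psi> (p powi n * u)" by (rule psi_cong)
    moreover have "\<eta> (u * w) = \<eta> u"
      using qc_mult[OF assms, of u w] qc_conductor[OF assms w] u one_units_units[OF w] by (simp add: M_def shell_iff)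
    ultimately show "shell_comp (\<lambda>x. \<psi> x * \<eta> x) n (u * w) = shell_comp (\<lambda>x. \<psi> x * \<eta> x) n u"
      using u uw by (simp add: shell_comp_def qc_p_powi[OF assms])
  qed (rule shell_comp_off)
  then show "shell_comp (\<lambda>x. \<psi> x * \<eta> x) n \<in> loc_const" by (rule level_loc_const)
qed

lemma psi_twist_shell_comp: "psi_twist l \<eta> = shell_comp (\<lambda>x. \<psi> x * \<eta> x) (- int l)"
proof
  fix u
  have "p powi (- int l) * u = u / p ^ l" by (simp add: power_int_minus field_simps)
  then show "psi_twist l \<eta> u = shell_comp (\<lambda>x. \<psi> x * \<eta> x) (- int l) u" by (simp add: psi_twist_def shell_comp_def)
qed

lemma ind_units_level: "(\<lambda>u. if u \<in> int_units then 1 else 0) \<in> level m"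
  by (rule levI) (auto intro: int_units_mult one_units_units)

text \<open>Below minus the conductor \<open>\<psi>\<close> oscillates on cosets on which
  \<open>\<eta>\<close> is constant, so the average of the component is 0. Above it,
  \<open>\<psi>\<close> on the shell is invariant under a subgroup on which \<open>\<eta>\<close> is
  still nontrivial.\<close>

lemma gauss_zero:
  assumes \<eta>: "\<eta> \<in> quasi_characters" "conductor_exp \<eta> > 0" and j: "j \<noteq> - int (conductor_exp \<eta>)"
  shows "gauss \<eta> j = 0"
proof (cases "j < - int (conductor_exp \<eta>)")
  case True
  define l where "l = nat (- j)"
  have l: "j = - int l" "max (conductor_exp \<eta>) 1 < l" using True \<eta>(2) by (auto simp: l_def)
  have loc_const: "psi_twist l \<eta> \<in> loc_const" using psi_twist_level[OF \<eta>(1), of l] l(2) by (intro level_loc_const[of _ l]) simp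
  have "uconv (proj 0) (psi_twist l \<eta>) = 0" using l(2) by (intro proj_psi_twist \<eta>) auto
  from integral_zero_if_proj[OF loc_const this ind_units_level]
  have "(LINT u|\<nu>. psi_twist l \<eta> u * (if u \<in> int_units then 1 else 0)) = 0" .
  moreover have "psi_twist l \<eta> u * (if u \<in> int_units then 1 else 0) = psi_twist l \<eta> u" for u by (simp add: psi_twist_def)
  ultimately show ?thesis unfolding gauss_def l(1) psi_twist_shell_comp[symmetric] by simp
next
  case False
  define m where "m = conductor_exp \<eta> - 1"
  have jm: "0 \<le> j + int m" using False j \<eta>(2) by (simp add: m_def of_nat_diff)
  obtain w where w: "w \<in> one_units m" "\<eta> w \<noteq> 1" using ramified_witness[of m \<eta>] \<eta>(2) by (auto simp: m_def)
  define a where "a u = (if u \<in> int_units then \<psi> (p powi j * u) * \<eta> p powi j else 0)" for u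
  have "a \<in> level m"
  proof (rule levI)
    fix u w :: 'a assume u: "u \<in> int_units" and w: "w \<in> one_units m"
    have uw: "u * w \<in> int_units" using int_units_mult[OF u one_units_units[OF w]] .
    have "p powi j * u * (w - 1) \<in> frac_ideal (j + int m)"
      by (rule frac_ideal_mult) (use u w in \<open>simp_all add: frac_ideal_iff shell_iff fval_mult fval_power_int one_units_def coset_iff\<close>)
    then have "p powi j * (u * w) - p powi j * u \<in> ring_of_integers"
      using jm by (auto simp: algebra_simps intro: frac_ideal_mono)
    then have "\<psi> (p powi j * (u * w)) = \<psi> (p powi j * u)" by (rule psi_cong)
    then show "a (u * w) = a u" using u uw by (simp add: a_def)
  qed (simp add: a_def)
  from integral_char_zero[OF \<eta>(1) w this] have "(LINT u|\<nu>. a u * \<eta> u) = 0" .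
  moreover have "a u * \<eta> u = shell_comp (\<lambda>x. \<psi> x * \<eta> x) j u" for u by (simp add: a_def shell_comp_def qc_p_powi[OF \<eta>(1)])
  ultimately show ?thesis by (simp add: gauss_def)
qed

lemma qc_shell_comp_loc_const:
  assumes "\<eta> \<in> quasi_characters" shows "shell_comp \<eta> n \<in> loc_const"
proof -
  have "shell_comp \<eta> n \<in> level (conductor_exp \<eta>)"
  proof (rule levI)
    fix u w :: 'a assume u: "u \<in> int_units" and w: "w \<in> one_units (conductor_exp \<eta>)"
    have "\<eta> (p powi n * u * w) = \<eta> (p powi n * u) * \<eta> w"
      using u one_units_units[OF w] by (intro qc_mult[OF assms]) (simp_all add: shell_iff)
    then show "shell_comp \<eta> n (u * w) = shell_comp \<eta> n u"
      using qc_conductor[OF assms w order_refl] u int_units_mult[OF u one_units_units[OF w]] by (simp add: shell_comp_def mult.assoc)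
  qed (rule shell_comp_off)
  then show ?thesis by (rule level_loc_const)
qed

text \<open>Absorbing the unit part of \<open>x\<close> into \<open>u\<close> leaves
  \<open>\<eta> x\<close> times a Gauss sum on shell \<open>fval x + n\<close>, and
  \<open>gauss_zero\<close> then confines \<open>x\<close> to one shell. For \<open>x = 0\<close>
  the ramified character alone is integrated, giving 0.\<close>

lemma psi_shell_integral:
  assumes \<eta>: "\<eta> \<in> quasi_characters" "conductor_exp \<eta> > 0"
  shows "(LINT u|\<nu>. \<psi> (x * (p powi n * u)) * shell_comp (\<lambda>y. inverse (\<eta> y)) n u)
    = \<eta> x * (if x \<in> shell (- int (conductor_exp \<eta>) - n) then gauss (\<lambda>y. inverse (\<eta> y)) (- int (conductor_exp \<eta>)) else 0)"
proof -
  let ?\<eta> = "\<lambda>y. inverse (\<eta> y)"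
  have \<eta>': "?\<eta> \<in> quasi_characters" "conductor_exp ?\<eta> > 0" using qc_inverse[OF \<eta>(1)] \<eta>(2) by (simp_all add: conductor_inverse)
  have loc_const: "shell_comp ?\<eta> n \<in> loc_const" for n by (rule qc_shell_comp_loc_const[OF \<eta>'(1)])
  note [measurable] = loc_const_measurable[OF loc_const] loc_const_measurable[OF smooth_shell_comp_loc_const[OF psi_qc_smooth[OF \<eta>'(1)]]]
  show ?thesis
  proof (cases "x = 0")
    case True
    obtain w where w: "w \<in> one_units 0" "?\<eta> w \<noteq> 1" using ramified_witness[OF \<eta>'(2)] by blast
    have "shell_comp ?\<eta> n u = ?\<eta> p powi n * ((if u \<in> int_units then 1 else 0) * ?\<eta> u)" for u
      using qc_p_powi[OF \<eta>'(1), of u n] by (simp add: shell_comp_def)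
    then have "(LINT u|\<nu>. shell_comp ?\<eta> n u) = 0"
      using integral_char_zero[OF \<eta>'(1) w ind_units_level] by simp
    then show ?thesis using True qc_zero[OF \<eta>(1)] by (simp add: psi_O)
  next
    case False
    define m where "m = fval x"
    define v where "v = x * p powi (- m)"
    have v: "v \<in> int_units" "p powi m * v = x" using shell_decomp[OF False] by (auto simp: v_def m_def)
    have "(LINT u|\<nu>. \<psi> (x * (p powi n * u)) * shell_comp ?\<eta> n u)
        = (LINT u|\<nu>. \<psi> (x * (p powi n * (inverse v * u))) * shell_comp ?\<eta> n (inverse v * u))"
      by (rule integral_nu_mult[symmetric]) (measurable, use v in simp)
    also have "\<dots> = (LINT u|\<nu>. \<eta> x * shell_comp (\<lambda>x. \<psi> x * ?\<eta> x) (m + n) u)"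
    proof (rule integral_nu_cong)
      fix u :: 'a assume u: "u \<in> int_units"
      have vu: "inverse v * u \<in> int_units" using v u by (simp add: int_units_mult)
      have nz: "u \<noteq> 0" "v \<noteq> 0" using u v by (auto simp: shell_iff)
      have e1: "x * (p powi n * (inverse v * u)) = p powi (m + n) * u"
        using nz by (subst v(2)[symmetric]) (simp add: power_int_add field_simps)
      have "?\<eta> (x * (p powi n * (inverse v * u))) = ?\<eta> x * ?\<eta> (p powi n * (inverse v * u))"
        by (rule qc_mult[OF \<eta>'(1)]) (use False nz in simp_all)
      then have "?\<eta> (p powi (m + n) * u) = ?\<eta> x * ?\<eta> (p powi n * (inverse v * u))" unfolding e1 .
      then show "\<psi> (x * (p powi n * (inverse v * u))) * shell_comp ?\<eta> n (inverse v * u)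
          = \<eta> x * shell_comp (\<lambda>x. \<psi> x * ?\<eta> x) (m + n) u"
        unfolding e1 using u vu qc_nz[OF \<eta>(1) False] by (simp add: shell_comp_def)
    qed measurable
    also have "\<dots> = \<eta> x * gauss ?\<eta> (m + n)" by (simp add: gauss_def)
    also have "gauss ?\<eta> (m + n) = (if x \<in> shell (- int (conductor_exp \<eta>) - n) then gauss ?\<eta> (- int (conductor_exp \<eta>)) else 0)"
    proof (cases "m + n = - int (conductor_exp \<eta>)")
      case True
      then show ?thesis using False by (auto simp: shell_iff m_def)
    next
      case ne: False
      then have "x \<notin> shell (- int (conductor_exp \<eta>) - n)" by (auto simp: shell_iff m_def)
      then show ?thesis using gauss_zero[OF \<eta>', of "m + n"] ne by (simp add: conductor_inverse)
    qed
    finally show ?thesis .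
  qed
qed

text \<open>Exchange the integrals and integrate over the units first:
  \<open>psi_shell_integral\<close> confines \<open>x\<close> to shell \<open>- c - n\<close> and
  leaves \<open>\<Phi> x * \<eta> x\<close> times the Gauss sum. The power of \<open>q\<close> is
  the value of \<open>fabs\<close> on that shell, converting \<open>dx\<close> to the multiplicative
  measure.\<close>

lemma zeta_coeff_fourier:
  assumes \<Phi>: "test_fun k K \<Phi>" and \<eta>: "\<eta> \<in> quasi_characters" "conductor_exp \<eta> > 0"
  defines "c \<equiv> int (conductor_exp \<eta>)"
  shows "zeta_coeff (fourier \<psi> dx \<Phi>) (\<lambda>y. inverse (\<eta> y)) n
    = gauss (\<lambda>y. inverse (\<eta> y)) (- c) * of_real (q powi (c + n)) * zeta_coeff \<Phi> \<eta> (- c - n)"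
proof -
  let ?\<eta> = "\<lambda>y. inverse (\<eta> y)" and ?\<tau> = "gauss (\<lambda>y. inverse (\<eta> y)) (- c)"
  have \<eta>': "?\<eta> \<in> quasi_characters" by (rule qc_inverse[OF \<eta>(1)])
  obtain B where B: "B \<ge> 0" "\<And>x. cmod (\<Phi> x) \<le> B" using test_fun_bounded[OF \<Phi>] by blast
  have loc_const: "shell_comp ?\<eta> n \<in> loc_const" by (rule qc_shell_comp_loc_const[OF \<eta>'])
  obtain E where E: "E \<ge> 0" "\<And>u. cmod (shell_comp ?\<eta> n u) \<le> E" using loc_const_bounded[OF loc_const] by blast
  have \<Phi>\<eta>: "(\<lambda>x. \<Phi> x * \<eta> x) \<in> smooth_functions" by (rule test_fun_qc_smooth[OF \<Phi> \<eta>(1)])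
  note [measurable] = test_fun_measurable[OF \<Phi>] loc_const_measurable[OF loc_const] smooth_measurable[OF \<Phi>\<eta>]
  let ?h = "\<lambda>u x. \<Phi> x * \<psi> (x * (p powi n * u)) * shell_comp ?\<eta> n u"
  have "zeta_coeff (fourier \<psi> dx \<Phi>) ?\<eta> n = (LINT u|\<nu>. LINT x|dx. ?h u x)"
    unfolding zeta_coeff_def
  proof (intro Bochner_Integration.integral_cong refl)
    fix u
    show "shell_comp (\<lambda>x. fourier \<psi> dx \<Phi> x * ?\<eta> x) n u = (LINT x|dx. ?h u x)"
      by (cases "u \<in> int_units") (simp_all add: shell_comp_def fourier_def)
  qed
  also have "\<dots> = (LINT x|dx. LINT u|\<nu>. ?h u x)"
  proof -
    interpret P: pair_sigma_finite \<nu> dx by standard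
    \<comment> \<open>The dominating function is constant in \<open>u\<close> (its factor
      \<open>indicator UNIV u\<close> is 1) and integrable because \<open>\<nu>\<close> is
      finite.\<close>
    have int0: "integrable (\<nu> \<Otimes>\<^sub>M dx) (\<lambda>(u, x). (E::complex) * (indicator UNIV u * \<Phi> x))"
    proof (rule P.Fubini_integrable)
      show "(\<lambda>(u, x). (E::complex) * (indicator UNIV u * \<Phi> x)) \<in> borel_measurable (\<nu> \<Otimes>\<^sub>M dx)" by measurable
      show "integrable \<nu> (\<lambda>u. LINT x|dx. norm (case (u, x) of (u, x) \<Rightarrow> (E::complex) * (indicator UNIV u * \<Phi> x)))" by simp
      show "AE u in \<nu>. integrable dx (\<lambda>x. case (u, x) of (u, x) \<Rightarrow> (E::complex) * (indicator UNIV u * \<Phi> x))"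
        using test_fun_integrable[OF \<Phi>] by simp
    qed
    have "integrable (\<nu> \<Otimes>\<^sub>M dx) (\<lambda>(u, x). ?h u x)"
    proof (rule Bochner_Integration.integrable_bound[OF int0])
      show "(\<lambda>(u, x). ?h u x) \<in> borel_measurable (\<nu> \<Otimes>\<^sub>M dx)" by measurable
      show "AE z in \<nu> \<Otimes>\<^sub>M dx. norm (case z of (u, x) \<Rightarrow> ?h u x) \<le> norm (case z of (u, x) \<Rightarrow> (E::complex) * (indicator UNIV u * \<Phi> x))"
      proof (intro AE_I2)
        fix z :: "'a \<times> 'a"
        obtain u x where z: "z = (u, x)" by force
        have "cmod (\<Phi> x) * cmod (shell_comp ?\<eta> n u) \<le> cmod (\<Phi> x) * E" using E by (intro mult_left_mono) auto
        then show "norm (case z of (u, x) \<Rightarrow> ?h u x) \<le> norm (case z of (u, x) \<Rightarrow> (E::complex) * (indicator UNIV u * \<Phi> x))"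
          using E(1) by (simp add: z norm_mult mult.commute)
      qed
    qed
    then show ?thesis by (rule P.Fubini_integral[symmetric])
  qed
  also have "\<dots> = (LINT x|dx. ?\<tau> * (indicator (shell (- c - n)) x * (\<Phi> x * \<eta> x)))"
  proof (intro Bochner_Integration.integral_cong refl)
    fix x
    have "(LINT u|\<nu>. ?h u x) = \<Phi> x * (LINT u|\<nu>. \<psi> (x * (p powi n * u)) * shell_comp ?\<eta> n u)"
      by (simp add: mult.assoc)
    then show "(LINT u|\<nu>. ?h u x) = ?\<tau> * (indicator (shell (- c - n)) x * (\<Phi> x * \<eta> x))"
      unfolding psi_shell_integral[OF \<eta>] by (simp add: c_def indicator_def)
  qed
  also have "\<dots> = ?\<tau> * (LINT x|dx. indicator (shell (- c - n)) x * (\<Phi> x * \<eta> x))" by simp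
  also have "(LINT x|dx. indicator (shell (- c - n)) x * (\<Phi> x * \<eta> x)) = of_real (q powi (c + n)) * zeta_coeff \<Phi> \<eta> (- c - n)"
  proof -
    have "zeta_coeff \<Phi> \<eta> (- c - n) = set_lebesgue_integral (mult_measure dx) (shell (- c - n)) (\<lambda>x. \<Phi> x * \<eta> x)"
      unfolding zeta_coeff_def by (rule smooth_set_integral(1)[OF \<Phi>\<eta>, symmetric])
    also have "\<dots> = of_real (q powi (- c - n)) * (LINT x|dx. indicator (shell (- c - n)) x * (\<Phi> x * \<eta> x))"
      using set_integral_shell_dx(1)[of "\<lambda>x. \<Phi> x * \<eta> x" "- c - n"] by simp
    finally have "zeta_coeff \<Phi> \<eta> (- c - n) = of_real (q powi (- c - n)) * (LINT x|dx. indicator (shell (- c - n)) x * (\<Phi> x * \<eta> x))" .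
    moreover have "complex_of_real (q powi (c + n)) * of_real (q powi (- c - n)) = 1"
      unfolding of_real_mult[symmetric] by (simp add: power_int_add[symmetric])
    ultimately show ?thesis by (simp add: mult.assoc[symmetric])
  qed
  finally show ?thesis by (simp add: mult.assoc)
qed

lemma qpow_one_minus: "qpow (1 - s) = inverse (of_real q * qpow s)"
proof -
  have "complex_of_real q = exp (of_real (ln q))" by (simp add: exp_of_real)
  then have "of_real q * qpow s = exp (of_real (ln q) + - s * of_real (ln q))" unfolding qpow_def by (simp only: mult_exp_exp)
  moreover have "qpow (1 - s) = exp (- (of_real (ln q) + - s * of_real (ln q)))" by (simp add: qpow_def algebra_simps)
  ultimately show ?thesis by (simp only: exp_minus)
qed

text \<open>Coefficient \<open>n\<close> on the left belongs to coefficient \<open>- c - n\<close>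
  on the right. As \<open>qpow (1 - s)\<close> is the inverse of \<open>q * qpow s\<close>,
  reindexing leaves one monomial in front, independent of \<open>\<Phi>\<close>.\<close>

lemma functional_equation:
  assumes \<Phi>: "\<Phi> \<in> schwartz_bruhat" and \<eta>: "\<eta> \<in> quasi_characters" "conductor_exp \<eta> > 0"
  shows "zeta dx (fourier \<psi> dx \<Phi>) (\<lambda>y. inverse (\<eta> y)) (1 - s)
    = gauss (\<lambda>y. inverse (\<eta> y)) (- int (conductor_exp \<eta>)) * (of_real q * qpow s) powi int (conductor_exp \<eta>) * zeta dx \<Phi> \<eta> s"
proof -
  obtain k K where test_fun: "test_fun k K \<Phi>" using schwartz_bruhat_test_fun[OF \<Phi>] .
  let ?\<eta> = "\<lambda>y. inverse (\<eta> y)" and ?c = "int (conductor_exp \<eta>)"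
  have \<eta>': "?\<eta> \<in> quasi_characters" "conductor_exp ?\<eta> > 0" using qc_inverse[OF \<eta>(1)] \<eta>(2) by (simp_all add: conductor_inverse)
  define X where "X = of_real q * qpow s"
  have X: "X \<noteq> 0" by (simp add: X_def)
  let ?g = "\<lambda>m. zeta_coeff \<Phi> \<eta> m * qpow s powi m"
  have fin: "finite {m. ?g m \<noteq> 0}"
    by (rule finite_subset[of _ "{K..<k}"]) (use zeta_coeff_zero[OF test_fun \<eta>] in force, simp)
  have summand: "zeta_coeff (fourier \<psi> dx \<Phi>) ?\<eta> n * qpow (1 - s) powi n = (gauss ?\<eta> (- ?c) * X powi ?c) * ?g (- ?c - n)" for n
  proof -
    have q: "complex_of_real (q powi (?c + n)) = of_real q powi (?c + n)" by (rule of_real_power_int)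
    have "qpow (1 - s) powi n = X powi (- n)"
      unfolding qpow_one_minus X_def[symmetric] by (simp add: power_int_minus power_int_inverse)
    moreover have "of_real q powi (?c + n) * X powi (- n) = X powi ?c * qpow s powi (- ?c - n)"
      unfolding X_def power_int_mult_distrib by (simp add: power_int_add power_int_diff power_int_minus field_simps)
    ultimately show ?thesis unfolding zeta_coeff_fourier[OF test_fun \<eta>] q by (simp add: mult_ac)
  qed
  have "zeta dx (fourier \<psi> dx \<Phi>) ?\<eta> (1 - s) = Sum_any (\<lambda>n. zeta_coeff (fourier \<psi> dx \<Phi>) ?\<eta> n * qpow (1 - s) powi n)"
    by (rule zeta_ramified[OF fourier_test_fun[OF test_fun] \<eta>'])
  also have "\<dots> = Sum_any (\<lambda>n. (gauss ?\<eta> (- ?c) * X powi ?c) * ?g (- ?c - n))" by (simp only: summand)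
  also have "\<dots> = Sum_any (\<lambda>m. (gauss ?\<eta> (- ?c) * X powi ?c) * ?g m)"
  proof (rule Sum_any.reindex_cong[of "\<lambda>m. - ?c - m"])
    show "bij (\<lambda>m. - ?c - m)" by (rule bij_betw_byWitness[of _ "\<lambda>m. - ?c - m"]) auto
  qed (simp add: fun_eq_iff)
  also have "\<dots> = (gauss ?\<eta> (- ?c) * X powi ?c) * Sum_any ?g" by (rule Sum_any_right_distrib[OF fin, symmetric])
  also have "Sum_any ?g = zeta dx \<Phi> \<eta> s" by (rule zeta_ramified[OF test_fun \<eta>, symmetric])
  finally show ?thesis by (simp add: X_def)
qed

text \<open>The indicator of \<open>1 + P^c\<close>, with \<open>c\<close> the conductor, has a
  constant nonzero zeta function, because \<open>\<eta>\<close> is 1 there and only shell 0 is met.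
  It forces uniqueness of the epsilon factor.\<close>

lemma ramified_test_function:
  assumes \<eta>: "\<eta> \<in> quasi_characters" "conductor_exp \<eta> > 0"
  obtains \<Phi> v where "\<Phi> \<in> schwartz_bruhat" "v \<noteq> 0" "\<And>s. zeta dx \<Phi> \<eta> s = v"
proof -
  define c where "c = conductor_exp \<eta>"
  have c: "c > 0" and cc: "conductor_exp \<eta> \<le> c" using \<eta> by (simp_all add: c_def)
  define \<Phi> :: "'a \<Rightarrow> complex" where "\<Phi> x = (if x \<in> coset 1 (int c) then 1 else 0)" for x
  have ou: "coset (1::'a) (int c) = one_units c"
    using coset_shell[of "1::'a" 0 "int c"] c by (auto simp: one_units_def)
  have test_fun: "test_fun (int c) 0 \<Phi>"
    unfolding test_fun_def
  proof (intro conjI allI impI)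
    fix x y :: 'a assume "y \<in> coset x (int c)"
    then have "x \<in> coset 1 (int c) \<longleftrightarrow> y \<in> coset 1 (int c)" using coset_eq[of y x "int c"] coset_sym[of x 1] coset_sym[of y 1] by metis
    then show "\<Phi> y = \<Phi> x" by (simp add: \<Phi>_def)
  next
    fix x :: 'a assume "x \<notin> ring_of_integers"
    then show "\<Phi> x = 0" unfolding \<Phi>_def ou using one_units_units[of x c] shell_subset[of 0] by auto
  qed
  have "\<Phi> \<in> schwartz_bruhat"
    using test_fun_locally_constant[OF test_fun] compact_coset[of "1::'a" "int c"] unfolding schwartz_bruhat_def
    by (auto simp: \<Phi>_def intro!: exI[of _ "coset 1 (int c)"])
  define v where "v = complex_of_real (measure \<nu> (one_units c))"
  have "zeta_coeff \<Phi> \<eta> n = (if n = 0 then v else 0)" for n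
  proof (cases "n = 0")
    case True
    have "shell_comp (\<lambda>x. \<Phi> x * \<eta> x) 0 u = indicator (one_units c) u *\<^sub>R 1" for u
      using qc_conductor[OF \<eta>(1), of u c] one_units_units[of u c] cc by (auto simp: shell_comp_def \<Phi>_def ou indicator_def)
    then show ?thesis using True by (simp add: zeta_coeff_def v_def scaleR_conv_of_real)
  next
    case False
    have "shell_comp (\<lambda>x. \<Phi> x * \<eta> x) n u = 0" for u
    proof (cases "u \<in> int_units")
      case u: True
      then have "p powi n * u \<notin> int_units" using False by (simp add: shell_iff fval_mult fval_power_int)
      then show ?thesis using one_units_units by (auto simp: shell_comp_def \<Phi>_def ou)
    qed (rule shell_comp_off)
    then show ?thesis using False by (simp add: zeta_coeff_def)
  qed
  then have "zeta dx \<Phi> \<eta> s = v" for s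
    unfolding zeta_ramified[OF test_fun \<eta>] by (subst Sum_any.expand_superset[of "{0}"]) auto
  moreover have "v \<noteq> 0" using measure_one_units[of c] by (simp add: v_def)
  ultimately show ?thesis using \<open>\<Phi> \<in> schwartz_bruhat\<close> by (intro that)
qed

text \<open>Both L-factors are 1, so the functional equation exhibits the monomial as a solution.
  Any other solution agrees with it off a sparse set, by the test function with constant zeta
  function, and hence everywhere as both are entire.\<close>

lemma epsilon_ramified:
  assumes \<eta>: "\<eta> \<in> quasi_characters" "conductor_exp \<eta> > 0"
  shows "epsilon p \<psi> dx \<eta> s
    = gauss (\<lambda>y. inverse (\<eta> y)) (- int (conductor_exp \<eta>)) * (of_real q * qpow s) powi int (conductor_exp \<eta>)"
proof -
  let ?\<eta> = "\<lambda>y. inverse (\<eta> y)"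
  define e where "e s = gauss ?\<eta> (- int (conductor_exp \<eta>)) * (of_real q * qpow s) powi int (conductor_exp \<eta>)" for s
  have L: "L_factor p \<eta> s = 1" "L_factor p ?\<eta> s = 1" for s
    using \<eta>(2) by (simp_all add: L_factor_def conductor_inverse)
  have hol: "e holomorphic_on UNIV" unfolding e_def[abs_def] by (intro holomorphic_intros qpow_holomorphic) simp_all
  have "epsilon p \<psi> dx \<eta> = e"
    unfolding epsilon_def L div_by_1
  proof (rule the_equality)
    show "e holomorphic_on UNIV \<and> (\<forall>\<Phi>\<in>schwartz_bruhat. \<forall>\<^sub>\<approx>s\<in>UNIV. zeta dx (fourier \<psi> dx \<Phi>) ?\<eta> (1 - s) = e s * zeta dx \<Phi> \<eta> s)"
      using hol functional_equation[OF _ \<eta>] by (simp add: e_def)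
  next
    fix e' assume e': "e' holomorphic_on UNIV \<and> (\<forall>\<Phi>\<in>schwartz_bruhat. \<forall>\<^sub>\<approx>s\<in>UNIV. zeta dx (fourier \<psi> dx \<Phi>) ?\<eta> (1 - s) = e' s * zeta dx \<Phi> \<eta> s)"
    obtain \<Phi> v where \<Phi>: "\<Phi> \<in> schwartz_bruhat" "v \<noteq> 0" "\<And>s. zeta dx \<Phi> \<eta> s = v"
      by (rule ramified_test_function[OF \<eta>]) (rule that)
    have "\<forall>\<^sub>\<approx>s\<in>UNIV. zeta dx (fourier \<psi> dx \<Phi>) ?\<eta> (1 - s) = e' s * zeta dx \<Phi> \<eta> s" using e' \<Phi>(1) by blast
    then have "\<forall>\<^sub>\<approx>s\<in>UNIV. e' s = e s"
      unfolding functional_equation[OF \<Phi>(1) \<eta>] \<Phi>(3) e_def by eventually_elim (use \<Phi>(2) in simp)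
    then have "remove_sings e' = remove_sings e" by (rule remove_sings_cong_cosparse)
    moreover have "e' nicely_meromorphic_on UNIV" "e nicely_meromorphic_on UNIV"
      using e' hol by (auto intro!: analytic_on_imp_nicely_meromorphic_on simp: analytic_on_open)
    ultimately show "e' = e" using remove_sings_nicely_meromorphic_eq by metis
  qed
  then show ?thesis by (simp add: e_def)
qed

section \<open>The Mellin transform of the germs\<close>

lemma unit_char_ext_qc:
  assumes "\<xi> \<in> unit_characters" shows "unit_char_ext p \<xi> \<in> quasi_characters"
proof -
  have c: "shell_comp (unit_char_ext p \<xi>) n = \<xi>" for n
  proof
    fix u show "shell_comp (unit_char_ext p \<xi>) n u = \<xi> u"
    proof (cases "u \<in> int_units")
      case True
      have "p powi n * u \<in> shell n" using shell_mult[OF p_powi_shell True] by simp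
      then have "p powi n * u * p powi (- fval (p powi n * u)) = u" by (simp add: shell_iff power_int_minus)
      then show ?thesis using True by (simp only: shell_comp_def unit_char_ext_def if_True)
    qed (simp add: shell_comp_off unit_char_off[OF assms])
  qed
  have zero: "unit_char_ext p \<xi> 0 = 0" using unit_char_off[OF assms, of 0] by (simp add: unit_char_ext_def shell_iff)
  have "unit_char_ext p \<xi> \<in> smooth_functions" by (rule shell_comp_loc_const_smooth) (rule zero, simp add: c unit_char_loc_const[OF assms])
  moreover have "unit_char_ext p \<xi> x \<noteq> 0" if "x \<noteq> 0" for x
  proof -
    have "cmod (unit_char_ext p \<xi> x) = 1"
      using assms shell_decomp(1)[OF that] by (simp add: unit_char_ext_def unit_characters_def)
    then show ?thesis by auto
  qed
  moreover have "unit_char_ext p \<xi> (x * y) = unit_char_ext p \<xi> x * unit_char_ext p \<xi> y" if "x \<noteq> 0" "y \<noteq> 0" for x y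
  proof -
    have "x * y * p powi (- fval (x * y)) = (x * p powi (- fval x)) * (y * p powi (- fval y))"
      using that by (simp add: fval_mult power_int_add power_int_diff power_int_minus field_simps)
    then show ?thesis using unit_char_mult[OF assms shell_decomp(1)[OF that(1)] shell_decomp(1)[OF that(2)]]
      by (simp only: unit_char_ext_def)
  qed
  ultimately show ?thesis using zero smooth_continuous by (simp add: quasi_characters_def)
qed

lemma unit_char_ext_unit: "u \<in> int_units \<Longrightarrow> unit_char_ext p \<xi> (p powi n * u) = \<xi> u"
proof -
  assume u: "u \<in> int_units"
  have "p powi n * u \<in> shell n" using shell_mult[OF p_powi_shell u] by simp
  then have "p powi n * u * p powi (- fval (p powi n * u)) = u" by (simp add: shell_iff power_int_minus)
  then show ?thesis by (simp only: unit_char_ext_def)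
qed

text \<open>From the conductor of \<open>\<omega>\<close> on, the twist is the inverse of
  \<open>\<xi>\<close> on \<open>1 + P^m\<close>. For smaller \<open>m\<close> both are nontrivial,
  since they are so already on the smaller group belonging to the conductor of
  \<open>\<omega>\<close>.\<close>

lemma twist_conductor:
  assumes \<xi>: "\<xi> \<in> unit_characters" and \<omega>: "\<omega> \<in> quasi_characters" and c: "conductor_exp \<omega> < conductor_exp \<xi>"
  shows "conductor_exp (\<lambda>x. inverse (unit_char_ext p \<xi> x) * inverse (\<omega> x)) = conductor_exp \<xi>"
proof (rule conductor_cong)
  fix m
  let ?t = "\<lambda>w. inverse (unit_char_ext p \<xi> w) * inverse (\<omega> w)"
  have ext: "unit_char_ext p \<xi> w = \<xi> w" if "w \<in> one_units m" for m w
    using unit_char_ext_unit[of w \<xi> 0] one_units_units[OF that] by simp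
  show "(\<forall>w\<in>one_units m. ?t w = 1) \<longleftrightarrow> (\<forall>w\<in>one_units m. \<xi> w = 1)"
  proof (cases "conductor_exp \<omega> \<le> m")
    case True
    then show ?thesis using qc_conductor[OF \<omega>, of _ m] by (simp add: ext)
  next
    case False
    define M where "M = conductor_exp \<omega>"
    have mM: "one_units M \<subseteq> (one_units m :: 'a set)" using False by (intro one_units_mono) (simp add: M_def)
    have "\<not> (\<forall>w\<in>one_units M. \<xi> w = 1)" using conductor_le[of M \<xi>] c by (auto simp: M_def)
    then obtain w where w: "w \<in> one_units M" "\<xi> w \<noteq> 1" by blast
    moreover have "?t w \<noteq> 1" using w qc_conductor[OF \<omega>, of w M] by (simp add: ext M_def)
    ultimately show ?thesis using mM by blast
  qed
qed

text \<open>The inverse of the twisted character is \<open>\<xi> \<omega>\<close>, so the Gauss sum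
  is the Fourier coefficient of \<open>psi_twist\<close> at \<open>\<xi>\<close>. At
  \<open>1 - s\<close> the monomial becomes a negative power of \<open>qpow s\<close>, matching
  shell \<open>- l\<close> of the Mellin transform.\<close>

lemma epsilon_twist:
  assumes \<xi>: "\<xi> \<in> unit_characters" and \<omega>: "\<omega> \<in> quasi_characters" and c: "conductor_exp \<omega> < conductor_exp \<xi>"
  shows "epsilon p \<psi> dx (\<lambda>x. inverse (unit_char_ext p \<xi> x) * inverse (\<omega> x)) (1 - s)
    = (LINT u|\<nu>. psi_twist (conductor_exp \<xi>) \<omega> u * \<xi> u) * qpow s powi (- int (conductor_exp \<xi>))"
proof -
  define l where "l = conductor_exp \<xi>"
  let ?\<eta> = "\<lambda>x. inverse (unit_char_ext p \<xi> x) * inverse (\<omega> x)"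
  have \<eta>: "?\<eta> \<in> quasi_characters" by (intro qc_times qc_inverse unit_char_ext_qc \<xi> \<omega>)
  have cond: "conductor_exp ?\<eta> = l" using twist_conductor[OF assms] by (simp add: l_def)
  have "(of_real q * qpow (1 - s)) powi int l = qpow s powi (- int l)"
    unfolding qpow_one_minus by (simp add: power_int_minus power_int_inverse field_simps)
  moreover have "gauss (\<lambda>y. inverse (?\<eta> y)) (- int l) = (LINT u|\<nu>. psi_twist l \<omega> u * \<xi> u)"
    unfolding gauss_def
  proof (intro Bochner_Integration.integral_cong refl)
    fix u
    show "shell_comp (\<lambda>x. \<psi> x * inverse (?\<eta> x)) (- int l) u = psi_twist l \<omega> u * \<xi> u"
      unfolding psi_twist_shell_comp using unit_char_ext_unit[of u \<xi> "- int l"] by (simp add: shell_comp_def)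
  qed
  ultimately show ?thesis using epsilon_ramified[OF \<eta>, of "1 - s"] c unfolding cond by (simp add: l_def)
qed

lemma epsilon_untwisted:
  assumes \<xi>: "\<xi> \<in> unit_characters" and c: "0 < conductor_exp \<xi>"
  shows "epsilon p \<psi> dx (\<lambda>x. inverse (unit_char_ext p \<xi> x)) (1 - s)
    = (LINT u|\<nu>. psi_twist (conductor_exp \<xi>) triv_char u * \<xi> u) * qpow s powi (- int (conductor_exp \<xi>))"
proof -
  have "(\<lambda>x. inverse (unit_char_ext p \<xi> x) * inverse (triv_char x)) = (\<lambda>x. inverse (unit_char_ext p \<xi> x))"
    using qc_zero[OF unit_char_ext_qc[OF \<xi>]] by (auto simp: triv_char_def)
  then show ?thesis using epsilon_twist[OF \<xi> triv_char_qc, of s] c by (simp add: conductor_triv)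
qed

text \<open>Pairing with \<open>\<xi>\<close> turns the iterated convolution into a product of
  \<open>d\<close> Gauss sums, one for each epsilon factor, while each monomial contributes
  \<open>- l\<close> to the exponent.\<close>

lemma E_ge_eq:
  assumes \<xi>: "\<xi> \<in> unit_characters" and \<omega>: "\<omega> \<in> quasi_characters" and d: "d \<ge> 1"
    and N: "max (conductor_exp \<omega>) 1 < N" "N \<le> conductor_exp \<xi>"
  shows "E_ge p \<psi> dx N \<omega> d \<xi> s = (LINT u|\<nu>. germ_units (conductor_exp \<xi>) \<omega> d u * \<xi> u) * qpow s powi (- int (conductor_exp \<xi> * d))"
proof -
  define l where "l = conductor_exp \<xi>"
  have l: "conductor_exp \<omega> < l" "0 < l" using N by (auto simp: l_def)
  define g where "g = psi_twist l triv_char"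
  have loc_const: "g \<in> loc_const" "psi_twist l \<omega> \<in> loc_const"
    using psi_twist_level[OF \<omega>, of l] psi_twist_triv_level[of l] l by (auto simp: g_def intro: level_loc_const)
  have "(LINT u|\<nu>. (uconv g ^^ k) (psi_twist l \<omega>) u * \<xi> u) = (LINT u|\<nu>. g u * \<xi> u) ^ k * (LINT u|\<nu>. psi_twist l \<omega> u * \<xi> u)" for k
    by (induction k) (simp_all add: integral_uconv_char[OF loc_const(1) funpow_uconv_loc_const[OF loc_const] \<xi>])
  then have germ_units: "(LINT u|\<nu>. germ_units l \<omega> d u * \<xi> u) = (LINT u|\<nu>. g u * \<xi> u) ^ (d - 1) * (LINT u|\<nu>. psi_twist l \<omega> u * \<xi> u)"
    by (simp add: germ_units_def g_def)
  have "(qpow s powi (- int l)) ^ (d - 1) * qpow s powi (- int l) = (qpow s powi (- int l)) ^ d"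
    using d by (cases d) simp_all
  also have "\<dots> = qpow s powi (- int (l * d))" by (simp add: power_int_power[symmetric] flip: power_int_of_nat power_int_mult)
  finally have T: "(qpow s powi (- int l)) ^ (d - 1) * qpow s powi (- int l) = qpow s powi (- int (l * d))" .
  show ?thesis
    using \<xi> N(2) epsilon_untwisted[OF \<xi>, of s] epsilon_twist[OF \<xi> \<omega>, of s] l
    unfolding E_ge_def l_def[symmetric] germ_units g_def[symmetric] T[symmetric]
    by (simp add: power_mult_distrib mult_ac)
qed

text \<open>Only the depth equal to the conductor of \<open>\<xi>\<close> contributes: at smaller
  \<open>l\<close> the character is nontrivial on \<open>1 + P^l\<close>, under which the component
  is invariant; at larger \<open>l\<close> the average of the component at the level of
  \<open>\<xi>\<close> is 0.\<close>

lemma mellin_coeff_germ_ge: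
  assumes \<xi>: "\<xi> \<in> unit_characters" and \<omega>: "\<omega> \<in> quasi_characters" and d: "d \<ge> 1"
    and N: "max (conductor_exp \<omega>) 1 < N" "N \<le> conductor_exp \<xi>"
  shows "mellin_coeff (shell_comp (germ_ge p \<psi> dx N \<omega> d)) \<xi> n
    = (if n = - int (conductor_exp \<xi> * d) then LINT u|\<nu>. germ_units (conductor_exp \<xi>) \<omega> d u * \<xi> u else 0)"
proof -
  define c where "c = conductor_exp \<xi>"
  have other: "(LINT u|\<nu>. germ_units l \<omega> d u * \<xi> u) = 0" if l: "l \<ge> N" "l \<noteq> c" for l
  proof (cases "l < c")
    case True
    have "\<not> (\<forall>w\<in>one_units l. \<xi> w = 1)" using conductor_le[of l \<xi>] True by (auto simp: c_def)
    then obtain w where w: "w \<in> one_units l" "\<xi> w \<noteq> 1" by blast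
    have level: "germ_units l \<omega> d \<in> level l" using germ_units_level[OF \<omega>, of l d] N l by simp
    have wu: "w \<in> int_units" by (rule one_units_units[OF w(1)])
    note [measurable] = loc_const_measurable[OF level_loc_const[OF level]] loc_const_measurable[OF unit_char_loc_const[OF \<xi>]]
    have "(LINT u|\<nu>. germ_units l \<omega> d u * \<xi> u) = (LINT u|\<nu>. germ_units l \<omega> d (w * u) * \<xi> (w * u))"
      by (rule integral_nu_mult[symmetric]) (measurable, rule wu)
    also have "\<dots> = (LINT u|\<nu>. \<xi> w * (germ_units l \<omega> d u * \<xi> u))"
    proof (rule integral_nu_cong)
      fix u :: 'a assume u: "u \<in> int_units"
      show "germ_units l \<omega> d (w * u) * \<xi> (w * u) = \<xi> w * (germ_units l \<omega> d u * \<xi> u)"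
        using levD[OF level u w(1)] unit_char_mult[OF \<xi> wu u] by (simp add: mult.commute[of w u])
    qed measurable
    finally show ?thesis using w(2) by simp
  next
    case False
    then have cl: "c < l" using l by simp
    have "germ_units l \<omega> d \<in> loc_const" using germ_units_level[OF \<omega>, of l d] N l by (intro level_loc_const[of _ l]) simp
    moreover have "uconv (proj c) (germ_units l \<omega> d) = 0" using N l by (intro proj_germ_units[OF \<omega> _ cl]) auto
    ultimately show ?thesis by (rule integral_zero_if_proj) (simp add: c_def unit_char_level[OF \<xi>])
  qed
  show ?thesis
  proof (cases "\<exists>l\<ge>N. n = - int (l * d)")
    case True
    then obtain l where l: "l \<ge> N" "n = - int (l * d)" by blast
    have "(- int (l * d) = - int (c * d)) = (l = c)" using d by (simp flip: of_nat_mult)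
    then show ?thesis unfolding l(2) mellin_coeff_def shell_comp_germ_ge[OF \<omega> d N(1) l(1)] c_def[symmetric] using other[OF l(1)] by simp
  next
    case False
    have "shell_comp (germ_ge p \<psi> dx N \<omega> d) n = 0" by (rule shell_comp_germ_ge_zero) (use False in blast)
    moreover have "n \<noteq> - int (conductor_exp \<xi> * d)" using False N(2) by blast
    ultimately show ?thesis by (simp add: mellin_coeff_def)
  qed
qed

text \<open>Such a character is determined by its values on the finite set \<open>R\<close> of
  representatives. By the pigeonhole principle two of the first \<open>card R + 1\<close> powers of
  a unit are congruent, so the values are roots of unity of order dividing
  \<open>fact (card R)\<close>.\<close>

lemma finite_unit_characters: "finite {\<xi> \<in> unit_characters :: ('a \<Rightarrow> complex) set. conductor_exp \<xi> \<le> M}"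
proof -
  obtain R where R: "finite R" "R \<subseteq> int_units" "\<And>u. u \<in> int_units \<Longrightarrow> \<exists>r\<in>R. u \<in> coset (r::'a) (int M)"
    by (rule unit_representatives[of "int M"]) (rule that)
  define n :: nat where "n = fact (card R)"
  have root: "\<xi> u ^ n = 1" if \<xi>: "\<xi> \<in> unit_characters" "conductor_exp \<xi> \<le> M" and u: "u \<in> int_units" for \<xi> :: "'a \<Rightarrow> complex" and u
  proof -
    have pu: "u ^ j \<in> int_units" for j using u by (simp add: shell_iff fval_power)
    have pxi: "\<xi> (u ^ j) = \<xi> u ^ j" for j
      by (induction j) (simp_all add: unit_char_one[OF \<xi>(1)] unit_char_mult[OF \<xi>(1) u pu])
    obtain r where r: "\<And>j. r j \<in> R \<and> u ^ j \<in> coset (r j) (int M)" using R(3)[OF pu] by metis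
    have "\<not> inj_on r {..card R}"
    proof
      assume "inj_on r {..card R}"
      then have "card {..card R} \<le> card R" using r by (intro card_inj_on_le[OF _ _ R(1)]) auto
      then show False by simp
    qed
    then obtain i j where ij: "i < j" "j \<le> card R" "r i = r j"
      unfolding inj_on_def by (metis atMost_iff linorder_neqE_nat)
    have "u ^ j \<in> coset (u ^ i) (int M)" using r[of i] r[of j] ij(3) coset_eq[of "u ^ i" "r i" "int M"] by simp
    then have "u ^ j * inverse (u ^ i) \<in> one_units M" using quotient_one_units[OF pu pu] by blast
    moreover have "u ^ j * inverse (u ^ i) = u ^ (j - i)"
      using ij(1) int_units_nonzero[OF u] by (simp add: power_diff divide_inverse)
    ultimately have "\<xi> u ^ (j - i) = 1" using unit_char_conductor[OF \<xi>(1) _ \<xi>(2)] pxi by metis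
    moreover have "(j - i) dvd n" unfolding n_def using ij by (intro dvd_fact) auto
    ultimately show ?thesis by (auto simp: power_mult)
  qed
  have "finite (R \<rightarrow>\<^sub>E {z::complex. z ^ n = 1})"
    by (intro finite_PiE R finite_nth_roots) (simp add: n_def)
  moreover have "inj_on (\<lambda>\<xi>. restrict \<xi> R) {\<xi> \<in> unit_characters. conductor_exp \<xi> \<le> M}"
  proof (rule inj_onI)
    fix \<xi> \<xi>' :: "'a \<Rightarrow> complex"
    assume a: "\<xi> \<in> {\<xi> \<in> unit_characters. conductor_exp \<xi> \<le> M}" "\<xi>' \<in> {\<xi> \<in> unit_characters. conductor_exp \<xi> \<le> M}"
      and eq: "restrict \<xi> R = restrict \<xi>' R"
    show "\<xi> = \<xi>'"
    proof
      fix u show "\<xi> u = \<xi>' u"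
      proof (cases "u \<in> int_units")
        case True
        obtain r where r: "r \<in> R" "u \<in> coset r (int M)" using R(3)[OF True] by blast
        have ru: "r \<in> int_units" using r R(2) by blast
        have "\<xi> u = \<xi> r" using a(1) by (intro level_coset[OF unit_char_level ru True r(2)]) auto
        moreover have "\<xi>' u = \<xi>' r" using a(2) by (intro level_coset[OF unit_char_level ru True r(2)]) auto
        moreover have "\<xi> r = \<xi>' r" using eq r(1) by (metis restrict_apply')
        ultimately show ?thesis by simp
      next
        case False
        then show ?thesis using a unit_char_off[of \<xi> u] unit_char_off[of \<xi>' u] by auto
      qed
    qed
  qed
  moreover have "(\<lambda>\<xi>. restrict \<xi> R) ` {\<xi> \<in> unit_characters. conductor_exp \<xi> \<le> M} \<subseteq> R \<rightarrow>\<^sub>E {z. z ^ n = 1}"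
    using root R(2) by auto
  ultimately show ?thesis using inj_on_finite by blast
qed

text \<open>Characters of large conductor do not see the \<open>S_sis\<close> part of
  \<open>f\<close>, whose components have a common level, and on them the transform is exactly the
  multiple of \<open>E_ge\<close>. The finitely many remaining characters make up the part in
  \<open>M_sis\<close>.\<close>

lemma mellin_S_sis_deg:
  assumes \<omega>: "\<omega> \<in> quasi_characters" and d: "d \<ge> 1" and f: "f \<in> S_sis_deg p \<psi> dx d \<omega>"
  shows "mellin p dx f \<in> M_sis_deg p \<psi> dx d \<omega>"
proof -
  obtain N where N: "max (conductor_exp \<omega>) 1 < N" using ex_large by blast
  let ?G = "germ_ge p \<psi> dx N \<omega> d"
  obtain C s where s: "s \<in> S_sis" and fs: "f = s + (\<lambda>x. C * ?G x)" using f unfolding S_sis_deg_iff[OF \<omega> d N] by blast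
  have GA: "?G \<in> conv_space" by (rule germ_ge_conv_space[OF \<omega> d N])
  have fA: "f \<in> conv_space" using f S_sis_deg_conv_space[OF \<omega>] by blast
  have sA: "s \<in> conv_space" using s S_sis_conv_space by blast
  obtain M where M: "\<And>n. shell_comp s n \<in> level M" by (rule S_sis_level[OF s]) (rule that)
  \<comment> \<open>Strictly above \<open>M\<close>, so that a character of conductor at least
    \<open>N'\<close> is nontrivial on \<open>1 + P^M\<close> and integrates to 0 against the
    components of \<open>s\<close>.\<close>
  define N' where "N' = max N (Suc M)"
  have N': "max (conductor_exp \<omega>) 1 < N'" "N' \<ge> 1" using N by (auto simp: N'_def)
  have large: "mellin p dx f \<xi> = (\<lambda>s. C * E_ge p \<psi> dx N' \<omega> d \<xi> s)"
    and large_nice: "(\<lambda>s. C * E_ge p \<psi> dx N' \<omega> d \<xi> s) nicely_meromorphic_on UNIV"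
    if \<xi>: "\<xi> \<in> unit_characters" and c: "N' \<le> conductor_exp \<xi>" for \<xi> :: "'a \<Rightarrow> complex"
  proof -
    define l where "l = conductor_exp \<xi>"
    have l: "N \<le> l" "M < l" using c by (auto simp: l_def N'_def)
    define A where "A = (LINT u|\<nu>. germ_units l \<omega> d u * \<xi> u)"
    have loc_const: "shell_comp s n \<in> loc_const" "shell_comp ?G n \<in> loc_const" for n using M level_loc_const arrays_loc_const[of "shell_comp ?G" n] GA by (auto simp: conv_space_def)
    have "(LINT u|\<nu>. shell_comp s n u * \<xi> u) = 0" for n
    proof -
      have "\<not> (\<forall>w\<in>one_units M. \<xi> w = 1)" using conductor_le[of M \<xi>] l by (auto simp: l_def)
      then obtain w where w: "w \<in> one_units M" "\<xi> w \<noteq> 1" by blast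
      have wu: "w \<in> int_units" by (rule one_units_units[OF w(1)])
      note [measurable] = loc_const_measurable[OF loc_const(1)] loc_const_measurable[OF unit_char_loc_const[OF \<xi>]]
      have "(LINT u|\<nu>. shell_comp s n u * \<xi> u) = (LINT u|\<nu>. shell_comp s n (w * u) * \<xi> (w * u))"
        by (rule integral_nu_mult[symmetric]) (measurable, rule wu)
      also have "\<dots> = (LINT u|\<nu>. \<xi> w * (shell_comp s n u * \<xi> u))"
      proof (rule integral_nu_cong)
        fix u :: 'a assume u: "u \<in> int_units"
        show "shell_comp s n (w * u) * \<xi> (w * u) = \<xi> w * (shell_comp s n u * \<xi> u)"
          using levD[OF M u w(1)] unit_char_mult[OF \<xi> wu u] by (simp add: mult.commute[of w u])
      qed measurable
      finally show ?thesis using w(2) by simp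
    qed
    then have mellin_coeff: "mellin_coeff (shell_comp f) \<xi> n = (if n = - int (l * d) then C * A else 0)" for n
    proof -
      assume s0: "\<And>n. (LINT u|\<nu>. shell_comp s n u * \<xi> u) = 0"
      have int: "integrable \<nu> (\<lambda>u. shell_comp s n u * \<xi> u)" "integrable \<nu> (\<lambda>u. C * (shell_comp ?G n u * \<xi> u))"
        by (intro loc_const_integrable loc_const_times loc_const unit_char_loc_const \<xi>, intro integrable_mult_right loc_const_integrable loc_const_times loc_const unit_char_loc_const \<xi>)
      have "mellin_coeff (shell_comp f) \<xi> n = (LINT u|\<nu>. shell_comp s n u * \<xi> u + C * (shell_comp ?G n u * \<xi> u))"
        unfolding mellin_coeff_def fs shell_comp_add shell_comp_scale by (simp add: distrib_right mult.assoc)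
      also have "\<dots> = C * mellin_coeff (shell_comp ?G) \<xi> n" using s0 int by (simp add: mellin_coeff_def)
      finally show ?thesis using mellin_coeff_germ_ge[OF \<xi> \<omega> d N] l by (simp add: l_def A_def)
    qed
    define h where "h s = C * A * qpow s powi (- int (l * d))" for s
    have E: "C * E_ge p \<psi> dx N' \<omega> d \<xi> s = h s" for s
      using E_ge_eq[OF \<xi> \<omega> d N'(1) c] by (simp add: h_def A_def l_def)
    have nice: "h nicely_meromorphic_on UNIV"
    proof -
      have "h holomorphic_on UNIV" unfolding h_def[abs_def] by (intro holomorphic_intros qpow_powi_holomorphic)
      then show ?thesis by (intro analytic_on_imp_nicely_meromorphic_on) (simp add: analytic_on_open)
    qed
    have lim: "pv_partial dx (mellin_integrand p f \<xi> s) \<longlonglongrightarrow> h s" for s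
    proof (rule tendsto_eventually, rule eventually_mono[OF eventually_ge_at_top[of "l * d"]])
      fix k assume k: "k \<ge> l * d"
      then have "- int (l * d) \<in> {- int k..int k}" by (auto simp flip: of_nat_mult)
      then show "pv_partial dx (mellin_integrand p f \<xi> s) k = h s"
        unfolding mellin_partial[OF conv_space_smooth[OF fA] \<xi>] mellin_coeff h_def
        by (subst sum.mono_neutral_right[of _ "{- int (l * d)}"]) (auto simp del: of_nat_mult)
    qed
    have "is_mellin p dx f \<xi> h" unfolding is_mellin_def mero_continuation_def
    proof (intro conjI exI[of _ 0] allI impI nice)
      fix s
      show "pv_exists dx (mellin_integrand p f \<xi> s)"
        using smooth_set_integral(2)[OF mellin_integrand_smooth[OF conv_space_smooth[OF fA] \<xi>]] lim[of s]
        by (auto simp: pv_exists_def convergent_def)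
      show "h s = pv_integral dx (mellin_integrand p f \<xi> s)"
        unfolding pv_integral_def by (rule limI[OF lim, symmetric])
    qed
    then have "mellin p dx f \<xi> = h" using \<xi> unfolding mellin_def is_mellin_def by (simp add: mero_continuation_the)
    then show "mellin p dx f \<xi> = (\<lambda>s. C * E_ge p \<psi> dx N' \<omega> d \<xi> s)" "(\<lambda>s. C * E_ge p \<psi> dx N' \<omega> d \<xi> s) nicely_meromorphic_on UNIV"
      using nice by (simp_all add: E)
  qed
  define m where "m \<xi> = (if \<xi> \<in> unit_characters \<and> conductor_exp \<xi> < N' then mellin p dx f \<xi> else (\<lambda>s. 0))" for \<xi> :: "'a \<Rightarrow> complex"
  have zero_rational: "(\<lambda>s. 0) \<in> rational_in_q_power TYPE('a)"
  proof -
    have "remove_sings (\<lambda>s. poly 0 (q_power TYPE('a) s) / poly 1 (q_power TYPE('a) s)) = (\<lambda>s. 0)"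
      by (rule ext) (simp add: remove_sings_at_analytic)
    then show ?thesis unfolding rational_in_q_power_def by (intro CollectI exI[of _ 0] exI[of _ 1]) simp
  qed
  have "m \<in> M_sis"
    unfolding M_sis_def
  proof (intro CollectI conjI)
    show "finite {\<xi>. m \<xi> \<noteq> (\<lambda>s. 0)}"
      by (rule finite_subset[OF _ finite_unit_characters[of N']]) (auto simp: m_def split: if_splits)
    show "\<forall>\<xi>. \<xi> \<notin> unit_characters \<longrightarrow> m \<xi> = (\<lambda>s. 0)" by (simp add: m_def)
    show "\<forall>\<xi>\<in>unit_characters. m \<xi> \<in> rational_in_q_power TYPE('a)"
      using zero_rational mellin_rational_in_q[OF fA] by (simp add: m_def)
  qed
  moreover have "mellin p dx f = (\<lambda>\<xi>. remove_sings (\<lambda>s. m \<xi> s + C * E_ge p \<psi> dx N' \<omega> d \<xi> s))"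
  proof
    fix \<xi> :: "'a \<Rightarrow> complex"
    consider "\<xi> \<notin> unit_characters" | "\<xi> \<in> unit_characters" "conductor_exp \<xi> < N'" | "\<xi> \<in> unit_characters" "N' \<le> conductor_exp \<xi>"
      by linarith
    then show "mellin p dx f \<xi> = remove_sings (\<lambda>s. m \<xi> s + C * E_ge p \<psi> dx N' \<omega> d \<xi> s)"
    proof cases
      case 1
      have "remove_sings (\<lambda>s. 0) = (\<lambda>s. 0 :: complex)" by (rule ext) (simp add: remove_sings_at_analytic)
      then show ?thesis using 1 by (simp add: m_def E_ge_def mellin_def)
    next
      case 2
      then show ?thesis
        using remove_sings_nicely_meromorphic_eq[OF mellin_nicely_meromorphic[OF fA 2(1)]] by (simp add: m_def E_ge_def)
    next
      case 3
      then show ?thesis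
        using remove_sings_nicely_meromorphic_eq[OF large_nice[OF 3]] large[OF 3] by (simp add: m_def)
    qed
  qed
  ultimately show ?thesis unfolding M_sis_deg_def using N'(2) by blast
qed

end

theorem proposition6p8:
  fixes p :: "'F::nonarch_local_field" and \<psi> :: "'F \<Rightarrow> complex" and dx :: "'F measure"
  assumes "uniformizer p"
    and "additive_character \<psi>"
    and "\<forall>x\<in>ring_of_integers. \<psi> x = 1"
    and "\<exists>x\<in>frac_ideal (- 1). \<psi> x \<noteq> 1"
    and "self_dual_haar \<psi> dx"
  shows
    "(\<forall>d1 d2 :: nat. \<forall>\<omega>1\<in>quasi_characters. \<forall>\<omega>2\<in>quasi_characters. d1 \<ge> 1 \<longrightarrow> d2 \<ge> 1 \<longrightarrow>
        (\<forall>f1\<in>S_sis_deg p \<psi> dx d1 \<omega>1. \<forall>f2\<in>S_sis_deg p \<psi> dx d2 \<omega>2. pv_conv_defined dx f1 f2)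
        \<and> bilinear_map_on (S_sis_deg p \<psi> dx d1 \<omega>1) (S_sis_deg p \<psi> dx d2 \<omega>2)
            (S_sis_deg p \<psi> dx (d1 + d2) (\<lambda>x. \<omega>1 x * \<omega>2 x)) (pv_conv dx))
     \<and> (\<forall>d1 d2 :: nat. \<forall>\<omega>1\<in>quasi_characters. \<forall>\<omega>2\<in>quasi_characters. d1 \<ge> 1 \<longrightarrow> d2 \<ge> 1 \<longrightarrow>
        (\<forall>f1\<in>S_sis_deg p \<psi> dx d1 \<omega>1. \<forall>f2\<in>S_sis_deg p \<psi> dx d2 \<omega>2.
          mellin_defined p dx f1 \<and> mellin_defined p dx f2 \<and> mellin_defined p dx (pv_conv dx f1 f2)
          \<and> mellin p dx (pv_conv dx f1 f2)
              \<in> M_sis_deg p \<psi> dx (d1 + d2) (\<lambda>x. \<omega>1 x * \<omega>2 x)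
          \<and> (\<forall>\<xi>\<in>unit_characters. mellin p dx (pv_conv dx f1 f2) \<xi>
              = remove_sings (\<lambda>s. mellin p dx f1 \<xi> s * mellin p dx f2 \<xi> s))))
     \<and> (\<forall>f\<in>S_sis_total p \<psi> dx. \<forall>g\<in>S_sis_total p \<psi> dx. pv_conv_defined dx f g)
     \<and> commutative_algebra_on (S_sis_total p \<psi> dx) (pv_conv dx)
     \<and> algebra_ideal S_sis (S_sis_total p \<psi> dx) (pv_conv dx)"
proof -
  interpret additive_char_field p dx "q_of TYPE('F)" \<psi>
    by unfold_locales (use assms in \<open>auto simp: self_dual_haar_def\<close>)
  have A: "f \<in> conv_space" if "\<omega> \<in> quasi_characters" "f \<in> S_sis_deg p \<psi> dx d \<omega>" for f d \<omega>
    using S_sis_deg_conv_space that by blast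
  show ?thesis
  proof (intro conjI allI ballI impI)
    fix d1 d2 :: nat and \<omega>1 \<omega>2 f1 f2 :: "'F \<Rightarrow> complex"
    assume \<omega>: "\<omega>1 \<in> quasi_characters" "\<omega>2 \<in> quasi_characters" and d: "d1 \<ge> 1" "d2 \<ge> 1"
      and f: "f1 \<in> S_sis_deg p \<psi> dx d1 \<omega>1" "f2 \<in> S_sis_deg p \<psi> dx d2 \<omega>2"
    note f1 = A[OF \<omega>(1) f(1)] and f2 = A[OF \<omega>(2) f(2)]
    show "pv_conv_defined dx f1 f2" by (rule pv_conv_defined_conv_space[OF f1 f2])
    show "mellin p dx (pv_conv dx f1 f2) \<in> M_sis_deg p \<psi> dx (d1 + d2) (\<lambda>x. \<omega>1 x * \<omega>2 x)"
      by (rule mellin_S_sis_deg[OF qc_times[OF \<omega>] _ S_sis_deg_conv[OF \<omega> d f]]) (use d in simp)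
    show "mellin_defined p dx f1" "mellin_defined p dx f2" "mellin_defined p dx (pv_conv dx f1 f2)"
      by (intro mellin_defined_conv_space pv_conv_conv_space f1 f2)+
    show "mellin p dx (pv_conv dx f1 f2) \<xi> = remove_sings (\<lambda>s. mellin p dx f1 \<xi> s * mellin p dx f2 \<xi> s)"
      if "\<xi> \<in> unit_characters" for \<xi>
      by (rule mellin_conv[OF f1 f2 that])
  next
    fix d1 d2 :: nat and \<omega>1 \<omega>2 :: "'F \<Rightarrow> complex"
    assume \<omega>: "\<omega>1 \<in> quasi_characters" "\<omega>2 \<in> quasi_characters" and d: "d1 \<ge> 1" "d2 \<ge> 1"
    show "bilinear_map_on (S_sis_deg p \<psi> dx d1 \<omega>1) (S_sis_deg p \<psi> dx d2 \<omega>2)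
        (S_sis_deg p \<psi> dx (d1 + d2) (\<lambda>x. \<omega>1 x * \<omega>2 x)) (pv_conv dx)"
      by (intro pv_conv_bilinear S_sis_deg_conv_space S_sis_deg_subspace qc_times \<omega>) (rule S_sis_deg_conv[OF \<omega> d])
  next
    fix f g :: "'F \<Rightarrow> complex" assume "f \<in> S_sis_total p \<psi> dx" "g \<in> S_sis_total p \<psi> dx"
    then show "pv_conv_defined dx f g" using S_sis_total_conv_space by (intro pv_conv_defined_conv_space) blast+
  qed (rule algebra_part)+
qed

end
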